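(* There exists an absolute constant $c>0$ such that for every integer $q\ge3$, every $\theta\in(0,1]$, every $n$ that is a multiple of $q$, every initial state $\mathsf{x}_0$ of the $q$-state noisy voter model with noise $\theta$ on the cycle $G=\mathbb Z_n=\mathbb Z/n\mathbb Z$, and every $t\ge0$, $$\mathcal A^{(2)}_t(\mathsf{x}_0)\ \ge\ \frac{c}{q^2}\,\mathcal A^{(2)}_t(\mathsf{x}_{\mathrm{rbw}}),$$ where $\mathsf{x}_{\mathrm{rbw}}(i)= i \bmod q$ for $i\in\mathbb Z_n$ is the rainbow configuration. Consequently, $T_{\mathsf{x}_0}\ge T_{\mathsf{x}_{\mathrm{rbw}}}+O(1)$ (with an implicit constant depending only on $q,\theta$, uniformly in $n$ and $\mathsf{x}_0$), and thus $\mathsf{x}_{\mathrm{rbw}}$ is the asymptotically fastest initial condition: for fixed $q,\theta$ and $0<\epsilon<1$ and any sequence $\mathsf{x}_0=\mathsf{x}_0^{(n)}$ of deterministic initial states, $\liminf_{n\to\infty} t_{\mathrm{mix}}^{\mathsf{x}_0}(\epsilon)/t_{\mathrm{mix}}^{\mathsf{x}_{\mathrm{rbw}}}(\epsilon)\ge1$ (along multiples $n$ of $q$).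
   Context: Noisy voter model on a graph $G=(V,E)$ with $q$ states and noise $\theta$: the continuous-time Markov chain $(X_t)_{t\ge0}$ on $\{0,\dots,q-1\}^V$ in which every vertex $u$ has an independent rate-1 Poisson clock, and when the clock of $u$ rings, with probability $1-\theta$ the value $X_t(u)$ is replaced by $X_t(v)$ for a uniformly chosen neighbor $v$ of $u$, and with probability $\theta$ it is replaced by a uniform element of $\{0,\dots,q-1\}$. Its unique stationary distribution is $\mu_G$. $\mathbb P_{\mathsf{x}_0}$ is the law of the chain with $X_0=\mathsf{x}_0$. $t_{\mathrm{mix}}^{\mathsf{x}_0}(\epsilon)=\inf\{t\ge0:\ \|\mathbb P_{\mathsf{x}_0}(X_t\in\cdot)-\mu_G\|_{\mathrm{TV}}<\epsilon\}$. With $\pi_G(v)=d_G(v)/(2|E|)$ (which equals $1/n$ on the cycle), $\mathcal A^{(2)}_t(\mathsf{x}_0)=\sum_{v\in V}\pi_G(v)\sum_{j=0}^{q-1}\big(\mathbb P_{\mathsf{x}_0}(X_t(v)=j)-\tfrac1q\big)^2$ and $T_{\mathsf{x}_0}=\inf\{t\ge 0:\ \mathcal A^{(2)}_t(\mathsf{x}_0)\le \tfrac1n\}$, where $n=|V|$. *)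

theory Defs
  imports "HOL-Probability.Probability"
begin

section \<open>Continuous-time Markov chains on a finite state space\<close>

text \<open>
  A chain on a finite set \<open>S\<close> is given by its jump rates \<open>r x y\<close> for \<open>x \<noteq> y\<close> (diagonal
  values of \<open>r\<close> are ignored). Its law at time \<open>t\<close> is the row of
  \<open>exp (t Q)\<close> belonging to the initial state, where \<open>Q\<close> is the generator.
\<close>

definition generator :: "'s set \<Rightarrow> ('s \<Rightarrow> 's \<Rightarrow> real) \<Rightarrow> 's \<Rightarrow> 's \<Rightarrow> real" where
  "generator S r x y = (if x = y then - (\<Sum>z\<in>S - {x}. r x z) else r x y)"

primrec kernel_power :: "'s set \<Rightarrow> ('s \<Rightarrow> 's \<Rightarrow> real) \<Rightarrow> nat \<Rightarrow> 's \<Rightarrow> 's \<Rightarrow> real" where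
  "kernel_power S Q 0 x y = (if x = y then 1 else 0)"
| "kernel_power S Q (Suc k) x y = (\<Sum>z\<in>S. Q x z * kernel_power S Q k z y)"

definition transition :: "'s set \<Rightarrow> ('s \<Rightarrow> 's \<Rightarrow> real) \<Rightarrow> real \<Rightarrow> 's \<Rightarrow> 's \<Rightarrow> real" where
  "transition S r t x y = (\<Sum>k. t ^ k / fact k * kernel_power S (generator S r) k x y)"

definition stationary :: "'s set \<Rightarrow> ('s \<Rightarrow> 's \<Rightarrow> real) \<Rightarrow> 's pmf \<Rightarrow> bool" where
  "stationary S r \<mu> \<longleftrightarrow> set_pmf \<mu> \<subseteq> S \<and>
     (\<forall>t\<ge>0. \<forall>y\<in>S. (\<Sum>x\<in>S. pmf \<mu> x * transition S r t x y) = pmf \<mu> y)"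

definition tv_dist :: "'s set \<Rightarrow> ('s \<Rightarrow> real) \<Rightarrow> ('s \<Rightarrow> real) \<Rightarrow> real" where
  "tv_dist S p p' = (SUP A\<in>Pow S. \<bar>sum p A - sum p' A\<bar>)"


section \<open>Graphs\<close>

text \<open>A finite simple graph is a pair of its vertex set and its set of (two-element) edges.\<close>

type_synonym 'v graph = "'v set \<times> 'v set set"

abbreviation vertices :: "'v graph \<Rightarrow> 'v set" where "vertices \<equiv> fst"
abbreviation edges :: "'v graph \<Rightarrow> 'v set set" where "edges \<equiv> snd"

definition neighbors :: "'v graph \<Rightarrow> 'v \<Rightarrow> 'v set" where
  "neighbors G u = {v \<in> vertices G. {u, v} \<in> edges G}"

definition graph_weight :: "'v graph \<Rightarrow> 'v \<Rightarrow> real" where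
  "graph_weight G v = real (card (neighbors G v)) / (2 * real (card (edges G)))"

text \<open>The cycle \<open>\<int>/n\<int>\<close> on the residues \<open>0, \<dots>, n - 1\<close>; a simple graph for \<open>n \<ge> 3\<close>.\<close>

definition cycle_graph :: "nat \<Rightarrow> nat graph" where
  "cycle_graph n = ({..<n}, (\<lambda>i. {i, (i + 1) mod n}) ` {..<n})"


section \<open>The noisy voter model\<close>

text \<open>Configurations are extensional: they take the value \<open>undefined\<close> off the vertex set.\<close>

definition configs :: "'v graph \<Rightarrow> nat \<Rightarrow> ('v \<Rightarrow> nat) set" where
  "configs G q = vertices G \<rightarrow>\<^sub>E {..<q}"

definition voter_update ::
    "'v graph \<Rightarrow> nat \<Rightarrow> real \<Rightarrow> 'v \<Rightarrow> ('v \<Rightarrow> nat) \<Rightarrow> ('v \<Rightarrow> nat) pmf" where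
  "voter_update G q \<theta> u x =
     bind_pmf (bernoulli_pmf \<theta>) (\<lambda>noise.
       if noise then map_pmf (\<lambda>j. x(u := j)) (pmf_of_set {..<q})
       else map_pmf (\<lambda>v. x(u := x v)) (pmf_of_set (neighbors G u)))"

text \<open>
  The clocks are independent of rate 1, so the chain jumps from \<open>x\<close> to \<open>y \<noteq> x\<close> at the
  sum over \<open>u\<close> of the probabilities that a ring at \<open>u\<close> turns \<open>x\<close> into \<open>y\<close>.
\<close>

definition voter_rate ::
    "'v graph \<Rightarrow> nat \<Rightarrow> real \<Rightarrow> ('v \<Rightarrow> nat) \<Rightarrow> ('v \<Rightarrow> nat) \<Rightarrow> real" where
  "voter_rate G q \<theta> x y = (\<Sum>u\<in>vertices G. pmf (voter_update G q \<theta> u x) y)"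

definition voter_law ::
    "'v graph \<Rightarrow> nat \<Rightarrow> real \<Rightarrow> ('v \<Rightarrow> nat) \<Rightarrow> real \<Rightarrow> ('v \<Rightarrow> nat) \<Rightarrow> real" where
  "voter_law G q \<theta> x0 t = transition (configs G q) (voter_rate G q \<theta>) t x0"

definition voter_stationary :: "'v graph \<Rightarrow> nat \<Rightarrow> real \<Rightarrow> ('v \<Rightarrow> nat) pmf" where
  "voter_stationary G q \<theta> = (THE \<mu>. stationary (configs G q) (voter_rate G q \<theta>) \<mu>)"

definition t_mix :: "'v graph \<Rightarrow> nat \<Rightarrow> real \<Rightarrow> ('v \<Rightarrow> nat) \<Rightarrow> real \<Rightarrow> real" where
  "t_mix G q \<theta> x0 \<epsilon> =
     Inf {t. 0 \<le> t \<and>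
       tv_dist (configs G q) (voter_law G q \<theta> x0 t) (pmf (voter_stationary G q \<theta>)) < \<epsilon>}"

definition voter_marginal ::
    "'v graph \<Rightarrow> nat \<Rightarrow> real \<Rightarrow> ('v \<Rightarrow> nat) \<Rightarrow> real \<Rightarrow> 'v \<Rightarrow> nat \<Rightarrow> real" where
  "voter_marginal G q \<theta> x0 t v j = (\<Sum>x | x \<in> configs G q \<and> x v = j. voter_law G q \<theta> x0 t x)"

definition autocorr2 ::
    "'v graph \<Rightarrow> nat \<Rightarrow> real \<Rightarrow> ('v \<Rightarrow> nat) \<Rightarrow> real \<Rightarrow> real" where
  "autocorr2 G q \<theta> x0 t =
     (\<Sum>v\<in>vertices G. graph_weight G v *
        (\<Sum>j<q. (voter_marginal G q \<theta> x0 t v j - 1 / real q)\<^sup>2))"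

definition autocorr_time :: "'v graph \<Rightarrow> nat \<Rightarrow> real \<Rightarrow> ('v \<Rightarrow> nat) \<Rightarrow> real" where
  "autocorr_time G q \<theta> x0 =
     Inf {t. 0 \<le> t \<and> autocorr2 G q \<theta> x0 t \<le> 1 / real (card (vertices G))}"

definition rainbow :: "nat \<Rightarrow> nat \<Rightarrow> nat \<Rightarrow> nat" where
  "rainbow q n = (\<lambda>i\<in>{..<n}. i mod q)"

end

(*
  One-point marginals evolve by a killed random walk on the cycle, diagonalized by Fourier analysis;
  k-point functions are controlled through the coalescing dual. Let lam = 1 - (1 - theta) cos (2 pi / q), the
  decay rate of the frequency n/q. A positivity argument with Fejer's kernel shows that for every
  initial state a fixed proportion of the energy sits at frequencies only slightly above n/q: two
  sites of equal colour contribute nonnegatively, so only the diagonal matters. This gives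
  A_t >= (c/q) exp (-2 lam t), while the rainbow has A_t <= q exp (-2 lam t), which yields the first
  two claims.

  With gamma = min lam (2 theta), the mixing time from the rainbow is (1 + o(1)) ln n / (2 gamma), and
  no initial state mixes faster. Lower bound: Chebyshev's inequality, valid because correlations decay
  like (1 - theta)^dist, applied to a one-point statistic if A_t is large, and to the number of
  agreeing neighbours if it is not; the latter relaxes at rate at best about 2 theta. Upper bound:
  from the rainbow, k-point marginals converge at rate gamma. Running the dual for a further small
  multiple of ln n leaves a random set of sites without clusters of k nearby points. On such a set
  the configuration is nearly a product over the clusters, so the chi-square distances of the
  clusters multiply.
*)
theory Submission
  imports Defs "HOL-Real_Asymp.Real_Asymp"
begin

section \<open>Poisson averages\<close>

text \<open>The exponential series of the generator is traded for an average over discrete steps: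
  all clocks together ring at rate n, so the law at time t is the \<open>step\<close> chain after a
  Poisson number of steps with mean \<open>n * t\<close>. Estimates become inductions on steps. The
  coalescing dual is not built as a process either; a linear functional is bounded on functions of
  the sites in S by a set function of S, and \<open>hop\<close> moves this bound by one step.

  The rate 2 theta is the total death rate of two dual walkers. Sets of two or more sites are
  handled at any rate below 2 theta, with constants that blow up at 2 theta itself, so the upper
  bound works slightly below gamma.

  The obstacle in the upper bound is the leading constant. Adding the errors of n sites would need
  an error below 1/n at each, which takes twice the claimed time. Multiplying chi-square distances
  needs only an error below n to the power -1/2, but it requires near independence of the pieces;
  this is why the configuration is first reduced to sparse clusters.\<close>

definition pois :: "real \<Rightarrow> (nat \<Rightarrow> real) \<Rightarrow> real" where
  "pois c p = (\<Sum>i. exp (- c) * c ^ i / fact i * p i)"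

lemma pois_weight_sums: "(\<lambda>i. exp (- c) * c ^ i / fact i) sums (1::real)"
proof -
  have "(\<lambda>i. exp (- c) * (c ^ i /\<^sub>R fact i)) sums (exp (- c) * exp c)"
    by (intro sums_mult exp_converges)
  thus ?thesis by (simp add: exp_minus field_simps scaleR_conv_of_real)
qed

lemma pois_summable_norm:
  fixes p :: "nat \<Rightarrow> real"
  assumes "\<And>i. \<bar>p i\<bar> \<le> B"
  shows "summable (\<lambda>i. norm (c ^ i / fact i * p i))"
proof (rule summable_comparison_test')
  have "summable (\<lambda>i. (\<bar>c\<bar> ^ i /\<^sub>R fact i) * B)"
    by (intro summable_mult2 summable_exp_generic)
  thus "summable (\<lambda>i. \<bar>c\<bar> ^ i / fact i * B)"
    by (simp add: scaleR_conv_of_real field_simps)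
  fix i
  have "\<bar>c\<bar> ^ i / fact i * \<bar>p i\<bar> \<le> \<bar>c\<bar> ^ i / fact i * B"
    by (intro mult_left_mono assms) auto
  thus "norm (norm (c ^ i / fact i * p i)) \<le> \<bar>c\<bar> ^ i / fact i * B"
    by (simp add: abs_mult power_abs)
qed

lemma pois_summable:
  fixes p :: "nat \<Rightarrow> real"
  assumes "\<And>i. \<bar>p i\<bar> \<le> B"
  shows "summable (\<lambda>i. exp (- c) * c ^ i / fact i * p i)"
proof -
  have "summable (\<lambda>i. exp (- c) * (c ^ i / fact i * p i))"
    by (intro summable_mult summable_norm_cancel[OF pois_summable_norm[OF assms]])
  thus ?thesis by (simp add: mult.assoc)
qed

lemma pois_const [simp]: "pois c (\<lambda>_. a) = a"
proof -
  have "(\<lambda>i. exp (- c) * c ^ i / fact i * a) sums (1 * a)"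
    by (intro sums_mult2 pois_weight_sums)
  thus ?thesis by (simp add: pois_def sums_iff)
qed

text \<open>The Poisson generating function. With \<open>c = real n * t\<close> and
  \<open>\<beta> = 1 - \<gamma> / real n\<close> it turns a contraction per step into decay at rate
  gamma in continuous time.\<close>

lemma pois_geometric: "pois c (\<lambda>i. \<beta> ^ i) = exp (- c * (1 - \<beta>))"
proof -
  have "(\<lambda>i. exp (- c) * ((c * \<beta>) ^ i /\<^sub>R fact i)) sums (exp (- c) * exp (c * \<beta>))"
    by (intro sums_mult exp_converges)
  hence "(\<lambda>i. exp (- c) * c ^ i / fact i * \<beta> ^ i) sums (exp (- c) * exp (c * \<beta>))"
    by (simp add: scaleR_conv_of_real field_simps power_mult_distrib)
  thus ?thesis by (simp add: pois_def sums_iff exp_add[symmetric] algebra_simps)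
qed

lemma pois_mono:
  assumes "0 \<le> c" "\<And>i. \<bar>p i\<bar> \<le> B" "\<And>i. \<bar>p' i\<bar> \<le> B'" "\<And>i. p i \<le> p' i"
  shows "pois c p \<le> pois c p'"
  unfolding pois_def
  by (intro suminf_le mult_left_mono pois_summable[OF assms(2)] pois_summable[OF assms(3)] assms(4))
     (use assms(1) in auto)

lemma pois_add:
  assumes "\<And>i. \<bar>p i\<bar> \<le> B" "\<And>i. \<bar>p' i\<bar> \<le> B'"
  shows "pois c (\<lambda>i. p i + p' i) = pois c p + pois c p'"
  unfolding pois_def distrib_left
  by (intro suminf_add[symmetric] pois_summable[OF assms(1)] pois_summable[OF assms(2)])

lemma pois_cmult:
  assumes "\<And>i. \<bar>p i\<bar> \<le> B"
  shows "pois c (\<lambda>i. a * p i) = a * pois c p"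
proof -
  have "pois c (\<lambda>i. a * p i) = (\<Sum>i. a * (exp (- c) * c ^ i / fact i * p i))"
    by (simp add: pois_def mult_ac)
  also have "\<dots> = a * pois c p"
    unfolding pois_def by (intro suminf_mult pois_summable[OF assms])
  finally show ?thesis .
qed

lemma pois_diff:
  assumes "\<And>i. \<bar>p i\<bar> \<le> B" "\<And>i. \<bar>p' i\<bar> \<le> B'"
  shows "pois c (\<lambda>i. p i - p' i) = pois c p - pois c p'"
  unfolding pois_def right_diff_distrib
  by (intro suminf_diff[symmetric] pois_summable[OF assms(1)] pois_summable[OF assms(2)])

lemma pois_sum:
  assumes "finite I" "\<And>k i. k \<in> I \<Longrightarrow> \<bar>p k i\<bar> \<le> B k"
  shows "pois c (\<lambda>i. \<Sum>k\<in>I. p k i) = (\<Sum>k\<in>I. pois c (p k))"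
proof -
  have "pois c (\<lambda>i. \<Sum>k\<in>I. p k i) = (\<Sum>i. \<Sum>k\<in>I. exp (- c) * c ^ i / fact i * p k i)"
    by (simp add: pois_def sum_distrib_left)
  also have "\<dots> = (\<Sum>k\<in>I. pois c (p k))"
    unfolding pois_def
    by (intro suminf_sum pois_summable[of "p k" "B k" for k]) (use assms(2) in blast)+
  finally show ?thesis .
qed

lemma pois_abs_le:
  assumes "0 \<le> c" "\<And>i. \<bar>p i\<bar> \<le> r i" "\<And>i. r i \<le> B"
  shows "\<bar>pois c p\<bar> \<le> pois c r"
proof -
  have B: "\<bar>p i\<bar> \<le> B" "\<bar>r i\<bar> \<le> B" for i using assms(2,3)[of i] by auto
  have "pois c p \<le> pois c r"
    by (rule pois_mono[OF assms(1) B]) (use assms(2) in \<open>auto simp: abs_le_iff\<close>)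
  moreover have "pois c (\<lambda>i. - 1 * p i) \<le> pois c r"
    by (rule pois_mono[OF assms(1) _ B(2), of _ B]) (use assms(2) B in \<open>auto simp: abs_le_iff\<close>)
  hence "- pois c p \<le> pois c r" by (subst (asm) pois_cmult[OF B(1)]) auto
  ultimately show ?thesis by linarith
qed

lemma pois_abs_bound: "\<lbrakk>0 \<le> c; \<And>i. \<bar>p i\<bar> \<le> B\<rbrakk> \<Longrightarrow> \<bar>pois c p\<bar> \<le> B"
  using pois_abs_le[of c p "\<lambda>_. B" B] by simp

text \<open>The sum of two independent Poisson variables of mean \<open>c\<close> is Poisson of mean
  \<open>2 * c\<close>, and given the total \<open>k\<close> the split is binomial. This writes a
  product of two expectations at time t as a single average over steps.\<close>

lemma pois_mult:
  assumes "\<And>i. \<bar>a i\<bar> \<le> A" "\<And>i. \<bar>b i\<bar> \<le> B"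
  shows "pois (2 * c) (\<lambda>k. (\<Sum>i\<le>k. real (k choose i) * a i * b (k - i)) / 2 ^ k) = pois c a * pois c b"
proof -
  have *: "(\<Sum>i\<le>k. (c ^ i / fact i * a i) * (c ^ (k - i) / fact (k - i) * b (k - i)))
      = (2 * c) ^ k / fact k * ((\<Sum>i\<le>k. real (k choose i) * a i * b (k - i)) / 2 ^ k)" for k
    unfolding sum_divide_distrib sum_distrib_left
  proof (intro sum.cong refl)
    fix i assume "i \<in> {..k}"
    hence i: "i \<le> k" by simp
    have "c ^ k = c ^ i * c ^ (k - i)" using i by (metis le_add_diff_inverse power_add)
    thus "(c ^ i / fact i * a i) * (c ^ (k - i) / fact (k - i) * b (k - i))
      = (2 * c) ^ k / fact k * (real (k choose i) * a i * b (k - i) / 2 ^ k)"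
      by (simp add: binomial_fact[OF i] field_simps power_mult_distrib)
  qed
  have "(\<lambda>k. (2 * c) ^ k / fact k * ((\<Sum>i\<le>k. real (k choose i) * a i * b (k - i)) / 2 ^ k)) sums
      ((\<Sum>i. c ^ i / fact i * a i) * (\<Sum>i. c ^ i / fact i * b i))"
    using Cauchy_product_sums[OF pois_summable_norm[of a A c, OF assms(1)] pois_summable_norm[of b B c, OF assms(2)]]
    by (simp only: *)
  from sums_mult[OF this, of "exp (- (2 * c))"]
  have "pois (2 * c) (\<lambda>k. (\<Sum>i\<le>k. real (k choose i) * a i * b (k - i)) / 2 ^ k)
     = exp (- (2 * c)) * ((\<Sum>i. c ^ i / fact i * a i) * (\<Sum>i. c ^ i / fact i * b i))"
    by (simp add: pois_def sums_iff mult.assoc)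
  also have "exp (- (2 * c)) = exp (- c) * exp (- c)" by (simp add: exp_add[symmetric])
  also have "exp (- c) * exp (- c) * ((\<Sum>i. c ^ i / fact i * a i) * (\<Sum>i. c ^ i / fact i * b i))
     = (exp (- c) * (\<Sum>i. c ^ i / fact i * a i)) * (exp (- c) * (\<Sum>i. c ^ i / fact i * b i))"
    by simp
  also have "\<dots> = pois c a * pois c b"
    unfolding pois_def
    using suminf_mult[OF summable_norm_cancel[OF pois_summable_norm[of a A c, OF assms(1)]], of "exp (- c)"]
      suminf_mult[OF summable_norm_cancel[OF pois_summable_norm[of b B c, OF assms(2)]], of "exp (- c)"]
    by (simp add: mult.assoc)
  finally show ?thesis .
qed

text \<open>Additivity of independent Poisson variables; it yields the semigroup property of the
  chain in \<open>expect_law_add\<close>.\<close>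

lemma pois_pois:
  assumes c: "0 \<le> c" and d: "0 \<le> d" and B: "\<And>i. \<bar>p i\<bar> \<le> B"
  shows "pois c (\<lambda>i. pois d (\<lambda>j. p (i + j))) = pois (c + d) p"
proof -
  define w :: "real \<Rightarrow> nat \<Rightarrow> real" where "w = (\<lambda>c i. exp (- c) * c ^ i / fact i)"
  define x where "x = (\<lambda>(i, j). w c i * w d j * p (i + j))"
  have w0: "0 \<le> w a i" if "0 \<le> a" for a i using that by (simp add: w_def)
  have wsum: "(w a has_sum 1) UNIV" if "0 \<le> a" for a
    by (rule sums_nonneg_imp_has_sum_strong) (use pois_weight_sums[of a] that in \<open>auto simp: w_def\<close>)
  have B0: "0 \<le> B" using B[of 0] by linarith
  \<comment> \<open>Absolute summability of the double family, with the bound \<open>B\<close> as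
    majorant of \<open>p\<close>; it licenses the rearrangement below.\<close>
  have "(\<lambda>(i, j). w c i * w d j * B) summable_on (SIGMA i:UNIV. UNIV)"
  proof (rule summable_on_SigmaI)
    fix i :: nat
    have "((\<lambda>j. w c i * B * w d j) has_sum w c i * B * 1) UNIV"
      by (intro has_sum_cmult_right wsum d)
    thus "((\<lambda>j. case (i, j) of (i, j) \<Rightarrow> w c i * w d j * B) has_sum w c i * B) UNIV"
      by (simp add: mult_ac)
    show "(\<lambda>i. w c i * B) summable_on UNIV"
      by (intro summable_on_cmult_left has_sum_imp_summable[OF wsum[OF c]])
  qed (use B0 w0 c d in auto)
  hence "(\<lambda>(i, j). w c i * w d j * B) summable_on UNIV" by simp
  hence "(\<lambda>ij. norm (x ij)) summable_on UNIV"
  proof (rule Infinite_Sum.abs_summable_on_comparison_test')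
    fix ij :: "nat \<times> nat"
    show "norm (x ij) \<le> (case ij of (i, j) \<Rightarrow> w c i * w d j * B)"
      by (cases ij) (simp add: x_def abs_mult w0 c d mult_left_mono B)
  qed
  hence xs: "x summable_on UNIV" by (rule abs_summable_summable)
  have pois_infsum: "pois a r = (\<Sum>\<^sub>\<infinity>i. w a i * r i)" if "0 \<le> a" "\<And>i. \<bar>r i\<bar> \<le> B" for a r
  proof -
    have sm: "summable (\<lambda>i. norm (w a i * r i))"
      using summable_mult[OF pois_summable_norm[of r B a, OF that(2)], of "exp (- a)"]
      by (simp add: w_def abs_mult mult.assoc)
    from sm have "((\<lambda>i. w a i * r i) has_sum (\<Sum>i. w a i * r i)) UNIV"
      by (rule norm_summable_imp_has_sum[OF _ summable_sums[OF summable_norm_cancel[OF sm]]])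
    thus ?thesis by (simp add: pois_def w_def infsumI)
  qed
  have inner: "(\<Sum>\<^sub>\<infinity>j. x (i, j)) = w c i * pois d (\<lambda>j. p (i + j))" for i
    unfolding x_def prod.case mult.assoc infsum_cmult_right'
    using pois_infsum[of d "\<lambda>j. p (i + j)"] d B by simp
  have "pois c (\<lambda>i. pois d (\<lambda>j. p (i + j))) = (\<Sum>\<^sub>\<infinity>i. w c i * pois d (\<lambda>j. p (i + j)))"
    by (rule pois_infsum[OF c]) (rule pois_abs_bound[OF d B])
  also have "\<dots> = (\<Sum>\<^sub>\<infinity>i. \<Sum>\<^sub>\<infinity>j. x (i, j))"
    by (simp only: inner)
  also have "\<dots> = (\<Sum>\<^sub>\<infinity>ij\<in>UNIV \<times> UNIV. x ij)"
    using infsum_Sigma_banach[of x UNIV "\<lambda>_. UNIV"] xs by simp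
  \<comment> \<open>Pairs are regrouped along the diagonals \<open>k = i + j\<close>, which the
    binomial theorem then sums.\<close>
  also have "\<dots> = (\<Sum>\<^sub>\<infinity>ki\<in>(SIGMA k:UNIV. {..k}). x (snd ki, fst ki - snd ki))"
    by (rule infsum_reindex_bij_betw[symmetric], rule bij_betw_byWitness[where f' = "\<lambda>(i, j). (i + j, i)"]) auto
  also have "\<dots> = (\<Sum>\<^sub>\<infinity>k. \<Sum>\<^sub>\<infinity>i\<in>{..k}. x (i, k - i))"
  proof -
    have "(\<lambda>ki. x (snd ki, fst ki - snd ki)) summable_on (SIGMA k:UNIV. {..k}) \<longleftrightarrow> x summable_on UNIV"
      by (rule summable_on_reindex_bij_betw, rule bij_betw_byWitness[where f' = "\<lambda>(i, j). (i + j, i)"]) auto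
    thus ?thesis using infsum_Sigma_banach[of "\<lambda>ki. x (snd ki, fst ki - snd ki)" UNIV "\<lambda>k. {..k}"] xs
      by simp
  qed
  also have "\<dots> = (\<Sum>\<^sub>\<infinity>k. w (c + d) k * p k)"
  proof (intro infsum_cong)
    fix k
    have "exp (- (c + d)) = exp (- c) * exp (- d)" by (simp add: exp_add[symmetric])
    hence "(\<Sum>i\<le>k. x (i, k - i)) = (\<Sum>i\<le>k. exp (- (c + d)) * p k / fact k * (real (k choose i) * c ^ i * d ^ (k - i)))"
      by (intro sum.cong refl)
         (simp add: x_def w_def binomial_fact field_simps)
    also have "\<dots> = exp (- (c + d)) * p k / fact k * (c + d) ^ k"
      unfolding sum_distrib_left[symmetric] binomial_ring by simp
    finally show "(\<Sum>\<^sub>\<infinity>i\<in>{..k}. x (i, k - i)) = w (c + d) k * p k"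
      by (simp add: w_def)
  qed
  also have "\<dots> = pois (c + d) p"
    by (simp add: pois_infsum c d B)
  finally show ?thesis .
qed

text \<open>If \<open>a k = (T - 1)\<^sup>k p\<close> is the sequence of finite differences of \<open>p i = T\<^sup>i p\<close>, this is \<open>exp (c (T - 1)) p\<close>.\<close>

lemma exp_series_eq_pois:
  assumes "\<And>i. \<bar>p i\<bar> \<le> B"
  shows "(\<lambda>k. c ^ k / fact k * (\<Sum>i\<le>k. real (k choose i) * (- 1) ^ (k - i) * p i)) sums pois c p"
proof -
  have *: "(\<Sum>i\<le>k. (c ^ i / fact i * p i) * ((- c) ^ (k - i) / fact (k - i) * 1))
      = c ^ k / fact k * (\<Sum>i\<le>k. real (k choose i) * (- 1) ^ (k - i) * p i)" for k
    unfolding sum_distrib_left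
  proof (intro sum.cong refl)
    fix i assume "i \<in> {..k}"
    hence i: "i \<le> k" by simp
    have "c ^ k = c ^ i * c ^ (k - i)" using i by (metis le_add_diff_inverse power_add)
    moreover have "(- c) ^ (k - i) = (- 1) ^ (k - i) * c ^ (k - i)" by (rule power_minus)
    ultimately show "(c ^ i / fact i * p i) * ((- c) ^ (k - i) / fact (k - i) * 1)
      = c ^ k / fact k * (real (k choose i) * (- 1) ^ (k - i) * p i)"
      by (simp add: binomial_fact[OF i] field_simps)
  qed
  have "(\<lambda>k. c ^ k / fact k * (\<Sum>i\<le>k. real (k choose i) * (- 1) ^ (k - i) * p i)) sums
      ((\<Sum>i. c ^ i / fact i * p i) * (\<Sum>i. (- c) ^ i / fact i * 1))"
    using Cauchy_product_sums[OF pois_summable_norm[of p B c, OF assms] pois_summable_norm[of "\<lambda>_. 1" 1 "- c"]]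
    by (simp only: *)
  also have "(\<Sum>i. (- c) ^ i / fact i * 1) = exp (- c)"
    by (simp add: exp_def scaleR_conv_of_real field_simps)
  also have "(\<Sum>i. c ^ i / fact i * p i) * exp (- c) = (\<Sum>i. exp (- c) * (c ^ i / fact i * p i))"
    by (subst suminf_mult[OF summable_norm_cancel[OF pois_summable_norm[of p B c, OF assms]]]) (rule mult.commute)
  also have "\<dots> = pois c p" by (simp add: pois_def mult.assoc)
  finally show ?thesis .
qed

text \<open>Pascal's rule for finite differences: a difference of order \<open>Suc k\<close> is one
  of order \<open>k\<close> applied to first differences. It is the induction step for the powers of
  \<open>T - 1\<close>.\<close>

lemma binomial_difference_Suc:
  fixes p :: "nat \<Rightarrow> real"
  shows "(\<Sum>i\<le>Suc k. real (Suc k choose i) * (- 1) ^ (Suc k - i) * p i)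
    = (\<Sum>i\<le>k. real (k choose i) * (- 1) ^ (k - i) * (p (Suc i) - p i))"
proof -
  have "(\<Sum>i\<le>Suc k. real (Suc k choose i) * (- 1) ^ (Suc k - i) * p i)
      = (- 1) ^ Suc k * p 0 + (\<Sum>i\<le>k. real (Suc k choose Suc i) * (- 1) ^ (k - i) * p (Suc i))"
    by (subst sum.atMost_Suc_shift) simp
  also have "(\<Sum>i\<le>k. real (Suc k choose Suc i) * (- 1) ^ (k - i) * p (Suc i))
      = (\<Sum>i\<le>k. real (k choose i) * (- 1) ^ (k - i) * p (Suc i))
        + (\<Sum>i\<le>k. real (k choose Suc i) * (- 1) ^ (k - i) * p (Suc i))"
    by (simp add: sum.distrib[symmetric] algebra_simps)
  also have "(\<Sum>i\<le>k. real (k choose Suc i) * (- 1) ^ (k - i) * p (Suc i))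
      = (\<Sum>i\<le>Suc k. real (k choose i) * (- 1) ^ (Suc k - i) * p i) - (- 1) ^ Suc k * p 0"
    by (subst sum.atMost_Suc_shift) simp
  also have "(\<Sum>i\<le>Suc k. real (k choose i) * (- 1) ^ (Suc k - i) * p i)
     = - (\<Sum>i\<le>k. real (k choose i) * (- 1) ^ (k - i) * p i)"
    by (simp add: sum_negf[symmetric] Suc_diff_le)
  finally show ?thesis by (simp add: sum_subtractf right_diff_distrib)
qed

section \<open>The voter model on the cycle\<close>

locale voter_cycle =
  fixes n q :: nat and \<theta> :: real
  assumes n3: "3 \<le> n" and q2: "2 \<le> q" and \<theta>_pos: "0 < \<theta>" and \<theta>_le_1: "\<theta> \<le> 1"
begin

text \<open>Successor and predecessor on the cycle, by cases instead of with \<open>mod\<close>, so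
  that linear arithmetic settles their properties.\<close>

definition nx :: "nat \<Rightarrow> nat" where "nx u = (if Suc u = n then 0 else Suc u)"
definition pv :: "nat \<Rightarrow> nat" where "pv u = (if u = 0 then n - 1 else u - 1)"

definition upd :: "nat \<Rightarrow> ((nat \<Rightarrow> nat) \<Rightarrow> real) \<Rightarrow> (nat \<Rightarrow> nat) \<Rightarrow> real" where
  "upd u f x = \<theta> * ((\<Sum>j<q. f (x(u := j))) / real q)
     + (1 - \<theta>) * ((f (x(u := x (nx u))) + f (x(u := x (pv u)))) / 2)"

text \<open>Expectation after one ring, at a uniformly chosen vertex: the transition operator of the
  uniformized chain.\<close>

definition step :: "((nat \<Rightarrow> nat) \<Rightarrow> real) \<Rightarrow> (nat \<Rightarrow> nat) \<Rightarrow> real" where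
  "step f x = (\<Sum>u<n. upd u f x) / real n"

text \<open>Run at rate \<open>2 * n\<close>, this has the same generator as \<open>step\<close> at
  rate \<open>n\<close>. It serves the comparison with two independent copies: these ring at total
  rate \<open>2 * n\<close>, and each ring moves either copy with probability 1/2.\<close>

definition lazy :: "((nat \<Rightarrow> nat) \<Rightarrow> real) \<Rightarrow> (nat \<Rightarrow> nat) \<Rightarrow> real" where
  "lazy f x = (f x + step f x) / 2"

abbreviation G :: "nat graph" where "G \<equiv> cycle_graph n"
abbreviation \<Omega> :: "(nat \<Rightarrow> nat) set" where "\<Omega> \<equiv> configs G q"

definition expect :: "((nat \<Rightarrow> nat) \<Rightarrow> real) \<Rightarrow> ((nat \<Rightarrow> nat) \<Rightarrow> real) \<Rightarrow> real" where
  "expect p f = (\<Sum>x\<in>\<Omega>. p x * f x)"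

abbreviation law :: "(nat \<Rightarrow> nat) \<Rightarrow> real \<Rightarrow> (nat \<Rightarrow> nat) \<Rightarrow> real" where
  "law x t \<equiv> voter_law G q \<theta> x t"

lemma nx_less [simp]: "u < n \<Longrightarrow> nx u < n" and pv_less [simp]: "u < n \<Longrightarrow> pv u < n"
  using n3 by (auto simp: nx_def pv_def)

lemma nx_pv [simp]: "u < n \<Longrightarrow> nx (pv u) = u" and pv_nx [simp]: "u < n \<Longrightarrow> pv (nx u) = u"
  using n3 by (auto simp: nx_def pv_def)

lemma nx_neq [simp]: "u < n \<Longrightarrow> nx u \<noteq> u" and pv_neq [simp]: "u < n \<Longrightarrow> pv u \<noteq> u"
  and nx_neq_pv: "u < n \<Longrightarrow> nx u \<noteq> pv u"
  using n3 by (auto simp: nx_def pv_def)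

lemma bij_nx: "bij_betw nx {..<n} {..<n}"
  by (rule bij_betw_byWitness[where f' = pv]) auto

lemma bij_pv: "bij_betw pv {..<n} {..<n}"
  by (rule bij_betw_byWitness[where f' = nx]) auto

lemma sum_nx: "(\<Sum>u<n. f (nx u)) = (\<Sum>u<n. f u)" and sum_pv: "(\<Sum>u<n. f (pv u)) = (\<Sum>u<n. f u)"
  by (rule sum.reindex_bij_betw[OF bij_nx] sum.reindex_bij_betw[OF bij_pv])+

lemma vertices_cycle: "vertices G = {..<n}"
  by (simp add: cycle_graph_def)

lemma configs_eq: "\<Omega> = {..<n} \<rightarrow>\<^sub>E {..<q}"
  by (simp add: configs_def vertices_cycle)

lemma finite_configs [simp]: "finite \<Omega>"
  unfolding configs_eq by (intro finite_PiE) auto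

lemma configs_update: "\<lbrakk>x \<in> \<Omega>; u < n; j < q\<rbrakk> \<Longrightarrow> x(u := j) \<in> \<Omega>"
  unfolding configs_eq by (auto simp: PiE_iff extensional_def)

lemma configs_less: "\<lbrakk>x \<in> \<Omega>; u < n\<rbrakk> \<Longrightarrow> x u < q"
  unfolding configs_eq by auto

lemma edges_cycle: "edges G = (\<lambda>i. {i, nx i}) ` {..<n}"
  unfolding cycle_graph_def snd_conv by (intro image_cong refl) (auto simp: nx_def mod_if)

lemma neighbors_cycle: assumes "u < n" shows "neighbors G u = {nx u, pv u}"
proof -
  have "v < n \<Longrightarrow> ({u, v} \<in> edges G) = (v = nx u \<or> v = pv u)" for v
    unfolding edges_cycle using assms by (auto simp: doubleton_eq_iff image_iff intro: bexI[of _ "pv u"])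
  thus ?thesis using assms by (auto simp: neighbors_def vertices_cycle)
qed

lemma card_edges_cycle: "card (edges G) = n"
proof -
  have "inj_on (\<lambda>i. {i, nx i}) {..<n}"
  proof (rule inj_onI)
    fix i j assume ij: "i \<in> {..<n}" "j \<in> {..<n}" "{i, nx i} = {j, nx j}"
    show "i = j"
    proof (rule ccontr)
      assume "i \<noteq> j"
      hence "i = nx j" "nx i = j" using ij(3) by (auto simp: doubleton_eq_iff)
      hence "nx j = pv j" using pv_nx[of i] ij by auto
      thus False using nx_neq_pv[of j] ij by auto
    qed
  qed
  thus ?thesis by (simp add: edges_cycle card_image)
qed

lemma graph_weight_cycle: "v < n \<Longrightarrow> graph_weight G v = 1 / real n"
  using nx_neq_pv[of v] by (simp add: graph_weight_def neighbors_cycle card_edges_cycle)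

lemma expect_voter_update:
  assumes x: "x \<in> \<Omega>" and u: "u < n"
  shows "(\<Sum>y\<in>\<Omega>. pmf (voter_update G q \<theta> u x) y * f y) = upd u f x"
proof -
  have q0: "{..<q} \<noteq> {}" using q2 by (auto simp: lessThan_empty_iff)
  have nn: "neighbors G u \<noteq> {}" "finite (neighbors G u)" using neighbors_cycle[OF u] by auto
  have nq: "x v < q" if "v \<in> neighbors G u" for v
    using that neighbors_cycle[OF u] configs_less[OF x] u by auto
  have *: "(\<Sum>y\<in>\<Omega>. pmf (map_pmf g (pmf_of_set B)) y * f y) = (\<Sum>b\<in>B. f (g b)) / card B"
    if "g ` B \<subseteq> \<Omega>" "B \<noteq> {}" "finite B" for g :: "nat \<Rightarrow> nat \<Rightarrow> nat" and B
  proof -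
    have "(\<Sum>y\<in>\<Omega>. pmf (map_pmf g (pmf_of_set B)) y * f y) = measure_pmf.expectation (map_pmf g (pmf_of_set B)) f"
      by (subst integral_measure_pmf[of \<Omega>]) (use that in auto)
    also have "\<dots> = (\<Sum>b\<in>B. f (g b)) / card B"
      using that by (simp add: integral_pmf_of_set)
    finally show ?thesis .
  qed
  have "pmf (voter_update G q \<theta> u x) y = \<theta> * pmf (map_pmf (\<lambda>j. x(u := j)) (pmf_of_set {..<q})) y
     + (1 - \<theta>) * pmf (map_pmf (\<lambda>v. x(u := x v)) (pmf_of_set (neighbors G u))) y" for y
    using \<theta>_pos \<theta>_le_1 by (simp add: voter_update_def pmf_bind)
  hence "(\<Sum>y\<in>\<Omega>. pmf (voter_update G q \<theta> u x) y * f y)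
     = \<theta> * (\<Sum>y\<in>\<Omega>. pmf (map_pmf (\<lambda>j. x(u := j)) (pmf_of_set {..<q})) y * f y)
     + (1 - \<theta>) * (\<Sum>y\<in>\<Omega>. pmf (map_pmf (\<lambda>v. x(u := x v)) (pmf_of_set (neighbors G u))) y * f y)"
    by (simp add: distrib_right sum.distrib sum_distrib_left mult.assoc)
  also have "(\<Sum>y\<in>\<Omega>. pmf (map_pmf (\<lambda>j. x(u := j)) (pmf_of_set {..<q})) y * f y)
      = (\<Sum>j<q. f (x(u := j))) / real q"
    by (subst *) (use q0 x u in \<open>auto intro: configs_update\<close>)
  also have "(\<Sum>y\<in>\<Omega>. pmf (map_pmf (\<lambda>v. x(u := x v)) (pmf_of_set (neighbors G u))) y * f y)
      = (f (x(u := x (nx u))) + f (x(u := x (pv u)))) / 2"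
    by (subst *) (use nn x u nq in \<open>auto intro: configs_update simp: neighbors_cycle nx_neq_pv\<close>)
  finally show ?thesis by (simp only: upd_def)
qed

lemma upd_const [simp]: "upd u (\<lambda>_. c) x = c"
  using q2 by (simp add: upd_def algebra_simps)

lemma generator_expect:
  assumes x: "x \<in> \<Omega>"
  shows "(\<Sum>y\<in>\<Omega>. generator \<Omega> (voter_rate G q \<theta>) x y * f y) = real n * (step f x - f x)"
proof -
  let ?r = "voter_rate G q \<theta>"
  have "(\<Sum>y\<in>\<Omega>. generator \<Omega> ?r x y * f y)
      = generator \<Omega> ?r x x * f x + (\<Sum>y\<in>\<Omega> - {x}. generator \<Omega> ?r x y * f y)"
    using x by (intro sum.remove) auto
  also have "(\<Sum>y\<in>\<Omega> - {x}. generator \<Omega> ?r x y * f y) = (\<Sum>y\<in>\<Omega> - {x}. ?r x y * f y)"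
    by (intro sum.cong refl) (auto simp: generator_def)
  also have "generator \<Omega> ?r x x * f x + (\<Sum>y\<in>\<Omega> - {x}. ?r x y * f y)
      = (\<Sum>y\<in>\<Omega> - {x}. ?r x y * (f y - f x))"
    by (simp add: generator_def sum_distrib_right sum_subtractf right_diff_distrib)
  \<comment> \<open>The rate \<open>?r x x\<close> may be positive, since a ring can leave
    \<open>x\<close> unchanged, but it multiplies \<open>f x - f x\<close>.\<close>
  also have "\<dots> = (\<Sum>y\<in>\<Omega>. ?r x y * (f y - f x))"
    using x by (subst (2) sum.remove[of _ x]) auto
  also have "\<dots> = (\<Sum>u<n. \<Sum>y\<in>\<Omega>. pmf (voter_update G q \<theta> u x) y * (f y - f x))"
    unfolding voter_rate_def vertices_cycle sum_distrib_right by (rule sum.swap)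
  also have "\<dots> = (\<Sum>u<n. upd u (\<lambda>y. f y - f x) x)"
    by (intro sum.cong refl expect_voter_update[OF x]) auto
  also have "\<dots> = (\<Sum>u<n. upd u f x - f x)"
    using q2 by (intro sum.cong refl) (simp add: upd_def sum_subtractf field_simps)
  also have "\<dots> = real n * (step f x - f x)"
    using n3 by (simp add: sum_subtractf step_def field_simps)
  finally show ?thesis .
qed

definition gen :: "((nat \<Rightarrow> nat) \<Rightarrow> real) \<Rightarrow> (nat \<Rightarrow> nat) \<Rightarrow> real" where
  "gen f x = real n * (step f x - f x)"

lemma upd_cong_configs:
  assumes "\<And>x. x \<in> \<Omega> \<Longrightarrow> f x = g x" "x \<in> \<Omega>" "u < n" shows "upd u f x = upd u g x"
  unfolding upd_def using assms configs_less[of x] by (simp add: configs_update)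

lemma gen_cong_configs:
  assumes "\<And>x. x \<in> \<Omega> \<Longrightarrow> f x = g x" "x \<in> \<Omega>" shows "gen f x = gen g x"
  unfolding gen_def step_def using assms upd_cong_configs[of f g x] by simp

lemma kernel_power_expect:
  assumes "x \<in> \<Omega>"
  shows "(\<Sum>y\<in>\<Omega>. kernel_power \<Omega> (generator \<Omega> (voter_rate G q \<theta>)) k x y * f y) = (gen ^^ k) f x"
  using assms
proof (induction k arbitrary: x)
  case 0
  have "(\<Sum>y\<in>\<Omega>. (if x = y then 1 else 0) * f y) = (\<Sum>y\<in>\<Omega>. if x = y then f y else 0)"
    by (intro sum.cong) auto
  with 0 show ?case by simp
next
  case (Suc k)
  let ?Q = "generator \<Omega> (voter_rate G q \<theta>)"
  have "(\<Sum>y\<in>\<Omega>. kernel_power \<Omega> ?Q (Suc k) x y * f y)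
      = (\<Sum>z\<in>\<Omega>. ?Q x z * (\<Sum>y\<in>\<Omega>. kernel_power \<Omega> ?Q k z y * f y))"
    by (simp add: sum_distrib_right sum_distrib_left mult.assoc) (rule sum.swap)
  also have "\<dots> = gen (\<lambda>z. \<Sum>y\<in>\<Omega>. kernel_power \<Omega> ?Q k z y * f y) x"
    unfolding gen_def using generator_expect[OF Suc.prems] .
  also have "\<dots> = gen ((gen ^^ k) f) x"
    by (rule gen_cong_configs) (use Suc in auto)
  finally show ?case by simp
qed

lemma step_sum: "step (\<lambda>x. \<Sum>i\<in>I. a i * g i x) = (\<lambda>x. \<Sum>i\<in>I. a i * step (g i) x)"
proof
  fix x
  have "upd u (\<lambda>x. \<Sum>i\<in>I. a i * g i x) x = (\<Sum>i\<in>I. a i * upd u (g i) x)" for u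
  proof -
    have "(\<Sum>j<q. \<Sum>i\<in>I. a i * g i (x(u := j))) = (\<Sum>i\<in>I. a i * (\<Sum>j<q. g i (x(u := j))))"
      by (subst sum.swap) (simp add: sum_distrib_left)
    thus ?thesis
      by (simp add: upd_def sum_distrib_left sum_divide_distrib sum.distrib algebra_simps add_divide_distrib)
  qed
  hence "step (\<lambda>x. \<Sum>i\<in>I. a i * g i x) x = (\<Sum>u<n. \<Sum>i\<in>I. a i * upd u (g i) x) / real n"
    by (simp add: step_def)
  also have "\<dots> = (\<Sum>i\<in>I. a i * (\<Sum>u<n. upd u (g i) x)) / real n"
    by (subst sum.swap) (simp add: sum_distrib_left)
  also have "\<dots> = (\<Sum>i\<in>I. a i * step (g i) x)"
    by (subst sum_divide_distrib) (simp add: step_def)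
  finally show "step (\<lambda>x. \<Sum>i\<in>I. a i * g i x) x = (\<Sum>i\<in>I. a i * step (g i) x)" .
qed

lemma lazy_sum: "lazy (\<lambda>x. \<Sum>i\<in>I. a i * g i x) = (\<lambda>x. \<Sum>i\<in>I. a i * lazy (g i) x)"
proof
  fix x
  have "(\<Sum>i\<in>I. a i * lazy (g i) x) = (\<Sum>i\<in>I. (a i * g i x + a i * step (g i) x) / 2)"
    by (intro sum.cong refl) (simp add: lazy_def field_simps)
  also have "\<dots> = ((\<Sum>i\<in>I. a i * g i x) + (\<Sum>i\<in>I. a i * step (g i) x)) / 2"
    by (simp add: sum_divide_distrib[symmetric] sum.distrib)
  finally show "lazy (\<lambda>x. \<Sum>i\<in>I. a i * g i x) x = (\<Sum>i\<in>I. a i * lazy (g i) x)"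
    by (simp add: lazy_def step_sum)
qed

lemma step_abs_le: assumes "\<And>x. \<bar>f x\<bar> \<le> B" shows "\<bar>step f x\<bar> \<le> B"
proof -
  have "\<bar>upd u f x\<bar> \<le> B" for u
  proof -
    have "\<bar>\<Sum>j<q. f (x(u := j))\<bar> \<le> (\<Sum>j<q. B)"
      by (intro order.trans[OF sum_abs] sum_mono assms)
    hence 1: "\<bar>(\<Sum>j<q. f (x(u := j))) / real q\<bar> \<le> B"
      using q2 by (simp add: field_simps)
    have 2: "\<bar>(f (x(u := x (nx u))) + f (x(u := x (pv u)))) / 2\<bar> \<le> B"
      using assms[of "x(u := x (nx u))"] assms[of "x(u := x (pv u))"] by (simp add: abs_le_iff)
    have "\<bar>upd u f x\<bar> \<le> \<bar>\<theta> * ((\<Sum>j<q. f (x(u := j))) / real q)\<bar>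
        + \<bar>(1 - \<theta>) * ((f (x(u := x (nx u))) + f (x(u := x (pv u)))) / 2)\<bar>"
      unfolding upd_def by (rule abs_triangle_ineq)
    also have "\<dots> \<le> \<theta> * B + (1 - \<theta>) * B"
      using \<theta>_pos \<theta>_le_1 1 2 unfolding abs_mult by (intro add_mono mult_mono) auto
    finally show ?thesis by (simp add: algebra_simps)
  qed
  hence "\<bar>\<Sum>u<n. upd u f x\<bar> \<le> (\<Sum>u<n. B)"
    by (intro order.trans[OF sum_abs] sum_mono)
  thus ?thesis using n3 by (simp add: step_def field_simps)
qed

lemma lazy_abs_le: assumes "\<And>x. \<bar>f x\<bar> \<le> B" shows "\<bar>lazy f x\<bar> \<le> B"
  using assms[of x] step_abs_le[of f B x, OF assms] by (simp add: lazy_def abs_le_iff)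

lemma step_pow_abs_le: assumes "\<And>x. \<bar>f x\<bar> \<le> B" shows "\<bar>(step ^^ i) f x\<bar> \<le> B"
proof (induction i arbitrary: x)
  case (Suc i)
  show ?case using step_abs_le[of "(step ^^ i) f" B x, OF Suc] by simp
qed (use assms in simp)

lemma lazy_pow_abs_le: assumes "\<And>x. \<bar>f x\<bar> \<le> B" shows "\<bar>(lazy ^^ i) f x\<bar> \<le> B"
proof (induction i arbitrary: x)
  case (Suc i)
  show ?case using lazy_abs_le[of "(lazy ^^ i) f" B x, OF Suc] by simp
qed (use assms in simp)

text \<open>Stated for an abstract operator \<open>T\<close> of rate \<open>c\<close>, because it is
  applied both to \<open>step\<close> with rate \<open>n\<close> and to \<open>lazy\<close> with
  rate \<open>2 * n\<close>.\<close>

lemma gen_pow_binomial: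
  assumes gen: "\<And>f x. gen f x = c * (T f x - f x)"
    and sum: "\<And>a g (I :: nat set). T (\<lambda>x. \<Sum>i\<in>I. a i * g i x) = (\<lambda>x. \<Sum>i\<in>I. a i * T (g i) x)"
  shows "(gen ^^ k) f = (\<lambda>x. \<Sum>i\<le>k. c ^ k * (real (k choose i) * (- 1) ^ (k - i)) * (T ^^ i) f x)"
proof (induction k)
  case 0 thus ?case by simp
next
  case (Suc k)
  show ?case
  proof
    fix x
    have "(gen ^^ Suc k) f x = c * (T ((gen ^^ k) f) x - (gen ^^ k) f x)"
      by (simp add: gen)
    also have "T ((gen ^^ k) f) x = (\<Sum>i\<le>k. c ^ k * (real (k choose i) * (- 1) ^ (k - i)) * (T ^^ Suc i) f x)"
      by (subst Suc.IH, subst sum) simp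
    also have "(gen ^^ k) f x = (\<Sum>i\<le>k. c ^ k * (real (k choose i) * (- 1) ^ (k - i)) * (T ^^ i) f x)"
      by (subst Suc.IH) simp
    also have "c * ((\<Sum>i\<le>k. c ^ k * (real (k choose i) * (- 1) ^ (k - i)) * (T ^^ Suc i) f x)
        - (\<Sum>i\<le>k. c ^ k * (real (k choose i) * (- 1) ^ (k - i)) * (T ^^ i) f x))
      = c ^ Suc k * (\<Sum>i\<le>k. real (k choose i) * (- 1) ^ (k - i) * ((T ^^ Suc i) f x - (T ^^ i) f x))"
      unfolding sum_subtractf[symmetric] sum_distrib_left
      by (intro sum.cong refl) (simp add: algebra_simps)
    finally have "(gen ^^ Suc k) f x = c ^ Suc k *
       (\<Sum>i\<le>k. real (k choose i) * (- 1) ^ (k - i) * ((T ^^ Suc i) f x - (T ^^ i) f x))" .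
    also have "\<dots> = (\<Sum>i\<le>Suc k. c ^ Suc k * (real (Suc k choose i) * (- 1) ^ (Suc k - i)) * (T ^^ i) f x)"
      by (subst binomial_difference_Suc[symmetric]) (simp add: sum_distrib_left mult.assoc del: sum.atMost_Suc)
    finally show "(gen ^^ Suc k) f x
        = (\<Sum>i\<le>Suc k. c ^ Suc k * (real (Suc k choose i) * (- 1) ^ (Suc k - i)) * (T ^^ i) f x)" .
  qed
qed

lemma gen_exp_series:
  assumes gen: "\<And>f x. gen f x = c * (T f x - f x)"
    and sum: "\<And>a g (I :: nat set). T (\<lambda>x. \<Sum>i\<in>I. a i * g i x) = (\<lambda>x. \<Sum>i\<in>I. a i * T (g i) x)"
    and B: "\<And>i. \<bar>(T ^^ i) f x\<bar> \<le> B"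
  shows "(\<lambda>k. t ^ k / fact k * (gen ^^ k) f x) sums pois (c * t) (\<lambda>i. (T ^^ i) f x)"
proof -
  have "t ^ k / fact k * (gen ^^ k) f x
     = (c * t) ^ k / fact k * (\<Sum>i\<le>k. real (k choose i) * (- 1) ^ (k - i) * (T ^^ i) f x)" for k
    by (subst gen_pow_binomial[OF gen sum])
       (simp add: sum_distrib_left sum_divide_distrib power_mult_distrib mult_ac)
  thus ?thesis using exp_series_eq_pois[of "\<lambda>i. (T ^^ i) f x" B "c * t", OF B] by simp
qed

lemma expect_law_sums:
  assumes x: "x \<in> \<Omega>"
  shows "(\<lambda>k. t ^ k / fact k * (gen ^^ k) f x) sums expect (law x t) f"
proof -
  let ?kp = "kernel_power \<Omega> (generator \<Omega> (voter_rate G q \<theta>))"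
  have 1: "?kp k x y = (gen ^^ k) (\<lambda>z. of_bool (z = y)) x" if "y \<in> \<Omega>" for k y
  proof -
    have "(\<Sum>z\<in>\<Omega>. ?kp k x z * of_bool (z = y)) = (\<Sum>z\<in>\<Omega>. if z = y then ?kp k x y else 0)"
      by (intro sum.cong) auto
    thus ?thesis using kernel_power_expect[OF x, of k "\<lambda>z. of_bool (z = y)"] that by simp
  qed
  have "(\<lambda>k. t ^ k / fact k * ?kp k x y) sums law x t y" if "y \<in> \<Omega>" for y
  proof -
    have "(\<lambda>k. t ^ k / fact k * ?kp k x y) sums pois (real n * t) (\<lambda>i. (step ^^ i) (\<lambda>z. of_bool (z = y)) x)"
      unfolding 1[OF that] by (rule gen_exp_series[OF gen_def step_sum step_pow_abs_le]) auto
    thus ?thesis by (simp add: voter_law_def transition_def sums_iff)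
  qed
  hence "(\<lambda>k. \<Sum>y\<in>\<Omega>. t ^ k / fact k * ?kp k x y * f y) sums (\<Sum>y\<in>\<Omega>. law x t y * f y)"
    by (intro sums_sum sums_mult2)
  thus ?thesis
    by (simp add: expect_def kernel_power_expect[OF x, symmetric] sum_distrib_left mult.assoc)
qed

lemma expect_law:
  assumes "x \<in> \<Omega>" "\<And>x. \<bar>f x\<bar> \<le> B"
  shows "expect (law x t) f = pois (real n * t) (\<lambda>i. (step ^^ i) f x)"
proof (rule sums_unique2[OF expect_law_sums[OF assms(1)]])
  show "(\<lambda>k. t ^ k / fact k * (gen ^^ k) f x) sums pois (real n * t) (\<lambda>i. (step ^^ i) f x)"
    by (rule gen_exp_series[OF gen_def step_sum step_pow_abs_le[of f B, OF assms(2)]])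
qed

lemma expect_law_lazy:
  assumes "x \<in> \<Omega>" "\<And>x. \<bar>f x\<bar> \<le> B"
  shows "expect (law x t) f = pois (2 * real n * t) (\<lambda>i. (lazy ^^ i) f x)"
proof (rule sums_unique2[OF expect_law_sums[OF assms(1)]])
  have "gen f x = 2 * real n * (lazy f x - f x)" for f x
    by (simp add: gen_def lazy_def field_simps)
  thus "(\<lambda>k. t ^ k / fact k * (gen ^^ k) f x) sums pois (2 * real n * t) (\<lambda>i. (lazy ^^ i) f x)"
    by (rule gen_exp_series[OF _ lazy_sum lazy_pow_abs_le[of f B, OF assms(2)]])
qed

end

section \<open>Local functions and linear functionals\<close>

definition dep :: "nat set \<Rightarrow> ((nat \<Rightarrow> nat) \<Rightarrow> real) \<Rightarrow> bool" where
  "dep S f \<longleftrightarrow> (\<forall>x y. (\<forall>v\<in>S. x v = y v) \<longrightarrow> f x = f y)"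

lemma depD: "\<lbrakk>dep S f; \<And>v. v \<in> S \<Longrightarrow> x v = y v\<rbrakk> \<Longrightarrow> f x = f y"
  unfolding dep_def by blast

lemma depI: "(\<And>x y. (\<And>v. v \<in> S \<Longrightarrow> x v = y v) \<Longrightarrow> f x = f y) \<Longrightarrow> dep S f"
  unfolding dep_def by blast

lemma dep_mono: "\<lbrakk>dep S f; S \<subseteq> T\<rbrakk> \<Longrightarrow> dep T f"
  unfolding dep_def by (meson subset_iff)

lemma dep_update: "\<lbrakk>dep S f; u \<notin> S\<rbrakk> \<Longrightarrow> f (x(u := j)) = f x"
  by (erule depD) auto

lemma dep_fun_upd: "dep S f \<Longrightarrow> dep (S - {u}) (\<lambda>x. f (x(u := j)))"
  by (rule depI, erule depD) auto

lemma dep_copy: "dep S f \<Longrightarrow> dep (insert w (S - {u})) (\<lambda>x. f (x(u := x w)))"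
  by (rule depI, erule depD) auto

lemma dep_const [simp]: "dep S (\<lambda>_. c)" by (simp add: dep_def)

lemma dep_lin:
  assumes "dep S f" "dep S g" shows "dep S (\<lambda>x. a * f x + b * g x)"
proof (rule depI)
  fix x y :: "nat \<Rightarrow> nat" assume "\<And>v. v \<in> S \<Longrightarrow> x v = y v"
  hence "f x = f y" "g x = g y" by (auto intro!: depD[OF assms(1)] depD[OF assms(2)])
  thus "a * f x + b * g x = a * f y + b * g y" by simp
qed

lemma dep_mult:
  assumes "dep S f" "dep T g" shows "dep (S \<union> T) (\<lambda>x. f x * g x)"
proof (rule depI)
  fix x y :: "nat \<Rightarrow> nat" assume "\<And>v. v \<in> S \<union> T \<Longrightarrow> x v = y v"
  hence "f x = f y" "g x = g y" by (auto intro!: depD[OF assms(1)] depD[OF assms(2)])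
  thus "f x * g x = f y * g y" by simp
qed

lemma dep_sum: "(\<And>i. i \<in> I \<Longrightarrow> dep S (f i)) \<Longrightarrow> dep S (\<lambda>x. \<Sum>i\<in>I. f i x)"
  unfolding dep_def by (meson sum.cong)

text \<open>The functionals in mind are errors, such as an expectation minus the stationary one, and
  covariances with one argument fixed. Linearity lets them be evaluated term by term on an averaged
  update.\<close>

definition lin :: "(((nat \<Rightarrow> nat) \<Rightarrow> real) \<Rightarrow> real) \<Rightarrow> bool" where
  "lin D \<longleftrightarrow> (\<forall>f g. D (\<lambda>x. f x + g x) = D f + D g) \<and> (\<forall>c f. D (\<lambda>x. c * f x) = c * D f)"

lemma linI: "\<lbrakk>\<And>f g. D (\<lambda>x. f x + g x) = D f + D g; \<And>c f. D (\<lambda>x. c * f x) = c * D f\<rbrakk> \<Longrightarrow> lin D"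
  unfolding lin_def by blast

lemma lin_add: "lin D \<Longrightarrow> D (\<lambda>x. f x + g x) = D f + D g"
  and lin_cmult: "lin D \<Longrightarrow> D (\<lambda>x. c * f x) = c * D f"
  unfolding lin_def by blast+

lemma lin_zero: "lin D \<Longrightarrow> D (\<lambda>_. 0) = 0"
  using lin_cmult[of D 0 "\<lambda>_. 0"] by (metis mult_zero_left)

lemma lin_sum:
  assumes "lin D" "finite I"
  shows "D (\<lambda>x. \<Sum>i\<in>I. a i * g i x) = (\<Sum>i\<in>I. a i * D (g i))"
  using assms(2)
proof induction
  case (insert i I)
  have "D (\<lambda>x. \<Sum>i\<in>insert i I. a i * g i x) = D (\<lambda>x. a i * g i x + (\<Sum>i\<in>I. a i * g i x))"
    using insert by simp
  also have "\<dots> = a i * D (g i) + D (\<lambda>x. \<Sum>i\<in>I. a i * g i x)"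
    by (simp only: lin_add[OF assms(1)] lin_cmult[OF assms(1)])
  finally show ?case using insert by simp
qed (simp add: lin_zero[OF assms(1)])

context voter_cycle
begin

section \<open>Dual recursion on sets of vertices\<close>

lemma lin_expect: "lin (expect p)"
  by (rule linI) (simp_all add: expect_def algebra_simps sum.distrib sum_distrib_left)

lemma step_add: "step (\<lambda>x. f x + g x) = (\<lambda>x. step f x + step g x)"
  using step_sum[where I = "{True, False}" and a = "\<lambda>_. 1" and g = "\<lambda>b. if b then f else g"] by simp

lemma step_cmult: "step (\<lambda>x. c * f x) = (\<lambda>x. c * step f x)"
  using step_sum[where I = "{True}" and a = "\<lambda>_. c" and g = "\<lambda>b. f"] by simp

lemma step_const [simp]: "step (\<lambda>_. c) = (\<lambda>_. c)"
  using n3 by (simp add: step_def[abs_def])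

lemma step_pow_const [simp]: "(step ^^ i) (\<lambda>_. c) = (\<lambda>_. c)"
  by (induction i) auto

lemma step_pow_add: "(step ^^ i) (\<lambda>x. f x + g x) = (\<lambda>x. (step ^^ i) f x + (step ^^ i) g x)"
  by (induction i) (simp_all add: step_add)

lemma step_pow_cmult: "(step ^^ i) (\<lambda>x. c * f x) = (\<lambda>x. c * (step ^^ i) f x)"
  by (induction i) (simp_all add: step_cmult)

lemma step_pow_sum: "(step ^^ i) (\<lambda>x. \<Sum>k\<in>I. a k * g k x) = (\<lambda>x. \<Sum>k\<in>I. a k * (step ^^ i) (g k) x)"
  by (induction i) (simp_all add: step_sum)

lemma lin_step_pow: assumes "lin D" shows "lin (\<lambda>f. D ((step ^^ i) f))"
  by (rule linI) (simp_all only: step_pow_add step_pow_cmult lin_add[OF assms] lin_cmult[OF assms])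

lemma lazy_add: "lazy (\<lambda>x. f x + g x) = (\<lambda>x. lazy f x + lazy g x)"
  by (rule ext) (simp add: lazy_def step_add add_divide_distrib)

lemma lazy_cmult: "lazy (\<lambda>x. c * f x) = (\<lambda>x. c * lazy f x)"
  by (rule ext) (simp add: lazy_def step_cmult distrib_left)

lemma lazy_pow_add: "(lazy ^^ i) (\<lambda>x. f x + g x) = (\<lambda>x. (lazy ^^ i) f x + (lazy ^^ i) g x)"
  by (induction i) (simp_all add: lazy_add)

lemma lazy_pow_cmult: "(lazy ^^ i) (\<lambda>x. c * f x) = (\<lambda>x. c * (lazy ^^ i) f x)"
  by (induction i) (simp_all add: lazy_cmult)

lemma upd_dep: "\<lbrakk>dep S f; u \<notin> S\<rbrakk> \<Longrightarrow> upd u f x = f x"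
  using q2 by (simp add: upd_def dep_update algebra_simps)

lemma step_dep:
  assumes f: "dep S f" and S: "S \<subseteq> {..<n}"
  shows "step f x = (1 - real (card S) / real n) * f x + (\<Sum>u\<in>S. upd u f x) / real n"
proof -
  have fin: "finite S" using S by (rule finite_subset) simp
  have "(\<Sum>u<n. upd u f x) = (\<Sum>u\<in>S. upd u f x) + (\<Sum>u\<in>{..<n} - S. upd u f x)"
    using sum.subset_diff[OF S, of "\<lambda>u. upd u f x"] by simp
  also have "(\<Sum>u\<in>{..<n} - S. upd u f x) = (\<Sum>u\<in>{..<n} - S. f x)"
    by (intro sum.cong refl upd_dep[OF f]) auto
  also have "\<dots> = (real n - real (card S)) * f x"
    using card_mono[OF _ S] fin S by (simp add: card_Diff_subset of_nat_diff)
  finally show ?thesis using n3 by (simp add: step_def field_simps)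
qed

text \<open>\<open>\<phi> S\<close> bounds the norm of \<open>D\<close> on functions of the
  coordinates in \<open>S\<close>. Bounds of this kind are what the dual recursion
  transports.\<close>

definition bnd :: "(((nat \<Rightarrow> nat) \<Rightarrow> real) \<Rightarrow> real) \<Rightarrow> (nat set \<Rightarrow> real) \<Rightarrow> bool" where
  "bnd D \<phi> \<longleftrightarrow> (\<forall>S f. S \<subseteq> {..<n} \<longrightarrow> dep S f \<longrightarrow> (\<forall>x. \<bar>f x\<bar> \<le> 1) \<longrightarrow> \<bar>D f\<bar> \<le> \<phi> S)"

lemma bndD: "\<lbrakk>bnd D \<phi>; S \<subseteq> {..<n}; dep S f; \<And>x. \<bar>f x\<bar> \<le> 1\<rbrakk> \<Longrightarrow> \<bar>D f\<bar> \<le> \<phi> S"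
  unfolding bnd_def by blast

lemma bndI: "(\<And>S f. \<lbrakk>S \<subseteq> {..<n}; dep S f; \<And>x. \<bar>f x\<bar> \<le> 1\<rbrakk> \<Longrightarrow> \<bar>D f\<bar> \<le> \<phi> S) \<Longrightarrow> bnd D \<phi>"
  unfolding bnd_def by blast

lemma lin_bound_scale:
  assumes D: "lin D" and f: "dep S f" "\<And>x. \<bar>f x\<bar> \<le> B"
    and b: "\<And>f. \<lbrakk>dep S f; \<And>x. \<bar>f x\<bar> \<le> 1\<rbrakk> \<Longrightarrow> \<bar>D f\<bar> \<le> c"
  shows "\<bar>D f\<bar> \<le> B * c"
proof (cases "B = 0")
  case True
  hence "f = (\<lambda>_. 0)" using f(2) by auto
  thus ?thesis using True by (simp add: lin_zero[OF D])
next
  case False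
  hence B: "B > 0" using f(2)[of "\<lambda>_. 0"] by linarith
  have "dep S (\<lambda>x. (1 / B) * f x)" using dep_lin[OF f(1) dep_const, of "1/B" 0 0] by simp
  moreover have "\<bar>(1 / B) * f x\<bar> \<le> 1" for x using f(2)[of x] B by (simp add: abs_mult field_simps)
  ultimately have "\<bar>D (\<lambda>x. (1 / B) * f x)\<bar> \<le> c" by (rule b)
  thus ?thesis using B by (simp only: lin_cmult[OF D]) (simp add: abs_mult field_simps)
qed

text \<open>One step of the dual process: a vertex of \<open>S\<close> dies (noise) or jumps to a neighbour and coalesces.\<close>

definition hop :: "(nat set \<Rightarrow> real) \<Rightarrow> nat set \<Rightarrow> real" where
  "hop \<phi> S = (1 - real (card S) / real n) * \<phi> S
     + (\<Sum>u\<in>S. \<theta> * \<phi> (S - {u})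
         + (1 - \<theta>) * ((\<phi> (insert (nx u) (S - {u})) + \<phi> (insert (pv u) (S - {u}))) / 2)) / real n"

text \<open>Duality on the level of dependence sets: averaging over a fresh colour at
  \<open>u\<close> leaves a function of \<open>S - {u}\<close>, and copying from \<open>w\<close>
  leaves a function of \<open>insert w (S - {u})\<close>. Both keep the bound 1, so \<open>D\<close>
  can be estimated on each of them by \<open>\<phi>\<close>.\<close>

lemma bnd_step:
  assumes D: "lin D" and b: "bnd D \<phi>"
  shows "bnd (\<lambda>f. D (step f)) (hop \<phi>)"
proof (rule bndI)
  fix S f assume S: "S \<subseteq> {..<n}" and f: "dep S f" and f1: "\<And>x. \<bar>f x\<bar> \<le> 1"
  have fin: "finite S" using S by (rule finite_subset) simp
  define A B C where "A = (\<lambda>u x. (\<Sum>j<q. (1 / real q) * f (x(u := j))))"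
    and "B = (\<lambda>u x. f (x(u := x (nx u))))" and "C = (\<lambda>u x. f (x(u := x (pv u))))"
  have step_eq: "step f = (\<lambda>x. (1 - real (card S) / real n) * f x
      + (\<Sum>u\<in>S. (1 / real n) * (\<theta> * A u x + ((1 - \<theta>) / 2 * B u x + (1 - \<theta>) / 2 * C u x))))"
  proof
    fix x
    have "(\<Sum>u\<in>S. upd u f x) / real n
       = (\<Sum>u\<in>S. (1 / real n) * (\<theta> * A u x + ((1 - \<theta>) / 2 * B u x + (1 - \<theta>) / 2 * C u x)))"
      unfolding sum_divide_distrib
    proof (intro sum.cong refl)
      fix u
      have "A u x = (\<Sum>j<q. f (x(u := j))) / real q" by (simp add: A_def sum_divide_distrib)
      thus "upd u f x / real n = (1 / real n) * (\<theta> * A u x + ((1 - \<theta>) / 2 * B u x + (1 - \<theta>) / 2 * C u x))"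
        by (simp add: upd_def B_def C_def add_divide_distrib distrib_left mult.commute)
    qed
    thus "step f x = (1 - real (card S) / real n) * f x
      + (\<Sum>u\<in>S. (1 / real n) * (\<theta> * A u x + ((1 - \<theta>) / 2 * B u x + (1 - \<theta>) / 2 * C u x)))"
      by (simp only: step_dep[OF f S])
  qed
  have Dstep: "D (step f) = (1 - real (card S) / real n) * D f
      + (\<Sum>u\<in>S. (1 / real n) * (\<theta> * D (A u) + ((1 - \<theta>) / 2 * D (B u) + (1 - \<theta>) / 2 * D (C u))))"
    unfolding step_eq by (simp only: lin_add[OF D] lin_cmult[OF D] lin_sum[OF D fin])
  have Df: "\<bar>D f\<bar> \<le> \<phi> S" by (rule bndD[OF b S f f1])
  have DA: "\<bar>D (A u)\<bar> \<le> \<phi> (S - {u})" if "u \<in> S" for u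
  proof (rule bndD[OF b])
    show "dep (S - {u}) (A u)" unfolding A_def
      using dep_lin[OF dep_fun_upd[OF f] dep_const, where a = "1 / real q" and b = 0] by (intro dep_sum) simp
    fix x
    have "\<bar>A u x\<bar> \<le> (\<Sum>j<q. \<bar>(1 / real q) * f (x(u := j))\<bar>)" unfolding A_def by (rule sum_abs)
    also have "\<dots> \<le> (\<Sum>j<q. 1 / real q)"
      by (intro sum_mono) (use f1 in \<open>simp add: abs_mult divide_right_mono\<close>)
    finally show "\<bar>A u x\<bar> \<le> 1" using q2 by simp
  qed (use S in auto)
  have DBC: "\<bar>D (B u)\<bar> \<le> \<phi> (insert (nx u) (S - {u}))" "\<bar>D (C u)\<bar> \<le> \<phi> (insert (pv u) (S - {u}))"
    if "u \<in> S" for u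
    unfolding B_def C_def using S that by (intro bndD[OF b] dep_copy[OF f] f1; auto)+
  have "card S \<le> n" using card_mono[OF _ S] by simp
  hence k: "0 \<le> 1 - real (card S) / real n" using n3 by simp
  have term_le: "\<bar>(1 / real n) * (\<theta> * D (A u) + ((1 - \<theta>) / 2 * D (B u) + (1 - \<theta>) / 2 * D (C u)))\<bar>
     \<le> (\<theta> * \<phi> (S - {u}) + (1 - \<theta>) * ((\<phi> (insert (nx u) (S - {u})) + \<phi> (insert (pv u) (S - {u}))) / 2)) / real n"
    if u: "u \<in> S" for u
  proof -
    have "\<bar>\<theta> * D (A u) + ((1 - \<theta>) / 2 * D (B u) + (1 - \<theta>) / 2 * D (C u))\<bar>
       \<le> \<bar>\<theta> * D (A u)\<bar> + (\<bar>(1 - \<theta>) / 2 * D (B u)\<bar> + \<bar>(1 - \<theta>) / 2 * D (C u)\<bar>)"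
      by linarith
    also have "\<dots> = \<theta> * \<bar>D (A u)\<bar> + ((1 - \<theta>) / 2 * \<bar>D (B u)\<bar> + (1 - \<theta>) / 2 * \<bar>D (C u)\<bar>)"
      using \<theta>_pos \<theta>_le_1 by (simp add: abs_mult)
    also have "\<dots> \<le> \<theta> * \<phi> (S - {u}) + ((1 - \<theta>) / 2 * \<phi> (insert (nx u) (S - {u}))
         + (1 - \<theta>) / 2 * \<phi> (insert (pv u) (S - {u})))"
      using \<theta>_pos \<theta>_le_1 by (intro add_mono mult_left_mono DA DBC u) auto
    also have "\<dots> = \<theta> * \<phi> (S - {u}) + (1 - \<theta>) * ((\<phi> (insert (nx u) (S - {u})) + \<phi> (insert (pv u) (S - {u}))) / 2)"
      by (simp add: field_simps)
    finally show ?thesis by (simp add: abs_mult divide_right_mono)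
  qed
  have "\<bar>D (step f)\<bar> \<le> \<bar>(1 - real (card S) / real n) * D f\<bar>
      + \<bar>\<Sum>u\<in>S. (1 / real n) * (\<theta> * D (A u) + ((1 - \<theta>) / 2 * D (B u) + (1 - \<theta>) / 2 * D (C u)))\<bar>"
    unfolding Dstep by (rule abs_triangle_ineq)
  also have "\<dots> \<le> hop \<phi> S"
    unfolding hop_def sum_divide_distrib
  proof (intro add_mono)
    show "\<bar>(1 - real (card S) / real n) * D f\<bar> \<le> (1 - real (card S) / real n) * \<phi> S"
      using mult_left_mono[OF Df k] k by (simp only: abs_mult abs_of_nonneg)
  qed (intro order.trans[OF sum_abs] sum_mono term_le)
  finally show "\<bar>D (step f)\<bar> \<le> hop \<phi> S" .
qed

lemma bnd_step_pow: "\<lbrakk>lin D; bnd D \<phi>\<rbrakk> \<Longrightarrow> bnd (\<lambda>f. D ((step ^^ i) f)) ((hop ^^ i) \<phi>)"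
proof (induction i)
  case (Suc i)
  have "bnd (\<lambda>f. D ((step ^^ i) (step f))) (hop ((hop ^^ i) \<phi>))"
    by (rule bnd_step[OF lin_step_pow[OF Suc.prems(1)]]) (use Suc in auto)
  thus ?case by (simp add: funpow_swap1)
qed simp

lemma hop_mono:
  assumes "\<And>S. S \<subseteq> {..<n} \<Longrightarrow> \<phi> S \<le> \<psi> S" "S \<subseteq> {..<n}"
  shows "hop \<phi> S \<le> hop \<psi> S"
proof -
  have "card S \<le> n" using card_mono[OF _ assms(2)] by simp
  hence "0 \<le> 1 - real (card S) / real n" using n3 by simp
  moreover have "insert (nx u) (S - {u}) \<subseteq> {..<n}" "insert (pv u) (S - {u}) \<subseteq> {..<n}" "S - {u} \<subseteq> {..<n}"
    if "u \<in> S" for u using assms(2) that by auto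
  ultimately show ?thesis
    unfolding hop_def using \<theta>_pos \<theta>_le_1 assms
    by (intro add_mono mult_left_mono divide_right_mono sum_mono) auto
qed

lemma hop_cmult: "hop (\<lambda>S. c * \<phi> S) S = c * hop \<phi> S"
proof -
  have "(\<Sum>u\<in>S. \<theta> * (c * \<phi> (S - {u})) + (1 - \<theta>) * ((c * \<phi> (insert (nx u) (S - {u})) + c * \<phi> (insert (pv u) (S - {u}))) / 2))
      = c * (\<Sum>u\<in>S. \<theta> * \<phi> (S - {u}) + (1 - \<theta>) * ((\<phi> (insert (nx u) (S - {u})) + \<phi> (insert (pv u) (S - {u}))) / 2))"
    unfolding sum_distrib_left by (intro sum.cong refl) (simp add: field_simps)
  thus ?thesis by (simp add: hop_def distrib_left)
qed

lemma hop_add: "hop (\<lambda>S. \<phi> S + \<psi> S) S = hop \<phi> S + hop \<psi> S"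
proof -
  have "(\<Sum>u\<in>S. \<theta> * (\<phi> (S - {u}) + \<psi> (S - {u})) + (1 - \<theta>) * ((\<phi> (insert (nx u) (S - {u})) + \<psi> (insert (nx u) (S - {u})) + (\<phi> (insert (pv u) (S - {u})) + \<psi> (insert (pv u) (S - {u})))) / 2))
      = (\<Sum>u\<in>S. \<theta> * \<phi> (S - {u}) + (1 - \<theta>) * ((\<phi> (insert (nx u) (S - {u})) + \<phi> (insert (pv u) (S - {u}))) / 2))
      + (\<Sum>u\<in>S. \<theta> * \<psi> (S - {u}) + (1 - \<theta>) * ((\<psi> (insert (nx u) (S - {u})) + \<psi> (insert (pv u) (S - {u}))) / 2))"
    unfolding sum.distrib[symmetric] by (intro sum.cong refl) (simp add: field_simps)
  thus ?thesis by (simp add: hop_def distrib_left add_divide_distrib)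
qed

lemma hop_pow_supersolution:
  assumes "\<And>S. S \<subseteq> {..<n} \<Longrightarrow> hop \<psi> S \<le> \<beta> * \<psi> S" "0 \<le> \<beta>" "S \<subseteq> {..<n}"
  shows "(hop ^^ i) \<psi> S \<le> \<beta> ^ i * \<psi> S"
  using assms(3)
proof (induction i arbitrary: S)
  case (Suc i)
  have "hop ((hop ^^ i) \<psi>) S \<le> hop (\<lambda>S. \<beta> ^ i * \<psi> S) S"
    by (rule hop_mono) (use Suc in auto)
  also have "\<dots> \<le> \<beta> ^ i * (\<beta> * \<psi> S)"
    unfolding hop_cmult using assms(1)[OF Suc.prems] assms(2) by (intro mult_left_mono) auto
  finally show ?case by (simp add: mult_ac)
qed simp

lemma card_insert_Diff_le: "\<lbrakk>finite S; u \<in> S\<rbrakk> \<Longrightarrow> card (insert w (S - {u})) \<le> card S"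
  using card_Suc_Diff1[of S u] by (simp add: card_insert_if)

lemma contraction_rate: "0 \<le> 1 - \<theta> / real n" "1 - \<theta> / real n < 1"
  using n3 \<theta>_pos \<theta>_le_1 by (auto simp: field_simps)

text \<open>Each vertex of \<open>S\<close> is selected with probability \<open>1 / n\<close> and
  then dies with probability \<open>\<theta>\<close>, while a jump never increases the
  cardinality.\<close>

lemma hop_card_le:
  assumes S: "S \<subseteq> {..<n}"
  shows "hop (\<lambda>S. 2 * real (card S)) S \<le> (1 - \<theta> / real n) * (2 * real (card S))"
proof -
  have fin: "finite S" using S by (rule finite_subset) simp
  let ?k = "real (card S)"
  have "(\<Sum>u\<in>S. \<theta> * (2 * real (card (S - {u}))) + (1 - \<theta>) *
      ((2 * real (card (insert (nx u) (S - {u}))) + 2 * real (card (insert (pv u) (S - {u})))) / 2))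
     \<le> (\<Sum>u\<in>S. \<theta> * (2 * (?k - 1)) + (1 - \<theta>) * (2 * ?k))"
  proof (intro sum_mono add_mono mult_left_mono)
    fix u assume u: "u \<in> S"
    have "card S > 0" using u fin by (auto simp: card_gt_0_iff)
    thus "real (card (S - {u})) \<le> ?k - 1" using u fin by simp
    show "(2 * real (card (insert (nx u) (S - {u}))) + 2 * real (card (insert (pv u) (S - {u})))) / 2 \<le> 2 * ?k"
      using of_nat_mono[OF card_insert_Diff_le[OF fin u, of "nx u"], where 'a = real]
        of_nat_mono[OF card_insert_Diff_le[OF fin u, of "pv u"], where 'a = real] by (simp add: field_simps)
  qed (use \<theta>_pos \<theta>_le_1 in auto)
  also have "\<dots> = ?k * (2 * ?k - 2 * \<theta>)" by (simp add: algebra_simps)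
  finally have "hop (\<lambda>S. 2 * real (card S)) S \<le> (1 - ?k / real n) * (2 * ?k) + ?k * (2 * ?k - 2 * \<theta>) / real n"
    unfolding hop_def by (intro add_mono divide_right_mono order.refl) auto
  also have "\<dots> = (1 - \<theta> / real n) * (2 * ?k)" using n3 by (simp add: field_simps)
  finally show ?thesis .
qed

text \<open>The bound is chosen to vanish at the empty set, where \<open>f\<close> is constant, to
  be at least 2 elsewhere, and to contract under \<open>hop\<close>.\<close>

lemma bnd_difference: "bnd (\<lambda>f. f x - f y) (\<lambda>S. 2 * real (card S))"
proof (rule bndI)
  fix S f assume S: "S \<subseteq> {..<n}" "dep S f" "\<And>x. \<bar>f x\<bar> \<le> 1"
  show "\<bar>f x - f y\<bar> \<le> 2 * real (card S)"
  proof (cases "S = {}")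
    case True
    hence "f x = f y" using S(2) by (auto intro: depD)
    thus ?thesis by simp
  next
    case False
    have "finite S" using S(1) by (rule finite_subset) simp
    hence "card S \<ge> 1" using False by (simp add: Suc_leI card_gt_0_iff)
    thus ?thesis using S(3)[of x] S(3)[of y] by linarith
  qed
qed

lemma step_contraction:
  assumes f: "dep S f" "\<And>x. \<bar>f x\<bar> \<le> B" and S: "S \<subseteq> {..<n}"
  shows "\<bar>(step ^^ i) f x - (step ^^ i) f y\<bar> \<le> B * ((1 - \<theta> / real n) ^ i * (2 * real (card S)))"
proof -
  let ?D = "\<lambda>f. (step ^^ i) f x - (step ^^ i) f y"
  have D: "lin ?D" by (rule linI) (simp_all add: step_pow_add step_pow_cmult algebra_simps)
  have L: "lin (\<lambda>f. f x - f y)" by (rule linI) (simp_all add: algebra_simps)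
  show ?thesis
  proof (rule lin_bound_scale[OF D f])
    fix g assume "dep S g" "\<And>x. \<bar>g x\<bar> \<le> 1"
    hence "\<bar>?D g\<bar> \<le> (hop ^^ i) (\<lambda>S. 2 * real (card S)) S"
      by (rule bndD[OF bnd_step_pow[OF L bnd_difference] S])
    also have "\<dots> \<le> (1 - \<theta> / real n) ^ i * (2 * real (card S))"
      by (rule hop_pow_supersolution[OF hop_card_le contraction_rate(1) S])
    finally show "\<bar>?D g\<bar> \<le> (1 - \<theta> / real n) ^ i * (2 * real (card S))" .
  qed
qed

end

context voter_cycle
begin

section \<open>The stationary distribution\<close>

definition base :: "nat \<Rightarrow> nat" where "base = (\<lambda>i\<in>{..<n}. 0)"

text \<open>Written on the coordinates below \<open>n\<close> instead of as \<open>z = y\<close>, so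
  that it is a local function even off the configurations; on \<open>\<Omega>\<close> the two
  agree.\<close>

definition ind :: "(nat \<Rightarrow> nat) \<Rightarrow> (nat \<Rightarrow> nat) \<Rightarrow> real" where
  "ind y z = of_bool (\<forall>v<n. z v = y v)"

text \<open>The stationary weights as the limit of the discrete chain from one fixed start;
  \<open>pmf_voter_stationary\<close> identifies them with \<open>voter_stationary\<close> on
  \<open>\<Omega>\<close>.\<close>

definition stat :: "(nat \<Rightarrow> nat) \<Rightarrow> real" where
  "stat y = lim (\<lambda>i. (step ^^ i) (ind y) base)"

lemma base_config: "base \<in> \<Omega>"
  using q2 by (auto simp: base_def configs_eq)

lemma ind_config: "\<lbrakk>y \<in> \<Omega>; z \<in> \<Omega>\<rbrakk> \<Longrightarrow> ind y z = of_bool (z = y)"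
proof -
  assume "y \<in> \<Omega>" "z \<in> \<Omega>"
  hence "z = y" if "\<forall>v<n. z v = y v"
    unfolding configs_eq using that by (intro PiE_ext[of z "{..<n}" "\<lambda>_. {..<q}" y]) auto
  thus ?thesis by (auto simp: ind_def)
qed

lemma ind_bound: "\<bar>ind y z\<bar> \<le> 1" by (simp add: ind_def)

lemma dep_ind: "dep {..<n} (ind y)"
  by (rule depI) (simp add: ind_def)

lemma step_pow_cong_configs:
  assumes "\<And>x. x \<in> \<Omega> \<Longrightarrow> f x = g x" "x \<in> \<Omega>"
  shows "(step ^^ i) f x = (step ^^ i) g x"
  using assms(2)
proof (induction i arbitrary: x)
  case (Suc i)
  show ?case by (simp add: step_def[of "(step ^^ i) f"] step_def[of "(step ^^ i) g"] upd_cong_configs[OF Suc.IH Suc.prems])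
qed (use assms(1) in simp)

lemma expand_ind: "x \<in> \<Omega> \<Longrightarrow> f x = (\<Sum>y\<in>\<Omega>. f y * ind y x)"
proof -
  assume x: "x \<in> \<Omega>"
  have "(\<Sum>y\<in>\<Omega>. f y * ind y x) = (\<Sum>y\<in>\<Omega>. if x = y then f y else 0)"
    by (intro sum.cong) (auto simp: ind_config x)
  thus ?thesis using x by simp
qed

lemma step_pow_expand:
  "x \<in> \<Omega> \<Longrightarrow> (step ^^ i) f x = (\<Sum>y\<in>\<Omega>. f y * (step ^^ i) (ind y) x)"
  by (subst step_pow_cong_configs[of f "\<lambda>x. \<Sum>y\<in>\<Omega>. f y * ind y x"], rule expand_ind)
     (simp_all only: step_pow_sum)

text \<open>Further steps only average the values of \<open>(step ^^ i) f\<close>, whose oscillation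
  has already contracted. One bound thus gives both the Cauchy property in time and the independence
  of the start.\<close>

lemma step_pow_shift:
  assumes f: "dep {..<n} f" "\<And>x. \<bar>f x\<bar> \<le> B"
  shows "\<bar>(step ^^ (i + j)) f x - (step ^^ i) f y\<bar> \<le> 2 * real n * B * (1 - \<theta> / real n) ^ i"
proof -
  let ?c = "(step ^^ i) f y"
  have "\<bar>(step ^^ i) f z - ?c\<bar> \<le> 2 * real n * B * (1 - \<theta> / real n) ^ i" for z
    using step_contraction[OF f order.refl, of i z y] by (simp add: mult_ac)
  hence "\<bar>(step ^^ j) (\<lambda>z. (step ^^ i) f z + (- ?c)) x\<bar> \<le> 2 * real n * B * (1 - \<theta> / real n) ^ i"
    by (intro step_pow_abs_le) simp
  thus ?thesis by (simp only: step_pow_add step_pow_const funpow_add o_def add.commute[of i j] diff_conv_add_uminus)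
qed

lemma geometric_to_0: "(\<lambda>i. c * (1 - \<theta> / real n) ^ i) \<longlonglongrightarrow> 0"
  using tendsto_mult_right_zero[OF LIMSEQ_power_zero, of "1 - \<theta> / real n" c] contraction_rate by simp

lemma step_pow_convergent:
  assumes f: "dep {..<n} f" "\<And>x. \<bar>f x\<bar> \<le> B"
  shows "convergent (\<lambda>i. (step ^^ i) f x)"
proof (rule Cauchy_convergent, rule CauchyI')
  fix e :: real assume e: "0 < e"
  have "eventually (\<lambda>i. \<bar>2 * real n * B * (1 - \<theta> / real n) ^ i\<bar> < e) sequentially"
    using tendstoD[OF geometric_to_0 e] by (simp add: dist_real_def)
  then obtain M where M: "\<And>i. i \<ge> M \<Longrightarrow> \<bar>2 * real n * B * (1 - \<theta> / real n) ^ i\<bar> < e"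
    by (auto simp: eventually_sequentially)
  show "\<exists>M. \<forall>m\<ge>M. \<forall>k>m. dist ((step ^^ m) f x) ((step ^^ k) f x) < e"
  proof (intro exI[of _ M] allI impI)
    fix m k assume m: "m \<ge> M" and k: "k > m"
    show "dist ((step ^^ m) f x) ((step ^^ k) f x) < e"
      using step_pow_shift[OF f, of m "k - m" x x] M[OF m] k by (simp add: dist_real_def)
  qed
qed

lemma stat_tendsto: "(\<lambda>i. (step ^^ i) (ind y) base) \<longlonglongrightarrow> stat y"
  unfolding stat_def using step_pow_convergent[OF dep_ind ind_bound]
  by (simp add: convergent_LIMSEQ_iff)

lemma expect_stat_tendsto: "(\<lambda>i. (step ^^ i) f base) \<longlonglongrightarrow> expect stat f"
proof -
  have "(\<lambda>i. \<Sum>y\<in>\<Omega>. f y * (step ^^ i) (ind y) base) \<longlonglongrightarrow> (\<Sum>y\<in>\<Omega>. f y * stat y)"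
    by (intro tendsto_sum tendsto_mult tendsto_const stat_tendsto)
  moreover have "(\<lambda>i. \<Sum>y\<in>\<Omega>. f y * (step ^^ i) (ind y) base) = (\<lambda>i. (step ^^ i) f base)"
    by (rule ext) (rule step_pow_expand[OF base_config, symmetric])
  ultimately show ?thesis by (simp add: expect_def mult.commute)
qed

lemma step_pow_stat:
  assumes f: "dep {..<n} f" "\<And>x. \<bar>f x\<bar> \<le> B"
  shows "\<bar>(step ^^ i) f x - expect stat f\<bar> \<le> 2 * real n * B * (1 - \<theta> / real n) ^ i"
proof (rule LIMSEQ_le_const2)
  show "(\<lambda>j. \<bar>(step ^^ i) f x - (step ^^ (i + j)) f base\<bar>) \<longlonglongrightarrow> \<bar>(step ^^ i) f x - expect stat f\<bar>"
    using LIMSEQ_ignore_initial_segment[OF expect_stat_tendsto[of f], of i]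
    by (intro tendsto_intros) (simp add: add.commute)
  show "\<exists>N. \<forall>j\<ge>N. \<bar>(step ^^ i) f x - (step ^^ (i + j)) f base\<bar> \<le> 2 * real n * B * (1 - \<theta> / real n) ^ i"
    using step_pow_shift[OF f, of i _ base x] by (intro exI[of _ 0]) (simp add: abs_minus_commute)
qed

lemma expect_const: "expect p (\<lambda>_. c) = c * (\<Sum>x\<in>\<Omega>. p x)"
  by (simp add: expect_def sum_distrib_left mult.commute)

lemma sum_stat: "(\<Sum>x\<in>\<Omega>. stat x) = 1"
  using LIMSEQ_unique[OF expect_stat_tendsto[of "\<lambda>_. 1"], of 1] by (simp add: expect_const)

lemma step_nonneg: "(\<And>x. 0 \<le> f x) \<Longrightarrow> 0 \<le> step f x"
  unfolding step_def upd_def using \<theta>_pos \<theta>_le_1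
  by (intro divide_nonneg_nonneg sum_nonneg add_nonneg_nonneg mult_nonneg_nonneg) auto

lemma step_pow_nonneg: assumes "\<And>x. 0 \<le> f x" shows "0 \<le> (step ^^ i) f x"
proof (induction i arbitrary: x)
  case (Suc i)
  show ?case using step_nonneg[of "(step ^^ i) f" x, OF Suc] by simp
qed (use assms in simp)

lemma stat_nonneg: "0 \<le> stat y"
  by (rule LIMSEQ_le_const[OF stat_tendsto]) (auto intro!: step_pow_nonneg simp: ind_def)

lemma expect_stat_step: "expect stat (step f) = expect stat f"
proof (rule LIMSEQ_unique[OF expect_stat_tendsto])
  show "(\<lambda>i. (step ^^ i) (step f) base) \<longlonglongrightarrow> expect stat f"
    using LIMSEQ_Suc[OF expect_stat_tendsto[of f]] by (simp add: funpow_swap1)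
qed

lemma expect_stat_step_pow: "expect stat ((step ^^ i) f) = expect stat f"
  by (induction i) (simp_all add: expect_stat_step)

lemma law_eq_expect: "y \<in> \<Omega> \<Longrightarrow> law x t y = expect (law x t) (ind y)"
proof -
  assume y: "y \<in> \<Omega>"
  have "expect (law x t) (ind y) = (\<Sum>z\<in>\<Omega>. if z = y then law x t z else 0)"
    unfolding expect_def by (intro sum.cong) (auto simp: ind_config y)
  thus ?thesis using y by simp
qed

lemma law_nonneg: assumes "x \<in> \<Omega>" "0 \<le> t" "y \<in> \<Omega>" shows "0 \<le> law x t y"
proof -
  have "pois (real n * t) (\<lambda>_. 0) \<le> pois (real n * t) (\<lambda>i. (step ^^ i) (ind y) x)"
    by (rule pois_mono[where B = 0 and B' = 1])
       (use assms in \<open>auto intro!: step_pow_abs_le step_pow_nonneg ind_bound simp: ind_def\<close>)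
  thus ?thesis unfolding law_eq_expect[OF assms(3)] expect_law[OF assms(1) ind_bound] by simp
qed

lemma sum_law: assumes "x \<in> \<Omega>" shows "(\<Sum>y\<in>\<Omega>. law x t y) = 1"
  using expect_law[OF assms, of "\<lambda>_. 1" 1 t] by (simp add: expect_const)

lemma expect_law_stat:
  assumes x: "x \<in> \<Omega>" and t: "0 \<le> t" and f: "dep {..<n} f" "\<And>x. \<bar>f x\<bar> \<le> B"
  shows "\<bar>expect (law x t) f - expect stat f\<bar> \<le> 2 * real n * B * exp (- \<theta> * t)"
proof -
  have B: "\<bar>(step ^^ i) f x\<bar> \<le> B" for i by (rule step_pow_abs_le[OF f(2)])
  have B0: "0 \<le> B" using f(2)[of x] by linarith
  have "expect (law x t) f - expect stat f = pois (real n * t) (\<lambda>i. (step ^^ i) f x - expect stat f)"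
    unfolding expect_law[OF x f(2)] by (subst pois_diff[OF B, of _ "\<bar>expect stat f\<bar>"]) auto
  also have "\<bar>\<dots>\<bar> \<le> pois (real n * t) (\<lambda>i. 2 * real n * B * (1 - \<theta> / real n) ^ i)"
  proof (rule pois_abs_le[OF _ step_pow_stat[OF f]])
    show "2 * real n * B * (1 - \<theta> / real n) ^ i \<le> 2 * real n * B * 1" for i
      using contraction_rate B0 by (intro mult_left_mono power_le_one) auto
  qed (use t in simp)
  also have "\<dots> = 2 * real n * B * pois (real n * t) (\<lambda>i. (1 - \<theta> / real n) ^ i)"
    by (rule pois_cmult[of _ 1]) (use contraction_rate in \<open>auto simp: power_abs intro!: power_le_one\<close>)
  also have "pois (real n * t) (\<lambda>i. (1 - \<theta> / real n) ^ i) = exp (- \<theta> * t)"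
    unfolding pois_geometric using n3 by simp
  finally show ?thesis .
qed

lemma exp_theta_to_0: "((\<lambda>t. c * exp (- \<theta> * t)) \<longlongrightarrow> 0) at_top"
proof -
  have "filterlim (\<lambda>t. \<theta> * t) at_top at_top"
    by (rule filterlim_tendsto_pos_mult_at_top[OF tendsto_const \<theta>_pos filterlim_ident])
  hence "((\<lambda>t. exp (- (\<theta> * t))) \<longlongrightarrow> 0) at_top"
    by (intro filterlim_compose[OF exp_at_bot] filterlim_compose[OF filterlim_uminus_at_bot_at_top])
  thus ?thesis using tendsto_mult_right_zero by fastforce
qed

lemma expect_law_tendsto_stat:
  assumes x: "x \<in> \<Omega>" and f: "dep {..<n} f" "\<And>x. \<bar>f x\<bar> \<le> B"
  shows "((\<lambda>t. expect (law x t) f) \<longlongrightarrow> expect stat f) at_top"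
proof (subst tendsto_dist_iff, rule tendsto_sandwich[OF _ _ tendsto_const exp_theta_to_0[of "2 * real n * B"]])
  show "eventually (\<lambda>t. dist (expect (law x t) f) (expect stat f) \<le> 2 * real n * B * exp (- \<theta> * t)) at_top"
    using eventually_ge_at_top[of 0]
    by eventually_elim (use expect_law_stat[OF x _ f] in \<open>simp add: dist_real_def\<close>)
qed simp

lemma stationary_stat:
  "stationary \<Omega> (voter_rate G q \<theta>) (embed_pmf (\<lambda>y. if y \<in> \<Omega> then stat y else 0))"
  and pmf_embed_stat: "pmf (embed_pmf (\<lambda>y. if y \<in> \<Omega> then stat y else 0)) = (\<lambda>y. if y \<in> \<Omega> then stat y else 0)"
proof -
  let ?s = "\<lambda>y. if y \<in> \<Omega> then stat y else 0"
  show pmf: "pmf (embed_pmf ?s) = ?s"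
  proof (rule ext, rule pmf_embed_pmf)
    have "(\<integral>\<^sup>+ y. ennreal (?s y) \<partial>count_space UNIV) = (\<Sum>y\<in>\<Omega>. ennreal (stat y))"
      by (subst nn_integral_count_space'[of \<Omega>]) auto
    also have "\<dots> = ennreal (\<Sum>y\<in>\<Omega>. stat y)" by (rule sum_ennreal) (rule stat_nonneg)
    finally show "(\<integral>\<^sup>+ y. ennreal (?s y) \<partial>count_space UNIV) = 1" by (simp add: sum_stat)
  qed (simp add: stat_nonneg)
  have "(\<Sum>x\<in>\<Omega>. stat x * transition \<Omega> (voter_rate G q \<theta>) t x y) = stat y" if y: "y \<in> \<Omega>" for t y
  proof -
    have "(\<Sum>x\<in>\<Omega>. stat x * transition \<Omega> (voter_rate G q \<theta>) t x y) = (\<Sum>x\<in>\<Omega>. stat x * law x t y)"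
      by (simp add: voter_law_def)
    also have "\<dots> = (\<Sum>x\<in>\<Omega>. stat x * pois (real n * t) (\<lambda>i. (step ^^ i) (ind y) x))"
      by (intro sum.cong refl) (simp add: law_eq_expect[OF y] expect_law[OF _ ind_bound])
    also have "\<dots> = (\<Sum>x\<in>\<Omega>. pois (real n * t) (\<lambda>i. stat x * (step ^^ i) (ind y) x))"
      by (simp add: pois_cmult[OF step_pow_abs_le[OF ind_bound]])
    also have "\<dots> = pois (real n * t) (\<lambda>i. \<Sum>x\<in>\<Omega>. stat x * (step ^^ i) (ind y) x)"
      by (rule pois_sum[symmetric, where B = "\<lambda>x. \<bar>stat x\<bar> * 1"])
         (use mult_left_mono[OF step_pow_abs_le[OF ind_bound] abs_ge_zero] in \<open>auto simp: abs_mult\<close>)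
    also have "\<dots> = pois (real n * t) (\<lambda>i. expect stat (ind y))"
      by (subst expect_def[symmetric], subst expect_stat_step_pow) simp
    also have "\<dots> = stat y"
    proof -
      have "expect stat (ind y) = (\<Sum>z\<in>\<Omega>. if z = y then stat z else 0)"
        unfolding expect_def by (intro sum.cong) (auto simp: ind_config y)
      thus ?thesis using y by simp
    qed
    finally show ?thesis .
  qed
  moreover have "set_pmf (embed_pmf ?s) \<subseteq> \<Omega>" by (auto simp: set_pmf_eq pmf split: if_splits)
  ultimately show "stationary \<Omega> (voter_rate G q \<theta>) (embed_pmf ?s)"
    by (simp add: stationary_def pmf)
qed

text \<open>Let t tend to infinity in the invariance equation: from every start the law converges to
  \<open>stat\<close>.\<close>

lemma stationary_unique:
  assumes \<mu>: "stationary \<Omega> (voter_rate G q \<theta>) \<mu>" and y: "y \<in> \<Omega>"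
  shows "pmf \<mu> y = stat y"
proof -
  have s1: "(\<Sum>x\<in>\<Omega>. pmf \<mu> x) = 1" using \<mu> by (intro sum_pmf_eq_1) (auto simp: stationary_def)
  have sy: "expect stat (ind y) = stat y"
  proof -
    have "expect stat (ind y) = (\<Sum>z\<in>\<Omega>. if z = y then stat z else 0)"
      unfolding expect_def by (intro sum.cong) (auto simp: ind_config y)
    thus ?thesis using y by simp
  qed
  have "((\<lambda>t. \<Sum>x\<in>\<Omega>. pmf \<mu> x * expect (law x t) (ind y)) \<longlongrightarrow> (\<Sum>x\<in>\<Omega>. pmf \<mu> x * expect stat (ind y))) at_top"
    by (intro tendsto_sum tendsto_mult tendsto_const expect_law_tendsto_stat[OF _ dep_ind ind_bound])
  moreover have "eventually (\<lambda>t. (\<Sum>x\<in>\<Omega>. pmf \<mu> x * expect (law x t) (ind y)) = pmf \<mu> y) at_top"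
    using eventually_ge_at_top[of 0]
  proof eventually_elim
    case (elim t)
    have "(\<Sum>x\<in>\<Omega>. pmf \<mu> x * expect (law x t) (ind y)) = (\<Sum>x\<in>\<Omega>. pmf \<mu> x * law x t y)"
      by (simp add: law_eq_expect[OF y])
    also have "\<dots> = pmf \<mu> y" using \<mu> elim y by (simp add: stationary_def voter_law_def)
    finally show ?case .
  qed
  hence "((\<lambda>t. \<Sum>x\<in>\<Omega>. pmf \<mu> x * expect (law x t) (ind y)) \<longlongrightarrow> pmf \<mu> y) at_top"
    by (rule tendsto_eventually)
  ultimately have "(\<Sum>x\<in>\<Omega>. pmf \<mu> x * expect stat (ind y)) = pmf \<mu> y"
    by (intro tendsto_unique[OF trivial_limit_at_top_linorder])
  thus ?thesis by (simp add: sy sum_distrib_right[symmetric] s1)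
qed

lemma pmf_voter_stationary: "y \<in> \<Omega> \<Longrightarrow> pmf (voter_stationary G q \<theta>) y = stat y"
proof -
  assume y: "y \<in> \<Omega>"
  let ?e = "embed_pmf (\<lambda>y. if y \<in> \<Omega> then stat y else 0)"
  have "voter_stationary G q \<theta> = ?e"
    unfolding voter_stationary_def
  proof (rule the_equality, rule stationary_stat)
    fix \<mu> assume \<mu>: "stationary \<Omega> (voter_rate G q \<theta>) \<mu>"
    show "\<mu> = ?e"
    proof (rule pmf_eqI)
      fix y show "pmf \<mu> y = pmf ?e y"
      proof (cases "y \<in> \<Omega>")
        case False
        hence "y \<notin> set_pmf \<mu>" using \<mu> by (auto simp: stationary_def)
        thus ?thesis using False by (simp add: pmf_embed_stat set_pmf_iff)
      qed (simp add: pmf_embed_stat stationary_unique[OF \<mu>])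
    qed
  qed
  thus ?thesis using y by (simp add: pmf_embed_stat)
qed

end

text \<open>Pascal's rule for binomial convolutions: the extra step goes to one factor or to the
  other. It gives the recursion \<open>indep_Suc\<close>.\<close>

lemma binomial_convolution_Suc:
  fixes F :: "nat \<Rightarrow> nat \<Rightarrow> real"
  shows "(\<Sum>i\<le>Suc k. real (Suc k choose i) * F i (Suc k - i))
    = (\<Sum>i\<le>k. real (k choose i) * F (Suc i) (k - i)) + (\<Sum>i\<le>k. real (k choose i) * F i (Suc (k - i)))"
proof -
  have "(\<Sum>i\<le>Suc k. real (Suc k choose i) * F i (Suc k - i))
      = F 0 (Suc k) + (\<Sum>i\<le>k. real (Suc k choose Suc i) * F (Suc i) (k - i))"
    by (subst sum.atMost_Suc_shift) simp
  also have "(\<Sum>i\<le>k. real (Suc k choose Suc i) * F (Suc i) (k - i))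
      = (\<Sum>i\<le>k. real (k choose i) * F (Suc i) (k - i)) + (\<Sum>i\<le>k. real (k choose Suc i) * F (Suc i) (k - i))"
    by (simp add: sum.distrib[symmetric] algebra_simps)
  also have "(\<Sum>i\<le>k. real (k choose Suc i) * F (Suc i) (k - i))
      = (\<Sum>i\<le>Suc k. real (k choose i) * F i (Suc k - i)) - F 0 (Suc k)"
    by (subst sum.atMost_Suc_shift) simp
  also have "(\<Sum>i\<le>Suc k. real (k choose i) * F i (Suc k - i)) = (\<Sum>i\<le>k. real (k choose i) * F i (Suc (k - i)))"
    by (simp add: Suc_diff_le)
  finally show ?thesis by simp
qed

context voter_cycle
begin

section \<open>Decay of correlations\<close>

text \<open>Graph distance on the cycle. The case distinction replaces the absolute value, as
  subtraction of naturals truncates.\<close>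

definition cdist :: "nat \<Rightarrow> nat \<Rightarrow> nat" where
  "cdist a b = (let d = (if a \<le> b then b - a else a - b) in min d (n - d))"

lemma cdist_self [simp]: "cdist a a = 0" by (simp add: cdist_def)

lemma cdist_commute: "cdist a b = cdist b a" by (simp add: cdist_def)

lemma cdist_Suc:
  assumes "Suc a < n" "b < n"
  shows "cdist a b \<le> Suc (cdist (Suc a) b)" "cdist (Suc a) b \<le> Suc (cdist a b)"
proof -
  have *: "min d (n - d) \<le> Suc (min e (n - e))" if "d \<le> Suc e" "e \<le> Suc d" for d e
    using that by (simp add: min_def) arith
  show "cdist a b \<le> Suc (cdist (Suc a) b)" "cdist (Suc a) b \<le> Suc (cdist a b)"
    unfolding cdist_def Let_def by (rule *; auto)+
qed

lemma cdist_wrap: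
  assumes "b < n"
  shows "cdist (n - 1) b \<le> Suc (cdist 0 b)" "cdist 0 b \<le> Suc (cdist (n - 1) b)"
  using assms by (cases "n - 1 \<le> b"; simp add: cdist_def; arith)+

lemma cdist_nx: "\<lbrakk>a < n; b < n\<rbrakk> \<Longrightarrow> cdist a b \<le> Suc (cdist (nx a) b)"
  using cdist_Suc(1)[of a b] cdist_wrap(1)[of b] by (cases "Suc a = n") (auto simp: nx_def)

lemma cdist_pv: "\<lbrakk>a < n; b < n\<rbrakk> \<Longrightarrow> cdist a b \<le> Suc (cdist (pv a) b)"
  using cdist_Suc(2)[of "a - 1" b] cdist_wrap(2)[of b] by (cases "a = 0") (auto simp: pv_def)

lemma cdist_pos: "\<lbrakk>a < n; b < n; a \<noteq> b\<rbrakk> \<Longrightarrow> 0 < cdist a b"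
  by (auto simp: cdist_def)

text \<open>A supersolution for the meeting of two dual walkers: 1 on the diagonal, superharmonic
  off it for the killed walk. For \<open>\<theta> = 1\<close> it is the indicator of the diagonal,
  because \<open>0 ^ 0 = 1\<close>.\<close>

definition ker :: "nat \<Rightarrow> nat \<Rightarrow> real" where "ker a b = (1 - \<theta>) ^ cdist a b"

lemma ker_nonneg [simp]: "0 \<le> ker a b" using \<theta>_le_1 by (simp add: ker_def)

text \<open>A jump shortens the distance by at most one, and the survival factor
  \<open>1 - \<theta>\<close> makes up for exactly that.\<close>

lemma ker_superharmonic:
  assumes "a < n" "b < n" "a \<noteq> b"
  shows "(1 - \<theta>) * ((ker (nx a) b + ker (pv a) b) / 2) \<le> ker a b"
proof -
  obtain d where d: "cdist a b = Suc d" using cdist_pos[OF assms] by (cases "cdist a b") auto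
  have "ker (nx a) b \<le> (1 - \<theta>) ^ d" "ker (pv a) b \<le> (1 - \<theta>) ^ d"
    unfolding ker_def using cdist_nx[OF assms(1,2)] cdist_pv[OF assms(1,2)] d \<theta>_pos \<theta>_le_1
    by (auto intro!: power_decreasing)
  hence "(1 - \<theta>) * ((ker (nx a) b + ker (pv a) b) / 2) \<le> (1 - \<theta>) * (1 - \<theta>) ^ d"
    using \<theta>_le_1 by (intro mult_left_mono) auto
  thus ?thesis by (simp add: ker_def d)
qed

text \<open>Union bound over the pairs of walkers, one started from \<open>A\<close> and one from
  \<open>B\<close>.\<close>

definition Ker :: "nat set \<Rightarrow> nat set \<Rightarrow> real" where
  "Ker A B = (\<Sum>a\<in>A. \<Sum>b\<in>B. ker a b)"

lemma Ker_nonneg: "0 \<le> Ker A B" by (auto simp: Ker_def intro!: sum_nonneg)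

lemma Ker_commute: "Ker A B = Ker B A"
  unfolding Ker_def by (subst sum.swap) (simp add: ker_def cdist_commute)

lemma Ker_ge_1: assumes "finite A" "finite B" "v \<in> A" "v \<in> B" shows "1 \<le> Ker A B"
proof -
  have "1 = ker v v" by (simp add: ker_def)
  also have "\<dots> \<le> (\<Sum>b\<in>B. ker v b)" by (rule member_le_sum) (use assms in auto)
  also have "\<dots> \<le> Ker A B" unfolding Ker_def
    by (rule member_le_sum) (use assms in \<open>auto intro!: sum_nonneg\<close>)
  finally show ?thesis .
qed

text \<open>Only the walkers in \<open>A\<close> move, and coalescence inside \<open>A\<close>
  merely drops nonnegative terms. Disjointness makes \<open>ker\<close> superharmonic at every pair
  concerned.\<close>

lemma hop_Ker_le:
  assumes A: "A \<subseteq> {..<n}" and B: "B \<subseteq> {..<n}" and AB: "A \<inter> B = {}"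
  shows "hop (\<lambda>A. 2 * Ker A B) A \<le> 2 * Ker A B"
proof -
  have fin: "finite A" using A by (rule finite_subset) simp
  define h where "h = (\<lambda>a. \<Sum>b\<in>B. ker a b)"
  have K: "Ker S B = (\<Sum>a\<in>S. h a)" for S by (simp add: Ker_def h_def)
  have h0: "0 \<le> h a" for a by (auto simp: h_def intro!: sum_nonneg)
  have Kd: "Ker (A - {u}) B = Ker A B - h u" if "u \<in> A" for u
    using that fin by (simp add: K sum_diff1)
  have Ki: "Ker (insert w (A - {u})) B \<le> Ker A B - h u + h w" if "u \<in> A" for u w
    using Kd[OF that] fin h0[of w] by (cases "w \<in> A - {u}") (auto simp: K insert_absorb)
  have super: "(1 - \<theta>) * ((h (nx u) + h (pv u)) / 2) \<le> h u" if u: "u \<in> A" for u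
  proof -
    have "(1 - \<theta>) * ((h (nx u) + h (pv u)) / 2) = (\<Sum>b\<in>B. (1 - \<theta>) * ((ker (nx u) b + ker (pv u) b) / 2))"
      by (simp add: h_def sum.distrib[symmetric] sum_distrib_left sum_divide_distrib)
    also have "\<dots> \<le> h u" unfolding h_def
      using A B AB u by (intro sum_mono ker_superharmonic) auto
    finally show ?thesis .
  qed
  let ?K = "Ker A B"
  have "(\<Sum>u\<in>A. \<theta> * (2 * Ker (A - {u}) B) + (1 - \<theta>) *
      ((2 * Ker (insert (nx u) (A - {u})) B + 2 * Ker (insert (pv u) (A - {u})) B) / 2)) \<le> (\<Sum>u\<in>A. 2 * ?K)"
  proof (rule sum_mono)
    fix u assume u: "u \<in> A"
    have "(1 - \<theta>) * ((2 * Ker (insert (nx u) (A - {u})) B + 2 * Ker (insert (pv u) (A - {u})) B) / 2)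
        \<le> (1 - \<theta>) * (2 * ?K - 2 * h u + 2 * ((h (nx u) + h (pv u)) / 2))"
      using Ki[OF u, of "nx u"] Ki[OF u, of "pv u"] \<theta>_le_1 by (intro mult_left_mono) (auto simp: field_simps)
    also have "\<dots> = (1 - \<theta>) * (2 * ?K - 2 * h u) + 2 * ((1 - \<theta>) * ((h (nx u) + h (pv u)) / 2))"
      by (simp only: distrib_left mult.left_commute)
    also have "\<dots> \<le> (1 - \<theta>) * (2 * ?K - 2 * h u) + 2 * h u"
      using super[OF u] by simp
    finally have "\<theta> * (2 * Ker (A - {u}) B) + (1 - \<theta>) *
      ((2 * Ker (insert (nx u) (A - {u})) B + 2 * Ker (insert (pv u) (A - {u})) B) / 2)
      \<le> \<theta> * (2 * (?K - h u)) + ((1 - \<theta>) * (2 * ?K - 2 * h u) + 2 * h u)"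
      by (simp add: Kd[OF u])
    also have "\<dots> = 2 * ?K" by (simp add: algebra_simps)
    finally show "\<theta> * (2 * Ker (A - {u}) B) + (1 - \<theta>) *
      ((2 * Ker (insert (nx u) (A - {u})) B + 2 * Ker (insert (pv u) (A - {u})) B) / 2) \<le> 2 * ?K" .
  qed
  hence "hop (\<lambda>A. 2 * Ker A B) A \<le> (1 - real (card A) / real n) * (2 * ?K) + (\<Sum>u\<in>A. 2 * ?K) / real n"
    unfolding hop_def by (intro add_left_mono divide_right_mono) auto
  thus ?thesis by (simp add: algebra_simps)
qed

text \<open>The law at a common time of two independent copies, as an average over \<open>j\<close> lazy steps.\<close>

definition indep :: "nat \<Rightarrow> (nat \<Rightarrow> nat) \<Rightarrow> ((nat \<Rightarrow> nat) \<Rightarrow> real) \<Rightarrow> ((nat \<Rightarrow> nat) \<Rightarrow> real) \<Rightarrow> real" where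
  "indep j x f g = (\<Sum>i\<le>j. real (j choose i) * (step ^^ i) f x * (step ^^ (j - i)) g x) / 2 ^ j"

lemma indep_Suc: "indep (Suc j) x f g = (indep j x (step f) g + indep j x f (step g)) / 2"
proof -
  have "(\<Sum>i\<le>Suc j. real (Suc j choose i) * ((step ^^ i) f x * (step ^^ (Suc j - i)) g x))
     = (\<Sum>i\<le>j. real (j choose i) * ((step ^^ Suc i) f x * (step ^^ (j - i)) g x))
     + (\<Sum>i\<le>j. real (j choose i) * ((step ^^ i) f x * (step ^^ Suc (j - i)) g x))"
    by (rule binomial_convolution_Suc[where F = "\<lambda>i k. (step ^^ i) f x * (step ^^ k) g x"])
  thus ?thesis
    by (simp add: indep_def mult.assoc funpow_Suc_right add_divide_distrib mult.commute[of "2 ^ j"]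
        del: sum.atMost_Suc funpow.simps)
qed

lemma lin_indep_left: "lin (\<lambda>f. indep j x f g)"
  by (rule linI) (simp_all add: indep_def step_pow_add step_pow_cmult algebra_simps sum.distrib
      sum_distrib_left add_divide_distrib)

lemma indep_commute: "indep j x f g = indep j x g f"
  unfolding indep_def
  by (subst sum.atLeastAtMost_rev[of _ 0 j, unfolded atLeast0AtMost])
     (auto intro!: sum.cong simp: binomial_symmetric[symmetric])

lemma indep_abs_le:
  assumes "\<And>x. \<bar>f x\<bar> \<le> 1" "\<And>x. \<bar>g x\<bar> \<le> 1"
  shows "\<bar>indep j x f g\<bar> \<le> 1"
  using assms
proof (induction j arbitrary: f g)
  case 0
  have "\<bar>f x\<bar> * \<bar>g x\<bar> \<le> 1 * 1" by (rule mult_mono) (use 0 in auto)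
  thus ?case by (simp add: indep_def abs_mult)
next
  case (Suc j)
  have "\<bar>indep j x (step f) g\<bar> \<le> 1" "\<bar>indep j x f (step g)\<bar> \<le> 1"
    by (rule Suc.IH step_abs_le Suc.prems)+
  thus ?case by (simp add: indep_Suc abs_le_iff)
qed

text \<open>A single update touches at most one of the two factors. In \<open>lazy\<close> the
  correction \<open>- f x * g x\<close> cancels against the identity part, which leaves the average
  of moving \<open>f\<close> and moving \<open>g\<close>, just as in
  \<open>indep_Suc\<close>.\<close>

lemma step_mult_disjoint:
  assumes "dep A f" "dep B g" "A \<inter> B = {}"
  shows "step (\<lambda>x. f x * g x) x = g x * step f x + f x * step g x - f x * g x"
proof -
  have "upd u (\<lambda>x. f x * g x) x = g x * upd u f x + f x * upd u g x - f x * g x" for u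
  proof (cases "u \<in> A")
    case True
    hence "u \<notin> B" using assms(3) by auto
    moreover have "(\<Sum>j<q. f (x(u := j)) * g (x(u := j))) = g x * (\<Sum>j<q. f (x(u := j)))"
      using \<open>u \<notin> B\<close> by (simp add: dep_update[OF assms(2)] sum_distrib_left mult.commute)
    ultimately have "upd u (\<lambda>x. f x * g x) x = g x * upd u f x"
      by (simp add: upd_def dep_update[OF assms(2)] field_simps)
    thus ?thesis using \<open>u \<notin> B\<close> by (simp add: upd_dep[OF assms(2)])
  next
    case False
    moreover from this have "(\<Sum>j<q. f (x(u := j)) * g (x(u := j))) = f x * (\<Sum>j<q. g (x(u := j)))"
      by (simp add: dep_update[OF assms(1)] sum_distrib_left)
    ultimately have "upd u (\<lambda>x. f x * g x) x = f x * upd u g x"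
      by (simp add: upd_def dep_update[OF assms(1)] field_simps)
    thus ?thesis using False by (simp add: upd_dep[OF assms(1)])
  qed
  hence "(\<Sum>u<n. upd u (\<lambda>x. f x * g x) x)
      = g x * (\<Sum>u<n. upd u f x) + f x * (\<Sum>u<n. upd u g x) - real n * (f x * g x)"
    by (simp only: sum.distrib sum_subtractf sum_distrib_left) simp
  thus ?thesis using n3 by (simp add: step_def field_simps)
qed

text \<open>As long as the two sets are disjoint, the true and the independent evolution take the
  same step, and the bound survives it by \<open>hop_Ker_le\<close>. Once the sets meet,
  \<open>Ker\<close> is at least 1 and the trivial bound 2 applies.\<close>

lemma lazy_indep:
  assumes "A \<subseteq> {..<n}" "B \<subseteq> {..<n}" "dep A f" "dep B g" "\<And>x. \<bar>f x\<bar> \<le> 1" "\<And>x. \<bar>g x\<bar> \<le> 1"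
  shows "\<bar>(lazy ^^ j) (\<lambda>x. f x * g x) x - indep j x f g\<bar> \<le> 2 * Ker A B"
  using assms
proof (induction j arbitrary: A B f g)
  case 0
  thus ?case using Ker_nonneg[of A B] by (simp add: indep_def)
next
  case (Suc j)
  show ?case
  proof (cases "A \<inter> B = {}")
    case False
    then obtain v where v: "v \<in> A" "v \<in> B" by auto
    have "finite A" "finite B" using Suc.prems(1,2) by (auto intro: finite_subset)
    hence K: "1 \<le> Ker A B" using v by (rule Ker_ge_1)
    have "\<bar>f x * g x\<bar> \<le> 1" for x
      using mult_mono[OF Suc.prems(5,6)[of x]] by (simp add: abs_mult)
    hence "\<bar>(lazy ^^ Suc j) (\<lambda>x. f x * g x) x\<bar> \<le> 1" by (rule lazy_pow_abs_le)
    moreover have "\<bar>indep (Suc j) x f g\<bar> \<le> 1" by (rule indep_abs_le[OF Suc.prems(5,6)])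
    ultimately show ?thesis using K by linarith
  next
    case True
    have lin1: "lin (\<lambda>f. (lazy ^^ j) (\<lambda>x. f x * g x) x - indep j x f g)" for g
      by (rule linI) (simp_all add: lin_add[OF lin_indep_left] lin_cmult[OF lin_indep_left]
          distrib_right lazy_pow_add mult.assoc lazy_pow_cmult right_diff_distrib)
    \<comment> \<open>The induction hypothesis is read as a bound in one factor with the other
      fixed, so that \<open>bnd_step\<close> moves only one of the two sets.\<close>
    have "bnd (\<lambda>f. (lazy ^^ j) (\<lambda>x. f x * g x) x - indep j x f g) (\<lambda>A. 2 * Ker A B)"
      by (rule bndI) (rule Suc.IH, auto simp: Suc.prems)
    from bndD[OF bnd_step[OF lin1 this] Suc.prems(1,3,5)]
    have 1: "\<bar>(lazy ^^ j) (\<lambda>x. step f x * g x) x - indep j x (step f) g\<bar> \<le> hop (\<lambda>A. 2 * Ker A B) A" .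
    have "bnd (\<lambda>g. (lazy ^^ j) (\<lambda>x. g x * f x) x - indep j x g f) (\<lambda>B. 2 * Ker B A)"
      by (rule bndI) (rule Suc.IH, auto simp: Suc.prems)
    from bndD[OF bnd_step[OF lin1 this] Suc.prems(2,4,6)]
    have 2: "\<bar>(lazy ^^ j) (\<lambda>x. step g x * f x) x - indep j x (step g) f\<bar> \<le> hop (\<lambda>B. 2 * Ker B A) B" .
    have "lazy (\<lambda>x. f x * g x) = (\<lambda>x. (1/2) * (step f x * g x) + (1/2) * (step g x * f x))"
      by (rule ext) (simp add: lazy_def step_mult_disjoint[OF Suc.prems(3,4) True] field_simps)
    hence "(lazy ^^ Suc j) (\<lambda>x. f x * g x) x
        = (1/2) * (lazy ^^ j) (\<lambda>x. step f x * g x) x + (1/2) * (lazy ^^ j) (\<lambda>x. step g x * f x) x"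
      by (simp only: funpow_Suc_right o_apply lazy_pow_add lazy_pow_cmult)
    moreover have "indep (Suc j) x f g = (1/2) * indep j x (step f) g + (1/2) * indep j x (step g) f"
      by (simp add: indep_Suc indep_commute[of j x f])
    moreover have "hop (\<lambda>A. 2 * Ker A B) A \<le> 2 * Ker A B" "hop (\<lambda>B. 2 * Ker B A) B \<le> 2 * Ker A B"
      using hop_Ker_le[of A B] hop_Ker_le[of B A] Suc.prems(1,2) True Ker_commute[of A B] by auto
    ultimately show ?thesis using 1 2 by (simp add: abs_le_iff)
  qed
qed

definition cov :: "((nat \<Rightarrow> nat) \<Rightarrow> real) \<Rightarrow> ((nat \<Rightarrow> nat) \<Rightarrow> real) \<Rightarrow> ((nat \<Rightarrow> nat) \<Rightarrow> real) \<Rightarrow> real" where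
  "cov p f g = expect p (\<lambda>x. f x * g x) - expect p f * expect p g"

lemma cov_commute: "cov p f g = cov p g f"
  by (simp add: cov_def mult.commute)

lemma lin_cov: "lin (\<lambda>f. cov p f g)"
  by (rule linI) (simp_all add: cov_def distrib_right lin_add[OF lin_expect] mult.assoc
      lin_cmult[OF lin_expect] right_diff_distrib)

lemma expect_law_indep:
  assumes "x \<in> \<Omega>" "\<And>x. \<bar>f x\<bar> \<le> 1" "\<And>x. \<bar>g x\<bar> \<le> 1"
  shows "expect (law x t) f * expect (law x t) g = pois (2 * real n * t) (\<lambda>j. indep j x f g)"
  using pois_mult[of "\<lambda>i. (step ^^ i) f x" 1 "\<lambda>i. (step ^^ i) g x" 1 "real n * t"]
    step_pow_abs_le[of f 1 _ x, OF assms(2)] step_pow_abs_le[of g 1 _ x, OF assms(3)]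
  by (simp add: expect_law[OF assms(1,2)] expect_law[OF assms(1,3)] indep_def mult.assoc)

lemma cov_law:
  assumes x: "x \<in> \<Omega>" and t: "0 \<le> t"
    and A: "A \<subseteq> {..<n}" "dep A f" "\<And>x. \<bar>f x\<bar> \<le> a"
    and B: "B \<subseteq> {..<n}" "dep B g" "\<And>x. \<bar>g x\<bar> \<le> b"
  shows "\<bar>cov (law x t) f g\<bar> \<le> a * (b * (2 * Ker A B))"
proof (rule lin_bound_scale[OF lin_cov A(2,3)])
  fix f assume f: "dep A f" "\<And>x. \<bar>f x\<bar> \<le> 1"
  have "\<bar>cov (law x t) g f\<bar> \<le> b * (2 * Ker A B)"
  proof (rule lin_bound_scale[OF lin_cov B(2,3)])
    fix g assume g: "dep B g" "\<And>x. \<bar>g x\<bar> \<le> 1"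
    have fg: "\<bar>f x * g x\<bar> \<le> 1" for x
      using mult_mono[OF f(2) g(2), of x x] by (simp add: abs_mult)
    have "cov (law x t) f g = pois (2 * real n * t) (\<lambda>j. (lazy ^^ j) (\<lambda>x. f x * g x) x - indep j x f g)"
      unfolding cov_def expect_law_indep[OF x f(2) g(2)] expect_law_lazy[OF x fg]
      by (rule pois_diff[symmetric, OF lazy_pow_abs_le[OF fg] indep_abs_le[OF f(2) g(2)]])
    also have "\<bar>\<dots>\<bar> \<le> 2 * Ker A B"
      by (rule pois_abs_bound) (use t lazy_indep[OF A(1) B(1) f(1) g(1) f(2) g(2)] in auto)
    finally show "\<bar>cov (law x t) g f\<bar> \<le> 2 * Ker A B" by (simp only: cov_commute[of _ g f])
  qed
  thus "\<bar>cov (law x t) f g\<bar> \<le> b * (2 * Ker A B)" by (simp only: cov_commute[of _ f g])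
qed

lemma cov_stat:
  assumes A: "A \<subseteq> {..<n}" "dep A f" "\<And>x. \<bar>f x\<bar> \<le> a"
    and B: "B \<subseteq> {..<n}" "dep B g" "\<And>x. \<bar>g x\<bar> \<le> b"
  shows "\<bar>cov stat f g\<bar> \<le> a * (b * (2 * Ker A B))"
proof (rule tendsto_upperbound[OF _ _ trivial_limit_at_top_linorder])
  have fd: "dep {..<n} f" "dep {..<n} g" using A B by (auto intro: dep_mono)
  have "dep ({..<n} \<union> {..<n}) (\<lambda>x. f x * g x)" by (rule dep_mult[OF fd])
  hence fgd: "dep {..<n} (\<lambda>x. f x * g x)" by simp
  have fgb: "\<bar>f x * g x\<bar> \<le> a * b" for x
    unfolding abs_mult by (rule mult_mono[OF A(3) B(3)]) (use A(3)[of x] in auto)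
  show "((\<lambda>t. \<bar>cov (law base t) f g\<bar>) \<longlongrightarrow> \<bar>cov stat f g\<bar>) at_top"
    unfolding cov_def
    by (intro tendsto_rabs tendsto_diff tendsto_mult expect_law_tendsto_stat[OF base_config fgd fgb]
        expect_law_tendsto_stat[OF base_config fd(1) A(3)] expect_law_tendsto_stat[OF base_config fd(2) B(3)])
  show "eventually (\<lambda>t. \<bar>cov (law base t) f g\<bar> \<le> a * (b * (2 * Ker A B))) at_top"
    using eventually_ge_at_top[of 0] by eventually_elim (rule cov_law[OF base_config _ A B])
qed

text \<open>A power with exponent \<open>min d (n - d)\<close> is at most the sum of the two powers.
  With the sites on either side of \<open>a\<close> this makes four geometric series, each at most
  \<open>1 / \<theta>\<close>.\<close>

lemma sum_ker: assumes a: "a < n" shows "(\<Sum>b<n. ker a b) \<le> 4 / \<theta>"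
proof -
  have geo: "(\<Sum>i<m. (1 - \<theta>) ^ i) \<le> 1 / \<theta>" for m
    using \<theta>_pos \<theta>_le_1 by (simp add: sum_gp_strict divide_right_mono)
  have inj_geo: "(\<Sum>b\<in>B. (1 - \<theta>) ^ r b) \<le> 1 / \<theta>" if "finite B" "inj_on r B" for B :: "nat set" and r
  proof -
    have "(\<Sum>b\<in>B. (1 - \<theta>) ^ r b) = (\<Sum>i\<in>r ` B. (1 - \<theta>) ^ i)"
      using that by (simp add: sum.reindex)
    also have "\<dots> \<le> (\<Sum>i<Suc (Max (r ` B)). (1 - \<theta>) ^ i)"
      using that \<theta>_le_1 by (intro sum_mono2) (auto simp: less_Suc_eq_le)
    finally show ?thesis using geo by (rule order.trans)
  qed
  let ?r = "1 - \<theta>"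
  have pw: "?r ^ min x y \<le> ?r ^ x + ?r ^ y" for x y using \<theta>_le_1 by (auto simp: min_def)
  have "(\<Sum>b<n. ker a b) = (\<Sum>b\<in>{..<a}. ker a b) + (\<Sum>b\<in>{a..<n}. ker a b)"
    using a by (subst sum.union_disjoint[symmetric]) (auto intro!: sum.cong)
  also have "\<dots> \<le> (\<Sum>b\<in>{..<a}. ?r ^ (a - b) + ?r ^ (n - (a - b))) + (\<Sum>b\<in>{a..<n}. ?r ^ (b - a) + ?r ^ (n - (b - a)))"
    by (intro add_mono sum_mono) (auto simp: ker_def cdist_def intro!: pw)
  also have "\<dots> = ((\<Sum>b\<in>{..<a}. ?r ^ (a - b)) + (\<Sum>b\<in>{..<a}. ?r ^ (n - (a - b))))
       + ((\<Sum>b\<in>{a..<n}. ?r ^ (b - a)) + (\<Sum>b\<in>{a..<n}. ?r ^ (n - (b - a))))"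
    by (simp add: sum.distrib)
  also have "\<dots> \<le> (1 / \<theta> + 1 / \<theta>) + (1 / \<theta> + 1 / \<theta>)"
    by (intro add_mono inj_geo inj_onI) (use a in auto)
  finally show ?thesis by simp
qed

end

section \<open>Fourier analysis of the one-point function\<close>

lemma sum_cos_roots:
  assumes "0 < k" "k < n"
  shows "(\<Sum>v<n. cos (2 * pi * real k * real v / real n)) = 0"
proof -
  let ?z = "cis (2 * pi * real k / real n)"
  have n0: "n > 0" using assms by simp
  have "inj_on (\<lambda>k. cis (2 * pi * real k / real n)) {..<n}"
    using Complex.bij_betw_roots_unity[OF n0] by (simp add: bij_betw_def)
  hence "?z \<noteq> cis (2 * pi * real 0 / real n)"
    using assms n0 by (auto simp del: cis_zero dest!: inj_onD[where x = k and y = 0])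
  hence z1: "?z \<noteq> 1" by simp
  have "?z ^ n = cis (real n * (2 * pi * real k / real n))" by (rule Complex.DeMoivre)
  also have "\<dots> = cis (2 * pi * real k)" using n0 by simp
  also have "\<dots> = 1" by (rule cis_multiple_2pi) simp
  finally have "(\<Sum>v<n. ?z ^ v) = 0" using z1 by (simp add: sum_gp_strict)
  moreover have "Re (?z ^ v) = cos (2 * pi * real k * real v / real n)" for v
    by (simp add: Complex.DeMoivre mult_ac)
  ultimately show ?thesis by (metis (mono_tags, lifting) Re_sum sum.cong zero_complex.sel(1))
qed

lemma sum_cos_roots_diff:
  assumes "v < n" "w < n"
  shows "(\<Sum>k<n. cos (2 * pi * real k * (real v - real w) / real n)) = (if v = w then real n else 0)"
proof (cases "v = w")
  case False
  define d where "d = (if v < w then w - v else v - w)"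
  have d: "0 < d" "d < n" using False assms by (auto simp: d_def)
  have "cos (2 * pi * real k * (real v - real w) / real n) = cos (2 * pi * real d * real k / real n)" for k
  proof (cases "v < w")
    case True
    hence "2 * pi * real k * (real v - real w) / real n = - (2 * pi * real d * real k / real n)"
      by (simp add: d_def of_nat_diff right_diff_distrib left_diff_distrib diff_divide_distrib mult_ac)
    thus ?thesis by (simp only: cos_minus)
  next
    case F: False
    hence "2 * pi * real k * (real v - real w) / real n = 2 * pi * real d * real k / real n"
      using False by (simp add: d_def of_nat_diff field_simps)
    thus ?thesis by (simp only:)
  qed
  thus ?thesis using sum_cos_roots[OF d] False by simp
qed simp

lemma sum_rotate:
  "(\<Sum>k\<in>A. \<Sum>v\<in>B. \<Sum>w\<in>C. f k v w) = (\<Sum>v\<in>B. \<Sum>w\<in>C. \<Sum>k\<in>A. f k v w)"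
proof -
  have "(\<Sum>k\<in>A. \<Sum>v\<in>B. \<Sum>w\<in>C. f k v w) = (\<Sum>v\<in>B. \<Sum>k\<in>A. \<Sum>w\<in>C. f k v w)"
    by (rule sum.swap)
  also have "\<dots> = (\<Sum>v\<in>B. \<Sum>w\<in>C. \<Sum>k\<in>A. f k v w)"
    by (intro sum.cong refl sum.swap)
  finally show ?thesis .
qed

text \<open>The squared modulus of a sum of \<open>K\<close> unit vectors with equally spaced
  angles. The left side shows nonnegativity and the value at angle 0, the right side that only
  frequencies below \<open>K\<close> occur.\<close>

lemma fejer:
  "(\<Sum>i<K. cos (real i * \<alpha>))\<^sup>2 + (\<Sum>i<K. sin (real i * \<alpha>))\<^sup>2
     = real K + 2 * (\<Sum>k\<in>{1..<K}. (real K - real k) * cos (real k * \<alpha>))"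
proof (induction K)
  case (Suc K)
  let ?C = "\<Sum>i<K. cos (real i * \<alpha>)" and ?S = "\<Sum>i<K. sin (real i * \<alpha>)"
  have cross: "?C * cos (real K * \<alpha>) + ?S * sin (real K * \<alpha>) = (\<Sum>k\<in>{1..<Suc K}. cos (real k * \<alpha>))"
  proof -
    have "?C * cos (real K * \<alpha>) + ?S * sin (real K * \<alpha>) = (\<Sum>i<K. cos (real (K - i) * \<alpha>))"
      unfolding sum_distrib_right sum.distrib[symmetric]
    proof (intro sum.cong refl)
      fix i assume "i \<in> {..<K}"
      hence "real (K - i) * \<alpha> = real K * \<alpha> - real i * \<alpha>" by (simp add: of_nat_diff algebra_simps)
      thus "cos (real i * \<alpha>) * cos (real K * \<alpha>) + sin (real i * \<alpha>) * sin (real K * \<alpha>) = cos (real (K - i) * \<alpha>)"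
        by (simp add: cos_diff)
    qed
    also have "\<dots> = (\<Sum>k\<in>{1..<Suc K}. cos (real k * \<alpha>))"
      by (rule sum.reindex_bij_witness[where i = "\<lambda>k. K - k" and j = "\<lambda>i. K - i"]) auto
    finally show ?thesis .
  qed
  have "(?C + cos (real K * \<alpha>))\<^sup>2 + (?S + sin (real K * \<alpha>))\<^sup>2
      = (?C\<^sup>2 + ?S\<^sup>2) + ((cos (real K * \<alpha>))\<^sup>2 + (sin (real K * \<alpha>))\<^sup>2)
        + 2 * (?C * cos (real K * \<alpha>) + ?S * sin (real K * \<alpha>))"
    by (simp add: power2_eq_square algebra_simps)
  also have "\<dots> = real K + 2 * (\<Sum>k\<in>{1..<K}. (real K - real k) * cos (real k * \<alpha>)) + 1
        + 2 * (\<Sum>k\<in>{1..<Suc K}. cos (real k * \<alpha>))"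
    by (simp only: Suc.IH cross) simp
  \<comment> \<open>The added term \<open>k = K\<close> has coefficient 0.\<close>
  also have "(\<Sum>k\<in>{1..<K}. (real K - real k) * cos (real k * \<alpha>))
     = (\<Sum>k\<in>{1..<Suc K}. (real K - real k) * cos (real k * \<alpha>))"
    by (cases "K = 0") (auto simp: sum.atLeastLessThan_Suc)
  also have "real K + 2 * \<dots> + 1 + 2 * (\<Sum>k\<in>{1..<Suc K}. cos (real k * \<alpha>))
     = real (Suc K) + 2 * (\<Sum>k\<in>{1..<Suc K}. (real (Suc K) - real k) * cos (real k * \<alpha>))"
  proof -
    have "(\<Sum>k\<in>{1..<Suc K}. (real (Suc K) - real k) * cos (real k * \<alpha>))
       = (\<Sum>k\<in>{1..<Suc K}. (real K - real k) * cos (real k * \<alpha>)) + (\<Sum>k\<in>{1..<Suc K}. cos (real k * \<alpha>))"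
      unfolding sum.distrib[symmetric] by (intro sum.cong refl) (simp add: algebra_simps)
    thus ?thesis by simp
  qed
  finally show ?case by simp
qed simp

text \<open>The range is dictated by the angles \<open>pi * (k + m) / n\<close> with
  \<open>k \<le> m \<le> n / 3\<close>. The constant comes from the cubic Taylor bound:
  \<open>1 - (21/10)^2 / 6\<close> exceeds 1/4.\<close>

lemma sin_ge_quarter: assumes "0 \<le> y" "y \<le> 2 * pi / 3" shows "y / 4 \<le> sin (y::real)"
proof (cases "y = 0")
  case False
  have "pi \<le> 315/100" using pi_approx by simp
  hence y: "y \<le> 21/10" "0 < y" using assms False by auto
  have "\<bar>sin y - (\<Sum>m<3. sin_coeff m * y ^ m)\<bar> \<le> inverse (fact 3) * \<bar>y\<bar> ^ 3"
    by (rule Maclaurin_sin_bound)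
  hence "sin y \<ge> y - y ^ 3 / 6"
    using y by (simp add: sin_coeff_def eval_nat_numeral abs_le_iff field_simps) argo
  moreover have "y ^ 3 \<le> y * (21/10)\<^sup>2"
    using y power_mono[of y "21/10" 2] by (simp add: power3_eq_cube power2_eq_square mult_left_mono)
  ultimately show ?thesis using y by (simp add: power2_eq_square)
qed simp

context voter_cycle
begin

definition site :: "nat \<Rightarrow> nat \<Rightarrow> (nat \<Rightarrow> nat) \<Rightarrow> real" where
  "site v j x = of_bool (x v = j) - 1 / real q"

definition bias :: "(nat \<Rightarrow> nat) \<Rightarrow> real \<Rightarrow> nat \<Rightarrow> nat \<Rightarrow> real" where
  "bias x t v j = expect (law x t) (site v j)"

text \<open>Eigenvalue, at frequency \<open>k\<close>, of the negative generator of the walk on the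
  cycle killed at rate theta.\<close>

definition eig :: "nat \<Rightarrow> real" where "eig k = 1 - (1 - \<theta>) * cos (2 * pi * real k / real n)"

definition fcos :: "(nat \<Rightarrow> real) \<Rightarrow> nat \<Rightarrow> real" where
  "fcos s k = (\<Sum>v<n. cos (2 * pi * real k * real v / real n) * s v)"
definition fsin :: "(nat \<Rightarrow> real) \<Rightarrow> nat \<Rightarrow> real" where
  "fsin s k = (\<Sum>v<n. sin (2 * pi * real k * real v / real n) * s v)"

text \<open>Energy of the initial state at frequency \<open>k\<close>, summed over the colours. The
  normalization is the one for which \<open>autocorr2_mass\<close> has no further factor.\<close>

definition mass :: "(nat \<Rightarrow> nat) \<Rightarrow> nat \<Rightarrow> real" where
  "mass x k = (\<Sum>j<q. (fcos (\<lambda>v. site v j x) k)\<^sup>2 + (fsin (\<lambda>v. site v j x) k)\<^sup>2) / (real n)\<^sup>2"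

lemma site_bound: "\<bar>site v j x\<bar> \<le> 1"
  using q2 by (auto simp: site_def of_bool_def field_simps)

lemma dep_site: "v \<in> S \<Longrightarrow> dep S (site v j)"
  by (rule depI) (simp add: site_def)

lemma step_site:
  assumes v: "v < n" and j: "j < q"
  shows "step (site v j) x = (1 - 1 / real n) * site v j x + (1 - \<theta>) / (2 * real n) * (site (nx v) j x + site (pv v) j x)"
proof -
  have "step (site v j) x = (1 - real (card {v}) / real n) * site v j x + (\<Sum>u\<in>{v}. upd u (site v j) x) / real n"
    by (rule step_dep[OF dep_site]) (use v in auto)
  also have "(\<Sum>u\<in>{v}. upd u (site v j) x) = (1 - \<theta>) / 2 * (site (nx v) j x + site (pv v) j x)"
  proof -
    have "(\<Sum>i<q. site v j (x(v := i))) = (\<Sum>i<q. if i = j then 1 else 0) - (\<Sum>i<q. 1 / real q)"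
      unfolding sum_subtractf[symmetric] by (intro sum.cong) (auto simp: site_def)
    also have "\<dots> = 0" using j q2 by simp
    finally show ?thesis by (simp add: upd_def site_def)
  qed
  finally show ?thesis using n3 by (simp add: field_simps)
qed

lemma step_pow_site_Suc:
  assumes v: "v < n" and j: "j < q"
  shows "(step ^^ Suc i) (site v j) x = (1 - 1 / real n) * (step ^^ i) (site v j) x
    + (1 - \<theta>) / (2 * real n) * ((step ^^ i) (site (nx v) j) x + (step ^^ i) (site (pv v) j) x)"
proof -
  have "step (site v j) = (\<lambda>x. (1 - 1 / real n) * site v j x + (1 - \<theta>) / (2 * real n) * (site (nx v) j x + site (pv v) j x))"
    using step_site[OF v j] by auto
  thus ?thesis by (simp only: funpow_Suc_right o_apply step_pow_add step_pow_cmult)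
qed

lemma trig_nx:
  assumes "v < n"
  shows "cos (2 * pi * real k * real (nx v) / real n) = cos (2 * pi * real k * real v / real n + 2 * pi * real k / real n)"
    and "sin (2 * pi * real k * real (nx v) / real n) = sin (2 * pi * real k * real v / real n + 2 * pi * real k / real n)"
proof -
  have *: "2 * pi * real k * real v / real n + 2 * pi * real k / real n = 2 * pi * real k * real (Suc v) / real n"
    by (simp add: distrib_left add_divide_distrib)
  have "Suc v = n \<Longrightarrow> cos (2 * pi * real k * real (Suc v) / real n) = 1 \<and> sin (2 * pi * real k * real (Suc v) / real n) = 0"
    using n3 cos_2npi[of k] sin_2npi[of k] by (simp add: mult_ac)
  thus "cos (2 * pi * real k * real (nx v) / real n) = cos (2 * pi * real k * real v / real n + 2 * pi * real k / real n)"
    "sin (2 * pi * real k * real (nx v) / real n) = sin (2 * pi * real k * real v / real n + 2 * pi * real k / real n)"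
    unfolding * by (auto simp: nx_def)
qed

lemma trig_pv:
  assumes "v < n"
  shows "cos (2 * pi * real k * real (pv v) / real n) = cos (2 * pi * real k * real v / real n - 2 * pi * real k / real n)"
    and "sin (2 * pi * real k * real (pv v) / real n) = sin (2 * pi * real k * real v / real n - 2 * pi * real k / real n)"
proof -
  define x y z where "x = 2 * pi * real k * real v / real n" and "y = 2 * pi * real k * real (pv v) / real n"
    and "z = 2 * pi * real k / real n"
  have 1: "cos x = cos (y + z)" "sin x = sin (y + z)"
    using trig_nx[of "pv v" k] assms by (simp_all add: x_def y_def z_def)
  have "cos (x - z) = cos ((y + z) - z)" unfolding cos_diff[of x z] cos_diff[of "y + z" z] 1 ..
  moreover have "sin (x - z) = sin ((y + z) - z)" unfolding sin_diff[of x z] sin_diff[of "y + z" z] 1 ..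
  ultimately show "cos y = cos (x - z)" "sin y = sin (x - z)" by simp_all
qed

lemma fcos_nbrs: "fcos (\<lambda>v. s (nx v) + s (pv v)) k = 2 * cos (2 * pi * real k / real n) * fcos s k"
  and fsin_nbrs: "fsin (\<lambda>v. s (nx v) + s (pv v)) k = 2 * cos (2 * pi * real k / real n) * fsin s k"
proof -
  let ?c = "\<lambda>v. cos (2 * pi * real k * real v / real n)" and ?s = "\<lambda>v. sin (2 * pi * real k * real v / real n)"
  have *: "(\<Sum>v<n. h v * (s (nx v) + s (pv v))) = (\<Sum>v<n. (h (pv v) + h (nx v)) * s v)" for h :: "nat \<Rightarrow> real"
  proof -
    have "(\<Sum>v<n. h v * s (nx v)) = (\<Sum>v<n. h (pv (nx v)) * s (nx v))" by (intro sum.cong) auto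
    also have "\<dots> = (\<Sum>v<n. h (pv v) * s v)" by (rule sum_nx)
    finally have 1: "(\<Sum>v<n. h v * s (nx v)) = (\<Sum>v<n. h (pv v) * s v)" .
    have "(\<Sum>v<n. h v * s (pv v)) = (\<Sum>v<n. h (nx (pv v)) * s (pv v))" by (intro sum.cong) auto
    also have "\<dots> = (\<Sum>v<n. h (nx v) * s v)" by (rule sum_pv)
    finally show ?thesis using 1 by (simp add: algebra_simps sum.distrib)
  qed
  show "fcos (\<lambda>v. s (nx v) + s (pv v)) k = 2 * cos (2 * pi * real k / real n) * fcos s k"
    unfolding fcos_def * sum_distrib_left
    by (intro sum.cong refl) (simp add: trig_nx trig_pv cos_add cos_diff)
  show "fsin (\<lambda>v. s (nx v) + s (pv v)) k = 2 * cos (2 * pi * real k / real n) * fsin s k"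
    unfolding fsin_def * sum_distrib_left
    by (intro sum.cong refl) (simp add: trig_nx trig_pv sin_add sin_diff)
qed

lemma fcos_lin: "fcos (\<lambda>v. a * s v + b * r v) k = a * fcos s k + b * fcos r k"
  and fsin_lin: "fsin (\<lambda>v. a * s v + b * r v) k = a * fsin s k + b * fsin r k"
  by (simp_all add: fcos_def fsin_def algebra_simps sum.distrib sum_distrib_left)

lemma fcos_step_pow:
  assumes j: "j < q"
  shows "fcos (\<lambda>v. (step ^^ i) (site v j) x) k = (1 - eig k / real n) ^ i * fcos (\<lambda>v. site v j x) k"
    and "fsin (\<lambda>v. (step ^^ i) (site v j) x) k = (1 - eig k / real n) ^ i * fsin (\<lambda>v. site v j x) k"
proof (induction i)
  case (Suc i)
  let ?s = "\<lambda>v. (step ^^ i) (site v j) x"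
  have c: "fcos (\<lambda>v. (step ^^ Suc i) (site v j) x) k = fcos (\<lambda>v. (1 - 1 / real n) * ?s v + (1 - \<theta>) / (2 * real n) * (?s (nx v) + ?s (pv v))) k"
    unfolding fcos_def by (intro sum.cong refl) (simp only: step_pow_site_Suc[OF _ j] lessThan_iff)
  have s: "fsin (\<lambda>v. (step ^^ Suc i) (site v j) x) k = fsin (\<lambda>v. (1 - 1 / real n) * ?s v + (1 - \<theta>) / (2 * real n) * (?s (nx v) + ?s (pv v))) k"
    unfolding fsin_def by (intro sum.cong refl) (simp only: step_pow_site_Suc[OF _ j] lessThan_iff)
  have e: "(1 - 1 / real n) + (1 - \<theta>) / (2 * real n) * (2 * cos (2 * pi * real k / real n)) = 1 - eig k / real n"
    using n3 by (simp add: eig_def field_simps)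
  { case 1
    have "fcos (\<lambda>v. (step ^^ Suc i) (site v j) x) k = (1 - eig k / real n) * fcos ?s k"
      unfolding c fcos_lin fcos_nbrs[of ?s] e[symmetric] by (simp only: distrib_right mult.assoc)
    thus ?case using Suc.IH(1) by simp }
  { case 2
    have "fsin (\<lambda>v. (step ^^ Suc i) (site v j) x) k = (1 - eig k / real n) * fsin ?s k"
      unfolding s fsin_lin fsin_nbrs[of ?s] e[symmetric] by (simp only: distrib_right mult.assoc)
    thus ?case using Suc.IH(2) by simp }
qed simp_all

lemma bias_pois: "x \<in> \<Omega> \<Longrightarrow> bias x t v j = pois (real n * t) (\<lambda>i. (step ^^ i) (site v j) x)"
  unfolding bias_def by (rule expect_law[OF _ site_bound])

lemma eig_bounds: "0 \<le> eig k" "eig k \<le> 2"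
proof -
  have "\<bar>(1 - \<theta>) * cos (2 * pi * real k / real n)\<bar> \<le> 1 * 1"
    unfolding abs_mult by (rule mult_mono) (use \<theta>_pos \<theta>_le_1 in auto)
  thus "0 \<le> eig k" "eig k \<le> 2" by (auto simp: eig_def abs_le_iff)
qed

lemma pois_eig: "pois (real n * t) (\<lambda>i. (1 - eig k / real n) ^ i * a) = exp (- t * eig k) * a"
proof -
  have "\<bar>1 - eig k / real n\<bar> \<le> 1" using eig_bounds[of k] n3 by (simp add: abs_le_iff field_simps)
  hence "\<bar>(1 - eig k / real n) ^ i\<bar> \<le> 1" for i by (simp add: power_abs power_le_one)
  hence "pois (real n * t) (\<lambda>i. a * (1 - eig k / real n) ^ i) = a * exp (- (real n * t) * (1 - (1 - eig k / real n)))"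
    by (subst pois_cmult, assumption) (simp only: pois_geometric)
  thus ?thesis using n3 by (simp add: mult.commute)
qed

lemma fcos_bias:
  assumes x: "x \<in> \<Omega>" and j: "j < q"
  shows "fcos (\<lambda>v. bias x t v j) k = exp (- t * eig k) * fcos (\<lambda>v. site v j x) k"
    and "fsin (\<lambda>v. bias x t v j) k = exp (- t * eig k) * fsin (\<lambda>v. site v j x) k"
proof -
  have b: "\<bar>(step ^^ i) (site v j) x\<bar> \<le> 1" for i v by (rule step_pow_abs_le[OF site_bound])
  have *: "(\<Sum>v<n. h v * bias x t v j) = pois (real n * t) (\<lambda>i. \<Sum>v<n. h v * (step ^^ i) (site v j) x)" for h :: "nat \<Rightarrow> real"
  proof -
    have "h v * bias x t v j = pois (real n * t) (\<lambda>i. h v * (step ^^ i) (site v j) x)" for v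
      unfolding bias_pois[OF x] by (rule pois_cmult[OF b, symmetric])
    moreover have "\<bar>h v * (step ^^ i) (site v j) x\<bar> \<le> \<bar>h v\<bar>" for v i
      using mult_left_mono[OF b[of i v] abs_ge_zero[of "h v"]] by (simp add: abs_mult)
    ultimately show ?thesis by (subst pois_sum[where B = "\<lambda>v. \<bar>h v\<bar>"]) auto
  qed
  show "fcos (\<lambda>v. bias x t v j) k = exp (- t * eig k) * fcos (\<lambda>v. site v j x) k"
    using fcos_step_pow(1)[OF j, of _ x k] by (simp only: fcos_def * pois_eig)
  show "fsin (\<lambda>v. bias x t v j) k = exp (- t * eig k) * fsin (\<lambda>v. site v j x) k"
    using fcos_step_pow(2)[OF j, of _ x k] by (simp only: fsin_def * pois_eig)
qed

lemma fcos_fsin_square: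
  "(fcos s k)\<^sup>2 + (fsin s k)\<^sup>2 = (\<Sum>v<n. \<Sum>w<n. s v * s w * cos (2 * pi * real k * (real v - real w) / real n))"
proof -
  have "cos (2 * pi * real k * (real v - real w) / real n)
     = cos (2 * pi * real k * real v / real n) * cos (2 * pi * real k * real w / real n)
     + sin (2 * pi * real k * real v / real n) * sin (2 * pi * real k * real w / real n)" for v w
    by (simp add: right_diff_distrib diff_divide_distrib cos_diff)
  thus ?thesis
    by (simp add: fcos_def fsin_def power2_eq_square sum_product sum.distrib[symmetric] algebra_simps)
qed

lemma parseval: "(\<Sum>k<n. (fcos s k)\<^sup>2 + (fsin s k)\<^sup>2) = real n * (\<Sum>v<n. (s v)\<^sup>2)"
proof -
  have "(\<Sum>k<n. (fcos s k)\<^sup>2 + (fsin s k)\<^sup>2)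
      = (\<Sum>v<n. \<Sum>w<n. s v * s w * (\<Sum>k<n. cos (2 * pi * real k * (real v - real w) / real n)))"
    unfolding fcos_fsin_square sum_distrib_left
    by (rule sum_rotate)
  also have "\<dots> = (\<Sum>v<n. \<Sum>w<n. if v = w then s v * s v * real n else 0)"
    by (intro sum.cong refl) (simp add: sum_cos_roots_diff)
  also have "\<dots> = real n * (\<Sum>v<n. (s v)\<^sup>2)"
    by (simp add: sum_distrib_left power2_eq_square mult_ac)
  finally show ?thesis .
qed

lemma voter_marginal_bias:
  assumes x: "x \<in> \<Omega>" shows "voter_marginal G q \<theta> x t v j - 1 / real q = bias x t v j"
proof -
  have "bias x t v j = (\<Sum>y\<in>\<Omega>. if y v = j then law x t y else 0) - (\<Sum>y\<in>\<Omega>. law x t y) / real q"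
    unfolding bias_def expect_def site_def sum_divide_distrib sum_subtractf[symmetric]
    by (intro sum.cong refl) (simp add: algebra_simps)
  also have "(\<Sum>y\<in>\<Omega>. if y v = j then law x t y else 0) = voter_marginal G q \<theta> x t v j"
    unfolding voter_marginal_def by (subst sum.inter_filter[symmetric]) auto
  finally show ?thesis using sum_law[OF x] by simp
qed

lemma autocorr2_bias:
  assumes x: "x \<in> \<Omega>"
  shows "autocorr2 G q \<theta> x t = (\<Sum>v<n. \<Sum>j<q. (bias x t v j)\<^sup>2) / real n"
  by (simp add: autocorr2_def vertices_cycle voter_marginal_bias[OF x] graph_weight_cycle sum_divide_distrib)

lemma autocorr2_mass:
  assumes x: "x \<in> \<Omega>"
  shows "autocorr2 G q \<theta> x t = (\<Sum>k<n. mass x k * exp (- 2 * t * eig k))"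
proof -
  have "real n * (\<Sum>v<n. \<Sum>j<q. (bias x t v j)\<^sup>2) = (\<Sum>j<q. real n * (\<Sum>v<n. (bias x t v j)\<^sup>2))"
    by (subst sum.swap) (simp add: sum_distrib_left)
  also have "\<dots> = (\<Sum>j<q. \<Sum>k<n. exp (- 2 * t * eig k) * ((fcos (\<lambda>v. site v j x) k)\<^sup>2 + (fsin (\<lambda>v. site v j x) k)\<^sup>2))"
    unfolding parseval[symmetric]
  proof (intro sum.cong refl)
    fix j k assume j: "j \<in> {..<q}"
    have "exp (- 2 * t * eig k) = (exp (- t * eig k))\<^sup>2"
      by (simp add: power2_eq_square exp_add[symmetric])
    thus "(fcos (\<lambda>v. bias x t v j) k)\<^sup>2 + (fsin (\<lambda>v. bias x t v j) k)\<^sup>2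
        = exp (- 2 * t * eig k) * ((fcos (\<lambda>v. site v j x) k)\<^sup>2 + (fsin (\<lambda>v. site v j x) k)\<^sup>2)"
      using j by (simp add: fcos_bias[OF x] power_mult_distrib distrib_left)
  qed
  also have "\<dots> = (\<Sum>k<n. exp (- 2 * t * eig k) * ((real n)\<^sup>2 * mass x k))"
  proof (subst sum.swap, intro sum.cong refl)
    fix k
    have "(real n)\<^sup>2 * mass x k = (\<Sum>j<q. (fcos (\<lambda>v. site v j x) k)\<^sup>2 + (fsin (\<lambda>v. site v j x) k)\<^sup>2)"
      using n3 by (simp add: mass_def)
    thus "(\<Sum>j<q. exp (- 2 * t * eig k) * ((fcos (\<lambda>v. site v j x) k)\<^sup>2 + (fsin (\<lambda>v. site v j x) k)\<^sup>2))
       = exp (- 2 * t * eig k) * ((real n)\<^sup>2 * mass x k)"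
      by (simp only: sum_distrib_left)
  qed
  finally have "real n * (\<Sum>v<n. \<Sum>j<q. (bias x t v j)\<^sup>2) = (real n)\<^sup>2 * (\<Sum>k<n. mass x k * exp (- 2 * t * eig k))"
    by (simp add: sum_distrib_left mult_ac)
  thus ?thesis using n3 by (simp add: autocorr2_bias[OF x] power2_eq_square field_simps)
qed

lemma mass_nonneg: "0 \<le> mass x k" unfolding mass_def by (intro divide_nonneg_nonneg sum_nonneg add_nonneg_nonneg) auto

lemma site_correlation:
  assumes x: "x \<in> \<Omega>" and v: "v < n" and w: "w < n"
  shows "(\<Sum>j<q. site v j x * site w j x) = of_bool (x v = x w) - 1 / real q"
proof -
  have "(\<Sum>j<q. site v j x * site w j x) = (\<Sum>j<q. if j = x v then of_bool (x v = x w) else 0)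
     - (\<Sum>j<q. if j = x v then 1 / real q else 0) - (\<Sum>j<q. if j = x w then 1 / real q else 0) + (\<Sum>j<q. 1 / (real q)\<^sup>2)"
    unfolding sum_subtractf[symmetric] sum.distrib[symmetric]
    by (intro sum.cong refl) (auto simp: site_def algebra_simps power2_eq_square)
  also have "\<dots> = of_bool (x v = x w) - 1 / real q"
    using configs_less[OF x v] configs_less[OF x w] q2 by (simp add: power2_eq_square)
  finally show ?thesis .
qed

lemma mass_correlation:
  assumes x: "x \<in> \<Omega>"
  shows "(real n)\<^sup>2 * mass x k = (\<Sum>v<n. \<Sum>w<n. (of_bool (x v = x w) - 1 / real q) * cos (2 * pi * real k * (real v - real w) / real n))"
proof -
  have "(real n)\<^sup>2 * mass x k = (\<Sum>j<q. \<Sum>v<n. \<Sum>w<n. site v j x * site w j x * cos (2 * pi * real k * (real v - real w) / real n))"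
    using n3 by (simp add: mass_def fcos_fsin_square)
  also have "\<dots> = (\<Sum>v<n. \<Sum>w<n. (\<Sum>j<q. site v j x * site w j x) * cos (2 * pi * real k * (real v - real w) / real n))"
    unfolding sum_distrib_right by (rule sum_rotate)
  also have "\<dots> = (\<Sum>v<n. \<Sum>w<n. (of_bool (x v = x w) - 1 / real q) * cos (2 * pi * real k * (real v - real w) / real n))"
    by (intro sum.cong refl) (simp add: site_correlation[OF x])
  finally show ?thesis .
qed

end

section \<open>Energy at low frequencies\<close>

context voter_cycle
begin

lemma sum_cos_diff_0:
  assumes "0 < k" "k < n"
  shows "(\<Sum>v<n. \<Sum>w<n. cos (2 * pi * real k * (real v - real w) / real n)) = 0"
proof -
  have "fcos (\<lambda>_. 1) k = 0" using sum_cos_roots[OF assms] by (simp add: fcos_def)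
  have "(\<Sum>v<n. \<Sum>w<n. cos (2 * pi * real k * (real v - real w) / real n)) = (fcos (\<lambda>_. 1) k)\<^sup>2 + (fsin (\<lambda>_. 1) k)\<^sup>2"
    by (simp add: fcos_fsin_square)
  moreover have "fsin (\<lambda>_. 1) k = 0"
  proof -
    \<comment> \<open>Neighbour summation multiplies the coefficient by twice the cosine, but it
      also doubles the constant function. Since the cosine is not 1, the coefficient
      vanishes.\<close>
    have "2 * cos (2 * pi * real k / real n) * fsin (\<lambda>_. 1) k = fsin (\<lambda>v. 1 + 1) k"
      by (rule fsin_nbrs[symmetric])
    also have "\<dots> = 2 * fsin (\<lambda>_. 1) k" by (simp add: fsin_def sum_distrib_left mult.commute)
    finally have "(1 - cos (2 * pi * real k / real n)) * fsin (\<lambda>_. 1) k = 0" by (simp add: algebra_simps)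
    moreover have "cos (2 * pi * real k / real n) \<noteq> 1"
    proof
      assume "cos (2 * pi * real k / real n) = 1"
      then obtain m :: int where "2 * pi * real k / real n = of_int m * 2 * pi"
        unfolding cos_one_2pi_int by auto
      hence "real k = of_int m * real n" using n3 by (simp add: field_simps)
      hence "int k = m * int n" by (metis of_int_eq_iff of_int_mult of_int_of_nat_eq)
      hence "int n dvd int k" by simp
      thus False using assms by (auto dest: dvd_imp_le)
    qed
    ultimately show ?thesis by simp
  qed
  ultimately show ?thesis using \<open>fcos (\<lambda>_. 1) k = 0\<close> by simp
qed

text \<open>Two vertices of the same colour contribute \<open>1 - 1/q\<close> and all others \<open>- 1/q\<close>;
  Fejer's kernel is nonnegative, so only the diagonal matters.\<close>

lemma mass_fejer:
  assumes x: "x \<in> \<Omega>" and K: "K \<le> n"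
  shows "real K * (real K - real n / real q) / real n
      \<le> real K * mass x 0 + 2 * (\<Sum>k\<in>{1..<K}. (real K - real k) * mass x k)"
proof -
  define F where "F = (\<lambda>v w. real K + 2 * (\<Sum>k\<in>{1..<K}. (real K - real k) * cos (2 * pi * real k * (real v - real w) / real n)))"
  have Feq: "F v w = (\<Sum>i<K. cos (real i * (2 * pi * (real v - real w) / real n)))\<^sup>2
      + (\<Sum>i<K. sin (real i * (2 * pi * (real v - real w) / real n)))\<^sup>2" for v w
    unfolding fejer F_def by (simp add: mult_ac)
  hence F0: "0 \<le> F v w" for v w by simp
  have Fvv: "F v v = (real K)\<^sup>2" for v unfolding Feq by simp
  have sumF: "(\<Sum>v<n. \<Sum>w<n. a v w * F v w) = real K * (\<Sum>v<n. \<Sum>w<n. a v w)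
       + 2 * (\<Sum>k\<in>{1..<K}. (real K - real k) * (\<Sum>v<n. \<Sum>w<n. a v w * cos (2 * pi * real k * (real v - real w) / real n)))"
    for a :: "nat \<Rightarrow> nat \<Rightarrow> real"
  proof -
    have "(\<Sum>v<n. \<Sum>w<n. a v w * F v w) = real K * (\<Sum>v<n. \<Sum>w<n. a v w)
       + 2 * (\<Sum>v<n. \<Sum>w<n. \<Sum>k\<in>{1..<K}. (real K - real k) * (a v w * cos (2 * pi * real k * (real v - real w) / real n)))"
      by (simp add: F_def distrib_left sum.distrib sum_distrib_left mult_ac)
    also have "(\<Sum>v<n. \<Sum>w<n. \<Sum>k\<in>{1..<K}. (real K - real k) * (a v w * cos (2 * pi * real k * (real v - real w) / real n)))
       = (\<Sum>k\<in>{1..<K}. (real K - real k) * (\<Sum>v<n. \<Sum>w<n. a v w * cos (2 * pi * real k * (real v - real w) / real n)))"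
      unfolding sum_distrib_left by (rule sum_rotate[symmetric])
    finally show ?thesis .
  qed
  let ?a = "\<lambda>v w. of_bool (x v = x w) - 1 / real q"
  have "(real n)\<^sup>2 * (real K * mass x 0 + 2 * (\<Sum>k\<in>{1..<K}. (real K - real k) * mass x k))
     = real K * ((real n)\<^sup>2 * mass x 0) + 2 * (\<Sum>k\<in>{1..<K}. (real K - real k) * ((real n)\<^sup>2 * mass x k))"
    by (simp add: distrib_left sum_distrib_left mult_ac)
  also have "\<dots> = (\<Sum>v<n. \<Sum>w<n. ?a v w * F v w)"
    unfolding sumF mass_correlation[OF x] by simp
  also have "\<dots> \<ge> (\<Sum>v<n. \<Sum>w<n. of_bool (v = w) * F v w - (1 / real q) * F v w)"
  proof (intro sum_mono)
    fix v w
    have "of_bool (v = w) * F v w \<le> of_bool (x v = x w) * F v w" using F0[of v w] by auto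
    thus "of_bool (v = w) * F v w - (1 / real q) * F v w \<le> ?a v w * F v w" by (simp add: left_diff_distrib)
  qed
  also have "(\<Sum>v<n. \<Sum>w<n. of_bool (v = w) * F v w - (1 / real q) * F v w)
      = (\<Sum>v<n. \<Sum>w<n. if v = w then F v w else 0) - (1 / real q) * (\<Sum>v<n. \<Sum>w<n. 1 * F v w)"
    unfolding sum_subtractf sum_distrib_left by (intro arg_cong2[where f = "(-)"] sum.cong refl) auto
  also have "(\<Sum>v<n. \<Sum>w<n. if v = w then F v w else 0) = real n * (real K)\<^sup>2"
    by (simp add: Fvv)
  also have "(\<Sum>v<n. \<Sum>w<n. 1 * F v w) = real K * (real n)\<^sup>2"
  proof -
    have "(\<Sum>k\<in>{1..<K}. (real K - real k) * (\<Sum>v<n. \<Sum>w<n. 1 * cos (2 * pi * real k * (real v - real w) / real n))) = 0"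
      using K by (intro sum.neutral ballI) (simp add: sum_cos_diff_0)
    thus ?thesis unfolding sumF by (simp add: power2_eq_square)
  qed
  finally have "(real n)\<^sup>2 * (real K * mass x 0 + 2 * (\<Sum>k\<in>{1..<K}. (real K - real k) * mass x k))
     \<ge> real n * (real K)\<^sup>2 - 1 / real q * (real K * (real n)\<^sup>2)" .
  moreover have "real n * (real K)\<^sup>2 - 1 / real q * (real K * (real n)\<^sup>2)
      = (real n)\<^sup>2 * (real K * (real K - real n / real q) / real n)"
    using n3 q2 by (simp add: power2_eq_square field_simps)
  ultimately have "(real n)\<^sup>2 * (real K * (real K - real n / real q) / real n)
      \<le> (real n)\<^sup>2 * (real K * mass x 0 + 2 * (\<Sum>k\<in>{1..<K}. (real K - real k) * mass x k))"
    by (simp only:)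
  moreover have "0 < (real n)\<^sup>2" using n3 by simp
  ultimately show ?thesis by (rule mult_left_le_imp_le)
qed

lemma mass_sym: assumes "k \<le> n" shows "mass x (n - k) = mass x k"
proof -
  have arg: "2 * pi * real (n - k) * real v / real n = 2 * pi * real v - 2 * pi * real k * real v / real n" for v
    using assms n3 by (simp add: of_nat_diff field_simps)
  have c: "cos (2 * pi * real v) = 1" "sin (2 * pi * real v) = 0" for v
    using cos_2npi[of v] sin_2npi[of v] by (simp_all add: mult_ac)
  have "fcos s (n - k) = fcos s k" "fsin s (n - k) = - fsin s k" for s
    unfolding fcos_def fsin_def arg by (simp_all add: cos_diff sin_diff c sum_negf)
  thus ?thesis by (simp add: mass_def)
qed

lemma eig_sym: assumes "k \<le> n" shows "eig (n - k) = eig k"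
proof -
  have "2 * pi * real (n - k) / real n = 2 * pi - 2 * pi * real k / real n"
    using assms n3 by (simp add: of_nat_diff field_simps)
  thus ?thesis by (simp add: eig_def cos_diff)
qed

text \<open>Frequencies \<open>k\<close> and \<open>n - k\<close> have equal energy and equal rate,
  hence the factor 2. The condition on \<open>K\<close> keeps the two ranges disjoint, and all other
  frequencies contribute nonnegatively.\<close>

lemma autocorr2_ge_low:
  assumes x: "x \<in> \<Omega>" and K: "0 < K" "2 * K \<le> n + 1"
  shows "mass x 0 * exp (- 2 * t * eig 0) + 2 * (\<Sum>k\<in>{1..<K}. mass x k * exp (- 2 * t * eig k)) \<le> autocorr2 G q \<theta> x t"
proof -
  define f where "f = (\<lambda>k. mass x k * exp (- 2 * t * eig k))"
  have f0: "0 \<le> f k" for k by (simp add: f_def mass_nonneg)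
  have "(\<Sum>k\<in>{1..<K}. f k) = (\<Sum>k\<in>{n-K<..<n}. f k)"
    by (rule sum.reindex_bij_witness[where i = "\<lambda>k. n - k" and j = "\<lambda>k. n - k"])
       (use K in \<open>auto simp: f_def mass_sym eig_sym\<close>)
  hence "f 0 + 2 * (\<Sum>k\<in>{1..<K}. f k) = (\<Sum>k\<in>{0} \<union> {1..<K} \<union> {n-K<..<n}. f k)"
    using K by (subst sum.union_disjoint, simp, simp, fastforce) (subst sum.union_disjoint, auto)
  also have "\<dots> \<le> (\<Sum>k<n. f k)"
    using f0 K n3 by (intro sum_mono2) auto
  finally show ?thesis unfolding autocorr2_mass[OF x] by (simp add: f_def)
qed

end

section \<open>Lower bound on the autocorrelation for every initial state\<close>

text \<open>Length of the Fejer window beyond the frequency \<open>m = n / q\<close> of the rainbow: about \<open>q n / a\<close>,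
  the scale on which \<open>exp (a cos)\<close> varies there, truncated to \<open>m / 2\<close>.\<close>

lemma window_exists:
  fixes a s :: real and m :: nat
  assumes "0 \<le> a" "1 \<le> m" "0 \<le> s"
  obtains \<kappa> :: nat where "1 \<le> \<kappa>" "2 * \<kappa> \<le> m + 1" "a * (real \<kappa> - 1) \<le> s" "m \<le> 2 * \<kappa> \<or> s \<le> a * real \<kappa>"
proof -
  define P where "P = (\<lambda>\<kappa>. 1 \<le> \<kappa> \<and> (m \<le> 2 * \<kappa> \<or> s \<le> a * real \<kappa>))"
  define \<kappa> where "\<kappa> = (LEAST \<kappa>. P \<kappa>)"
  have "P m" using assms by (auto simp: P_def)
  hence P: "P \<kappa>" unfolding \<kappa>_def by (rule LeastI)
  have N: "\<not> P (\<kappa> - 1)" using P not_less_Least[of "\<kappa> - 1" P] by (auto simp: \<kappa>_def P_def)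
  show ?thesis
  proof (rule that[of \<kappa>])
    show "2 * \<kappa> \<le> m + 1" "a * (real \<kappa> - 1) \<le> s"
      using N P assms by (cases "\<kappa> = 1"; auto simp: P_def of_nat_diff)+
  qed (use P in \<open>auto simp: P_def\<close>)
qed

locale rainbow_cycle = voter_cycle +
  assumes q3: "3 \<le> q" and q_dvd_n: "q dvd n"
begin

definition lam :: real where "lam = 1 - (1 - \<theta>) * cos (2 * pi / real q)"

text \<open>The number 50 bounds the loss in the exponent over the part of the window beyond
  frequency \<open>n / q\<close>; the factor \<open>1 / q\<close> is a lower bound for
  \<open>K / n\<close>. Both arise in \<open>autocorr2_lower\<close>.\<close>

definition low_const :: real where "low_const = exp (- 50) / real q"

lemma low_const_pos: "0 < low_const" using q3 by (simp add: low_const_def)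

lemma lam_pos: "0 < lam" and lam_le_2: "lam \<le> 2" and lam_ge: "\<theta> \<le> lam"
proof -
  have "(1 - \<theta>) * cos (2 * pi / real q) \<le> (1 - \<theta>) * 1"
    using \<theta>_le_1 by (intro mult_left_mono) auto
  thus "\<theta> \<le> lam" by (simp add: lam_def)
  thus "0 < lam" using \<theta>_pos by simp
  have "(1 - \<theta>) * (- 1) \<le> (1 - \<theta>) * cos (2 * pi / real q)"
    using \<theta>_le_1 by (intro mult_left_mono) auto
  thus "lam \<le> 2" using \<theta>_pos by (simp add: lam_def)
qed

text \<open>Relative to \<open>exp (- 2 * lam * t)\<close>, frequency \<open>k\<close> is weighted
  by \<open>E k\<close>. It suffices that \<open>E k\<close> dominates \<open>exp (- 50)\<close>
  times the Fejer weight \<open>(K - k) / \<kappa>\<close>, for then \<open>mass_fejer\<close>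
  bounds the weighted energy from below. Up to frequency \<open>m = n / q\<close> the factor
  \<open>E k\<close> is at least 1 and grows at least linearly as \<open>k\<close> decreases. Beyond
  \<open>m\<close> the Fejer weight is at most 1, and the window is short enough for
  \<open>E k\<close> to stay above \<open>exp (- 50)\<close>.\<close>

lemma autocorr2_lower:
  assumes x: "x \<in> \<Omega>" and t: "0 \<le> t"
  shows "low_const * exp (- 2 * lam * t) \<le> autocorr2 G q \<theta> x t"
proof -
  obtain m where m: "n = q * m" using q_dvd_n by (auto elim: dvdE)
  have m1: "1 \<le> m" using m n3 by (cases m) auto
  have m3: "3 * m \<le> n" using m q3 by simp
  define a where "a = 2 * t * (1 - \<theta>)"
  have a0: "0 \<le> a" using t \<theta>_le_1 by (simp add: a_def)
  obtain \<kappa> where \<kappa>: "1 \<le> \<kappa>" "2 * \<kappa> \<le> m + 1" "a * (real \<kappa> - 1) \<le> real q * real n"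
      "m \<le> 2 * \<kappa> \<or> real q * real n \<le> a * real \<kappa>"
    by (rule window_exists[OF a0 m1, of "real q * real n"]) auto
  define K where "K = m + \<kappa>"
  have K: "0 < K" "2 * K \<le> n + 1" "K \<le> n" using \<kappa> m3 m1 by (auto simp: K_def)
  let ?ang = "\<lambda>k. 2 * pi * real k / real n"
  define E where "E = (\<lambda>k. exp (a * (cos (?ang k) - cos (?ang m))))"
  have ang_m: "?ang m = 2 * pi / real q" using m1 q3 by (simp add: m)
  have expE: "exp (- 2 * t * eig k) = exp (- 2 * lam * t) * E k" for k
  proof -
    have "lam = 1 - (1 - \<theta>) * cos (?ang m)" by (simp only: lam_def ang_m)
    hence "- 2 * t * eig k = - 2 * lam * t + a * (cos (?ang k) - cos (?ang m))"
      unfolding eig_def a_def by algebra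
    thus ?thesis unfolding E_def exp_add[symmetric] by (simp only:)
  qed
  have cos_diff_eq: "cos (?ang k) - cos (?ang l) = 2 * sin (pi * (real k + real l) / real n) * sin (pi * (real l - real k) / real n)" for k l
  proof -
    have "(?ang k + ?ang l) / 2 = pi * (real k + real l) / real n" "(?ang l - ?ang k) / 2 = pi * (real l - real k) / real n"
      by (simp_all add: add_divide_distrib diff_divide_distrib distrib_left right_diff_distrib)
    thus ?thesis by (simp only: cos_diff_cos)
  qed
  have nq: "real m * real q = real n" using m by simp
  have nn: "real n * real n = real m * (real q * real n)" by (simp add: nq[symmetric])
  have m0: "real m \<noteq> 0" using m1 by simp
  have Ek: "exp (- 50) * (real K - real k) / real \<kappa> \<le> E k" if k: "k < K" for k
  proof (cases "k \<le> m")
    case True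
    have s1: "pi * (real k + real m) / real n / 4 \<le> sin (pi * (real k + real m) / real n)"
    proof (rule sin_ge_quarter)
      have "pi * (real k + real m) / real n \<le> pi * (2 / 3 * real n) / real n"
        using True m3 n3 by (intro divide_right_mono mult_left_mono) auto
      thus "pi * (real k + real m) / real n \<le> 2 * pi / 3" using n3 by simp
    qed auto
    have s2: "pi * (real m - real k) / real n / 4 \<le> sin (pi * (real m - real k) / real n)"
    proof (rule sin_ge_quarter)
      have "pi * (real m - real k) / real n \<le> pi * (2 / 3 * real n) / real n"
        using True m3 n3 by (intro divide_right_mono mult_left_mono) auto
      thus "pi * (real m - real k) / real n \<le> 2 * pi / 3" using n3 by simp
    qed (use True in auto)
    have "(real m - real k) / (real q * real n) \<le> cos (?ang k) - cos (?ang m)"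
    proof -
      have pi3: "9 \<le> pi * pi" using mult_mono[of 3 pi 3 pi] pi_gt3 by simp
      have "(real m - real k) / (real q * real n) = real m * (real m - real k) / (real n * real n)"
        unfolding nn by (rule mult_divide_mult_cancel_left[OF m0, symmetric])
      also have "\<dots> \<le> (pi * pi / 8) * ((real k + real m) * (real m - real k)) / (real n * real n)"
      proof (intro divide_right_mono)
        have "real m * (real m - real k) \<le> (real k + real m) * (real m - real k)"
          using True by (intro mult_right_mono) auto
        also have "\<dots> \<le> (pi * pi / 8) * ((real k + real m) * (real m - real k))"
          using mult_right_mono[of 1 "pi * pi / 8" "(real k + real m) * (real m - real k)"] pi3 True by simp
        finally show "real m * (real m - real k) \<le> (pi * pi / 8) * ((real k + real m) * (real m - real k))" .
      qed auto
      also have "\<dots> = 2 * ((pi * (real k + real m) / real n / 4) * (pi * (real m - real k) / real n / 4))"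
      proof -
        have "(p * p / 8) * (A * B) / (N * N) = 2 * ((p * A / N / 4) * (p * B / N / 4))" for p A B N :: real
          by (simp add: field_simps)
        thus ?thesis .
      qed
      also have "\<dots> \<le> 2 * (sin (pi * (real k + real m) / real n) * sin (pi * (real m - real k) / real n))"
        using True s1 by (intro mult_left_mono mult_mono s1 s2) (auto intro: order.trans[OF _ s1])
      finally show ?thesis by (simp add: cos_diff_eq)
    qed
    hence "a * ((real m - real k) / (real q * real n)) \<le> a * (cos (?ang k) - cos (?ang m))"
      using a0 by (rule mult_left_mono)
    also have "\<dots> \<le> E k - 1" unfolding E_def using exp_ge_add_one_self[of "a * (cos (?ang k) - cos (?ang m))"] by linarith
    finally have E1: "1 + a * ((real m - real k) / (real q * real n)) \<le> E k" by simp
    have E2: "1 \<le> E k"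
    proof -
      have "0 \<le> a * ((real m - real k) / (real q * real n))" using a0 True by simp
      thus ?thesis using E1 by linarith
    qed
    have e50: "exp (- 50) \<le> (1 / 3 :: real)"
    proof -
      have "3 \<le> exp (50::real)" using exp_ge_add_one_self[of 50] by linarith
      thus ?thesis by (simp add: exp_minus field_simps)
    qed
    have eq: "(real K - real k) / real \<kappa> = 1 + (real m - real k) / real \<kappa>"
      using \<kappa>(1) by (simp add: K_def field_simps)
    show ?thesis
    \<comment> \<open>If the window was cut at about \<open>m / 2\<close>, the Fejer weights are at
      most 3 and \<open>E k \<ge> 1\<close> suffices. Otherwise \<open>1 / \<kappa>\<close> is at
      most \<open>a / (q * n)\<close>, so the linear growth of \<open>E k\<close> matches that of
      the weights.\<close>
    proof (cases "m \<le> 2 * \<kappa>")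
      case True
      hence "(real K - real k) / real \<kappa> \<le> 3" using \<kappa>(1) unfolding K_def by (simp add: field_simps)
      hence "exp (- 50) * ((real K - real k) / real \<kappa>) \<le> (1 / 3) * 3"
        using e50 k by (intro mult_mono) auto
      thus ?thesis using E2 by simp
    next
      case False
      hence q: "real q * real n \<le> a * real \<kappa>" using \<kappa>(4) by simp
      have "(real m - real k) / real \<kappa> \<le> a * ((real m - real k) / (real q * real n))"
        using mult_right_mono[OF q, of "real m - real k"] True \<kappa>(1) q3 n3 by (simp add: field_simps)
      hence "(real K - real k) / real \<kappa> \<le> E k" using E1 eq by linarith
      moreover have "exp (- 50) * ((real K - real k) / real \<kappa>) \<le> 1 * ((real K - real k) / real \<kappa>)"
        using k by (intro mult_right_mono) auto
      ultimately show ?thesis by simp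
    qed
  next
    case False
    define i where "i = k - m"
    have i: "k = m + i" "1 \<le> i" "i < \<kappa>" using False k by (auto simp: i_def K_def)
    have "a * (cos (?ang m) - cos (?ang k)) \<le> 50"
    proof -
      have "cos (?ang m) - cos (?ang k) = 2 * (sin (pi * (real m + real k) / real n) * sin (pi * (real k - real m) / real n))"
        by (simp add: cos_diff_eq)
      also have "\<dots> \<le> 2 * ((pi * (real m + real k) / real n) * (pi * (real k - real m) / real n))"
      proof (intro mult_left_mono mult_mono)
        have "real k - real m \<le> real n" using k K by linarith
        hence "pi * (real k - real m) / real n \<le> pi * real n / real n"
          by (intro divide_right_mono mult_left_mono) auto
        hence "pi * (real k - real m) / real n \<le> pi" using n3 by simp
        moreover have "0 \<le> pi * (real k - real m) / real n" using i by simp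
        ultimately show "0 \<le> sin (pi * (real k - real m) / real n)" by (rule sin_ge_zero[rotated])
      qed (use i in \<open>auto intro!: sin_x_le_x\<close>)
      also have "\<dots> = 2 * (pi * pi) * (2 * real m + real i) * real i / (real n * real n)"
        by (simp add: i(1) field_simps)
      also have "\<dots> \<le> 2 * 10 * (5 / 2 * real m) * real i / (real n * real n)"
      proof (intro divide_right_mono mult_mono)
        have "pi \<le> 315/100" using pi_approx by simp
        hence "pi * pi \<le> (315/100) * (315/100)" by (intro mult_mono) auto
        thus "pi * pi \<le> 10" by simp
        \<comment> \<open>Here \<open>i \<le> \<kappa> - 1\<close>, and
          \<open>2 * \<kappa> \<le> m + 1\<close> gives \<open>2 * i \<le> m - 1\<close>.\<close>
        show "2 * real m + real i \<le> 5 / 2 * real m" using i \<kappa>(2) by linarith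
      qed auto
      also have "\<dots> = 50 * real i / (real q * real n)"
      proof -
        have *: "2 * 10 * (5 / 2 * real m) * real i = real m * (50 * real i)" by simp
        show ?thesis unfolding nn * by (rule mult_divide_mult_cancel_left[OF m0])
      qed
      finally have "a * (cos (?ang m) - cos (?ang k)) \<le> a * (50 * real i / (real q * real n))"
        using a0 by (rule mult_left_mono)
      also have "\<dots> = 50 * (a * real i) / (real q * real n)" by simp
      also have "\<dots> \<le> 50 * (real q * real n) / (real q * real n)"
      proof (intro divide_right_mono mult_left_mono)
        have "a * real i \<le> a * (real \<kappa> - 1)" using i a0 by (intro mult_left_mono) auto
        thus "a * real i \<le> real q * real n" using \<kappa>(3) by linarith
      qed auto
      also have "\<dots> = 50" using q3 n3 by simp
      finally show ?thesis .
    qed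
    hence "exp (- 50) \<le> E k" unfolding E_def by (simp add: algebra_simps)
    moreover have "(real K - real k) / real \<kappa> \<le> 1" using i by (simp add: K_def)
    hence "exp (- 50) * ((real K - real k) / real \<kappa>) \<le> exp (- 50) * 1" by (intro mult_left_mono) auto
    ultimately show ?thesis by simp
  qed
  have "low_const \<le> exp (- 50) / real \<kappa> * (real K * (real K - real n / real q) / real n)"
  proof -
    have "real n / real q = real m" using nq q3 by (simp add: field_simps)
    \<comment> \<open>Since \<open>n / q = m\<close>, the excess \<open>K - n / q\<close> is exactly
      \<open>\<kappa>\<close> and cancels the normalization of the weights.\<close>
    hence "exp (- 50) / real \<kappa> * (real K * (real K - real n / real q) / real n) = exp (- 50) * (real K / real n)"
      using \<kappa>(1) by (simp add: K_def)
    moreover have "1 / real q = real m / real n" using m0 by (simp add: nq[symmetric])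
    hence "1 / real q \<le> real K / real n" by (simp add: K_def divide_right_mono)
    hence "exp (- 50) * (1 / real q) \<le> exp (- 50) * (real K / real n)" by (intro mult_left_mono) auto
    ultimately show ?thesis by (simp add: low_const_def)
  qed
  also have "\<dots> \<le> exp (- 50) / real \<kappa> * (real K * mass x 0 + 2 * (\<Sum>k\<in>{1..<K}. (real K - real k) * mass x k))"
    by (intro mult_left_mono mass_fejer[OF x K(3)]) auto
  also have "\<dots> = mass x 0 * (exp (- 50) * (real K - real 0) / real \<kappa>)
      + 2 * (\<Sum>k\<in>{1..<K}. mass x k * (exp (- 50) * (real K - real k) / real \<kappa>))"
    by (simp add: distrib_left sum_distrib_left mult_ac)
  also have "\<dots> \<le> mass x 0 * E 0 + 2 * (\<Sum>k\<in>{1..<K}. mass x k * E k)"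
    by (intro add_mono mult_left_mono sum_mono Ek mass_nonneg) (use K in auto)
  finally have "exp (- 2 * lam * t) * low_const \<le> exp (- 2 * lam * t) * (mass x 0 * E 0 + 2 * (\<Sum>k\<in>{1..<K}. mass x k * E k))"
    by (intro mult_left_mono) auto
  also have "\<dots> = mass x 0 * exp (- 2 * t * eig 0) + 2 * (\<Sum>k\<in>{1..<K}. mass x k * exp (- 2 * t * eig k))"
    unfolding expE by (simp add: distrib_left sum_distrib_left mult_ac)
  also have "\<dots> \<le> autocorr2 G q \<theta> x t" by (rule autocorr2_ge_low[OF x K(1,2)])
  finally show ?thesis by (simp add: mult.commute)
qed

section \<open>The rainbow configuration\<close>

abbreviation rbw :: "nat \<Rightarrow> nat" where "rbw \<equiv> rainbow q n"

lemma rainbow_config: "rbw \<in> \<Omega>"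
  using q3 by (auto simp: rainbow_def configs_eq)

text \<open>The value of \<open>eig\<close> at frequency \<open>l * n / q\<close>. The rainbow is
  q-periodic, so no other frequencies occur in it.\<close>

definition rainbow_eig :: "nat \<Rightarrow> real" where "rainbow_eig l = 1 - (1 - \<theta>) * cos (2 * pi * real l / real q)"

lemma cos_le_cos_1: assumes "1 \<le> l" "l < q" shows "cos (2 * pi * real l / real q) \<le> cos (2 * pi / real q)"
proof -
  have *: "cos (2 * pi * real l / real q) \<le> cos (2 * pi / real q)" if "1 \<le> l" "2 * l \<le> q" for l
  proof (rule cos_monotone_0_pi_le)
    show "2 * pi / real q \<le> 2 * pi * real l / real q" using that q3 by (simp add: divide_right_mono)
    have "real (2 * l) \<le> real q" using that(2) by (simp only: of_nat_le_iff)
    thus "2 * pi * real l / real q \<le> pi" using q3 by (simp add: field_simps)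
  qed simp
  show ?thesis
  proof (cases "2 * l \<le> q")
    case False
    have "2 * pi * real l / real q = 2 * pi - 2 * pi * real (q - l) / real q"
      using assms q3 by (simp add: of_nat_diff field_simps)
    hence "cos (2 * pi * real l / real q) = cos (2 * pi * real (q - l) / real q)"
      by (simp add: cos_diff)
    thus ?thesis using *[of "q - l"] False assms by simp
  qed (use * assms in simp)
qed

lemma rainbow_eig_rate: assumes "1 \<le> l" "l < q" shows "\<bar>1 - rainbow_eig l / real n\<bar> \<le> 1 - lam / real n"
proof -
  have "lam \<le> rainbow_eig l" unfolding lam_def rainbow_eig_def
    using cos_le_cos_1[OF assms] \<theta>_le_1 by (simp add: mult_left_mono)
  moreover have "(1 - \<theta>) * (- 1) \<le> (1 - \<theta>) * cos (2 * pi * real l / real q)"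
    using \<theta>_le_1 by (intro mult_left_mono) auto
  hence "rainbow_eig l \<le> 2" using \<theta>_pos by (simp add: rainbow_eig_def)
  ultimately show ?thesis using lam_le_2 n3 by (simp add: abs_le_iff field_simps)
qed

text \<open>The indicator of a colour is a q-periodic function of the site and expands in q-th roots
  of unity. The mode \<open>l = 0\<close> is the subtracted \<open>1 / q\<close>, so the sum starts
  at 1; each remaining mode is an eigenfunction of the killed walk.\<close>

lemma site_rainbow:
  assumes v: "v < n" and j: "j < q"
  shows "(step ^^ i) (site v j) rbw
    = (\<Sum>l\<in>{1..<q}. (1 - rainbow_eig l / real n) ^ i * cos (2 * pi * real l * (real v - real j) / real q)) / real q"
  using v
proof (induction i arbitrary: v)
  case 0
  have period: "cos (2 * pi * real l * (real v - real j) / real q) = cos (2 * pi * real l * (real (v mod q) - real j) / real q)" for l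
  proof -
    have "real v = real (v mod q) + real q * real (v div q)"
      by (metis mod_mult_div_eq of_nat_add of_nat_mult)
    hence "2 * pi * real l * (real v - real j) / real q
        = 2 * pi * real l * (real (v mod q) - real j) / real q + 2 * pi * real (l * (v div q))"
      using q3 by (simp add: field_simps)
    moreover have "cos (2 * pi * real (l * (v div q))) = 1" "sin (2 * pi * real (l * (v div q))) = 0"
      using cos_2npi[of "l * (v div q)"] sin_2npi[of "l * (v div q)"] by (simp_all add: mult_ac)
    ultimately show ?thesis by (simp only: cos_add mult_1_right mult_zero_right diff_0_right)
  qed
  have "1 + (\<Sum>l\<in>{1..<q}. cos (2 * pi * real l * (real (v mod q) - real j) / real q))
      = (\<Sum>l<q. cos (2 * pi * real l * (real (v mod q) - real j) / real q))"
    using q3 by (simp add: sum.atLeast_Suc_lessThan lessThan_atLeast0)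
  also have "\<dots> = (if v mod q = j then real q else 0)"
    using q3 j by (intro sum_cos_roots_diff) auto
  finally have "(\<Sum>l\<in>{1..<q}. cos (2 * pi * real l * (real v - real j) / real q)) = (if v mod q = j then real q else 0) - 1"
    by (simp only: period)
  thus ?case using q3 0 by (simp add: site_def rainbow_def field_simps)
next
  case (Suc i)
  let ?R = "\<lambda>l. 1 - rainbow_eig l / real n"
  let ?a = "\<lambda>l v. 2 * pi * real l * (real v - real j) / real q"
  have nxv: "cos (?a l (nx v)) = cos (?a l v + 2 * pi * real l / real q)"
    and pvv: "cos (?a l (pv v)) = cos (?a l v - 2 * pi * real l / real q)" for l
  proof -
    obtain m where m: "n = q * m" using q_dvd_n by (auto elim: dvdE)
    \<comment> \<open>Divisibility of \<open>n\<close> by \<open>q\<close> is what makes the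
      q-periodic modes close up around the cycle.\<close>
    have wrap: "cos (y + 2 * pi * real l * real n / real q) = cos y" "cos (y - 2 * pi * real l * real n / real q) = cos y" for y
    proof -
      have *: "2 * pi * real l * real n / real q = 2 * pi * real (l * m)" using m q3 by simp
      have "cos (2 * pi * real (l * m)) = 1" "sin (2 * pi * real (l * m)) = 0"
        using cos_2npi[of "l * m"] sin_2npi[of "l * m"] by (simp_all add: mult_ac)
      thus "cos (y + 2 * pi * real l * real n / real q) = cos y" "cos (y - 2 * pi * real l * real n / real q) = cos y"
        unfolding * cos_add cos_diff by simp_all
    qed
    show "cos (?a l (nx v)) = cos (?a l v + 2 * pi * real l / real q)"
    proof (cases "Suc v = n")
      case True
      hence nv: "real n = real v + 1" by linarith
      have "cos (?a l (nx v)) = cos (?a l 0)" using True by (simp add: nx_def)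
      also have "\<dots> = cos (?a l 0 + 2 * pi * real l * real n / real q)" by (rule wrap(1)[symmetric])
      also have "?a l 0 + 2 * pi * real l * real n / real q = ?a l v + 2 * pi * real l / real q"
        unfolding nv add_divide_distrib[symmetric] by (simp add: algebra_simps)
      finally show ?thesis .
    next
      case False
      have "?a l (Suc v) = ?a l v + 2 * pi * real l / real q"
        unfolding add_divide_distrib[symmetric] by (simp add: algebra_simps)
      thus ?thesis using False by (simp only: nx_def if_False)
    qed
    show "cos (?a l (pv v)) = cos (?a l v - 2 * pi * real l / real q)"
    proof (cases "v = 0")
      case True
      have nv: "real (n - 1) = real n - 1" using n3 by (simp add: of_nat_diff)
      have "cos (?a l (pv v)) = cos (?a l (n - 1))" using True by (simp add: pv_def)
      also have "\<dots> = cos (?a l (n - 1) - 2 * pi * real l * real n / real q)" by (rule wrap(2)[symmetric])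
      also have "?a l (n - 1) - 2 * pi * real l * real n / real q = ?a l v - 2 * pi * real l / real q"
        unfolding nv True diff_divide_distrib[symmetric] by (simp add: algebra_simps)
      finally show ?thesis .
    next
      case False
      have "?a l (v - 1) = ?a l v - 2 * pi * real l / real q"
        unfolding diff_divide_distrib[symmetric] using False by (simp add: of_nat_diff algebra_simps)
      thus ?thesis using False by (simp only: pv_def if_False)
    qed
  qed
  have "(step ^^ Suc i) (site v j) rbw = (1 - 1 / real n) * ((\<Sum>l\<in>{1..<q}. ?R l ^ i * cos (?a l v)) / real q)
     + (1 - \<theta>) / (2 * real n) * ((\<Sum>l\<in>{1..<q}. ?R l ^ i * cos (?a l (nx v))) / real q + (\<Sum>l\<in>{1..<q}. ?R l ^ i * cos (?a l (pv v))) / real q)"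
    by (simp only: step_pow_site_Suc[OF Suc.prems j] Suc.IH[OF Suc.prems] Suc.IH[OF nx_less[OF Suc.prems]] Suc.IH[OF pv_less[OF Suc.prems]])
  also have "\<dots> = (\<Sum>l\<in>{1..<q}. (1 - 1 / real n) * (?R l ^ i * cos (?a l v))
     + (1 - \<theta>) / (2 * real n) * (?R l ^ i * cos (?a l (nx v)) + ?R l ^ i * cos (?a l (pv v)))) / real q"
    by (simp only: sum.distrib sum_distrib_left[symmetric]) (simp add: add_divide_distrib distrib_left)
  also have "\<dots> = (\<Sum>l\<in>{1..<q}. ?R l ^ Suc i * cos (?a l v)) / real q"
  proof (intro arg_cong2[where f = "(/)"] sum.cong refl)
    fix l
    have "cos (?a l (nx v)) + cos (?a l (pv v)) = 2 * cos (2 * pi * real l / real q) * cos (?a l v)"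
      unfolding nxv pvv by (simp add: cos_add cos_diff)
    hence "(1 - 1 / real n) * (?R l ^ i * cos (?a l v)) + (1 - \<theta>) / (2 * real n) * (?R l ^ i * cos (?a l (nx v)) + ?R l ^ i * cos (?a l (pv v)))
       = ?R l ^ i * ((1 - 1 / real n) * cos (?a l v) + (1 - \<theta>) / (2 * real n) * (2 * cos (2 * pi * real l / real q) * cos (?a l v)))"
      by (simp only: distrib_left[symmetric] mult.left_commute[of _ "?R l ^ i"])
    also have "(1 - 1 / real n) * cos (?a l v) + (1 - \<theta>) / (2 * real n) * (2 * cos (2 * pi * real l / real q) * cos (?a l v)) = ?R l * cos (?a l v)"
      using n3 by (simp add: rainbow_eig_def field_simps)
    finally show "(1 - 1 / real n) * (?R l ^ i * cos (?a l v)) + (1 - \<theta>) / (2 * real n) * (?R l ^ i * cos (?a l (nx v)) + ?R l ^ i * cos (?a l (pv v)))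
       = ?R l ^ Suc i * cos (?a l v)" by (simp add: mult_ac)
  qed
  finally show ?case .
qed

lemma site_rainbow_le:
  assumes v: "v < n" and j: "j < q"
  shows "\<bar>(step ^^ i) (site v j) rbw\<bar> \<le> (1 - lam / real n) ^ i"
proof -
  have r0: "0 \<le> 1 - lam / real n" using lam_le_2 n3 by (simp add: field_simps)
  have "\<bar>\<Sum>l\<in>{1..<q}. (1 - rainbow_eig l / real n) ^ i * cos (2 * pi * real l * (real v - real j) / real q)\<bar>
      \<le> (\<Sum>l\<in>{1..<q}. (1 - lam / real n) ^ i)"
  proof (intro order.trans[OF sum_abs] sum_mono)
    fix l assume "l \<in> {1..<q}"
    hence "\<bar>(1 - rainbow_eig l / real n) ^ i\<bar> \<le> (1 - lam / real n) ^ i"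
      unfolding power_abs by (intro power_mono rainbow_eig_rate) auto
    hence "\<bar>(1 - rainbow_eig l / real n) ^ i\<bar> * \<bar>cos (2 * pi * real l * (real v - real j) / real q)\<bar> \<le> (1 - lam / real n) ^ i * 1"
      using r0 by (intro mult_mono) auto
    thus "\<bar>(1 - rainbow_eig l / real n) ^ i * cos (2 * pi * real l * (real v - real j) / real q)\<bar> \<le> (1 - lam / real n) ^ i"
      by (simp add: abs_mult)
  qed
  also have "\<dots> \<le> real q * (1 - lam / real n) ^ i"
    using r0 by (simp add: mult_right_mono)
  finally show ?thesis unfolding site_rainbow[OF v j] using q3 by (simp add: field_simps)
qed

lemma bias_rainbow_le:
  assumes v: "v < n" and j: "j < q" and t: "0 \<le> t"
  shows "\<bar>bias rbw t v j\<bar> \<le> exp (- lam * t)"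
proof -
  have r: "0 \<le> 1 - lam / real n" "1 - lam / real n \<le> 1" using lam_le_2 lam_pos n3 by (auto simp: field_simps)
  have "\<bar>bias rbw t v j\<bar> \<le> pois (real n * t) (\<lambda>i. (1 - lam / real n) ^ i)"
    unfolding bias_pois[OF rainbow_config]
    by (rule pois_abs_le[OF _ site_rainbow_le[OF v j]]) (use t r in \<open>auto intro: power_le_one\<close>)
  thus ?thesis unfolding pois_geometric using n3 by (simp add: mult.commute)
qed

lemma autocorr2_rainbow_le:
  assumes t: "0 \<le> t"
  shows "autocorr2 G q \<theta> rbw t \<le> real q * exp (- 2 * lam * t)"
proof -
  have "(bias rbw t v j)\<^sup>2 \<le> exp (- 2 * lam * t)" if "v < n" "j < q" for v j
  proof -
    have "(bias rbw t v j)\<^sup>2 \<le> (exp (- lam * t))\<^sup>2"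
      using power_mono[OF bias_rainbow_le[OF that t] abs_ge_zero, of 2] by simp
    also have "\<dots> = exp (- 2 * lam * t)" by (simp add: power2_eq_square exp_add[symmetric])
    finally show ?thesis .
  qed
  hence "(\<Sum>v<n. \<Sum>j<q. (bias rbw t v j)\<^sup>2) \<le> (\<Sum>v<n. \<Sum>j<q. exp (- 2 * lam * t))"
    by (intro sum_mono) auto
  thus ?thesis unfolding autocorr2_bias[OF rainbow_config] using n3 by (simp add: field_simps)
qed

text \<open>One factor \<open>1 / q\<close> comes from \<open>low_const\<close>, the other from the
  prefactor \<open>q\<close> in the upper bound for the rainbow.\<close>

lemma autocorr2_comparison:
  assumes x: "x \<in> \<Omega>" and t: "0 \<le> t"
  shows "exp (- 50) / (real q)\<^sup>2 * autocorr2 G q \<theta> rbw t \<le> autocorr2 G q \<theta> x t"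
proof -
  have "exp (- 50) / (real q)\<^sup>2 * autocorr2 G q \<theta> rbw t \<le> exp (- 50) / (real q)\<^sup>2 * (real q * exp (- 2 * lam * t))"
    by (intro mult_left_mono autocorr2_rainbow_le t) auto
  also have "\<dots> = low_const * exp (- 2 * lam * t)"
    using q3 by (simp add: low_const_def power2_eq_square)
  also have "\<dots> \<le> autocorr2 G q \<theta> x t" by (rule autocorr2_lower[OF x t])
  finally show ?thesis .
qed

text \<open>A crude decay estimate, used to see that the set in the infimum defining
  \<open>autocorr_time\<close> is nonempty.\<close>

lemma autocorr2_le:
  assumes x: "x \<in> \<Omega>" and t: "0 \<le> t"
  shows "autocorr2 G q \<theta> x t \<le> (\<Sum>k<n. mass x k) * exp (- 2 * \<theta> * t)"
proof -
  have "\<theta> \<le> eig k" for k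
    using mult_left_mono[of "cos (2 * pi * real k / real n)" 1 "1 - \<theta>"] \<theta>_le_1 by (simp add: eig_def)
  hence "exp (- 2 * t * eig k) \<le> exp (- 2 * \<theta> * t)" for k
    using mult_left_mono[of \<theta> "eig k" t] t by (simp add: mult.commute[of t])
  thus ?thesis unfolding autocorr2_mass[OF x] sum_distrib_right
    by (intro sum_mono mult_left_mono mass_nonneg) auto
qed

lemma card_vertices: "card (vertices G) = n" by (simp add: vertices_cycle)

text \<open>The subtracted constant is the extra time after which the upper bound for the rainbow,
  with prefactor \<open>q\<close>, has fallen to the lower bound for \<open>x\<close>, with
  prefactor \<open>low_const\<close>. The first part of the proof ensures that the infimum for
  \<open>x\<close> is over a nonempty set.\<close>

lemma autocorr_time_comparison:
  assumes x: "x \<in> \<Omega>"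
  shows "autocorr_time G q \<theta> rbw - ln (real q / low_const) / (2 * lam) \<le> autocorr_time G q \<theta> x"
  unfolding autocorr_time_def card_vertices
proof (rule cInf_greatest)
  have "eventually (\<lambda>t. (\<Sum>k<n. mass x k) * exp (- 2 * \<theta> * t) < 1 / real n) at_top"
  proof (rule order_tendstoD)
    have "filterlim (\<lambda>t. 2 * \<theta> * t) at_top at_top"
      by (rule filterlim_tendsto_pos_mult_at_top[OF tendsto_const _ filterlim_ident]) (use \<theta>_pos in simp)
    hence "((\<lambda>t. exp (- (2 * \<theta> * t))) \<longlongrightarrow> 0) at_top"
      by (intro filterlim_compose[OF exp_at_bot] filterlim_compose[OF filterlim_uminus_at_bot_at_top])
    thus "((\<lambda>t. (\<Sum>k<n. mass x k) * exp (- 2 * \<theta> * t)) \<longlongrightarrow> 0) at_top"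
      using tendsto_mult_right_zero by fastforce
  qed (use n3 in simp)
  hence "eventually (\<lambda>t. (\<Sum>k<n. mass x k) * exp (- 2 * \<theta> * t) < 1 / real n \<and> 0 \<le> t) at_top"
    using eventually_ge_at_top[of 0] by eventually_elim simp
  then obtain t where "(\<Sum>k<n. mass x k) * exp (- 2 * \<theta> * t) < 1 / real n" "0 \<le> t"
    by (auto simp: eventually_at_top_linorder)
  thus "{t. 0 \<le> t \<and> autocorr2 G q \<theta> x t \<le> 1 / real n} \<noteq> {}"
    using autocorr2_le[OF x, of t] by auto
next
  fix t assume t: "t \<in> {t. 0 \<le> t \<and> autocorr2 G q \<theta> x t \<le> 1 / real n}"
  define C where "C = ln (real q / low_const) / (2 * lam)"
  have "low_const \<le> 1 / real q" unfolding low_const_def by (intro divide_right_mono) auto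
  also have "\<dots> \<le> 1" using q3 by simp
  also have "\<dots> \<le> real q" using q3 by simp
  finally have lc: "low_const \<le> real q" .
  have C0: "0 \<le> C" using lc low_const_pos lam_pos by (simp add: C_def)
  have "autocorr2 G q \<theta> rbw (t + C) \<le> real q * exp (- 2 * lam * (t + C))"
    using t C0 by (intro autocorr2_rainbow_le) auto
  also have "\<dots> = real q * (exp (- 2 * lam * t) * exp (- (2 * lam * C)))"
    by (simp add: exp_add[symmetric] algebra_simps)
  also have "2 * lam * C = ln (real q / low_const)" using lam_pos by (simp add: C_def)
  also have "exp (- ln (real q / low_const)) = low_const / real q"
    using low_const_pos q3 by (simp add: exp_minus)
  also have "real q * (exp (- 2 * lam * t) * (low_const / real q)) = low_const * exp (- 2 * lam * t)"
    using q3 by simp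
  also have "\<dots> \<le> 1 / real n" using autocorr2_lower[OF x, of t] t by auto
  finally have "t + C \<in> {t. 0 \<le> t \<and> autocorr2 G q \<theta> rbw t \<le> 1 / real n}" using t C0 by auto
  hence "Inf {t. 0 \<le> t \<and> autocorr2 G q \<theta> rbw t \<le> 1 / real n} \<le> t + C"
    by (rule cInf_lower) (auto intro: bdd_belowI)
  thus "Inf {t. 0 \<le> t \<and> autocorr2 G q \<theta> rbw t \<le> 1 / real n} - ln (real q / low_const) / (2 * lam) \<le> t"
    by (simp add: C_def)
qed

end

text \<open>Orthogonality for arbitrary integers, as needed for the shifted differences
  \<open>v - w - d\<close> and \<open>v - w + d\<close> in \<open>mass_pairf\<close>.\<close>

lemma sum_cos_int:
  fixes z :: int
  assumes "0 < n"
  shows "(\<Sum>k<n. cos (2 * pi * real k * of_int z / real n)) = (if int n dvd z then real n else 0)"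
proof -
  define d where "d = nat (z mod int n)"
  have d: "int d = z mod int n" "d < n"
    using assms pos_mod_bound[of "int n" z] pos_mod_sign[of "int n" z] by (auto simp: d_def nat_less_iff)
  have "cos (2 * pi * real k * of_int z / real n) = cos (2 * pi * real d * real k / real n)" for k
  proof -
    have "z = int d + int n * (z div int n)" using d(1) by simp
    hence "real_of_int z = real d + real n * real_of_int (z div int n)"
      by (metis of_int_add of_int_mult of_int_of_nat_eq)
    hence "2 * pi * real k * of_int z / real n = 2 * pi * real d * real k / real n + 2 * pi * real_of_int (int k * (z div int n))"
      using assms by (simp add: add_divide_distrib distrib_left mult_ac)
    moreover have "cos (2 * pi * real_of_int (int k * (z div int n))) = 1" "sin (2 * pi * real_of_int (int k * (z div int n))) = 0"
      using cos_int_2pin[of "int k * (z div int n)"] sin_int_2pin[of "int k * (z div int n)"] by (simp_all only:)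
    ultimately show ?thesis by (simp only: cos_add mult_1_right mult_zero_right diff_0_right)
  qed
  moreover have "int n dvd z \<longleftrightarrow> d = 0" using d by (auto simp: dvd_eq_mod_eq_0)
  ultimately show ?thesis using sum_cos_roots[of d n] d(2) by auto
qed

context voter_cycle
begin

section \<open>Distinguishing statistics\<close>

definition weights :: "((nat \<Rightarrow> nat) \<Rightarrow> real) \<Rightarrow> bool" where
  "weights p \<longleftrightarrow> (\<forall>x\<in>\<Omega>. 0 \<le> p x) \<and> (\<Sum>x\<in>\<Omega>. p x) = 1"

lemma weights_law: "\<lbrakk>x \<in> \<Omega>; 0 \<le> t\<rbrakk> \<Longrightarrow> weights (law x t)"
  by (simp add: weights_def law_nonneg sum_law)

lemma weights_stat: "weights stat"
  by (simp add: weights_def stat_nonneg sum_stat)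

lemma expect_mono: "\<lbrakk>weights p; \<And>x. x \<in> \<Omega> \<Longrightarrow> f x \<le> g x\<rbrakk> \<Longrightarrow> expect p f \<le> expect p g"
  unfolding expect_def weights_def by (intro sum_mono mult_left_mono) auto

lemma expect_cong: "(\<And>x. x \<in> \<Omega> \<Longrightarrow> f x = g x) \<Longrightarrow> expect p f = expect p g"
  unfolding expect_def by (intro sum.cong) auto

lemma expect_const_weights: "weights p \<Longrightarrow> expect p (\<lambda>_. c) = c"
  by (simp add: expect_const weights_def)

lemma expect_of_bool: "A \<subseteq> \<Omega> \<Longrightarrow> expect p (\<lambda>x. of_bool (x \<in> A)) = sum p A"
proof -
  assume A: "A \<subseteq> \<Omega>"
  have "expect p (\<lambda>x. of_bool (x \<in> A)) = (\<Sum>x\<in>\<Omega>. if x \<in> A then p x else 0)"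
    unfolding expect_def by (intro sum.cong) auto
  also have "\<dots> = sum p A" using A by (simp add: sum.inter_restrict[symmetric] Int_absorb1)
  finally show ?thesis .
qed

lemma tv_dist_ge: "A \<subseteq> \<Omega> \<Longrightarrow> \<bar>sum p A - sum p' A\<bar> \<le> tv_dist \<Omega> p p'"
  unfolding tv_dist_def by (rule cSUP_upper) (auto intro!: bdd_above_finite)

lemma cov_square: assumes "weights p" shows "cov p f f = expect p (\<lambda>x. (f x - expect p f)\<^sup>2)"
proof -
  let ?m = "expect p f"
  have "expect p (\<lambda>x. (f x - ?m)\<^sup>2) = expect p (\<lambda>x. f x * f x + ((- 2 * ?m) * f x + ?m\<^sup>2))"
    by (simp add: power2_eq_square algebra_simps)
  also have "\<dots> = expect p (\<lambda>x. f x * f x) + ((- 2 * ?m) * ?m + ?m\<^sup>2)"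
    by (simp only: lin_add[OF lin_expect] lin_cmult[OF lin_expect] expect_const_weights[OF assms])
  finally show ?thesis by (simp add: cov_def power2_eq_square)
qed

text \<open>The distinguishing event is that \<open>f\<close> lies within half the mean difference
  of its mean under \<open>p\<close>. Chebyshev's inequality bounds its complement under
  \<open>p\<close>, and the event itself under \<open>p'\<close>, by
  \<open>4 * V / D\<^sup>2\<close>.\<close>

lemma chebyshev_tv:
  assumes p: "weights p" and p': "weights p'"
    and V: "cov p f f \<le> V" "cov p' f f \<le> V" and D: "D = expect p f - expect p' f" "D \<noteq> 0"
  shows "1 - 8 * V / D\<^sup>2 \<le> tv_dist \<Omega> p p'"
proof -
  define A where "A = {x \<in> \<Omega>. \<bar>f x - expect p f\<bar> < \<bar>D\<bar> / 2}"
  have A: "A \<subseteq> \<Omega>" by (auto simp: A_def)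
  have D2: "0 < D\<^sup>2" using D(2) by simp
  have tail: "\<bar>D\<bar> / 2 \<le> \<bar>y\<bar> \<Longrightarrow> 1 \<le> 4 / D\<^sup>2 * y\<^sup>2" for y
  proof -
    assume "\<bar>D\<bar> / 2 \<le> \<bar>y\<bar>"
    hence "(\<bar>D\<bar> / 2)\<^sup>2 \<le> \<bar>y\<bar>\<^sup>2" by (intro power_mono) auto
    thus "1 \<le> 4 / D\<^sup>2 * y\<^sup>2" using D2 by (simp add: power_divide field_simps)
  qed
  have "1 - sum p A = expect p (\<lambda>x. 1 + (- 1) * of_bool (x \<in> A))"
    by (simp only: lin_add[OF lin_expect] lin_cmult[OF lin_expect] expect_const_weights[OF p] expect_of_bool[OF A])
  also have "\<dots> \<le> expect p (\<lambda>x. 4 / D\<^sup>2 * (f x - expect p f)\<^sup>2)"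
  proof (rule expect_mono[OF p])
    fix x assume "x \<in> \<Omega>"
    thus "1 + (- 1) * of_bool (x \<in> A) \<le> 4 / D\<^sup>2 * (f x - expect p f)\<^sup>2"
      using tail[of "f x - expect p f"] by (cases "x \<in> A") (auto simp: A_def)
  qed
  also have "\<dots> = 4 / D\<^sup>2 * cov p f f" by (simp only: lin_cmult[OF lin_expect] cov_square[OF p])
  also have "\<dots> \<le> 4 / D\<^sup>2 * V" by (intro mult_left_mono V) simp
  finally have 1: "1 - sum p A \<le> 4 / D\<^sup>2 * V" .
  have "sum p' A = expect p' (\<lambda>x. of_bool (x \<in> A))" by (simp add: expect_of_bool[OF A])
  also have "\<dots> \<le> expect p' (\<lambda>x. 4 / D\<^sup>2 * (f x - expect p' f)\<^sup>2)"
  proof (rule expect_mono[OF p'])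
    fix x assume "x \<in> \<Omega>"
    show "of_bool (x \<in> A) \<le> 4 / D\<^sup>2 * (f x - expect p' f)\<^sup>2"
    proof (cases "x \<in> A")
      case True
      hence "\<bar>f x - expect p f\<bar> < \<bar>D\<bar> / 2" by (simp add: A_def)
      moreover have "\<bar>D\<bar> \<le> \<bar>f x - expect p f\<bar> + \<bar>f x - expect p' f\<bar>" unfolding D(1) by linarith
      ultimately have "\<bar>D\<bar> / 2 \<le> \<bar>f x - expect p' f\<bar>" by linarith
      thus ?thesis using tail True by simp
    qed simp
  qed
  also have "\<dots> = 4 / D\<^sup>2 * cov p' f f" by (simp only: lin_cmult[OF lin_expect] cov_square[OF p'])
  also have "\<dots> \<le> 4 / D\<^sup>2 * V" by (intro mult_left_mono V) simp
  finally have 2: "sum p' A \<le> 4 / D\<^sup>2 * V" .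
  have "1 - 8 * V / D\<^sup>2 \<le> sum p A - sum p' A" using 1 2 by simp
  also have "\<dots> \<le> tv_dist \<Omega> p p'" using tv_dist_ge[OF A, of p p'] by simp
  finally show ?thesis .
qed

lemma cov_sum: "cov p (\<lambda>x. \<Sum>v<n. f v x) (\<lambda>x. \<Sum>w<n. f w x) = (\<Sum>v<n. \<Sum>w<n. cov p (f v) (f w))"
proof -
  have l: "cov p (\<lambda>x. \<Sum>v<n. f v x) g = (\<Sum>v<n. cov p (f v) g)" for g
    using lin_sum[OF lin_cov[of p g] finite_lessThan[of n], of "\<lambda>_. 1" f] by simp
  have "cov p (f v) (\<lambda>x. \<Sum>w<n. f w x) = (\<Sum>w<n. cov p (f v) (f w))" for v
    using l[of "f v"] by (simp add: cov_commute[of p "f v"])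
  thus ?thesis by (simp add: l)
qed

text \<open>The property shared by the laws of the chain and the stationary law, so that variances
  and clusters are treated once for both.\<close>

definition decorrelated :: "((nat \<Rightarrow> nat) \<Rightarrow> real) \<Rightarrow> bool" where
  "decorrelated p \<longleftrightarrow> weights p \<and> (\<forall>A B f g a b. A \<subseteq> {..<n} \<longrightarrow> dep A f \<longrightarrow> (\<forall>x. \<bar>f x\<bar> \<le> a) \<longrightarrow>
     B \<subseteq> {..<n} \<longrightarrow> dep B g \<longrightarrow> (\<forall>x. \<bar>g x\<bar> \<le> b) \<longrightarrow> \<bar>cov p f g\<bar> \<le> a * (b * (2 * Ker A B)))"

lemma decorrelatedD:
  "\<lbrakk>decorrelated p; A \<subseteq> {..<n}; dep A f; \<And>x. \<bar>f x\<bar> \<le> a; B \<subseteq> {..<n}; dep B g; \<And>x. \<bar>g x\<bar> \<le> b\<rbrakk>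
    \<Longrightarrow> \<bar>cov p f g\<bar> \<le> a * (b * (2 * Ker A B))"
  unfolding decorrelated_def by blast

lemma decorrelated_law: "\<lbrakk>x \<in> \<Omega>; 0 \<le> t\<rbrakk> \<Longrightarrow> decorrelated (law x t)"
  unfolding decorrelated_def using weights_law cov_law by blast

lemma decorrelated_stat: "decorrelated stat"
  unfolding decorrelated_def using weights_stat cov_stat by blast

text \<open>Schur's test: the product \<open>s v * s w\<close> is bounded by squares, and then the
  row sums of \<open>ker\<close> by \<open>4 / \<theta>\<close>. A bound through the sum of squares
  is what balances the mean difference in \<open>tv_one_point\<close>.\<close>

lemma variance_one_point:
  assumes p: "decorrelated p" and f: "\<And>v. v < n \<Longrightarrow> dep {v} (f v)" "\<And>v x. v < n \<Longrightarrow> \<bar>f v x\<bar> \<le> s v"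
  shows "cov p (\<lambda>x. \<Sum>v<n. f v x) (\<lambda>x. \<Sum>v<n. f v x) \<le> 8 / \<theta> * (\<Sum>v<n. (s v)\<^sup>2)"
proof -
  have "cov p (\<lambda>x. \<Sum>v<n. f v x) (\<lambda>x. \<Sum>v<n. f v x) \<le> (\<Sum>v<n. \<Sum>w<n. (s v)\<^sup>2 * ker v w + (s w)\<^sup>2 * ker w v)"
    unfolding cov_sum
  proof (intro sum_mono)
    fix v w assume vw: "v \<in> {..<n}" "w \<in> {..<n}"
    have "cov p (f v) (f w) \<le> s v * (s w * (2 * Ker {v} {w}))"
      using decorrelatedD[OF p, of "{v}" "f v" "s v" "{w}" "f w" "s w"] f vw by (auto simp: abs_le_iff)
    also have "\<dots> = 2 * s v * s w * ker v w" by (simp add: Ker_def)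
    also have "\<dots> \<le> ((s v)\<^sup>2 + (s w)\<^sup>2) * ker v w"
      using sum_squares_bound[of "s v" "s w"] by (intro mult_right_mono) auto
    finally show "cov p (f v) (f w) \<le> (s v)\<^sup>2 * ker v w + (s w)\<^sup>2 * ker w v"
      by (simp add: distrib_right ker_def cdist_commute)
  qed
  also have "\<dots> = (\<Sum>v<n. \<Sum>w<n. (s v)\<^sup>2 * ker v w) + (\<Sum>w<n. \<Sum>v<n. (s w)\<^sup>2 * ker w v)"
    by (simp add: sum.distrib) (rule sum.swap)
  also have "\<dots> = 2 * (\<Sum>v<n. (s v)\<^sup>2 * (\<Sum>w<n. ker v w))" by (simp add: sum_distrib_left)
  also have "\<dots> \<le> 2 * (\<Sum>v<n. (s v)\<^sup>2 * (4 / \<theta>))"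
    by (intro mult_left_mono sum_mono sum_ker) auto
  also have "\<dots> = 8 / \<theta> * (\<Sum>v<n. (s v)\<^sup>2)" unfolding sum_distrib_right[symmetric] by simp
  finally show ?thesis .
qed

lemma step_pow_site_le: assumes "v < n" "j < q" shows "\<bar>(step ^^ i) (site v j) x\<bar> \<le> (1 - \<theta> / real n) ^ i"
  using assms(1)
proof (induction i arbitrary: v)
  case (Suc i)
  let ?r = "(1 - \<theta> / real n) ^ i"
  have "\<bar>(step ^^ Suc i) (site v j) x\<bar> \<le> \<bar>(1 - 1 / real n) * (step ^^ i) (site v j) x\<bar>
      + \<bar>(1 - \<theta>) / (2 * real n) * ((step ^^ i) (site (nx v) j) x + (step ^^ i) (site (pv v) j) x)\<bar>"
    unfolding step_pow_site_Suc[OF Suc.prems assms(2)] by (rule abs_triangle_ineq)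
  also have "\<dots> \<le> (1 - 1 / real n) * ?r + (1 - \<theta>) / (2 * real n) * (?r + ?r)"
  proof (intro add_mono)
    show "\<bar>(1 - 1 / real n) * (step ^^ i) (site v j) x\<bar> \<le> (1 - 1 / real n) * ?r"
      using mult_left_mono[OF Suc.IH[OF Suc.prems], of "1 - 1 / real n"] n3 by (simp add: abs_mult)
    have "\<bar>(step ^^ i) (site (nx v) j) x + (step ^^ i) (site (pv v) j) x\<bar> \<le> ?r + ?r"
      using Suc.IH[of "nx v"] Suc.IH[of "pv v"] Suc.prems by (intro order.trans[OF abs_triangle_ineq] add_mono) auto
    thus "\<bar>(1 - \<theta>) / (2 * real n) * ((step ^^ i) (site (nx v) j) x + (step ^^ i) (site (pv v) j) x)\<bar> \<le> (1 - \<theta>) / (2 * real n) * (?r + ?r)"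
      unfolding abs_mult using \<theta>_le_1 n3 by (intro mult_mono) auto
  qed
  also have "\<dots> = (1 - \<theta> / real n) ^ Suc i" using n3 by (simp add: field_simps)
  finally show ?case .
qed (use site_bound in simp)

lemma expect_stat_site: assumes "v < n" "j < q" shows "expect stat (site v j) = 0"
proof (rule LIMSEQ_unique[OF expect_stat_tendsto])
  show "(\<lambda>i. (step ^^ i) (site v j) base) \<longlonglongrightarrow> 0"
    by (rule Lim_null_comparison[OF _ geometric_to_0[of 1]])
       (use step_pow_site_le[OF assms] in simp)
qed

text \<open>The statistic weights the colour indicators with the biases themselves. Its mean shifts
  by \<open>A\<close>, that is n times the autocorrelation, while its variance is at most
  \<open>8 / \<theta> * A\<close>; with the 8 of \<open>chebyshev_tv\<close> this gives 64.\<close>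

lemma tv_one_point:
  assumes x: "x \<in> \<Omega>" and t: "0 \<le> t" and pos: "0 < autocorr2 G q \<theta> x t"
  shows "1 - 64 / (\<theta> * (real n * autocorr2 G q \<theta> x t)) \<le> tv_dist \<Omega> (law x t) stat"
proof -
  define b where "b = bias x t"
  define A where "A = real n * autocorr2 G q \<theta> x t"
  have A: "A = (\<Sum>v<n. \<Sum>j<q. (b v j)\<^sup>2)" using n3 by (simp add: A_def b_def autocorr2_bias[OF x])
  have A0: "0 < A" using pos n3 by (simp add: A_def)
  define f where "f = (\<lambda>v y. \<Sum>j<q. b v j * site v j y)"
  define s where "s = (\<lambda>v. sqrt (\<Sum>j<q. (b v j)\<^sup>2))"
  have s2: "(s v)\<^sup>2 = (\<Sum>j<q. (b v j)\<^sup>2)" for v by (simp add: s_def sum_nonneg)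
  \<comment> \<open>Uncentred indicators: at each configuration at most one term survives, so that
    \<open>g v\<close> is bounded by the Euclidean norm \<open>s v\<close>. Centring would change
    the mean only by a constant.\<close>
  define g where "g = (\<lambda>v y. \<Sum>j<q. b v j * of_bool (y v = j))"
  have g_dep: "dep {v} (g v)" for v unfolding g_def by (rule depI) simp
  have g_le: "\<bar>g v y\<bar> \<le> s v" for v y
  proof -
    have "g v y = (\<Sum>j<q. if j = y v then b v (y v) else 0)"
      unfolding g_def by (intro sum.cong) auto
    also have "\<bar>\<dots>\<bar> \<le> s v"
    proof (cases "y v < q")
      case True
      have "(b v (y v))\<^sup>2 \<le> (\<Sum>j<q. (b v j)\<^sup>2)" by (rule member_le_sum) (use True in auto)
      thus ?thesis using True by (simp add: s_def real_le_rsqrt)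
    qed (simp add: s_def sum_nonneg)
    finally show ?thesis .
  qed
  let ?\<Phi> = "\<lambda>y. \<Sum>v<n. g v y"
  have V: "cov p ?\<Phi> ?\<Phi> \<le> 8 / \<theta> * A" if "decorrelated p" for p
    using variance_one_point[OF that g_dep g_le] by (simp add: s2 A)
  have eg: "expect p ?\<Phi> = (\<Sum>v<n. \<Sum>j<q. b v j * (expect p (site v j) + 1 / real q))" if p: "weights p" for p
  proof -
    have e: "expect p (\<lambda>y. of_bool (y v = j)) = expect p (site v j) + 1 / real q" for v j
    proof -
      have "expect p (\<lambda>y. of_bool (y v = j)) = expect p (\<lambda>y. site v j y + 1 / real q)" by (simp add: site_def)
      thus ?thesis by (simp only: lin_add[OF lin_expect] expect_const_weights[OF p])
    qed
    have "expect p ?\<Phi> = (\<Sum>v<n. expect p (g v))"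
      using lin_sum[OF lin_expect[of p] finite_lessThan[of n], of "\<lambda>_. 1" g] by simp
    also have "\<dots> = (\<Sum>v<n. \<Sum>j<q. b v j * expect p (\<lambda>y. of_bool (y v = j)))"
      unfolding g_def by (intro sum.cong refl lin_sum[OF lin_expect]) auto
    finally show ?thesis by (simp only: e)
  qed
  have "expect (law x t) ?\<Phi> - expect stat ?\<Phi> = (\<Sum>v<n. \<Sum>j<q. b v j * b v j)"
    unfolding eg[OF weights_law[OF x t]] eg[OF weights_stat] sum_subtractf[symmetric]
    by (intro sum.cong refl) (simp add: expect_stat_site b_def bias_def algebra_simps)
  hence D: "A = expect (law x t) ?\<Phi> - expect stat ?\<Phi>" by (simp add: A power2_eq_square)
  have "1 - 8 * (8 / \<theta> * A) / A\<^sup>2 \<le> tv_dist \<Omega> (law x t) stat"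
    by (rule chebyshev_tv[OF weights_law[OF x t] weights_stat V V D])
       (use A0 decorrelated_law[OF x t] decorrelated_stat in auto)
  thus ?thesis using A0 \<theta>_pos by (simp add: A_def[symmetric] power2_eq_square field_simps)
qed

section \<open>Agreement of pairs of sites at a given distance\<close>

definition pairf :: "nat \<Rightarrow> (nat \<Rightarrow> nat) \<Rightarrow> real" where
  "pairf d x = (\<Sum>v<n. of_bool (x v = x ((v + d) mod n))) / real n - 1 / real q"

lemma pairf_0: "pairf 0 x = 1 - 1 / real q"
  using n3 by (simp add: pairf_def)

lemma pairf_bound: "\<bar>pairf d x\<bar> \<le> 1"
proof -
  have "(\<Sum>v<n. of_bool (x v = x ((v + d) mod n))) \<le> (\<Sum>v<n. 1 :: real)" by (intro sum_mono) simp
  hence "(\<Sum>v<n. of_bool (x v = x ((v + d) mod n))) / real n \<le> 1" using n3 by (simp add: field_simps)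
  moreover have "0 \<le> (\<Sum>v<n. of_bool (x v = x ((v + d) mod n))) / real n" by (simp add: sum_nonneg)
  moreover have "0 \<le> 1 / real q" "1 / real q \<le> 1" using q2 by auto
  ultimately show ?thesis unfolding pairf_def by linarith
qed

text \<open>Averaging over the position closes the recursion in \<open>d\<close>: moving either end
  changes the distance by one, and noise resets the agreement probability to \<open>1 / q\<close>,
  which \<open>pairf\<close> subtracts. At \<open>d = 0\<close> a site always agrees with itself,
  which acts as a boundary value.\<close>

lemma step_pairf:
  assumes x: "x \<in> \<Omega>" and d: "0 < d" "d < n"
  shows "step (pairf d) x = (1 - 2 / real n) * pairf d x + (1 - \<theta>) / real n * (pairf (nx d) x + pairf (pv d) x)"
proof -
  define c :: "nat \<Rightarrow> nat \<Rightarrow> (nat \<Rightarrow> nat) \<Rightarrow> real" where "c = (\<lambda>u w x. of_bool (x u = x w))"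
  let ?w = "\<lambda>v. (v + d) mod n"
  have w: "?w v < n" "?w v \<noteq> v" if "v < n" for v
    using d that by (auto simp: mod_if split: if_splits)
  have nw: "nx (?w v) = (v + nx d) mod n" "pv (?w v) = (v + pv d) mod n"
      "?w v = (nx v + pv d) mod n" "?w v = (pv v + nx d) mod n" if "v < n" for v
    using d that n3 by (auto simp: nx_def pv_def mod_if split: if_splits)
  have cs: "c w u x = c u w x" for u w x by (auto simp: c_def)
  have updu: "upd u (c u w) x = \<theta> / real q + (1 - \<theta>) / 2 * (c (nx u) w x + c (pv u) w x)"
    if "u < n" "w < n" "u \<noteq> w" for u w
  proof -
    have "(\<Sum>j<q. c u w (x(u := j))) = (\<Sum>j<q. if j = x w then 1 else 0)"
      using that by (intro sum.cong) (auto simp: c_def)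
    also have "\<dots> = 1" using configs_less[OF x that(2)] by simp
    finally have "(\<Sum>j<q. c u w (x(u := j))) = 1" .
    moreover have "c u w (x(u := x z)) = c z w x" for z using that by (simp add: c_def)
    ultimately show ?thesis by (simp add: upd_def)
  qed
  have updw: "upd w (c u w) x = \<theta> / real q + (1 - \<theta>) / 2 * (c u (nx w) x + c u (pv w) x)"
    if "u < n" "w < n" "u \<noteq> w" for u w
    using updu[of w u] that by (simp only: cs[of w, abs_def] cs[of _ u, abs_def])
  have stepc: "step (c v (?w v)) x = (1 - 2 / real n) * c v (?w v) x + 2 * \<theta> / (real n * real q)
      + (1 - \<theta>) / (2 * real n) * (c (nx v) ((nx v + pv d) mod n) x + c (pv v) ((pv v + nx d) mod n) x
          + c v ((v + nx d) mod n) x + c v ((v + pv d) mod n) x)" if v: "v < n" for v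
  proof -
    have "step (c v (?w v)) x = (1 - real (card {v, ?w v}) / real n) * c v (?w v) x + (\<Sum>u\<in>{v, ?w v}. upd u (c v (?w v)) x) / real n"
      by (rule step_dep) (use v w[OF v] in \<open>auto simp: c_def intro!: depI\<close>)
    also have "\<dots> = (1 - 2 / real n) * c v (?w v) x + (upd v (c v (?w v)) x + upd (?w v) (c v (?w v)) x) / real n"
      using w(2)[OF v] by (simp add: card_insert_if eq_commute)
    also have "upd v (c v (?w v)) x = \<theta> / real q + (1 - \<theta>) / 2 * (c (nx v) (?w v) x + c (pv v) (?w v) x)"
      by (rule updu) (use v w[OF v] in auto)
    also have "upd (?w v) (c v (?w v)) x = \<theta> / real q + (1 - \<theta>) / 2 * (c v (nx (?w v)) x + c v (pv (?w v)) x)"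
      by (rule updw) (use v w[OF v] in auto)
    also have "c (nx v) (?w v) x = c (nx v) ((nx v + pv d) mod n) x" using nw(3)[OF v] by simp
    also have "c (pv v) (?w v) x = c (pv v) ((pv v + nx d) mod n) x" using nw(4)[OF v] by simp
    finally show ?thesis using n3 q2 by (simp only: nw(1,2)[OF v]) (simp add: field_simps)
  qed
  let ?S = "\<lambda>d. \<Sum>v<n. c v ((v + d) mod n) x"
  have P: "pairf d y = (\<Sum>v<n. (1 / real n) * c v ((v + d) mod n) y) + (- 1 / real q)" for d y
    unfolding pairf_def c_def by (simp only: sum_distrib_left[symmetric]) simp
  have "step (pairf d) x = (\<Sum>v<n. (1 / real n) * step (c v (?w v)) x) + (- 1 / real q)"
    unfolding P[abs_def] step_add step_sum step_const ..
  also have "(\<Sum>v<n. (1 / real n) * step (c v (?w v)) x) = (\<Sum>v<n. step (c v (?w v)) x) / real n"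
    by (simp add: sum_divide_distrib)
  also have "(\<Sum>v<n. step (c v (?w v)) x) = (1 - 2 / real n) * ?S d + 2 * \<theta> / real q
     + (1 - \<theta>) / (2 * real n) * ((\<Sum>v<n. c (nx v) ((nx v + pv d) mod n) x) + (\<Sum>v<n. c (pv v) ((pv v + nx d) mod n) x)
          + ?S (nx d) + ?S (pv d))"
  proof -
    have "(\<Sum>v<n. step (c v (?w v)) x) = (\<Sum>v<n. (1 - 2 / real n) * c v (?w v) x + 2 * \<theta> / (real n * real q)
      + (1 - \<theta>) / (2 * real n) * (c (nx v) ((nx v + pv d) mod n) x + c (pv v) ((pv v + nx d) mod n) x
          + c v ((v + nx d) mod n) x + c v ((v + pv d) mod n) x))"
      by (intro sum.cong refl stepc) simp
    moreover have "(\<Sum>v<n. 2 * \<theta> / (real n * real q)) = 2 * \<theta> / real q" using n3 by simp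
    ultimately show ?thesis by (simp only: sum.distrib sum_distrib_left[symmetric])
  qed
  also have "(\<Sum>v<n. c (nx v) ((nx v + pv d) mod n) x) = ?S (pv d)" by (rule sum_nx)
  also have "(\<Sum>v<n. c (pv v) ((pv v + nx d) mod n) x) = ?S (nx d)" by (rule sum_pv)
  finally have "step (pairf d) x = ((1 - 2 / real n) * ?S d + 2 * \<theta> / real q
     + (1 - \<theta>) / (2 * real n) * (?S (pv d) + ?S (nx d) + ?S (nx d) + ?S (pv d))) / real n + (- 1 / real q)" .
  moreover have S: "?S d = real n * (pairf d x + 1 / real q)" for d
    using n3 by (simp add: pairf_def c_def)
  moreover have "((1 - 2 / N) * (N * (A + i)) + 2 * \<theta> * i + (1 - \<theta>) / (2 * N) * (N * (C + i) + N * (B + i) + N * (B + i) + N * (C + i))) / N + - i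
      = (1 - 2 / N) * A + (1 - \<theta>) / N * (B + C)" if "N \<noteq> 0" for A B C i N :: real
    using that by (simp add: field_simps)
  from this[of "real n" "pairf d x" "1 / real q" "pairf (pv d) x" "pairf (nx d) x"]
  have "((1 - 2 / real n) * (real n * (pairf d x + 1 / real q)) + 2 * \<theta> / real q + (1 - \<theta>) / (2 * real n)
      * (real n * (pairf (pv d) x + 1 / real q) + real n * (pairf (nx d) x + 1 / real q)
        + real n * (pairf (nx d) x + 1 / real q) + real n * (pairf (pv d) x + 1 / real q))) / real n + - 1 / real q
     = (1 - 2 / real n) * pairf d x + (1 - \<theta>) / real n * (pairf (nx d) x + pairf (pv d) x)"
    using n3 by simp
  ultimately show ?thesis unfolding S by (simp only:)
qed

lemma step_pow_pairf_Suc: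
  assumes x: "x \<in> \<Omega>" and d: "0 < d" "d < n"
  shows "(step ^^ Suc i) (pairf d) x = (1 - 2 / real n) * (step ^^ i) (pairf d) x
     + (1 - \<theta>) / real n * ((step ^^ i) (pairf (nx d)) x + (step ^^ i) (pairf (pv d)) x)"
proof -
  have "(step ^^ i) (step (pairf d)) x
    = (step ^^ i) (\<lambda>x. (1 - 2 / real n) * pairf d x + (1 - \<theta>) / real n * (pairf (nx d) x + pairf (pv d) x)) x"
    by (rule step_pow_cong_configs[OF _ x]) (rule step_pairf[OF _ d])
  thus ?thesis by (simp only: funpow_Suc_right o_apply step_pow_add step_pow_cmult)
qed

lemma step_pow_pairf_0: "(step ^^ i) (pairf 0) x = 1 - 1 / real q"
  by (simp add: pairf_0[abs_def])

text \<open>Wiener-Khinchin: the energy spectrum and the spatial autocorrelation are Fourier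
  transforms of each other. The product formula for cosines yields the shifts by \<open>d\<close>
  and by \<open>- d\<close>, which contribute equally.\<close>

lemma mass_pairf:
  assumes x: "x \<in> \<Omega>" and d: "d < n"
  shows "(\<Sum>k<n. mass x k * cos (2 * pi * real k * real d / real n)) = pairf d x"
proof -
  let ?R = "\<lambda>v w. of_bool (x v = x w) - 1 / real q"
  let ?w = "\<lambda>v. (v + d) mod n"
  have n0: "0 < n" using n3 by simp
  have inner: "(\<Sum>k<n. cos (2 * pi * real k * (real v - real w) / real n) * cos (2 * pi * real k * real d / real n))
     = real n / 2 * ((if w = ?w v then 1 else 0) + (if v = ?w w then 1 else 0))" if v: "v < n" and w: "w < n" for v w
  proof -
    have "cos (2 * pi * real k * (real v - real w) / real n) * cos (2 * pi * real k * real d / real n)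
      = (cos (2 * pi * real k * of_int (int v - int w - int d) / real n) + cos (2 * pi * real k * of_int (int v - int w + int d) / real n)) / 2" for k
    proof -
      have "2 * pi * real k * of_int (int v - int w - int d) / real n = 2 * pi * real k * (real v - real w) / real n - 2 * pi * real k * real d / real n"
        "2 * pi * real k * of_int (int v - int w + int d) / real n = 2 * pi * real k * (real v - real w) / real n + 2 * pi * real k * real d / real n"
        by (simp_all add: diff_divide_distrib add_divide_distrib right_diff_distrib distrib_left)
      thus ?thesis by (simp only: cos_times_cos)
    qed
    hence "(\<Sum>k<n. cos (2 * pi * real k * (real v - real w) / real n) * cos (2 * pi * real k * real d / real n))
      = ((\<Sum>k<n. cos (2 * pi * real k * of_int (int v - int w - int d) / real n)) + (\<Sum>k<n. cos (2 * pi * real k * of_int (int v - int w + int d) / real n))) / 2"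
      by (simp only: sum_divide_distrib[symmetric] sum.distrib)
    also have "\<dots> = ((if int n dvd int v - int w - int d then real n else 0) + (if int n dvd int v - int w + int d then real n else 0)) / 2"
      by (simp only: sum_cos_int[OF n0])
    also have "int n dvd int v - int w - int d \<longleftrightarrow> v = ?w w"
    proof -
      have "int n dvd int v - int (w + d) \<longleftrightarrow> v mod n = (w + d) mod n"
        by (metis mod_eq_dvd_iff of_nat_eq_iff zmod_int)
      thus ?thesis using v by (simp add: algebra_simps)
    qed
    also have "int n dvd int v - int w + int d \<longleftrightarrow> w = ?w v"
    proof -
      have "int n dvd int (v + d) - int w \<longleftrightarrow> (v + d) mod n = w mod n"
        by (metis mod_eq_dvd_iff of_nat_eq_iff zmod_int)
      thus ?thesis using w by (auto simp: algebra_simps)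
    qed
    finally show ?thesis by simp
  qed
  have wn: "?w v < n" for v using n0 by simp
  have "(real n)\<^sup>2 * (\<Sum>k<n. mass x k * cos (2 * pi * real k * real d / real n))
      = (\<Sum>k<n. ((real n)\<^sup>2 * mass x k) * cos (2 * pi * real k * real d / real n))"
    by (simp add: sum_distrib_left mult_ac)
  also have "\<dots> = (\<Sum>k<n. \<Sum>v<n. \<Sum>w<n. ?R v w * (cos (2 * pi * real k * (real v - real w) / real n) * cos (2 * pi * real k * real d / real n)))"
    unfolding mass_correlation[OF x] sum_distrib_right mult.assoc ..
  also have "\<dots> = (\<Sum>v<n. \<Sum>w<n. ?R v w * (\<Sum>k<n. cos (2 * pi * real k * (real v - real w) / real n) * cos (2 * pi * real k * real d / real n)))"
    unfolding sum_distrib_left by (rule sum_rotate)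
  also have "\<dots> = (\<Sum>v<n. \<Sum>w<n. real n / 2 * (if w = ?w v then ?R v w else 0) + real n / 2 * (if v = ?w w then ?R v w else 0))"
    by (intro sum.cong refl) (auto simp: inner distrib_left)
  also have "\<dots> = (\<Sum>v<n. \<Sum>w<n. real n / 2 * (if w = ?w v then ?R v w else 0)) + (\<Sum>w<n. \<Sum>v<n. real n / 2 * (if v = ?w w then ?R v w else 0))"
    unfolding sum.distrib by (intro arg_cong2[where f = "(+)"] refl sum.swap)
  also have "\<dots> = (\<Sum>v<n. real n / 2 * ?R v (?w v)) + (\<Sum>w<n. real n / 2 * ?R (?w w) w)"
    by (simp only: sum_distrib_left[symmetric]) (simp add: wn)
  also have "(\<Sum>w<n. real n / 2 * ?R (?w w) w) = (\<Sum>v<n. real n / 2 * ?R v (?w v))"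
    by (intro sum.cong refl) (simp add: eq_commute)
  also have "(\<Sum>v<n. real n / 2 * ?R v (?w v)) + (\<Sum>v<n. real n / 2 * ?R v (?w v)) = real n * (\<Sum>v<n. ?R v (?w v))"
    by (simp only: sum_distrib_left[symmetric])
  also have "(\<Sum>v<n. ?R v (?w v)) = real n * pairf d x"
    using n0 by (simp add: sum_subtractf pairf_def field_simps)
  finally show ?thesis using n0 by (simp add: power2_eq_square)
qed


definition pair_stat :: "nat \<Rightarrow> real" where "pair_stat d = expect stat (pairf d)"

lemma pair_stat_rec:
  assumes d: "0 < d" "d < n"
  shows "pair_stat d = (1 - 2 / real n) * pair_stat d + (1 - \<theta>) / real n * (pair_stat (nx d) + pair_stat (pv d))"
proof -
  have "pair_stat d = expect stat (step (pairf d))" by (simp add: pair_stat_def expect_stat_step)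
  also have "\<dots> = expect stat (\<lambda>x. (1 - 2 / real n) * pairf d x + (1 - \<theta>) / real n * (pairf (nx d) x + pairf (pv d) x))"
    by (rule expect_cong) (rule step_pairf[OF _ d])
  also have "\<dots> = (1 - 2 / real n) * pair_stat d + (1 - \<theta>) / real n * (pair_stat (nx d) + pair_stat (pv d))"
    by (simp only: lin_add[OF lin_expect] lin_cmult[OF lin_expect] pair_stat_def)
  finally show ?thesis .
qed

lemma pair_stat_0: "pair_stat 0 = 1 - 1 / real q"
  unfolding pair_stat_def pairf_0[abs_def] by (rule expect_const_weights[OF weights_stat])

text \<open>A subsolution that keeps only the jumps shortening the distance; such a jump is the next
  event at the pair with probability \<open>(1 - \<theta>) / 2\<close>. The comparison starts from
  the constant configuration, where all pairs agree.\<close>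

lemma pair_stat_ge: assumes "d < n" shows "(1 - 1 / real q) * ((1 - \<theta>) / 2) ^ d \<le> pair_stat d"
proof -
  have q1: "0 \<le> 1 - 1 / real q" using q2 by simp
  have h0: "0 \<le> (1 - \<theta>) / 2" "(1 - \<theta>) / 2 \<le> 1" using \<theta>_le_1 \<theta>_pos by auto
  let ?w = "\<lambda>d. (1 - 1 / real q) * ((1 - \<theta>) / 2) ^ d"
  have w0: "0 \<le> ?w d" for d using q1 h0 by simp
  have "?w d \<le> (step ^^ i) (pairf d) base" for i
    using assms
  proof (induction i arbitrary: d)
    case 0
    have "pairf d base = 1 - 1 / real q" using n3 by (simp add: pairf_def base_def)
    moreover have "?w d \<le> (1 - 1 / real q) * 1" using q1 h0 by (intro mult_left_mono power_le_one) auto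
    ultimately show ?case by simp
  next
    case (Suc i)
    show ?case
    proof (cases d)
      case 0
      have "(step ^^ Suc i) (pairf 0) base = 1 - 1 / real q" by (rule step_pow_pairf_0)
      thus ?thesis using 0 by simp
    next
      case (Suc e)
      have d: "0 < d" "d < n" "pv d = e" using Suc Suc.prems by (auto simp: pv_def)
      have "0 \<le> (step ^^ i) (pairf (nx d)) base"
        using order.trans[OF w0 Suc.IH[OF nx_less[OF d(2)]]] .
      moreover have "?w e \<le> (step ^^ i) (pairf (pv d)) base" using Suc.IH[of e] d Suc by simp
      ultimately have "?w e \<le> (step ^^ i) (pairf (nx d)) base + (step ^^ i) (pairf (pv d)) base" by linarith
      hence "(1 - 2 / real n) * ?w d + (1 - \<theta>) / real n * ?w e \<le> (step ^^ Suc i) (pairf d) base"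
        unfolding step_pow_pairf_Suc[OF base_config d(1,2)]
        using Suc.IH[OF d(2)] n3 \<theta>_le_1 by (intro add_mono mult_left_mono) auto
      moreover have "(1 - \<theta>) / real n * ?w e = 2 / real n * ?w d" using Suc by simp
      ultimately have "(1 - 2 / real n) * ?w d + 2 / real n * ?w d \<le> (step ^^ Suc i) (pairf d) base"
        by (simp only:)
      thus ?thesis by (simp only: distrib_right[symmetric]) simp
    qed
  qed
  thus ?thesis unfolding pair_stat_def by (intro LIMSEQ_le_const[OF expect_stat_tendsto]) auto
qed

lemma cos_product: "cos (y + z) + cos (y - z) = 2 * cos z * cos (y :: real)"
  by (simp add: cos_add cos_diff)

text \<open>Comparison argument: \<open>pair_stat - pairf + r\<close>, where \<open>r\<close> is the free evolution of the initial pair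
  correlation, solves the same recursion off \<open>d = 0\<close> and is nonnegative at \<open>d = 0\<close>; hence it dominates
  the subsolution \<open>sin (\<pi> d / M)\<close> with Dirichlet boundary values.\<close>

lemma pair_gap:
  assumes x: "x \<in> \<Omega>" and t: "0 \<le> t" and M: "2 \<le> M" "M < n" and n4: "4 \<le> n"
  shows "(1 - 1 / real q) * ((1 - \<theta>) / 2) ^ M * sin (pi / real M) * exp (- 2 * t * (1 - (1 - \<theta>) * cos (pi / real M)))
      - autocorr2 G q \<theta> x t \<le> pair_stat 1 - expect (law x t) (pairf 1)"
proof -
  define \<omega> where "\<omega> = 1 - (1 - \<theta>) * cos (pi / real M)"
  define c where "c = (1 - 1 / real q) * ((1 - \<theta>) / 2) ^ M"
  define \<zeta> where "\<zeta> = 1 - 2 * \<omega> / real n"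
  \<comment> \<open>Cut off at \<open>M\<close>, where the sine vanishes; beyond that point zero is
    a subsolution because \<open>s\<close> is nonnegative.\<close>
  define s where "s = (\<lambda>d. if d < M then sin (pi * real d / real M) else 0)"
  have s0: "0 \<le> s d" for d
  proof (cases "d < M")
    case True
    hence "pi * real d / real M \<le> pi * real M / real M" by (intro divide_right_mono mult_left_mono) auto
    thus ?thesis using M True by (auto simp: s_def intro!: sin_ge_zero)
  qed (simp add: s_def)
  have c0: "0 \<le> c" using q2 \<theta>_le_1 by (simp add: c_def)
  have cosM: "0 \<le> cos (pi / real M)" 
  proof (rule cos_ge_zero)
    show "pi / real M \<le> pi / 2" by (rule divide_left_mono) (use M in auto)
    have "0 \<le> pi / real M" by simp
    thus "- (pi / 2) \<le> pi / real M" using pi_gt_zero by linarith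
  qed
  have \<omega>: "0 \<le> \<omega>" "\<omega> \<le> 1"
    using mult_mono[of "1 - \<theta>" 1 "cos (pi / real M)" 1] \<theta>_le_1 \<theta>_pos cosM by (auto simp: \<omega>_def)
  have \<zeta>: "0 \<le> \<zeta>" "\<zeta> \<le> 1" using \<omega> n4 by (auto simp: \<zeta>_def field_simps)
  \<comment> \<open>Both ends of a pair move, so frequency \<open>k\<close> decays at twice the rate
    \<open>eig k\<close>. In continuous time the value at \<open>d = 0\<close> becomes
    \<open>autocorr2\<close>, which dominates the one at \<open>d = 1\<close>.\<close>
  define r where "r = (\<lambda>i d. \<Sum>k<n. mass x k * ((1 - 2 * eig k / real n) ^ i * cos (2 * pi * real k * real d / real n)))"
  \<comment> \<open>Since \<open>eig k \<le> 2\<close>, the assumption \<open>4 \<le> n\<close>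
    keeps these multipliers nonnegative; this gives the sign of \<open>r\<close> at
    \<open>d = 0\<close>.\<close>
  have ev: "0 \<le> 1 - 2 * eig k / real n" "1 - 2 * eig k / real n \<le> 1" for k
    using eig_bounds[of k] n4 by (auto simp: field_simps)
  have r_rec: "r (Suc i) d = (1 - 2 / real n) * r i d + (1 - \<theta>) / real n * (r i (nx d) + r i (pv d))" if d: "d < n" for i d
  proof -
    have "mass x k * ((1 - 2 * eig k / real n) ^ Suc i * cos (2 * pi * real k * real d / real n))
      = (1 - 2 / real n) * (mass x k * ((1 - 2 * eig k / real n) ^ i * cos (2 * pi * real k * real d / real n)))
      + (1 - \<theta>) / real n * (mass x k * ((1 - 2 * eig k / real n) ^ i * cos (2 * pi * real k * real (nx d) / real n))
         + mass x k * ((1 - 2 * eig k / real n) ^ i * cos (2 * pi * real k * real (pv d) / real n)))" for k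
    proof -
      let ?C = "cos (2 * pi * real k * real d / real n)" and ?e = "mass x k * (1 - 2 * eig k / real n) ^ i"
      have "cos (2 * pi * real k * real (nx d) / real n) + cos (2 * pi * real k * real (pv d) / real n)
          = 2 * cos (2 * pi * real k / real n) * ?C"
        unfolding trig_nx(1)[OF d] trig_pv(1)[OF d] by (rule cos_product)
      moreover have "?e * ((1 - 2 * eig k / real n) * ?C) = ?e * ((1 - 2 / real n) * ?C + (1 - \<theta>) / real n * (2 * cos (2 * pi * real k / real n) * ?C))"
        using n3 by (simp add: eig_def field_simps)
      ultimately have "?e * ((1 - 2 * eig k / real n) * ?C) = ?e * ((1 - 2 / real n) * ?C
          + (1 - \<theta>) / real n * (cos (2 * pi * real k * real (nx d) / real n) + cos (2 * pi * real k * real (pv d) / real n)))"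
        by (simp only:)
      thus ?thesis by (simp add: algebra_simps)
    qed
    thus ?thesis unfolding r_def by (simp only: sum_distrib_left sum.distrib distrib_left)
  qed
  have r00: "0 \<le> r i 0" for i unfolding r_def
    using ev mass_nonneg by (intro sum_nonneg mult_nonneg_nonneg) auto
  have r0: "r 0 d = pairf d x" if "d < n" for d
    using mass_pairf[OF x that] by (simp add: r_def)
  have key: "c * \<zeta> ^ i * s d \<le> pair_stat d - (step ^^ i) (pairf d) x + r i d" if "d < n" for i d
    using that
  proof (induction i arbitrary: d)
    case 0
    have "c * s d \<le> pair_stat d"
    proof (cases "d < M")
      case True
      have "c * s d \<le> (1 - 1 / real q) * ((1 - \<theta>) / 2) ^ d * 1"
      proof (intro mult_mono)
        show "c \<le> (1 - 1 / real q) * ((1 - \<theta>) / 2) ^ d"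
          unfolding c_def using q2 \<theta>_le_1 \<theta>_pos True by (intro mult_left_mono power_decreasing) auto
      qed (use True s0[of d] q2 \<theta>_le_1 in \<open>auto simp: s_def\<close>)
      thus ?thesis using pair_stat_ge[OF 0] by linarith
    next
      case False
      have "0 \<le> (1 - 1 / real q) * ((1 - \<theta>) / 2) ^ d" using q2 \<theta>_le_1 by simp
      thus ?thesis using pair_stat_ge[OF 0] False by (simp add: s_def)
    qed
    thus ?case using r0[OF 0] by simp
  next
    case (Suc i)
    show ?case
    proof (cases "d = 0")
      case True
      have "(step ^^ Suc i) (pairf 0) x = 1 - 1 / real q" by (rule step_pow_pairf_0)
      thus ?thesis using True r00[of "Suc i"] pair_stat_0 by (simp add: s_def)
    next
      case False
      hence d: "0 < d" "d < n" using Suc.prems by auto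
      define z where "z = c * \<zeta> ^ i"
      have z0: "0 \<le> z" using c0 \<zeta> by (simp add: z_def)
      have sub: "\<zeta> * s d \<le> (1 - 2 / real n) * s d + (1 - \<theta>) / real n * (s (nx d) + s (pv d))"
      proof (cases "d < M")
        case True
        have "nx d = Suc d" "pv d = d - 1" using True M d by (auto simp: nx_def pv_def)
        moreover have "sin (pi * real (Suc d) / real M) \<le> s (Suc d)"
          using True by (cases "Suc d = M") (auto simp: s_def)
        ultimately have "sin (pi * real (Suc d) / real M) + sin (pi * real (d - 1) / real M) \<le> s (nx d) + s (pv d)"
          using True by (auto simp: s_def)
        moreover have "pi * real (Suc d) / real M = pi * real d / real M + pi / real M"
          "pi * real (d - 1) / real M = pi * real d / real M - pi / real M"
          using d by (auto simp: of_nat_diff add_divide_distrib diff_divide_distrib algebra_simps)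
        ultimately have "2 * cos (pi / real M) * s d \<le> s (nx d) + s (pv d)"
          using True by (simp add: sin_add sin_diff s_def mult_ac)
        hence "(1 - \<theta>) / real n * (2 * cos (pi / real M) * s d) \<le> (1 - \<theta>) / real n * (s (nx d) + s (pv d))"
          using \<theta>_le_1 by (intro mult_left_mono) auto
        moreover have "\<zeta> * s d = (1 - 2 / real n) * s d + (1 - \<theta>) / real n * (2 * cos (pi / real M) * s d)"
          using n3 by (simp add: \<zeta>_def \<omega>_def field_simps)
        ultimately show ?thesis by linarith
      next
        case False
        thus ?thesis using s0[of "nx d"] s0[of "pv d"] \<theta>_le_1 by (simp add: s_def)
      qed
      have "c * \<zeta> ^ Suc i * s d = z * (\<zeta> * s d)" by (simp add: z_def)
      also have "\<dots> \<le> z * ((1 - 2 / real n) * s d + (1 - \<theta>) / real n * (s (nx d) + s (pv d)))"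
        by (rule mult_left_mono[OF sub z0])
      also have "\<dots> = (1 - 2 / real n) * (z * s d) + (1 - \<theta>) / real n * (z * s (nx d) + z * s (pv d))"
        by (simp add: algebra_simps)
      also have "\<dots> \<le> (1 - 2 / real n) * (pair_stat d - (step ^^ i) (pairf d) x + r i d)
         + (1 - \<theta>) / real n * ((pair_stat (nx d) - (step ^^ i) (pairf (nx d)) x + r i (nx d))
            + (pair_stat (pv d) - (step ^^ i) (pairf (pv d)) x + r i (pv d)))"
        unfolding z_def using Suc.IH d n3 \<theta>_le_1 by (intro add_mono mult_left_mono) auto
      also have "\<dots> = pair_stat d - (step ^^ Suc i) (pairf d) x + r (Suc i) d"
        unfolding step_pow_pairf_Suc[OF x d] r_rec[OF d(2)] using pair_stat_rec[OF d] by (simp only: distrib_left right_diff_distrib)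
      finally show ?thesis .
    qed
  qed
  let ?p = "pois (real n * t)"
  have bS: "\<bar>(step ^^ i) (pairf 1) x\<bar> \<le> 1" for i by (rule step_pow_abs_le[OF pairf_bound])
  have br': "\<bar>mass x k * ((1 - 2 * eig k / real n) ^ i * a)\<bar> \<le> mass x k" if "\<bar>a\<bar> \<le> 1" for a i k
  proof -
    have "\<bar>1 - 2 * eig k / real n\<bar> ^ i * \<bar>a\<bar> \<le> 1 * 1" using ev[of k] that by (intro mult_mono power_le_one) auto
    thus ?thesis using mass_nonneg[of x k] by (simp add: abs_mult power_abs mult_left_le)
  qed
  have br: "\<bar>r i d\<bar> \<le> (\<Sum>k<n. mass x k)" for i d
    unfolding r_def by (intro order.trans[OF sum_abs] sum_mono br') simp
  have pr: "?p (\<lambda>i. r i 1) = (\<Sum>k<n. mass x k * exp (- 2 * t * eig k) * cos (2 * pi * real k * real 1 / real n))"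
  proof -
    have "?p (\<lambda>i. r i 1) = (\<Sum>k<n. ?p (\<lambda>i. mass x k * ((1 - 2 * eig k / real n) ^ i * cos (2 * pi * real k * real 1 / real n))))"
      unfolding r_def by (rule pois_sum[where B = "mass x"]) (auto intro!: br')
    also have "\<dots> = (\<Sum>k<n. mass x k * exp (- 2 * t * eig k) * cos (2 * pi * real k * real 1 / real n))"
    proof (intro sum.cong refl)
      fix k
      have "?p (\<lambda>i. (mass x k * cos (2 * pi * real k * real 1 / real n)) * (1 - 2 * eig k / real n) ^ i)
         = (mass x k * cos (2 * pi * real k * real 1 / real n)) * ?p (\<lambda>i. (1 - 2 * eig k / real n) ^ i)"
        by (rule pois_cmult[of _ 1]) (use ev[of k] in \<open>simp add: power_abs power_le_one\<close>)
      moreover have "?p (\<lambda>i. (1 - 2 * eig k / real n) ^ i) = exp (- 2 * t * eig k)"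
        unfolding pois_geometric using n3 by simp
      ultimately show "?p (\<lambda>i. mass x k * ((1 - 2 * eig k / real n) ^ i * cos (2 * pi * real k * real 1 / real n)))
         = mass x k * exp (- 2 * t * eig k) * cos (2 * pi * real k * real 1 / real n)"
        by (simp add: mult_ac)
    qed
    finally show ?thesis .
  qed
  have "?p (\<lambda>i. r i 1) \<le> autocorr2 G q \<theta> x t"
    unfolding pr autocorr2_mass[OF x]
    by (intro sum_mono) (use mass_nonneg in \<open>auto intro!: mult_left_le mult_nonneg_nonneg\<close>)
  moreover have "c * s 1 * exp (- 2 * t * \<omega>) \<le> pair_stat 1 - expect (law x t) (pairf 1) + ?p (\<lambda>i. r i 1)"
  proof -
    have "c * s 1 * exp (- 2 * t * \<omega>) = c * s 1 * ?p (\<lambda>i. \<zeta> ^ i)"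
      unfolding pois_geometric \<zeta>_def using n3 by (simp add: mult_ac)
    also have "\<dots> = ?p (\<lambda>i. c * s 1 * \<zeta> ^ i)"
      by (rule pois_cmult[symmetric, of _ 1]) (use \<zeta> in \<open>simp add: power_abs power_le_one\<close>)
    also have "\<dots> \<le> ?p (\<lambda>i. pair_stat 1 - (step ^^ i) (pairf 1) x + r i 1)"
    proof (rule pois_mono)
      show "c * s 1 * \<zeta> ^ i \<le> pair_stat 1 - (step ^^ i) (pairf 1) x + r i 1" for i
        using key[of 1 i] n3 by (simp add: mult_ac)
      show "\<bar>c * s 1 * \<zeta> ^ i\<bar> \<le> c * s 1" for i
        using c0 s0[of 1] \<zeta> by (simp add: abs_mult power_abs mult_left_le power_le_one)
      show "\<bar>pair_stat 1 - (step ^^ i) (pairf 1) x + r i 1\<bar> \<le> \<bar>pair_stat 1\<bar> + 1 + (\<Sum>k<n. mass x k)" for i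
        using bS[of i] br[of i 1] by linarith
    qed (use t in simp)
    also have "\<dots> = ?p (\<lambda>i. pair_stat 1 - (step ^^ i) (pairf 1) x) + ?p (\<lambda>i. r i 1)"
    proof (rule pois_add[OF _ br])
      show "\<bar>pair_stat 1 - (step ^^ i) (pairf 1) x\<bar> \<le> \<bar>pair_stat 1\<bar> + 1" for i
        using bS[of i] by linarith
    qed
    also have "?p (\<lambda>i. pair_stat 1 - (step ^^ i) (pairf 1) x) = pair_stat 1 - expect (law x t) (pairf 1)"
      unfolding expect_law[OF x pairf_bound] by (subst pois_diff[OF _ bS, of _ "\<bar>pair_stat 1\<bar>"]) auto
    finally show ?thesis .
  qed
  moreover have "s 1 = sin (pi / real M)" using M by (simp add: s_def)
  ultimately show ?thesis by (simp add: c_def \<omega>_def)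
qed

text \<open>Each indicator involves two neighbouring sites, so a covariance is bounded by four
  kernel values. The variance is then at most \<open>32 * n / \<theta>\<close>, and the 8 of
  \<open>chebyshev_tv\<close> makes 256.\<close>

lemma tv_pair:
  assumes x: "x \<in> \<Omega>" and t: "0 \<le> t" and \<epsilon>: "\<epsilon> = pair_stat 1 - expect (law x t) (pairf 1)" "\<epsilon> \<noteq> 0"
  shows "1 - 256 / (\<theta> * (real n * \<epsilon>\<^sup>2)) \<le> tv_dist \<Omega> (law x t) stat"
proof -
  define f :: "nat \<Rightarrow> (nat \<Rightarrow> nat) \<Rightarrow> real" where "f = (\<lambda>v y. of_bool (y v = y (nx v)))"
  have dep_f: "dep {v, nx v} (f v)" for v by (rule depI) (simp add: f_def)
  let ?\<Phi> = "\<lambda>y. \<Sum>v<n. f v y"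
  have V: "cov p ?\<Phi> ?\<Phi> \<le> 32 * real n / \<theta>" if p: "decorrelated p" for p
  proof -
    have "cov p ?\<Phi> ?\<Phi> \<le> (\<Sum>v<n. \<Sum>w<n. 2 * (ker v w + ker v (nx w) + (ker (nx v) w + ker (nx v) (nx w))))"
      unfolding cov_sum
    proof (intro sum_mono)
      fix v w assume vw: "v \<in> {..<n}" "w \<in> {..<n}"
      have "cov p (f v) (f w) \<le> 1 * (1 * (2 * Ker {v, nx v} {w, nx w}))"
        using decorrelatedD[OF p _ dep_f _ _ dep_f, of v 1 w 1] vw
        by (auto simp: f_def abs_le_iff)
      also have "Ker {v, nx v} {w, nx w} = ker v w + ker v (nx w) + (ker (nx v) w + ker (nx v) (nx w))"
      proof -
        have "v \<noteq> nx v" "w \<noteq> nx w" using vw nx_neq by (metis lessThan_iff)+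
        thus ?thesis by (simp add: Ker_def)
      qed
      finally show "cov p (f v) (f w) \<le> 2 * (ker v w + ker v (nx w) + (ker (nx v) w + ker (nx v) (nx w)))" by simp
    qed
    also have "\<dots> = 2 * (\<Sum>v<n. (\<Sum>w<n. ker v w) + (\<Sum>w<n. ker v (nx w)) + ((\<Sum>w<n. ker (nx v) w) + (\<Sum>w<n. ker (nx v) (nx w))))"
      by (simp add: sum.distrib sum_distrib_left)
    also have "\<dots> = 2 * (\<Sum>v<n. (\<Sum>w<n. ker v w) + (\<Sum>w<n. ker v w) + ((\<Sum>w<n. ker (nx v) w) + (\<Sum>w<n. ker (nx v) w)))"
      by (simp only: sum_nx)
    also have "\<dots> \<le> 2 * (\<Sum>v<n. 4 / \<theta> + 4 / \<theta> + (4 / \<theta> + 4 / \<theta>))"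
      by (intro mult_left_mono sum_mono add_mono sum_ker) auto
    finally show ?thesis by simp
  qed
  have mod1: "(v + 1) mod n = nx v" if "v < n" for v using that by (auto simp: nx_def)
  have "?\<Phi> = (\<lambda>y. real n * pairf 1 y + real n / real q)"
    using n3 by (rule_tac ext) (simp add: pairf_def f_def mod1[simplified] field_simps)
  hence E: "expect p ?\<Phi> = real n * expect p (pairf 1) + real n / real q" if "weights p" for p
    by (simp only: lin_add[OF lin_expect] lin_cmult[OF lin_expect] expect_const_weights[OF that])
  have D: "- (real n * \<epsilon>) = expect (law x t) ?\<Phi> - expect stat ?\<Phi>"
    unfolding E[OF weights_law[OF x t]] E[OF weights_stat] \<epsilon>(1) pair_stat_def by (simp add: algebra_simps)
  have "1 - 8 * (32 * real n / \<theta>) / (- (real n * \<epsilon>))\<^sup>2 \<le> tv_dist \<Omega> (law x t) stat"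
    by (rule chebyshev_tv[OF weights_law[OF x t] weights_stat V V D])
       (use \<epsilon> n3 decorrelated_law[OF x t] decorrelated_stat in auto)
  also have "8 * (32 * real n / \<theta>) / (- (real n * \<epsilon>))\<^sup>2 = 256 / (\<theta> * (real n * \<epsilon>\<^sup>2))"
    using n3 \<theta>_pos \<epsilon>(2) by (simp add: power_mult_distrib power2_eq_square field_simps)
  finally show ?thesis .
qed

end

text \<open>The recursion makes \<open>kconst a \<theta> \<gamma> (card S) * (1 - \<gamma> / n) ^ i\<close> a supersolution of the dual recursion.\<close>

fun kconst :: "real \<Rightarrow> real \<Rightarrow> real \<Rightarrow> nat \<Rightarrow> real" where
  "kconst a \<theta> \<gamma> 0 = 0"
| "kconst a \<theta> \<gamma> (Suc 0) = a"
| "kconst a \<theta> \<gamma> (Suc (Suc k)) = kconst a \<theta> \<gamma> (Suc k) * (real (k + 2) * \<theta> / (real (k + 2) * \<theta> - \<gamma>))"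

lemma kconst_mono:
  assumes "0 \<le> a" "0 < \<theta>" "0 \<le> \<gamma>" "\<gamma> < 2 * \<theta>"
  shows "mono (kconst a \<theta> \<gamma>)" "0 \<le> kconst a \<theta> \<gamma> k"
proof -
  have fac: "1 \<le> real (k + 2) * \<theta> / (real (k + 2) * \<theta> - \<gamma>)" for k
  proof -
    have "2 * \<theta> \<le> real (k + 2) * \<theta>" using assms by (intro mult_right_mono) auto
    hence d: "0 < real (k + 2) * \<theta> - \<gamma>" using assms by linarith
    show ?thesis unfolding le_divide_eq_1_pos[OF d] using assms by simp
  qed
  have nn: "0 \<le> kconst a \<theta> \<gamma> k" for k
  proof (induction k)
    case (Suc k)
    show ?case
    proof (cases k)
      case (Suc l)
      have "0 \<le> kconst a \<theta> \<gamma> k * (real (l + 2) * \<theta> / (real (l + 2) * \<theta> - \<gamma>))"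
        by (intro mult_nonneg_nonneg Suc.IH order.trans[OF zero_le_one fac])
      thus ?thesis by (simp only: Suc kconst.simps)
    qed (use assms in simp)
  qed simp
  thus "0 \<le> kconst a \<theta> \<gamma> k" .
  show "mono (kconst a \<theta> \<gamma>)"
  proof (subst mono_iff_le_Suc, rule allI)
    fix k show "kconst a \<theta> \<gamma> k \<le> kconst a \<theta> \<gamma> (Suc k)"
    proof (cases k)
      case (Suc l)
      thus ?thesis using mult_left_mono[OF fac[of l] nn[of "Suc l"]] by simp
    qed (use assms in simp)
  qed
qed

text \<open>Cauchy-Schwarz for the density of \<open>a\<close> with respect to \<open>b\<close>,
  whose second moment is 1 plus the chi-square distance. Unlike a bound on differences, this form
  composes over independent pieces.\<close>

lemma cauchy_schwarz_density:
  fixes a b f :: "'a \<Rightarrow> real"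
  assumes fin: "finite P" and b: "\<And>x. x \<in> P \<Longrightarrow> 0 < b x" and a1: "sum a P = 1" and b1: "sum b P = 1"
    and h: "(\<Sum>x\<in>P. (a x - b x)\<^sup>2 / b x) \<le> h"
  shows "(\<Sum>x\<in>P. a x * f x)\<^sup>2 \<le> (1 + h) * (\<Sum>x\<in>P. b x * (f x)\<^sup>2)"
proof -
  have "(\<Sum>x\<in>P. a x * f x) = (\<Sum>x\<in>P. (a x / sqrt (b x)) * (sqrt (b x) * f x))"
    using b by (intro sum.cong refl) (auto simp: less_imp_neq[symmetric])
  also have "\<dots>\<^sup>2 \<le> (\<Sum>x\<in>P. (a x / sqrt (b x))\<^sup>2) * (\<Sum>x\<in>P. (sqrt (b x) * f x)\<^sup>2)"
    by (rule Cauchy_Schwarz_ineq_sum)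
  also have "(\<Sum>x\<in>P. (a x / sqrt (b x))\<^sup>2) = (\<Sum>x\<in>P. (a x - b x)\<^sup>2 / b x + (2 * a x - b x))"
  proof (intro sum.cong refl)
    fix x assume "x \<in> P"
    hence "0 < b x" by (rule b)
    thus "(a x / sqrt (b x))\<^sup>2 = (a x - b x)\<^sup>2 / b x + (2 * a x - b x)"
      by (simp add: power_divide) (simp add: power2_eq_square field_simps)
  qed
  also have "\<dots> = (\<Sum>x\<in>P. (a x - b x)\<^sup>2 / b x) + 1"
    using a1 b1 by (simp add: sum.distrib sum_subtractf sum_distrib_left[symmetric])
  also have "(\<Sum>x\<in>P. (sqrt (b x) * f x)\<^sup>2) = (\<Sum>x\<in>P. b x * (f x)\<^sup>2)"
    using b by (intro sum.cong refl) (auto simp: power_mult_distrib less_imp_le)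
  also have "((\<Sum>x\<in>P. (a x - b x)\<^sup>2 / b x) + 1) * (\<Sum>x\<in>P. b x * (f x)\<^sup>2) \<le> (1 + h) * (\<Sum>x\<in>P. b x * (f x)\<^sup>2)"
    using h b by (intro mult_right_mono sum_nonneg) (auto simp: less_imp_le)
  finally show ?thesis .
qed

section \<open>Patterns on finite sets: chi-square comparison and decoupling\<close>

context voter_cycle
begin

definition pat :: "nat set \<Rightarrow> (nat \<Rightarrow> nat) \<Rightarrow> (nat \<Rightarrow> nat) \<Rightarrow> real" where
  "pat C \<pi> x = of_bool (\<forall>v\<in>C. x v = \<pi> v)"

lemma dep_pat: "dep C (pat C \<pi>)" by (rule depI) (simp add: pat_def)

lemma pat_bound: "\<bar>pat C \<pi> x\<bar> \<le> 1" by (simp add: pat_def)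

lemma finite_patterns: "finite C \<Longrightarrow> finite (C \<rightarrow>\<^sub>E {..<q})"
  by (intro finite_PiE) auto

lemma card_patterns: "finite C \<Longrightarrow> card (C \<rightarrow>\<^sub>E {..<q}) = q ^ card C"
  by (simp add: card_PiE)

lemma pattern_expansion:
  assumes C: "C \<subseteq> {..<n}" and x: "x \<in> \<Omega>"
  shows "F x = (\<Sum>\<pi>\<in>C \<rightarrow>\<^sub>E {..<q}. pat C \<pi> x * F (\<lambda>v. if v \<in> C then \<pi> v else x v))"
proof -
  have fin: "finite C" using C by (rule finite_subset) simp
  let ?r = "restrict x C"
  have r: "?r \<in> C \<rightarrow>\<^sub>E {..<q}" using C configs_less[OF x] by auto
  have "pat C \<pi> x * F (\<lambda>v. if v \<in> C then \<pi> v else x v) = (if \<pi> = ?r then F x else 0)" if \<pi>: "\<pi> \<in> C \<rightarrow>\<^sub>E {..<q}" for \<pi>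
  proof (cases "\<pi> = ?r")
    case True
    hence "(\<lambda>v. if v \<in> C then \<pi> v else x v) = x" by auto
    thus ?thesis using True by (simp add: pat_def)
  next
    case False
    have "\<not> (\<forall>v\<in>C. x v = \<pi> v)"
    proof
      assume "\<forall>v\<in>C. x v = \<pi> v"
      hence "\<pi> = ?r" using PiE_ext[OF \<pi> r] by auto
      thus False using False by contradiction
    qed
    thus ?thesis using False by (simp add: pat_def)
  qed
  hence "(\<Sum>\<pi>\<in>C \<rightarrow>\<^sub>E {..<q}. pat C \<pi> x * F (\<lambda>v. if v \<in> C then \<pi> v else x v)) = (\<Sum>\<pi>\<in>C \<rightarrow>\<^sub>E {..<q}. if \<pi> = ?r then F x else 0)"
    by (intro sum.cong) auto
  thus ?thesis using r finite_patterns[OF fin] by simp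
qed

lemma expect_pattern:
  assumes C: "C \<subseteq> {..<n}" and f: "dep C f"
  shows "expect p f = (\<Sum>\<pi>\<in>C \<rightarrow>\<^sub>E {..<q}. expect p (pat C \<pi>) * f \<pi>)"
proof -
  have fin: "finite C" using C by (rule finite_subset) simp
  have "expect p f = expect p (\<lambda>x. \<Sum>\<pi>\<in>C \<rightarrow>\<^sub>E {..<q}. f \<pi> * pat C \<pi> x)"
  proof (rule expect_cong)
    fix x assume x: "x \<in> \<Omega>"
    have "f (\<lambda>v. if v \<in> C then \<pi> v else x v) = f \<pi>" for \<pi> by (rule depD[OF f]) simp
    thus "f x = (\<Sum>\<pi>\<in>C \<rightarrow>\<^sub>E {..<q}. f \<pi> * pat C \<pi> x)"
      using pattern_expansion[OF C x, of f] by (simp add: mult.commute)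
  qed
  also have "\<dots> = (\<Sum>\<pi>\<in>C \<rightarrow>\<^sub>E {..<q}. f \<pi> * expect p (pat C \<pi>))"
    by (rule lin_sum[OF lin_expect finite_patterns[OF fin]])
  finally show ?thesis by (simp add: mult.commute)
qed

text \<open>In the invariance equation for the pattern, keep only the noise updates that set some
  \<open>u\<close> in \<open>C\<close> to its prescribed colour. This supplies the denominators of
  the chi-square distance.\<close>

lemma stat_pattern_ge:
  assumes "C \<subseteq> {..<n}" "\<And>v. v \<in> C \<Longrightarrow> \<pi> v < q"
  shows "(\<theta> / real q) ^ card C \<le> expect stat (pat C \<pi>)"
  using assms
proof (induction "card C" arbitrary: C)
  case 0
  have "finite C" using 0 by (auto intro: finite_subset)
  hence "C = {}" using 0 by simp
  thus ?case using expect_const_weights[OF weights_stat, of 1] by (simp add: pat_def)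
next
  case (Suc k)
  have fin: "finite C" using Suc.prems by (auto intro: finite_subset)
  have k: "card C = Suc k" using Suc.hyps by simp
  let ?c = "(\<theta> / real q) ^ k"
  have step: "(1 - real (Suc k) / real n) * pat C \<pi> x + (\<Sum>u\<in>C. (\<theta> / (real q * real n)) * pat (C - {u}) \<pi> x) \<le> step (pat C \<pi>) x" for x
  proof -
    have "\<theta> / real q * pat (C - {u}) \<pi> x \<le> upd u (pat C \<pi>) x" if u: "u \<in> C" for u
    proof -
      have "pat (C - {u}) \<pi> x = pat C \<pi> (x(u := \<pi> u))" by (auto simp: pat_def)
      also have "\<dots> \<le> (\<Sum>j<q. pat C \<pi> (x(u := j)))"
        by (rule member_le_sum) (use Suc.prems u in \<open>auto simp: pat_def\<close>)
      finally have "\<theta> * (pat (C - {u}) \<pi> x / real q) \<le> \<theta> * ((\<Sum>j<q. pat C \<pi> (x(u := j))) / real q)"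
        using \<theta>_pos by (intro mult_left_mono divide_right_mono) auto
      moreover have "0 \<le> (1 - \<theta>) * ((pat C \<pi> (x(u := x (nx u))) + pat C \<pi> (x(u := x (pv u)))) / 2)"
        using \<theta>_le_1 by (simp add: pat_def)
      ultimately show ?thesis by (simp add: upd_def)
    qed
    hence "(\<Sum>u\<in>C. \<theta> / real q * pat (C - {u}) \<pi> x) / real n \<le> (\<Sum>u\<in>C. upd u (pat C \<pi>) x) / real n"
      by (intro divide_right_mono sum_mono) auto
    thus ?thesis unfolding step_dep[OF dep_pat Suc.prems(1)] k by (simp add: sum_divide_distrib)
  qed
  have "(1 - real (Suc k) / real n) * expect stat (pat C \<pi>) + (\<Sum>u\<in>C. (\<theta> / (real q * real n)) * expect stat (pat (C - {u}) \<pi>))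
      = expect stat (\<lambda>x. (1 - real (Suc k) / real n) * pat C \<pi> x + (\<Sum>u\<in>C. (\<theta> / (real q * real n)) * pat (C - {u}) \<pi> x))"
    by (simp only: lin_add[OF lin_expect] lin_cmult[OF lin_expect] lin_sum[OF lin_expect fin])
  also have "\<dots> \<le> expect stat (step (pat C \<pi>))" by (intro expect_mono weights_stat step)
  also have "\<dots> = expect stat (pat C \<pi>)" by (rule expect_stat_step)
  finally have "(\<Sum>u\<in>C. (\<theta> / (real q * real n)) * expect stat (pat (C - {u}) \<pi>)) \<le> real (Suc k) / real n * expect stat (pat C \<pi>)"
    by (simp add: left_diff_distrib)
  moreover have "(\<Sum>u\<in>C. (\<theta> / (real q * real n)) * ?c) \<le> (\<Sum>u\<in>C. (\<theta> / (real q * real n)) * expect stat (pat (C - {u}) \<pi>))"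
  proof (intro sum_mono mult_left_mono)
    fix u assume "u \<in> C"
    thus "?c \<le> expect stat (pat (C - {u}) \<pi>)"
      using Suc.hyps(1)[of "C - {u}"] k Suc.prems by auto
  qed (use \<theta>_pos in simp)
  moreover have "(\<Sum>u\<in>C. (\<theta> / (real q * real n)) * ?c) = real (Suc k) / real n * (\<theta> / real q) ^ Suc k"
    by (simp add: k)
  ultimately have "real (Suc k) / real n * (\<theta> / real q) ^ Suc k \<le> real (Suc k) / real n * expect stat (pat C \<pi>)" by linarith
  moreover have "0 < real (Suc k) / real n" using n3 by simp
  ultimately have "(\<theta> / real q) ^ Suc k \<le> expect stat (pat C \<pi>)" by (rule mult_left_le_imp_le)
  thus ?case by (simp only: k)
qed

text \<open>There are at most \<open>q ^ k\<close> patterns, each differs by at most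
  \<open>\<eta>\<close> between the two laws, and each has stationary weight at least
  \<open>(\<theta> / q) ^ k\<close>.\<close>

lemma chi_bound:
  assumes C: "C \<subseteq> {..<n}" "card C \<le> k" and p: "weights p"
    and close: "\<And>f. \<lbrakk>dep C f; \<And>x. \<bar>f x\<bar> \<le> 1\<rbrakk> \<Longrightarrow> \<bar>expect p f - expect stat f\<bar> \<le> \<eta>"
    and f: "dep C f"
  shows "(expect p f)\<^sup>2 \<le> (1 + real q ^ k * (\<eta>\<^sup>2 / (\<theta> / real q) ^ k)) * expect stat (\<lambda>x. (f x)\<^sup>2)"
proof -
  have fin: "finite C" using C by (auto intro: finite_subset)
  let ?P = "C \<rightarrow>\<^sub>E {..<q}"
  have f2: "dep C (\<lambda>x. (f x)\<^sup>2)" using dep_mult[OF f f] by (simp add: power2_eq_square)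
  have tq: "0 < \<theta> / real q" "\<theta> / real q \<le> 1" using \<theta>_pos \<theta>_le_1 q2 by (auto simp: field_simps)
  have c0: "(\<theta> / real q) ^ k \<le> expect stat (pat C \<pi>)" if "\<pi> \<in> ?P" for \<pi>
    using power_decreasing[OF C(2), of "\<theta> / real q"] tq stat_pattern_ge[OF C(1), of \<pi>] that by fastforce
  have cpos: "0 < (\<theta> / real q) ^ k" using tq by simp
  show ?thesis
    unfolding expect_pattern[OF C(1) f] expect_pattern[OF C(1) f2]
  proof (rule cauchy_schwarz_density[OF finite_patterns[OF fin]])
    show "0 < expect stat (pat C \<pi>)" if "\<pi> \<in> ?P" for \<pi> using c0[OF that] cpos by linarith
    show "(\<Sum>\<pi>\<in>?P. expect p (pat C \<pi>)) = 1" "(\<Sum>\<pi>\<in>?P. expect stat (pat C \<pi>)) = 1"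
      using expect_pattern[OF C(1) dep_const, of p 1] expect_pattern[OF C(1) dep_const, of stat 1]
        expect_const_weights[OF p] expect_const_weights[OF weights_stat] by simp_all
    have "(\<Sum>\<pi>\<in>?P. (expect p (pat C \<pi>) - expect stat (pat C \<pi>))\<^sup>2 / expect stat (pat C \<pi>))
        \<le> (\<Sum>\<pi>\<in>?P. \<eta>\<^sup>2 / (\<theta> / real q) ^ k)"
    proof (intro sum_mono frac_le)
      fix \<pi> assume "\<pi> \<in> ?P"
      thus "(\<theta> / real q) ^ k \<le> expect stat (pat C \<pi>)" by (rule c0)
      have "\<bar>expect p (pat C \<pi>) - expect stat (pat C \<pi>)\<bar> \<le> \<eta>" by (rule close[OF dep_pat pat_bound])
      from power_mono[OF this, of 2] show "(expect p (pat C \<pi>) - expect stat (pat C \<pi>))\<^sup>2 \<le> \<eta>\<^sup>2" by simp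
    qed (use cpos in auto)
    also have "\<dots> = real q ^ card C * (\<eta>\<^sup>2 / (\<theta> / real q) ^ k)" by (simp add: card_patterns[OF fin])
    also have "\<dots> \<le> real q ^ k * (\<eta>\<^sup>2 / (\<theta> / real q) ^ k)"
      using cpos C(2) q2 by (intro mult_right_mono power_increasing) auto
    finally show "(\<Sum>\<pi>\<in>?P. (expect p (pat C \<pi>) - expect stat (pat C \<pi>))\<^sup>2 / expect stat (pat C \<pi>)) \<le> real q ^ k * (\<eta>\<^sup>2 / (\<theta> / real q) ^ k)" .
  qed
qed

text \<open>Expanding \<open>F\<close> over the patterns on \<open>C\<close> writes the difference
  as a sum of \<open>q ^ card C\<close> covariances between the two blocks.\<close>

lemma decouple:
  assumes p: "decorrelated p" and C: "C \<subseteq> {..<n}" and B: "B \<subseteq> {..<n}" "C \<inter> B = {}"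
    and F: "dep (C \<union> B) F" "\<And>x. \<bar>F x\<bar> \<le> 1"
  shows "\<bar>expect p F - expect p (\<lambda>x. expect p (\<lambda>y. F (\<lambda>v. if v \<in> C then x v else y v)))\<bar> \<le> real q ^ card C * (2 * Ker C B)"
proof -
  have fin: "finite C" using C by (rule finite_subset) simp
  let ?P = "C \<rightarrow>\<^sub>E {..<q}"
  let ?G = "\<lambda>\<pi> y. F (\<lambda>v. if v \<in> C then \<pi> v else y v)"
  have Gdep: "dep B (?G \<pi>)" for \<pi>
    by (rule depI, rule depD[OF F(1)]) auto
  have "expect p F = expect p (\<lambda>x. \<Sum>\<pi>\<in>?P. 1 * (pat C \<pi> x * ?G \<pi> x))"
    by (rule expect_cong) (simp add: pattern_expansion[OF C, of _ F, symmetric])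
  hence 1: "expect p F = (\<Sum>\<pi>\<in>?P. expect p (\<lambda>x. pat C \<pi> x * ?G \<pi> x))"
    by (simp only: lin_sum[OF lin_expect finite_patterns[OF fin]]) simp
  have "dep C (\<lambda>x. expect p (?G x))"
  proof (rule depI)
    fix x y :: "nat \<Rightarrow> nat" assume "\<And>v. v \<in> C \<Longrightarrow> x v = y v"
    hence "?G x = ?G y" by (intro ext arg_cong[where f = F]) auto
    thus "expect p (?G x) = expect p (?G y)" by simp
  qed
  from expect_pattern[OF C this, of p]
  have 2: "expect p (\<lambda>x. expect p (?G x)) = (\<Sum>\<pi>\<in>?P. expect p (pat C \<pi>) * expect p (?G \<pi>))" .
  have "\<bar>expect p F - expect p (\<lambda>x. expect p (?G x))\<bar> = \<bar>\<Sum>\<pi>\<in>?P. cov p (pat C \<pi>) (?G \<pi>)\<bar>"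
    unfolding 1 2 by (simp add: cov_def sum_subtractf)
  also have "\<dots> \<le> (\<Sum>\<pi>\<in>?P. 1 * (1 * (2 * Ker C B)))"
    by (intro order.trans[OF sum_abs] sum_mono decorrelatedD[OF p C dep_pat pat_bound B(1) Gdep] F(2))
  also have "\<dots> = real q ^ card C * (2 * Ker C B)" by (simp add: card_patterns[OF fin])
  finally show ?thesis .
qed

end

context rainbow_cycle
begin

section \<open>Mixing from the rainbow configuration\<close>

definition kerr :: "nat \<Rightarrow> ((nat \<Rightarrow> nat) \<Rightarrow> real) \<Rightarrow> real" where
  "kerr i f = (step ^^ i) f rbw - expect stat f"

lemma lin_kerr: "lin (kerr i)"
  unfolding kerr_def
  by (rule linI) (simp_all add: step_pow_add step_pow_cmult lin_add[OF lin_expect] lin_cmult[OF lin_expect] algebra_simps)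

lemma kerr_Suc: "kerr (Suc i) f = kerr i (step f)"
  by (simp add: kerr_def funpow_swap1 expect_stat_step)

text \<open>Up to constants, a function of one site is a combination of the \<open>site v j\<close>,
  so it inherits the exact spectral rate of the rainbow.\<close>

lemma kerr_single:
  assumes v: "v < n" and f: "dep {v} f" "\<And>x. \<bar>f x\<bar> \<le> 1"
  shows "\<bar>kerr i f\<bar> \<le> real q * (1 - lam / real n) ^ i"
proof -
  define h where "h = (\<lambda>j. f (\<lambda>_. j))"
  have fh: "f x = (\<Sum>j<q. h j * (site v j x + 1 / real q))" if x: "x \<in> \<Omega>" for x
  proof -
    have "(\<Sum>j<q. h j * (site v j x + 1 / real q)) = (\<Sum>j<q. if j = x v then h (x v) else 0)"
      by (intro sum.cong) (auto simp: site_def)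
    also have "\<dots> = h (x v)" using configs_less[OF x v] by simp
    also have "\<dots> = f x" unfolding h_def by (rule depD[OF f(1)]) simp
    finally show ?thesis by simp
  qed
  have site1: "site v j = (\<lambda>x. site v j x + 0)" for j by simp
  have "(step ^^ i) f rbw = (step ^^ i) (\<lambda>x. \<Sum>j<q. h j * (site v j x + 1 / real q)) rbw"
    by (rule step_pow_cong_configs[OF fh rainbow_config])
  also have "\<dots> = (\<Sum>j<q. h j * ((step ^^ i) (site v j) rbw + 1 / real q))"
    by (simp only: step_pow_sum step_pow_add step_pow_const)
  finally have s: "(step ^^ i) f rbw = (\<Sum>j<q. h j * ((step ^^ i) (site v j) rbw + 1 / real q))" .
  have "expect stat f = expect stat (\<lambda>x. \<Sum>j<q. h j * (site v j x + 1 / real q))"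
    by (rule expect_cong[OF fh])
  also have "\<dots> = (\<Sum>j<q. h j * (expect stat (site v j) + 1 / real q))"
    by (simp only: lin_sum[OF lin_expect finite_lessThan] lin_add[OF lin_expect] expect_const_weights[OF weights_stat])
  also have "\<dots> = (\<Sum>j<q. h j * (1 / real q))"
    by (intro sum.cong refl) (simp add: expect_stat_site[OF v])
  finally have "kerr i f = (\<Sum>j<q. h j * (step ^^ i) (site v j) rbw)"
    unfolding kerr_def s by (simp add: sum_subtractf[symmetric] algebra_simps)
  also have "\<bar>\<dots>\<bar> \<le> (\<Sum>j<q. 1 * (1 - lam / real n) ^ i)"
  proof (intro order.trans[OF sum_abs] sum_mono)
    fix j assume "j \<in> {..<q}"
    thus "\<bar>h j * (step ^^ i) (site v j) rbw\<bar> \<le> 1 * (1 - lam / real n) ^ i"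
      unfolding abs_mult using f(2) site_rainbow_le[OF v, of j i] by (intro mult_mono) (auto simp: h_def)
  qed
  finally show ?thesis by simp
qed

text \<open>The dual recursion alone would give a single site only the rate theta, so single sites
  are taken from \<open>kerr_single\<close> instead. The empty set has no error. A larger set loses
  a vertex at total rate at least \<open>2 * \<theta> > \<gamma>\<close>, and the quotient in
  \<open>kconst\<close> is precisely what makes the resulting bound equal to the bound at the next
  step.\<close>

lemma kerr_bound:
  assumes \<gamma>: "0 \<le> \<gamma>" "\<gamma> < 2 * \<theta>" "\<gamma> \<le> lam"
  shows "bnd (kerr i) (\<lambda>S. kconst (real q) \<theta> \<gamma> (card S) * (1 - \<gamma> / real n) ^ i)"
proof (induction i)
  let ?C = "kconst (real q) \<theta> \<gamma>"
  note C = kconst_mono[of "real q" \<theta> \<gamma>, OF of_nat_0_le_iff \<theta>_pos \<gamma>(1,2)]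
  have C2: "2 \<le> ?C k" if "0 < k" for k
  proof -
    have "?C 1 \<le> ?C k" using that by (intro monoD[OF C(1)]) simp
    thus ?thesis using q3 by simp
  qed
  have D0: "kerr i f = 0" if "dep {} f" for f i
  proof -
    define c where "c = f base"
    have "f = (\<lambda>_. c)" unfolding c_def using that by (auto intro: depD)
    thus ?thesis by (simp add: kerr_def expect_const_weights[OF weights_stat])
  qed
  {
    case 0
    show ?case
    proof (rule bndI)
      fix S f assume S: "S \<subseteq> {..<n}" "dep S f" "\<And>x. \<bar>f x\<bar> \<le> 1"
      show "\<bar>kerr 0 f\<bar> \<le> ?C (card S) * (1 - \<gamma> / real n) ^ 0"
      proof (cases "S = {}")
        case True
        thus ?thesis using D0[of f 0] S(2) by simp
      next
        case False
        have "finite S" using S(1) by (rule finite_subset) simp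
        hence k: "0 < card S" using False by (simp add: card_gt_0_iff)
        have "expect stat f \<le> expect stat (\<lambda>_. 1)" "expect stat (\<lambda>_. - 1) \<le> expect stat f"
          by (intro expect_mono weights_stat; use S(3) in \<open>auto simp: abs_le_iff minus_le_iff\<close>)+
        hence "\<bar>expect stat f\<bar> \<le> 1" by (simp add: expect_const_weights[OF weights_stat] abs_le_iff)
        moreover have "kerr 0 f = f rbw - expect stat f" by (simp add: kerr_def)
        ultimately show ?thesis using C2[OF k] S(3)[of rbw] by simp
      qed
    qed
  next
    case (Suc i)
    have \<gamma>2: "\<gamma> \<le> 2" using \<gamma> \<theta>_le_1 by linarith
    have \<beta>: "0 \<le> 1 - \<gamma> / real n" using \<gamma>2 n3 by (simp add: field_simps)
    let ?\<phi> = "\<lambda>S. ?C (card S) * (1 - \<gamma> / real n) ^ i"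
    show ?case
    proof (rule bndI)
      fix S f assume S: "S \<subseteq> {..<n}" "dep S f" "\<And>x. \<bar>f x\<bar> \<le> 1"
      have fin: "finite S" using S(1) by (rule finite_subset) simp
      show "\<bar>kerr (Suc i) f\<bar> \<le> ?C (card S) * (1 - \<gamma> / real n) ^ Suc i"
      proof (cases "2 \<le> card S")
        case False
        hence "card S = 0 \<or> card S = 1" by linarith
        thus ?thesis
        proof
          assume "card S = 0"
          hence "S = {}" using fin by simp
          thus ?thesis using D0[of f "Suc i"] S(2) by simp
        next
          assume c: "card S = 1"
          then obtain v where v: "S = {v}" by (auto simp: card_1_singleton_iff)
          have "\<bar>kerr (Suc i) f\<bar> \<le> real q * (1 - lam / real n) ^ Suc i"
            by (rule kerr_single) (use S v in auto)
          also have "\<dots> \<le> real q * (1 - \<gamma> / real n) ^ Suc i"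
            using \<gamma>(3) lam_le_2 n3 by (intro mult_left_mono power_mono) (auto simp: field_simps)
          finally show ?thesis using c by simp
        qed
      next
        case True
        then obtain k where k: "card S = Suc (Suc k)" by (metis Suc_le_D numeral_2_eq_2 Suc_le_mono le_SucE)
        let ?K = "real (k + 2)"
        let ?b = "(1 - \<gamma> / real n) ^ i"
        have "\<bar>kerr (Suc i) f\<bar> \<le> hop ?\<phi> S"
          unfolding kerr_Suc by (rule bndD[OF bnd_step[OF lin_kerr Suc.IH] S])
        also have "hop ?\<phi> S \<le> (1 - ?K / real n) * (?C (card S) * ?b)
            + (\<Sum>u\<in>S. \<theta> * (?C (Suc k) * ?b) + (1 - \<theta>) * (?C (card S) * ?b)) / real n"
          unfolding hop_def
        proof (intro add_mono divide_right_mono sum_mono mult_left_mono)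
          fix u assume u: "u \<in> S"
          show "?C (card (S - {u})) * ?b \<le> ?C (Suc k) * ?b" using u fin k by simp
          have "?C (card (insert (nx u) (S - {u}))) * ?b \<le> ?C (card S) * ?b"
            "?C (card (insert (pv u) (S - {u}))) * ?b \<le> ?C (card S) * ?b"
            using \<beta> by (auto intro!: mult_right_mono monoD[OF C(1)] card_insert_Diff_le fin u)
          thus "(?C (card (insert (nx u) (S - {u}))) * ?b + ?C (card (insert (pv u) (S - {u}))) * ?b) / 2 \<le> ?C (card S) * ?b"
            by (simp only: divide_le_eq_numeral1)
        qed (use \<theta>_pos \<theta>_le_1 k in auto)
        also have "\<dots> = ?b * ((1 - ?K / real n) * ?C (card S) + ?K * (\<theta> * ?C (Suc k) + (1 - \<theta>) * ?C (card S)) / real n)"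
          using k by (simp add: algebra_simps)
        also have "(1 - ?K / real n) * ?C (card S) + ?K * (\<theta> * ?C (Suc k) + (1 - \<theta>) * ?C (card S)) / real n
            = (1 - \<gamma> / real n) * ?C (card S)"
        proof -
          have "2 * \<theta> \<le> ?K * \<theta>" using \<theta>_pos by (intro mult_right_mono) auto
          hence d: "0 < ?K * \<theta> - \<gamma>" using \<gamma>(2) by linarith
          have Ck: "?C (card S) * (?K * \<theta> - \<gamma>) = ?C (Suc k) * (?K * \<theta>)" using d by (simp add: k)
          have "?K * \<theta> * ?C (Suc k) = ?K * \<theta> * ?C (card S) - \<gamma> * ?C (card S)"
            using Ck by (simp add: algebra_simps)
          hence "?K * (\<theta> * ?C (Suc k) + (1 - \<theta>) * ?C (card S)) = ?K * ?C (card S) - \<gamma> * ?C (card S)"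
            by (simp only: distrib_left mult.assoc[symmetric]) (simp add: algebra_simps)
          thus ?thesis by (simp only:) (simp add: left_diff_distrib diff_divide_distrib)
        qed
        finally show ?thesis by (simp add: mult_ac)
      qed
    qed
  }
qed

lemma rainbow_local_mixing:
  assumes \<gamma>: "0 \<le> \<gamma>" "\<gamma> < 2 * \<theta>" "\<gamma> \<le> lam" and t: "0 \<le> t"
    and S: "S \<subseteq> {..<n}" "dep S f" "\<And>x. \<bar>f x\<bar> \<le> 1" "card S \<le> k"
  shows "\<bar>expect (law rbw t) f - expect stat f\<bar> \<le> kconst (real q) \<theta> \<gamma> k * exp (- \<gamma> * t)"
proof -
  let ?C = "kconst (real q) \<theta> \<gamma>"
  note C = kconst_mono[of "real q" \<theta> \<gamma>, OF of_nat_0_le_iff \<theta>_pos \<gamma>(1,2)]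
  have \<gamma>2: "\<gamma> \<le> 2" using \<gamma> \<theta>_le_1 by linarith
  have \<beta>: "0 \<le> 1 - \<gamma> / real n" "1 - \<gamma> / real n \<le> 1" using \<gamma>2 \<gamma>(1) n3 by (auto simp: field_simps)
  have b: "\<bar>(step ^^ i) f rbw\<bar> \<le> 1" for i by (rule step_pow_abs_le[OF S(3)])
  have "expect (law rbw t) f - expect stat f = pois (real n * t) (\<lambda>i. kerr i f)"
    unfolding expect_law[OF rainbow_config S(3)] kerr_def by (subst pois_diff[OF b, of _ "\<bar>expect stat f\<bar>"]) auto
  also have "\<bar>\<dots>\<bar> \<le> pois (real n * t) (\<lambda>i. ?C k * (1 - \<gamma> / real n) ^ i)"
  proof (rule pois_abs_le)
    fix i
    have "\<bar>kerr i f\<bar> \<le> ?C (card S) * (1 - \<gamma> / real n) ^ i" by (rule bndD[OF kerr_bound[OF \<gamma>] S(1-3)])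
    also have "\<dots> \<le> ?C k * (1 - \<gamma> / real n) ^ i"
      using S(4) \<beta> by (intro mult_right_mono monoD[OF C(1)]) auto
    finally show "\<bar>kerr i f\<bar> \<le> ?C k * (1 - \<gamma> / real n) ^ i" .
    show "?C k * (1 - \<gamma> / real n) ^ i \<le> ?C k" using C(2)[of k] \<beta> by (simp add: mult_left_le power_le_one)
  qed (use t in simp)
  also have "\<dots> = ?C k * exp (- \<gamma> * t)"
    using \<beta> n3 by (subst pois_cmult[of _ 1]) (auto simp: power_le_one pois_geometric)
  finally show ?thesis .
qed

end

section \<open>Thinning by the dual\<close>

lemma sum_UN_le:
  fixes g :: "'b \<Rightarrow> real"
  assumes "finite I" "\<And>i. i \<in> I \<Longrightarrow> finite (A i)" "\<And>x. 0 \<le> g x"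
  shows "sum g (\<Union>i\<in>I. A i) \<le> (\<Sum>i\<in>I. sum g (A i))"
  using assms(1,2)
proof (induction I rule: finite_induct)
  case (insert i I)
  have "sum g (A i \<union> (\<Union>i\<in>I. A i)) \<le> sum g (A i) + sum g (\<Union>i\<in>I. A i)"
    using insert by (subst sum_Un) (auto intro: sum_nonneg assms(3))
  thus ?case using insert by fastforce
qed simp

context voter_cycle
begin

text \<open>The entries act as labelled particles occupying distinct points of
  \<open>S\<close>.\<close>

definition tuples :: "nat \<Rightarrow> nat set \<Rightarrow> (nat \<Rightarrow> nat) set" where
  "tuples k S = {s \<in> {..<k} \<rightarrow>\<^sub>E S. inj_on s {..<k}}"

definition tuple_sum :: "nat \<Rightarrow> ((nat \<Rightarrow> nat) \<Rightarrow> real) \<Rightarrow> nat set \<Rightarrow> real" where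
  "tuple_sum k g S = (\<Sum>s\<in>tuples k S. g s)"

text \<open>One step of \<open>k\<close> labelled walkers that move independently, without
  coalescence, and are killed with probability \<open>\<theta>\<close> when selected.\<close>

definition tuple_hop :: "nat \<Rightarrow> ((nat \<Rightarrow> nat) \<Rightarrow> real) \<Rightarrow> (nat \<Rightarrow> nat) \<Rightarrow> real" where
  "tuple_hop k g s = (1 - real k / real n) * g s
     + (\<Sum>i<k. (1 - \<theta>) * ((g (s(i := nx (s i))) + g (s(i := pv (s i)))) / 2)) / real n"

lemma finite_tuples: "finite S \<Longrightarrow> finite (tuples k S)"
  unfolding tuples_def by (rule finite_subset[of _ "{..<k} \<rightarrow>\<^sub>E S"]) (auto intro: finite_PiE)

lemma tuples_Diff: "tuples k (S - {u}) = {s \<in> tuples k S. u \<notin> s ` {..<k}}"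
  by (fastforce simp: tuples_def PiE_iff)

text \<open>A tuple of the moved set either avoids both the old point and a genuinely new one, or
  exactly one of its entries is the new point \<open>w\<close>; putting \<open>u\<close> back there
  gives a tuple of \<open>S\<close>.\<close>

lemma tuples_insert_Diff:
  assumes "u \<in> S"
  shows "tuples k (insert w (S - {u})) \<subseteq> {s \<in> tuples k S. u \<notin> s ` {..<k}}
    \<union> (\<Union>i<k. (\<lambda>s. s(i := w)) ` {s \<in> tuples k S. s i = u})"
proof
  fix s assume s: "s \<in> tuples k (insert w (S - {u}))"
  show "s \<in> {s \<in> tuples k S. u \<notin> s ` {..<k}} \<union> (\<Union>i<k. (\<lambda>s. s(i := w)) ` {s \<in> tuples k S. s i = u})"
  proof (cases "\<exists>i<k. s i \<notin> S - {u}")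
    case True
    then obtain i where i: "i < k" "s i \<notin> S - {u}" by blast
    hence w: "s i = w" using s by (auto simp: tuples_def PiE_iff)
    have other: "s j \<in> S - {u}" if "j < k" "j \<noteq> i" for j
    proof -
      have "s j \<noteq> s i" using s that i(1) by (auto simp: tuples_def inj_on_def)
      moreover have "s j \<in> insert w (S - {u})" using s that by (auto simp: tuples_def)
      ultimately show ?thesis using w by auto
    qed
    have "s(i := u) \<in> tuples k S"
      unfolding tuples_def
    proof (intro CollectI conjI)
      show "s(i := u) \<in> {..<k} \<rightarrow>\<^sub>E S" using other s i assms by (auto simp: tuples_def PiE_iff extensional_def)
      show "inj_on (s(i := u)) {..<k}"
        using s other by (auto simp: tuples_def inj_on_def)
    qed
    moreover have "s = (s(i := u))(i := w)" using w by auto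
    ultimately have "s \<in> (\<lambda>s. s(i := w)) ` {s \<in> tuples k S. s i = u}" by (intro image_eqI[of _ _ "s(i := u)"]) auto
    thus ?thesis using i by blast
  next
    case False
    hence "s \<in> tuples k (S - {u})" using s by (auto simp: tuples_def PiE_iff)
    thus ?thesis by (simp add: tuples_Diff)
  qed
qed

lemma tuple_sum_insert_Diff:
  assumes S: "finite S" "u \<in> S" and g: "\<And>s. 0 \<le> g s"
  shows "tuple_sum k g (insert w (S - {u})) \<le> tuple_sum k g (S - {u})
    + (\<Sum>i<k. \<Sum>s\<in>tuples k S. if s i = u then g (s(i := w)) else 0)"
proof -
  let ?A = "{s \<in> tuples k S. u \<notin> s ` {..<k}}"
  let ?B = "\<lambda>i. (\<lambda>s. s(i := w)) ` {s \<in> tuples k S. s i = u}"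
  have fin: "finite ?A" "\<And>i. finite (?B i)" "finite (tuples k S)" using finite_tuples[OF S(1)] by auto
  have "tuple_sum k g (insert w (S - {u})) \<le> sum g (?A \<union> (\<Union>i<k. ?B i))"
    unfolding tuple_sum_def using tuples_insert_Diff[OF S(2)] fin g by (intro sum_mono2) auto
  also have "\<dots> \<le> sum g ?A + sum g (\<Union>i<k. ?B i)"
    using fin g by (simp add: sum_Un sum_nonneg)
  also have "sum g (\<Union>i<k. ?B i) \<le> (\<Sum>i<k. sum g (?B i))"
    by (rule sum_UN_le) (use fin g in auto)
  also have "\<dots> \<le> (\<Sum>i<k. \<Sum>s | s \<in> tuples k S \<and> s i = u. g (s(i := w)))"
    by (intro sum_mono order.trans[OF sum_image_le]) (use fin g in auto)
  also have "\<dots> = (\<Sum>i<k. \<Sum>s\<in>tuples k S. if s i = u then g (s(i := w)) else 0)"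
    by (simp only: sum.inter_filter[OF fin(3)])
  finally show ?thesis by (simp add: tuple_sum_def tuples_Diff)
qed

text \<open>Every tuple of the moved set descends from a tuple of \<open>S\<close>, while
  coalescence only destroys tuples. The \<open>card S - k\<close> selections of a vertex off the
  tuple leave it unchanged and combine with the holding probability of \<open>S\<close> into that of
  \<open>k\<close> walkers.\<close>

lemma hop_tuple_sum_le:
  assumes S: "S \<subseteq> {..<n}" and g: "\<And>s. 0 \<le> g s"
  shows "hop (tuple_sum k g) S \<le> tuple_sum k (tuple_hop k g) S"
proof -
  have fin: "finite S" using S by (rule finite_subset) simp
  let ?T = "tuples k S"
  have finT: "finite ?T" by (rule finite_tuples[OF fin])
  let ?R = "\<lambda>w u. \<Sum>i<k. \<Sum>s\<in>?T. if s i = u then g (s(i := w)) else 0"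
  have R: "(\<Sum>u\<in>S. ?R (w u) u) = (\<Sum>s\<in>?T. \<Sum>i<k. g (s(i := w (s i))))" for w
  proof -
    have "(\<Sum>u\<in>S. ?R (w u) u) = (\<Sum>u\<in>S. \<Sum>s\<in>?T. \<Sum>i<k. if s i = u then g (s(i := w u)) else 0)"
      by (intro sum.cong refl sum.swap)
    also have "\<dots> = (\<Sum>s\<in>?T. \<Sum>u\<in>S. \<Sum>i<k. if s i = u then g (s(i := w u)) else 0)" by (rule sum.swap)
    also have "\<dots> = (\<Sum>s\<in>?T. \<Sum>i<k. \<Sum>u\<in>S. if s i = u then g (s(i := w u)) else 0)"
      by (intro sum.cong refl sum.swap)
    also have "\<dots> = (\<Sum>s\<in>?T. \<Sum>i<k. g (s(i := w (s i))))"
      by (intro sum.cong refl) (use fin in \<open>auto simp: tuples_def sum.delta\<close>)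
    finally show ?thesis .
  qed
  have W: "(\<Sum>u\<in>S. tuple_sum k g (S - {u})) = (real (card S) - real k) * sum g ?T"
  proof -
    have "(\<Sum>u\<in>S. tuple_sum k g (S - {u})) = (\<Sum>u\<in>S. \<Sum>s\<in>?T. if u \<notin> s ` {..<k} then g s else 0)"
      unfolding tuple_sum_def tuples_Diff by (simp only: sum.inter_filter[OF finT])
    also have "\<dots> = (\<Sum>s\<in>?T. \<Sum>u\<in>S. if u \<notin> s ` {..<k} then g s else 0)" by (rule sum.swap)
    also have "\<dots> = (\<Sum>s\<in>?T. (real (card S) - real k) * g s)"
    proof (intro sum.cong refl)
      fix s assume s: "s \<in> ?T"
      have c: "card (s ` {..<k}) = k" "s ` {..<k} \<subseteq> S" using s by (auto simp: tuples_def card_image)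
      have "(\<Sum>u\<in>S. if u \<notin> s ` {..<k} then g s else 0) = (\<Sum>u\<in>S - s ` {..<k}. g s)"
        by (simp only: sum.inter_filter[OF fin, symmetric] set_diff_eq)
      also have "\<dots> = real (card S - k) * g s" using c fin by (simp add: card_Diff_subset)
      also have "real (card S - k) = real (card S) - real k" using card_mono[OF fin c(2)] c(1) by simp
      finally show "(\<Sum>u\<in>S. if u \<notin> s ` {..<k} then g s else 0) = (real (card S) - real k) * g s" .
    qed
    finally show ?thesis by (simp only: sum_distrib_left)
  qed
  have term_le: "\<theta> * tuple_sum k g (S - {u}) + (1 - \<theta>) * ((tuple_sum k g (insert (nx u) (S - {u})) + tuple_sum k g (insert (pv u) (S - {u}))) / 2)
      \<le> tuple_sum k g (S - {u}) + (1 - \<theta>) / 2 * ?R (nx u) u + (1 - \<theta>) / 2 * ?R (pv u) u" if "u \<in> S" for u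
  proof -
    have "(tuple_sum k g (insert (nx u) (S - {u})) + tuple_sum k g (insert (pv u) (S - {u}))) / 2
        \<le> ((tuple_sum k g (S - {u}) + ?R (nx u) u) + (tuple_sum k g (S - {u}) + ?R (pv u) u)) / 2"
      by (intro divide_right_mono add_mono tuple_sum_insert_Diff fin that g) simp
    from mult_left_mono[OF this, of "1 - \<theta>"] \<theta>_le_1 show ?thesis by (simp add: field_simps)
  qed
  have "hop (tuple_sum k g) S \<le> (1 - real (card S) / real n) * tuple_sum k g S
      + (\<Sum>u\<in>S. tuple_sum k g (S - {u}) + (1 - \<theta>) / 2 * ?R (nx u) u + (1 - \<theta>) / 2 * ?R (pv u) u) / real n"
    unfolding hop_def by (intro add_mono order.refl divide_right_mono sum_mono term_le) auto
  also have "\<dots> = (\<Sum>s\<in>?T. (1 - real (card S) / real n) * g s + ((real (card S) - real k) * g s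
      + (1 - \<theta>) / 2 * (\<Sum>i<k. g (s(i := nx (s i)))) + (1 - \<theta>) / 2 * (\<Sum>i<k. g (s(i := pv (s i))))) / real n)"
    by (simp only: sum.distrib W[unfolded tuple_sum_def] sum_distrib_left[symmetric] R[of nx] R[of pv] sum_divide_distrib[symmetric] tuple_sum_def)
  also have "\<dots> = tuple_sum k (tuple_hop k g) S"
    unfolding tuple_sum_def
  proof (intro sum.cong refl)
    fix s
    have "(\<Sum>i<k. (1 - \<theta>) * ((g (s(i := nx (s i))) + g (s(i := pv (s i)))) / 2))
       = (1 - \<theta>) / 2 * (\<Sum>i<k. g (s(i := nx (s i)))) + (1 - \<theta>) / 2 * (\<Sum>i<k. g (s(i := pv (s i))))"
      unfolding sum_distrib_left sum.distrib[symmetric] by (intro sum.cong refl) (simp add: field_simps)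
    thus "(1 - real (card S) / real n) * g s + ((real (card S) - real k) * g s
      + (1 - \<theta>) / 2 * (\<Sum>i<k. g (s(i := nx (s i)))) + (1 - \<theta>) / 2 * (\<Sum>i<k. g (s(i := pv (s i))))) / real n
      = tuple_hop k g s"
      by (simp add: tuple_hop_def left_diff_distrib add_divide_distrib diff_divide_distrib)
  qed
  finally show ?thesis .
qed

lemma tuple_hop_nonneg:
  assumes "k \<le> n" "\<And>s. 0 \<le> g s"
  shows "0 \<le> tuple_hop k g s"
  unfolding tuple_hop_def using assms \<theta>_le_1 n3
  by (intro add_nonneg_nonneg mult_nonneg_nonneg divide_nonneg_nonneg sum_nonneg) auto

lemma tuple_hop_pow_nonneg:
  assumes "k \<le> n" "\<And>s. 0 \<le> g s"
  shows "0 \<le> (tuple_hop k ^^ i) g s"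
proof (induction i arbitrary: s)
  case (Suc i)
  show ?case using tuple_hop_nonneg[OF assms(1) Suc] by simp
qed (use assms in simp)

lemma hop_const_add: "hop (\<lambda>S. c + \<phi> S) S = c + hop \<phi> S"
proof -
  have "hop (\<lambda>_. c) S = c"
    using n3 by (simp add: hop_def field_simps)
  thus ?thesis by (simp add: hop_add)
qed

lemma hop_pow_tuple_sum_le:
  assumes k: "k \<le> n" and g: "\<And>s. 0 \<le> g s" and S: "S \<subseteq> {..<n}" and \<phi>: "\<And>S. S \<subseteq> {..<n} \<Longrightarrow> \<phi> S \<le> c + d * tuple_sum k g S" "0 \<le> d"
  shows "(hop ^^ i) \<phi> S \<le> c + d * tuple_sum k ((tuple_hop k ^^ i) g) S"
  using S
proof (induction i arbitrary: S)
  case (Suc i)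
  have "hop ((hop ^^ i) \<phi>) S \<le> hop (\<lambda>S. c + d * tuple_sum k ((tuple_hop k ^^ i) g) S) S"
    by (rule hop_mono) (use Suc in auto)
  also have "\<dots> = c + d * hop (tuple_sum k ((tuple_hop k ^^ i) g)) S"
    by (simp only: hop_const_add hop_cmult)
  also have "\<dots> \<le> c + d * tuple_sum k (tuple_hop k ((tuple_hop k ^^ i) g)) S"
    by (intro add_left_mono mult_left_mono hop_tuple_sum_le Suc.prems tuple_hop_pow_nonneg k g \<phi>(2))
  finally show ?case by simp
qed (use \<phi> in simp)

lemma sum_tuple_shift:
  assumes "i < k" "bij_betw w {..<n} {..<n}"
  shows "(\<Sum>s\<in>{..<k} \<rightarrow>\<^sub>E {..<n}. g (s(i := w (s i)))) = (\<Sum>s\<in>{..<k} \<rightarrow>\<^sub>E {..<n}. g s)"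
proof (rule sum.reindex_bij_betw)
  let ?w' = "inv_into {..<n} w"
  show "bij_betw (\<lambda>s. s(i := w (s i))) ({..<k} \<rightarrow>\<^sub>E {..<n}) ({..<k} \<rightarrow>\<^sub>E {..<n})"
  proof (rule bij_betw_byWitness[where f' = "\<lambda>s. s(i := ?w' (s i))"])
    have *: "w a \<in> {..<n}" "?w' a \<in> {..<n}" "?w' (w a) = a" "w (?w' a) = a" if "a \<in> {..<n}" for a
      using that assms(2) by (auto simp: bij_betw_inv_into_left bij_betw_inv_into_right dest: bij_betw_apply bij_betw_apply[OF bij_betw_inv_into])
    have mem: "s i \<in> {..<n}" if "s \<in> {..<k} \<rightarrow>\<^sub>E {..<n}" for s using that assms(1) by auto
    show "\<forall>s\<in>{..<k} \<rightarrow>\<^sub>E {..<n}. (s(i := w (s i)))(i := ?w' ((s(i := w (s i))) i)) = s"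
      "\<forall>s\<in>{..<k} \<rightarrow>\<^sub>E {..<n}. (s(i := ?w' (s i)))(i := w ((s(i := ?w' (s i))) i)) = s"
      using *(3,4)[OF mem] by auto
    show "(\<lambda>s. s(i := w (s i))) ` ({..<k} \<rightarrow>\<^sub>E {..<n}) \<subseteq> {..<k} \<rightarrow>\<^sub>E {..<n}"
      "(\<lambda>s. s(i := ?w' (s i))) ` ({..<k} \<rightarrow>\<^sub>E {..<n}) \<subseteq> {..<k} \<rightarrow>\<^sub>E {..<n}"
      using *(1,2)[OF mem] assms(1) by (auto simp: PiE_iff extensional_def split: if_splits)
  qed
qed

text \<open>Over all tuples, injective or not, moving one entry to a neighbour is a bijection, so
  only the killing changes the total. This is why \<open>tuple_sum_hop_pow_le\<close> enlarges the
  index set.\<close>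

lemma sum_tuple_hop:
  "(\<Sum>s\<in>{..<k} \<rightarrow>\<^sub>E {..<n}. tuple_hop k g s) = (1 - real k * \<theta> / real n) * (\<Sum>s\<in>{..<k} \<rightarrow>\<^sub>E {..<n}. g s)"
proof -
  let ?E = "{..<k} \<rightarrow>\<^sub>E {..<n}"
  have "(\<Sum>s\<in>?E. \<Sum>i<k. (1 - \<theta>) * ((g (s(i := nx (s i))) + g (s(i := pv (s i)))) / 2))
      = (\<Sum>i<k. \<Sum>s\<in>?E. (1 - \<theta>) * ((g (s(i := nx (s i))) + g (s(i := pv (s i)))) / 2))" by (rule sum.swap)
  also have "\<dots> = (\<Sum>i<k. (1 - \<theta>) * (((\<Sum>s\<in>?E. g (s(i := nx (s i)))) + (\<Sum>s\<in>?E. g (s(i := pv (s i))))) / 2))"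
    by (simp only: sum_distrib_left[symmetric] sum_divide_distrib[symmetric] sum.distrib)
  also have "\<dots> = (\<Sum>i<k. (1 - \<theta>) * sum g ?E)"
    by (intro sum.cong refl) (simp add: sum_tuple_shift bij_nx bij_pv)
  finally have X: "(\<Sum>s\<in>?E. \<Sum>i<k. (1 - \<theta>) * ((g (s(i := nx (s i))) + g (s(i := pv (s i)))) / 2)) = real k * ((1 - \<theta>) * sum g ?E)"
    by simp
  have "(\<Sum>s\<in>?E. tuple_hop k g s) = (1 - real k / real n) * sum g ?E
      + (\<Sum>s\<in>?E. \<Sum>i<k. (1 - \<theta>) * ((g (s(i := nx (s i))) + g (s(i := pv (s i)))) / 2)) / real n"
    by (simp only: tuple_hop_def sum.distrib sum_distrib_left sum_divide_distrib)
  thus ?thesis unfolding X by (simp add: algebra_simps add_divide_distrib diff_divide_distrib)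
qed

lemma tuple_sum_hop_pow_le:
  assumes k: "k \<le> n" and g: "\<And>s. 0 \<le> g s"
  shows "tuple_sum k ((tuple_hop k ^^ i) g) {..<n} \<le> (1 - real k * \<theta> / real n) ^ i * (\<Sum>s\<in>{..<k} \<rightarrow>\<^sub>E {..<n}. g s)"
proof -
  have "tuple_sum k ((tuple_hop k ^^ i) g) {..<n} \<le> (\<Sum>s\<in>{..<k} \<rightarrow>\<^sub>E {..<n}. (tuple_hop k ^^ i) g s)"
    unfolding tuple_sum_def using tuple_hop_pow_nonneg[OF k g]
    by (intro sum_mono2 finite_PiE) (auto simp: tuples_def)
  also have "\<dots> = (1 - real k * \<theta> / real n) ^ i * (\<Sum>s\<in>{..<k} \<rightarrow>\<^sub>E {..<n}. g s)"
    by (induction i) (simp_all add: sum_tuple_hop)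
  finally show ?thesis .
qed

text \<open>Enumerations of clusters of \<open>k\<close> points with gaps below \<open>L\<close>. Sums over tuples are used since the
  tuples of a set, unlike its clusters, can be followed individually through \<open>hop\<close>.\<close>

definition linked :: "nat \<Rightarrow> nat \<Rightarrow> (nat \<Rightarrow> nat) \<Rightarrow> bool" where
  "linked L k s \<longleftrightarrow> (\<forall>i<k. 0 < i \<longrightarrow> (\<exists>j<i. cdist (s j) (s i) < L))"

text \<open>Four intervals of length at most \<open>L\<close>: on each side of \<open>a\<close>,
  once directly and once around the cycle.\<close>

lemma card_near: 
  assumes a: "a < n"
  shows "card {b. b < n \<and> cdist a b < L} \<le> 4 * L"
proof -
  have "{b. b < n \<and> cdist a b < L} \<subseteq> {a..<a + L} \<union> {a + n - L..<a + n} \<union> {Suc a - L..<Suc a} \<union> {..<a + L - n}"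
    using a by (auto simp: cdist_def Let_def min_def split: if_splits)
  hence "card {b. b < n \<and> cdist a b < L} \<le> card ({a..<a + L} \<union> {a + n - L..<a + n} \<union> {Suc a - L..<Suc a} \<union> {..<a + L - n})"
    by (rule card_mono[rotated]) simp
  also have "\<dots> \<le> L + L + L + L"
    by (intro order.trans[OF card_Un_le] add_mono) (use a in auto)
  finally show ?thesis by simp
qed

text \<open>The first entry is free, and every further one lies within \<open>L\<close> of an
  earlier one. The number of earlier entries is bounded uniformly by \<open>Suc k\<close>, so that
  the count is a plain power.\<close>

lemma card_linked:
  assumes "j \<le> k"
  shows "card {s \<in> {..<Suc j} \<rightarrow>\<^sub>E {..<n}. linked L (Suc j) s} \<le> n * (Suc k * (4 * L)) ^ j"
  using assms
proof (induction j)
  case 0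
  have "card {s \<in> {..<Suc 0} \<rightarrow>\<^sub>E {..<n}. linked L (Suc 0) s} \<le> card ({..<Suc 0} \<rightarrow>\<^sub>E {..<n})"
    by (intro card_mono finite_PiE) auto
  thus ?case by (simp add: card_PiE)
next
  case (Suc j)
  let ?A = "\<lambda>j. {s \<in> {..<Suc j} \<rightarrow>\<^sub>E {..<n}. linked L (Suc j) s}"
  let ?B = "\<lambda>s. \<Union>i<Suc j. {b. b < n \<and> cdist (s i) b < L}"
  have fin: "finite (?A j)" by (rule finite_subset[of _ "{..<Suc j} \<rightarrow>\<^sub>E {..<n}"]) (auto intro: finite_PiE)
  have "?A (Suc j) \<subseteq> (\<Union>s\<in>?A j. (\<lambda>b. s(Suc j := b)) ` ?B s)"
  proof
    fix s assume s: "s \<in> ?A (Suc j)"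
    let ?s = "restrict s {..<Suc j}"
    have "linked L (Suc j) ?s" unfolding linked_def
    proof (intro allI impI)
      fix i assume i: "i < Suc j" "0 < i"
      have "\<forall>i<Suc (Suc j). 0 < i \<longrightarrow> (\<exists>j<i. cdist (s j) (s i) < L)" using s by (simp add: linked_def)
      then obtain l where "l < i" "cdist (s l) (s i) < L" using i by (meson less_SucI)
      thus "\<exists>l<i. cdist (?s l) (?s i) < L" using i by (intro exI[of _ l]) simp
    qed
    moreover have sE: "s \<in> {..<Suc (Suc j)} \<rightarrow>\<^sub>E {..<n}" using s by simp
    hence "?s \<in> {..<Suc j} \<rightarrow>\<^sub>E {..<n}" by (simp add: PiE_iff)
    ultimately have "?s \<in> ?A j" by simp
    moreover have "s (Suc j) \<in> ?B ?s"
    proof -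
      have "\<exists>i<Suc j. cdist (s i) (s (Suc j)) < L" using s unfolding linked_def by blast
      then obtain i where "i < Suc j" "cdist (s i) (s (Suc j)) < L" by blast
      moreover have "s (Suc j) < n" using sE by (simp add: PiE_iff)
      ultimately show ?thesis by (intro UN_I[of i]) simp_all
    qed
    moreover have "s = ?s(Suc j := s (Suc j))"
      using sE by (intro ext) (auto simp: PiE_iff extensional_def restrict_def less_Suc_eq)
    ultimately show "s \<in> (\<Union>s\<in>?A j. (\<lambda>b. s(Suc j := b)) ` ?B s)" by blast
  qed
  hence "card (?A (Suc j)) \<le> card (\<Union>s\<in>?A j. (\<lambda>b. s(Suc j := b)) ` ?B s)"
    using fin by (intro card_mono) auto
  also have "\<dots> \<le> (\<Sum>s\<in>?A j. card ((\<lambda>b. s(Suc j := b)) ` ?B s))" by (rule card_UN_le[OF fin])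
  also have "\<dots> \<le> (\<Sum>s\<in>?A j. Suc k * (4 * L))"
  proof (intro sum_mono)
    fix s assume s: "s \<in> ?A j"
    have "card ((\<lambda>b. s(Suc j := b)) ` ?B s) \<le> card (?B s)" by (rule card_image_le) simp
    also have "\<dots> \<le> (\<Sum>i<Suc j. card {b. b < n \<and> cdist (s i) b < L})" by (rule card_UN_le) simp
    also have "\<dots> \<le> (\<Sum>i<Suc j. 4 * L)"
    proof (intro sum_mono)
      fix i assume "i \<in> {..<Suc j}"
      hence "s i < n" using s by auto
      thus "card {b. b < n \<and> cdist (s i) b < L} \<le> 4 * L" by (rule card_near)
    qed
    also have "\<dots> \<le> Suc k * (4 * L)" using Suc.prems by (simp del: mult_Suc)
    finally show "card ((\<lambda>b. s(Suc j := b)) ` ?B s) \<le> Suc k * (4 * L)" .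
  qed
  also have "\<dots> \<le> n * (Suc k * (4 * L)) ^ j * (Suc k * (4 * L))"
    using Suc by (simp del: mult_Suc) 
  finally show ?case by (simp only: power_Suc mult_ac)
qed

end

section \<open>Product approximation on sparse sets and thinning\<close>

context voter_cycle
begin

text \<open>In effect all clusters at scale \<open>L\<close> have fewer than \<open>k\<close>
  points, since a larger cluster contains a linked enumeration of \<open>k\<close> of its
  points.\<close>

definition spread :: "nat \<Rightarrow> nat \<Rightarrow> nat set \<Rightarrow> bool" where
  "spread L k S \<longleftrightarrow> (\<forall>s\<in>tuples k S. \<not> linked L k s)"

lemma spread_mono: "\<lbrakk>spread L k S; T \<subseteq> S\<rbrakk> \<Longrightarrow> spread L k T"
  by (fastforce simp: spread_def tuples_def PiE_iff)

text \<open>Take a linked tuple of a length beyond which none exists in \<open>S\<close>. It has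
  fewer than \<open>k\<close> entries because \<open>S\<close> is spread, and no other point of
  \<open>S\<close> is within \<open>L\<close> of it, as the tuple could then be extended.\<close>

lemma spread_clump:
  assumes S: "S \<noteq> {}" "spread L k S"
  obtains C where "C \<subseteq> S" "C \<noteq> {}" "card C < k" "\<And>a b. \<lbrakk>a \<in> C; b \<in> S - C\<rbrakk> \<Longrightarrow> L \<le> cdist a b"
proof -
  define P where "P m \<longleftrightarrow> (\<exists>s\<in>tuples m S. linked L m s)" for m
  have P0: "P 0" by (auto simp: P_def tuples_def linked_def)
  have P1: "P (Suc 0)"
  proof -
    obtain a where "a \<in> S" using S(1) by blast
    hence "(\<lambda>i\<in>{..<Suc 0}. a) \<in> tuples (Suc 0) S" by (auto simp: tuples_def inj_on_def)
    moreover have "linked L (Suc 0) (\<lambda>i\<in>{..<Suc 0}. a)" by (simp add: linked_def)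
    ultimately show ?thesis unfolding P_def by blast
  qed
  have nk: "\<not> P k" using S(2) by (auto simp: P_def spread_def)
  have "\<exists>m\<ge>1. m < k \<and> P m \<and> \<not> P (Suc m)"
  proof (rule ccontr)
    assume *: "\<not> (\<exists>m\<ge>1. m < k \<and> P m \<and> \<not> P (Suc m))"
    have "1 \<le> m \<Longrightarrow> m \<le> k \<Longrightarrow> P m" for m
      by (induction m rule: dec_induct) (use P1 * in auto)
    hence "P k" using P0 by (cases "k = 0") auto
    thus False using nk by contradiction
  qed
  then obtain m s where m: "1 \<le> m" "m < k" "\<not> P (Suc m)" and s: "s \<in> tuples m S" "linked L m s"
    by (auto simp: P_def)
  show ?thesis
  proof
    show "s ` {..<m} \<subseteq> S" "s ` {..<m} \<noteq> {}" "card (s ` {..<m}) < k"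
      using s m card_image_le[of "{..<m}" s] by (auto simp: tuples_def lessThan_empty_iff)
    fix a b assume a: "a \<in> s ` {..<m}" and b: "b \<in> S - s ` {..<m}"
    show "L \<le> cdist a b"
    proof (rule ccontr)
      assume d: "\<not> L \<le> cdist a b"
      have "s(m := b) \<in> tuples (Suc m) S"
        using s(1) b by (auto simp: tuples_def PiE_iff extensional_def inj_on_def less_Suc_eq)
      moreover have "linked L (Suc m) (s(m := b))"
      proof -
        obtain l where l: "l < m" "a = s l" using a by blast
        have "\<exists>j<i. cdist ((s(m := b)) j) ((s(m := b)) i) < L" if i: "i < Suc m" "0 < i" for i
        proof (cases "i = m")
          case True
          thus ?thesis using l d by (intro exI[of _ l]) simp
        next
          case False
          hence "i < m" using i by simp
          then obtain j where "j < i" "cdist (s j) (s i) < L" using s(2) i by (auto simp: linked_def)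
          thus ?thesis using \<open>i < m\<close> by (intro exI[of _ j]) simp
        qed
        thus ?thesis by (simp add: linked_def)
      qed
      ultimately show False using m(3) by (auto simp: P_def)
    qed
  qed
qed

lemma Ker_far:
  assumes C: "C \<subseteq> {..<n}" "card C \<le> k" and B: "B \<subseteq> {..<n}" and d: "\<And>a b. \<lbrakk>a \<in> C; b \<in> B\<rbrakk> \<Longrightarrow> L \<le> cdist a b"
  shows "Ker C B \<le> real k * real n * (1 - \<theta>) ^ L"
proof -
  have "Ker C B \<le> (\<Sum>a\<in>C. \<Sum>b\<in>B. (1 - \<theta>) ^ L)"
    unfolding Ker_def ker_def using d \<theta>_pos \<theta>_le_1 by (intro sum_mono power_decreasing) auto
  also have "\<dots> = real (card C) * (real (card B) * (1 - \<theta>) ^ L)" by simp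
  also have "\<dots> \<le> real k * (real n * (1 - \<theta>) ^ L)"
    using C(2) card_mono[OF _ B] \<theta>_le_1 by (intro mult_mono mult_right_mono) auto
  finally show ?thesis by (simp add: mult.assoc)
qed

abbreviation mix :: "nat set \<Rightarrow> (nat \<Rightarrow> nat) \<Rightarrow> (nat \<Rightarrow> nat) \<Rightarrow> nat \<Rightarrow> nat" where
  "mix C x y \<equiv> (\<lambda>v. if v \<in> C then x v else y v)"

text \<open>Splitting off one clump costs its decoupling error against the rest, plus the error
  \<open>E\<close> already made on the rest.\<close>

lemma clump_error:
  assumes p: "decorrelated p" and C: "C \<subseteq> S" "card C \<le> k" and S: "S \<subseteq> {..<n}"
    and d: "\<And>a b. \<lbrakk>a \<in> C; b \<in> S - C\<rbrakk> \<Longrightarrow> L \<le> cdist a b"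
    and f: "dep S f" "\<And>x. \<bar>f x\<bar> \<le> 1"
    and F: "\<And>g. \<lbrakk>dep (S - C) g; \<And>x. \<bar>g x\<bar> \<le> 1\<rbrakk> \<Longrightarrow> \<bar>expect p g - F g\<bar> \<le> E"
  shows "\<bar>expect p f - expect p (\<lambda>x. F (\<lambda>y. f (mix C x y)))\<bar> \<le> real q ^ k * (2 * (real k * real n * (1 - \<theta>) ^ L)) + E"
proof -
  have w: "weights p" using p by (simp add: decorrelated_def)
  have g: "dep (S - C) (\<lambda>y. f (mix C x y))" for x
    by (rule depI, rule depD[OF f(1)]) auto
  have "\<bar>expect p f - expect p (\<lambda>x. expect p (\<lambda>y. f (mix C x y)))\<bar> \<le> real q ^ card C * (2 * Ker C (S - C))"
  proof (rule decouple[OF p])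
    have "C \<union> (S - C) = S" using C(1) by blast
    thus "dep (C \<union> (S - C)) f" using f(1) by simp
  qed (use C S f in auto)
  also have "\<dots> \<le> real q ^ k * (2 * (real k * real n * (1 - \<theta>) ^ L))"
    using q2 C S d by (intro mult_mono mult_left_mono power_increasing Ker_far) (auto intro: Ker_nonneg)
  finally have 1: "\<bar>expect p f - expect p (\<lambda>x. expect p (\<lambda>y. f (mix C x y)))\<bar> \<le> real q ^ k * (2 * (real k * real n * (1 - \<theta>) ^ L))" .
  have Fx: "\<bar>expect p (\<lambda>y. f (mix C x y)) - F (\<lambda>y. f (mix C x y))\<bar> \<le> E" for x
    by (rule F[OF g f(2)])
  have "expect p (\<lambda>x. expect p (\<lambda>y. f (mix C x y))) \<le> expect p (\<lambda>x. F (\<lambda>y. f (mix C x y)) + E)"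
    "expect p (\<lambda>x. F (\<lambda>y. f (mix C x y))) \<le> expect p (\<lambda>x. expect p (\<lambda>y. f (mix C x y)) + E)"
    using Fx by (intro expect_mono[OF w]; simp add: abs_le_iff algebra_simps)+
  hence "\<bar>expect p (\<lambda>x. expect p (\<lambda>y. f (mix C x y))) - expect p (\<lambda>x. F (\<lambda>y. f (mix C x y)))\<bar> \<le> E"
    by (simp only: lin_add[OF lin_expect] expect_const_weights[OF w] abs_le_iff) simp
  thus ?thesis using 1 by linarith
qed

definition near_stat :: "nat \<Rightarrow> real \<Rightarrow> ((nat \<Rightarrow> nat) \<Rightarrow> real) \<Rightarrow> bool" where
  "near_stat k \<eta> p \<longleftrightarrow> (\<forall>C f. C \<subseteq> {..<n} \<longrightarrow> card C \<le> k \<longrightarrow> dep C f \<longrightarrow> (\<forall>x. \<bar>f x\<bar> \<le> 1) \<longrightarrow> \<bar>expect p f - expect stat f\<bar> \<le> \<eta>)"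

lemma near_statD:
  "\<lbrakk>near_stat k \<eta> p; C \<subseteq> {..<n}; card C \<le> k; dep C f; \<And>x. \<bar>f x\<bar> \<le> 1\<rbrakk> \<Longrightarrow> \<bar>expect p f - expect stat f\<bar> \<le> \<eta>"
  unfolding near_stat_def by blast

text \<open>\<open>F\<close> and \<open>F'\<close> stand for the products of the marginals of \<open>p\<close> and \<open>stat\<close> over the clumps of \<open>S\<close>.\<close>

definition factorized where
  "factorized p e h S F F' \<longleftrightarrow> lin F \<and> lin F' \<and> F (\<lambda>_. 1) = 1 \<and> F' (\<lambda>_. 1) = 1 \<and> (\<forall>f g. (\<forall>x. f x \<le> g x) \<longrightarrow> F' f \<le> F' g)
    \<and> (\<forall>f. dep S f \<longrightarrow> (\<forall>x. \<bar>f x\<bar> \<le> 1) \<longrightarrow> \<bar>expect p f - F f\<bar> \<le> e * real (card S) \<and> \<bar>expect stat f - F' f\<bar> \<le> e * real (card S))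
    \<and> (\<forall>f. dep S f \<longrightarrow> (F f)\<^sup>2 \<le> (1 + h) ^ card S * F' (\<lambda>x. (f x)\<^sup>2))"

lemma factorizedD:
  assumes "factorized p e h S F F'"
  shows "lin F" "lin F'" "F (\<lambda>_. 1) = 1" "F' (\<lambda>_. 1) = 1" "(\<And>x. f x \<le> g x) \<Longrightarrow> F' f \<le> F' g"
    "\<lbrakk>dep S f; \<And>x. \<bar>f x\<bar> \<le> 1\<rbrakk> \<Longrightarrow> \<bar>expect p f - F f\<bar> \<le> e * real (card S)"
    "\<lbrakk>dep S f; \<And>x. \<bar>f x\<bar> \<le> 1\<rbrakk> \<Longrightarrow> \<bar>expect stat f - F' f\<bar> \<le> e * real (card S)"
    "dep S f \<Longrightarrow> (F f)\<^sup>2 \<le> (1 + h) ^ card S * F' (\<lambda>x. (f x)\<^sup>2)"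
  using assms unfolding factorized_def by blast+

text \<open>Clumps are peeled off one at a time. Each adds \<open>e\<close> to the error and a
  factor \<open>1 + h\<close> to the second-moment comparison; since clumps are nonempty,
  \<open>card S\<close> bounds their number.\<close>

lemma factorized_approximation:
  assumes p: "decorrelated p" and close: "near_stat k \<eta> p" and S: "S \<subseteq> {..<n}" "spread L k S"
  defines "e \<equiv> real q ^ k * (2 * (real k * real n * (1 - \<theta>) ^ L))"
    and "h \<equiv> real q ^ k * (\<eta>\<^sup>2 / (\<theta> / real q) ^ k)"
  shows "\<exists>F F'. factorized p e h S F F'"
  using S
proof (induction "card S" arbitrary: S rule: less_induct)
  case less
  have w: "weights p" using p by (simp add: decorrelated_def)
  have e0: "0 \<le> e" using \<theta>_le_1 by (simp add: e_def)
  have h0: "0 \<le> h" using \<theta>_pos by (simp add: h_def)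
  have fin: "finite S" using less.prems(1) by (rule finite_subset) simp
  show ?case
  proof (cases "S = {}")
    case True
    have c: "f = (\<lambda>_. f base)" if "dep {} f" for f using that by (auto intro: depD)
    show ?thesis
      unfolding factorized_def
    proof (intro exI[of _ "\<lambda>f. f base"] conjI allI impI)
      show "lin (\<lambda>f. f base)" by (rule linI) auto
      show "lin (\<lambda>f. f base)" by (rule linI) auto
      fix f :: "(nat \<Rightarrow> nat) \<Rightarrow> real" assume "dep S f"
      hence f: "f = (\<lambda>_. f base)" using c True by simp
      have "expect r f = f base" if "weights r" for r
        by (subst f) (rule expect_const_weights[OF that])
      thus "\<bar>expect p f - f base\<bar> \<le> e * real (card S)" "\<bar>expect stat f - f base\<bar> \<le> e * real (card S)"
        using w weights_stat True by simp_all
    qed (use True in auto)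
  next
    case False
    obtain C where C: "C \<subseteq> S" "C \<noteq> {}" "card C < k" "\<And>a b. \<lbrakk>a \<in> C; b \<in> S - C\<rbrakk> \<Longrightarrow> L \<le> cdist a b"
      using spread_clump[OF False less.prems(2)] by blast
    let ?T = "S - C"
    have cT: "card ?T < card S" using C fin by (intro psubset_card_mono) auto
    have T: "?T \<subseteq> {..<n}" "spread L k ?T" using less.prems spread_mono[of L k S ?T] by auto
    obtain F F' where FF: "factorized p e h ?T F F'" using less.hyps[OF cT T] by blast
    note F = factorizedD(1-5)[OF FF] and ap = factorizedD(6,7)[OF FF] and sq = factorizedD(8)[OF FF]
    let ?F = "\<lambda>f. expect p (\<lambda>x. F (\<lambda>y. f (mix C x y)))" and ?F' = "\<lambda>f. expect stat (\<lambda>x. F' (\<lambda>y. f (mix C x y)))"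
    have eS: "e + e * real (card ?T) \<le> e * real (card S)"
    proof -
      have "e * (1 + real (card ?T)) \<le> e * real (card S)" using cT e0 by (intro mult_left_mono) auto
      thus ?thesis by (simp add: algebra_simps)
    qed
    show ?thesis
      unfolding factorized_def
    proof (rule exI[of _ ?F], rule exI[of _ ?F'], intro conjI allI impI)
      show "lin ?F" "lin ?F'"
        by (rule linI; simp only: lin_add[OF F(1)] lin_cmult[OF F(1)] lin_add[OF F(2)] lin_cmult[OF F(2)] lin_add[OF lin_expect] lin_cmult[OF lin_expect])+
      show "?F (\<lambda>_. 1) = 1" "?F' (\<lambda>_. 1) = 1"
        using F(3,4) expect_const_weights w weights_stat by simp_all
      show "?F' f \<le> ?F' g" if "\<forall>x. f x \<le> g x" for f g
        using that by (intro expect_mono weights_stat F(5)) auto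
      fix f :: "(nat \<Rightarrow> nat) \<Rightarrow> real" assume f: "dep S f"
      have g: "dep ?T (\<lambda>y. f (mix C x y))" for x
        by (rule depI, rule depD[OF f]) auto
      show "\<bar>expect p f - ?F f\<bar> \<le> e * real (card S)" if b: "\<forall>x. \<bar>f x\<bar> \<le> 1"
      proof (rule order.trans[OF _ eS])
        show "\<bar>expect p f - ?F f\<bar> \<le> e + e * real (card ?T)"
          unfolding e_def by (rule clump_error[OF p C(1) less_imp_le[OF C(3)] less.prems(1) C(4) f b[rule_format] ap(1)[unfolded e_def]])
      qed
      show "\<bar>expect stat f - ?F' f\<bar> \<le> e * real (card S)" if b: "\<forall>x. \<bar>f x\<bar> \<le> 1"
      proof (rule order.trans[OF _ eS])
        show "\<bar>expect stat f - ?F' f\<bar> \<le> e + e * real (card ?T)"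
          unfolding e_def by (rule clump_error[OF decorrelated_stat C(1) less_imp_le[OF C(3)] less.prems(1) C(4) f b[rule_format] ap(2)[unfolded e_def]])
      qed
      have Cn: "C \<subseteq> {..<n}" using C(1) less.prems(1) by blast
      have "dep C (\<lambda>x. F (\<lambda>y. f (mix C x y)))"
      proof (rule depI)
        fix x x' :: "nat \<Rightarrow> nat" assume "\<And>v. v \<in> C \<Longrightarrow> x v = x' v"
        hence "mix C x y = mix C x' y" for y by auto
        thus "F (\<lambda>y. f (mix C x y)) = F (\<lambda>y. f (mix C x' y))" by simp
      qed
      \<comment> \<open>The comparison on the clump is applied to the function already averaged over
        the rest; the induction hypothesis then handles the rest for each fixed pattern on the
        clump.\<close>
      hence "(?F f)\<^sup>2 \<le> (1 + h) * expect stat (\<lambda>x. (F (\<lambda>y. f (mix C x y)))\<^sup>2)"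
        unfolding h_def by (intro chi_bound[OF Cn less_imp_le[OF C(3)] w near_statD[OF close Cn less_imp_le[OF C(3)]]]) auto
      also have "\<dots> \<le> (1 + h) * expect stat (\<lambda>x. (1 + h) ^ card ?T * F' (\<lambda>y. (f (mix C x y))\<^sup>2))"
        using h0 by (intro mult_left_mono expect_mono weights_stat sq g) auto
      also have "\<dots> = (1 + h) ^ Suc (card ?T) * ?F' (\<lambda>x. (f x)\<^sup>2)"
        by (simp only: lin_cmult[OF lin_expect] power_Suc mult.assoc)
      also have "\<dots> \<le> (1 + h) ^ card S * ?F' (\<lambda>x. (f x)\<^sup>2)"
      proof (intro mult_right_mono power_increasing)
        have "0 \<le> F' g" if "\<And>x. 0 \<le> g x" for g using F(5)[of "\<lambda>_. 0" g] that lin_zero[OF F(2)] by simp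
        hence "expect stat (\<lambda>_. 0) \<le> ?F' (\<lambda>x. (f x)\<^sup>2)" by (intro expect_mono weights_stat) auto
        thus "0 \<le> ?F' (\<lambda>x. (f x)\<^sup>2)" by (simp add: expect_const_weights[OF weights_stat])
      qed (use h0 cT in auto)
      finally show "(?F f)\<^sup>2 \<le> (1 + h) ^ card S * ?F' (\<lambda>x. (f x)\<^sup>2)" .
    qed
  qed
qed

text \<open>Testing the quadratic bound on \<open>1 + s (f - F' f)\<close> and optimizing over \<open>s\<close> turns the
  second-moment comparison into a bound on \<open>F - F'\<close>.\<close>

lemma second_moment_difference:
  assumes F: "lin F" "lin F'" "F (\<lambda>_. 1) = 1" "F' (\<lambda>_. 1) = 1" "\<And>f g. (\<And>x. f x \<le> g x) \<Longrightarrow> F' f \<le> F' g"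
    and sq: "\<And>f. dep S f \<Longrightarrow> (F f)\<^sup>2 \<le> B * F' (\<lambda>x. (f x)\<^sup>2)" and B: "0 \<le> B"
    and f: "dep S f" "\<And>x. \<bar>f x\<bar> \<le> 1"
  shows "\<bar>F f - F' f\<bar> \<le> sqrt (B - 1)"
proof -
  define c where "c = F' f"
  define A where "A = F f - c"
  have K: "F (\<lambda>_. a) = a" "F' (\<lambda>_. a) = a" for a
    using lin_cmult[OF F(1), of a "\<lambda>_. 1"] lin_cmult[OF F(2), of a "\<lambda>_. 1"] F(3,4) by simp_all
  let ?g = "\<lambda>x. (1 - A * c) + A * f x"
  have Fg: "F ?g = 1 + A\<^sup>2"
    by (simp only: lin_add[OF F(1)] lin_cmult[OF F(1)] K) (simp add: A_def power2_eq_square algebra_simps)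
  have "(\<lambda>x. (?g x)\<^sup>2) = (\<lambda>x. (1 - A * c)\<^sup>2 + ((2 * (1 - A * c) * A) * f x + A\<^sup>2 * (f x)\<^sup>2))"
    by (auto simp: power2_eq_square algebra_simps)
  hence "F' (\<lambda>x. (?g x)\<^sup>2) = (1 - A * c)\<^sup>2 + (2 * (1 - A * c) * A * c + A\<^sup>2 * F' (\<lambda>x. (f x)\<^sup>2))"
    by (simp only: lin_add[OF F(2)] lin_cmult[OF F(2)] K c_def[symmetric])
  also have "\<dots> = 1 + (A\<^sup>2 * F' (\<lambda>x. (f x)\<^sup>2) - (A * c)\<^sup>2)" by (simp add: power2_eq_square algebra_simps)
  also have "\<dots> \<le> 1 + (A\<^sup>2 * 1 - 0)"
    using F(5)[of "\<lambda>x. (f x)\<^sup>2" "\<lambda>_. 1"] f(2) F(4)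
    by (intro add_left_mono diff_mono mult_left_mono) (auto simp: abs_square_le_1)
  finally have V: "F' (\<lambda>x. (?g x)\<^sup>2) \<le> 1 + A\<^sup>2" by simp
  have "dep S ?g" by (rule depI) (use depD[OF f(1)] in metis)
  hence "(1 + A\<^sup>2)\<^sup>2 \<le> B * (1 + A\<^sup>2)"
    using sq[of ?g] mult_left_mono[OF V B] unfolding Fg by linarith
  moreover have "0 < 1 + A\<^sup>2" by (simp add: add_pos_nonneg)
  ultimately have "1 + A\<^sup>2 \<le> B" by (simp add: power2_eq_square)
  hence "A\<^sup>2 \<le> B - 1" by simp
  from real_sqrt_le_mono[OF this] show ?thesis by (simp add: A_def c_def)
qed

text \<open>The last term is small once \<open>n * \<eta>\<^sup>2\<close> is: the number of sites
  multiplies the square of the local error, not the error itself.\<close>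

lemma spread_mixing:
  assumes p: "decorrelated p" and close: "near_stat k \<eta> p"
    and S: "S \<subseteq> {..<n}" "spread L k S" and f: "dep S f" "\<And>x. \<bar>f x\<bar> \<le> 1"
  shows "\<bar>expect p f - expect stat f\<bar> \<le> 4 * real q ^ k * real k * (real n)\<^sup>2 * (1 - \<theta>) ^ L
    + sqrt ((1 + real q ^ k * (\<eta>\<^sup>2 / (\<theta> / real q) ^ k)) ^ n - 1)"
proof -
  define e where "e = real q ^ k * (2 * (real k * real n * (1 - \<theta>) ^ L))"
  define h where "h = real q ^ k * (\<eta>\<^sup>2 / (\<theta> / real q) ^ k)"
  have e0: "0 \<le> e" using \<theta>_le_1 by (simp add: e_def)
  have h0: "0 \<le> h" using \<theta>_pos by (simp add: h_def)
  have cS: "card S \<le> n" using card_mono[OF _ S(1)] by simp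
  obtain F F' where FF: "factorized p e h S F F'"
    using factorized_approximation[OF p close S] unfolding e_def h_def by blast
  note F = factorizedD(1-5)[OF FF] and ap = factorizedD(6,7)[OF FF f] and sq = factorizedD(8)[OF FF]
  have "\<bar>F f - F' f\<bar> \<le> sqrt ((1 + h) ^ card S - 1)"
    by (rule second_moment_difference[OF F sq _ f]) (use h0 in auto)
  also have "\<dots> \<le> sqrt ((1 + h) ^ n - 1)" using h0 cS by (simp add: power_increasing)
  finally have "\<bar>F f - F' f\<bar> \<le> sqrt ((1 + h) ^ n - 1)" .
  moreover have "e * real (card S) \<le> e * real n" using e0 cS by (intro mult_left_mono) auto
  ultimately have "\<bar>expect p f - expect stat f\<bar> \<le> 2 * (e * real n) + sqrt ((1 + h) ^ n - 1)"
    using ap by linarith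
  also have "2 * (e * real n) = 4 * real q ^ k * real k * (real n)\<^sup>2 * (1 - \<theta>) ^ L"
    by (simp add: e_def power2_eq_square)
  finally show ?thesis by (simp add: h_def)
qed

lemma tv_dist_le:
  assumes "\<And>f. \<lbrakk>dep {..<n} f; \<And>x. \<bar>f x\<bar> \<le> 1\<rbrakk> \<Longrightarrow> \<bar>expect p f - expect r f\<bar> \<le> c"
  shows "tv_dist \<Omega> p r \<le> c"
  unfolding tv_dist_def
proof (rule cSUP_least)
  fix A assume "A \<in> Pow \<Omega>"
  hence A: "A \<subseteq> \<Omega>" by simp
  \<comment> \<open>The restriction makes the indicator depend only on the coordinates below
    \<open>n\<close>, and it is the identity on configurations.\<close>
  let ?f = "\<lambda>x. of_bool (restrict x {..<n} \<in> A) :: real"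
  have "expect w ?f = sum w A" for w
  proof -
    have "restrict x {..<n} = x" if "x \<in> \<Omega>" for x
      using that unfolding configs_eq by (rule PiE_restrict)
    hence "expect w ?f = expect w (\<lambda>x. of_bool (x \<in> A))" by (intro expect_cong) simp
    thus ?thesis using expect_of_bool[OF A] by simp
  qed
  moreover have "dep {..<n} ?f"
  proof (rule depI)
    fix x y :: "nat \<Rightarrow> nat" assume "\<And>v. v \<in> {..<n} \<Longrightarrow> x v = y v"
    hence "restrict x {..<n} = restrict y {..<n}" by (rule restrict_ext)
    thus "?f x = ?f y" by simp
  qed
  ultimately show "\<bar>sum p A - sum r A\<bar> \<le> c" using assms[of ?f] by simp
qed blast

text \<open>Semigroup property with the second time span left as discrete steps, on which the dual
  acts.\<close>

lemma expect_law_add: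
  assumes x: "x \<in> \<Omega>" and f: "\<And>x. \<bar>f x\<bar> \<le> 1" and r: "0 \<le> r" "0 \<le> \<tau>"
  shows "expect (law x (r + \<tau>)) f = pois (real n * \<tau>) (\<lambda>i. expect (law x r) ((step ^^ i) f))"
proof -
  have b: "\<bar>(step ^^ i) f y\<bar> \<le> 1" for i y by (rule step_pow_abs_le[OF f])
  have "(step ^^ j) ((step ^^ i) f) = (step ^^ (i + j)) f" for i j
    by (simp add: funpow_add[symmetric, unfolded comp_def fun_eq_iff] add.commute)
  hence "expect (law x r) ((step ^^ i) f) = pois (real n * r) (\<lambda>j. (step ^^ (i + j)) f x)" for i
    by (simp add: expect_law[OF x b])
  thus ?thesis using pois_pois[of "real n * \<tau>" "real n * r" "\<lambda>i. (step ^^ i) f x", OF _ _ b] r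
    by (simp add: expect_law[OF x f] distrib_left add.commute)
qed

text \<open>The dual runs for the last time span \<open>\<tau>\<close> from the full vertex set. On
  a spread set the error is at most \<open>\<eta>\<close>; on any other set the trivial bound 2 is
  at most twice the number of linked \<open>k\<close>-tuples, and the bound on their expected number
  decays at rate \<open>k * \<theta>\<close>.\<close>

lemma thinning:
  assumes x: "x \<in> \<Omega>" and r: "0 \<le> r" "0 \<le> \<tau>" and k: "0 < k" "k \<le> n"
    and \<eta>: "0 \<le> \<eta>" "\<And>S f. \<lbrakk>S \<subseteq> {..<n}; spread L k S; dep S f; \<And>x. \<bar>f x\<bar> \<le> 1\<rbrakk> \<Longrightarrow> \<bar>expect (law x r) f - expect stat f\<bar> \<le> \<eta>"
  shows "tv_dist \<Omega> (law x (r + \<tau>)) stat \<le> \<eta> + 2 * (real n * (real (Suc k) * (4 * real L)) ^ (k - 1) * exp (- real k * \<theta> * \<tau>))"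
proof (rule tv_dist_le)
  fix f assume f: "dep {..<n} f" "\<And>x. \<bar>f x\<bar> \<le> 1"
  define D where "D f = expect (law x r) f - expect stat f" for f
  define g :: "(nat \<Rightarrow> nat) \<Rightarrow> real" where "g s = of_bool (linked L k s)" for s
  let ?\<phi> = "\<lambda>S. \<eta> + 2 * tuple_sum k g S"
  let ?\<beta> = "1 - real k * \<theta> / real n"
  let ?N = "real n * (real (Suc k) * (4 * real L)) ^ (k - 1)"
  have g0: "0 \<le> g s" for s by (simp add: g_def)
  have D: "lin D" unfolding D_def
    by (rule linI) (simp_all only: lin_add[OF lin_expect] lin_cmult[OF lin_expect], simp_all add: algebra_simps)
  have "bnd D ?\<phi>"
  proof (rule bndI)
    fix S f assume S: "S \<subseteq> {..<n}" "dep S f" "\<And>x. \<bar>f x\<bar> \<le> 1"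
    have fin: "finite S" using S(1) by (rule finite_subset) simp
    show "\<bar>D f\<bar> \<le> ?\<phi> S"
    proof (cases "spread L k S")
      case True
      have "0 \<le> tuple_sum k g S" unfolding tuple_sum_def by (intro sum_nonneg g0)
      thus ?thesis using \<eta>(2)[OF S(1) True S(2,3)] unfolding D_def by linarith
    next
      case False
      then obtain s where s: "s \<in> tuples k S" "linked L k s" by (auto simp: spread_def)
      have "1 = g s" using s by (simp add: g_def)
      also have "\<dots> \<le> tuple_sum k g S" unfolding tuple_sum_def
        by (rule member_le_sum) (use s finite_tuples[OF fin] g0 in auto)
      finally have t: "1 \<le> tuple_sum k g S" .
      have "\<bar>expect p f\<bar> \<le> 1" if "weights p" for p
      proof -
        have "expect p f \<le> expect p (\<lambda>_. 1)" "expect p (\<lambda>_. - 1) \<le> expect p f"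
          by (intro expect_mono that; use S(3) in \<open>auto simp: abs_le_iff minus_le_iff\<close>)+
        thus ?thesis by (simp add: expect_const_weights[OF that] abs_le_iff)
      qed
      from this[OF weights_law[OF x r(1)]] this[OF weights_stat] show ?thesis
        using t \<eta>(1) unfolding D_def by linarith
    qed
  qed
  from bnd_step_pow[OF D this] have "\<bar>D ((step ^^ i) f)\<bar> \<le> (hop ^^ i) ?\<phi> {..<n}" for i
    by (rule bndD[OF _ _ f]) simp
  also have "(hop ^^ i) ?\<phi> {..<n} \<le> \<eta> + 2 * tuple_sum k ((tuple_hop k ^^ i) g) {..<n}" for i
    by (rule hop_pow_tuple_sum_le[OF k(2) g0]) auto
  also have "tuple_sum k ((tuple_hop k ^^ i) g) {..<n} \<le> ?\<beta> ^ i * ?N" for i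
  proof -
    have \<beta>: "0 \<le> ?\<beta>"
    proof -
      have "real k * \<theta> \<le> real n * 1" using k \<theta>_pos \<theta>_le_1 by (intro mult_mono) auto
      thus ?thesis using n3 by (simp add: field_simps)
    qed
    obtain j where j: "k = Suc j" using k(1) by (cases k) auto
    have finE: "finite ({..<k} \<rightarrow>\<^sub>E {..<n})" by (intro finite_PiE) auto
    have "(\<Sum>s\<in>{..<k} \<rightarrow>\<^sub>E {..<n}. g s) = real (card {s \<in> {..<k} \<rightarrow>\<^sub>E {..<n}. linked L k s})"
      unfolding g_def of_bool_def by (simp only: sum.inter_filter[OF finE, symmetric]) simp
    also have "\<dots> \<le> real (n * (Suc k * (4 * L)) ^ j)"
      unfolding of_nat_le_iff using card_linked[of j k L] j by simp
    finally have "(\<Sum>s\<in>{..<k} \<rightarrow>\<^sub>E {..<n}. g s) \<le> ?N" by (simp add: j del: of_nat_Suc mult_Suc)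
    hence "?\<beta> ^ i * (\<Sum>s\<in>{..<k} \<rightarrow>\<^sub>E {..<n}. g s) \<le> ?\<beta> ^ i * ?N"
      by (rule mult_left_mono) (use \<beta> in simp)
    with tuple_sum_hop_pow_le[OF k(2) g0, of i] show ?thesis by (rule order.trans)
  qed
  finally have Di: "\<bar>D ((step ^^ i) f)\<bar> \<le> \<eta> + 2 * ?N * ?\<beta> ^ i" for i by (simp add: mult_ac)
  have \<beta>: "0 \<le> ?\<beta>" "?\<beta> \<le> 1"
  proof -
    have "real k * \<theta> \<le> real n * 1" using k \<theta>_pos \<theta>_le_1 by (intro mult_mono) auto
    thus "0 \<le> ?\<beta>" "?\<beta> \<le> 1" using n3 \<theta>_pos by (auto simp: field_simps)
  qed
  have b: "\<bar>(step ^^ i) f y\<bar> \<le> 1" for i y by (rule step_pow_abs_le[OF f(2)])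
  have N0: "0 \<le> ?N" by simp
  have "\<bar>expect (law x r) ((step ^^ i) f)\<bar> \<le> 1" for i
  proof -
    note w = weights_law[OF x r(1)]
    have "expect (law x r) ((step ^^ i) f) \<le> expect (law x r) (\<lambda>_. 1)" "expect (law x r) (\<lambda>_. - 1) \<le> expect (law x r) ((step ^^ i) f)"
      by (intro expect_mono w; use b[of i] in \<open>auto simp: abs_le_iff minus_le_iff\<close>)+
    thus ?thesis by (simp add: expect_const_weights[OF w] abs_le_iff)
  qed
  hence "expect (law x (r + \<tau>)) f - expect stat f = pois (real n * \<tau>) (\<lambda>i. D ((step ^^ i) f))"
    unfolding D_def expect_law_add[OF x f(2) r] expect_stat_step_pow
    by (subst pois_diff[of _ 1 _ "\<bar>expect stat f\<bar>"]) auto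
  also have "\<bar>\<dots>\<bar> \<le> pois (real n * \<tau>) (\<lambda>i. \<eta> + 2 * ?N * ?\<beta> ^ i)"
  proof (rule pois_abs_le[OF _ Di])
    show "\<eta> + 2 * ?N * ?\<beta> ^ i \<le> \<eta> + 2 * ?N" for i
      using N0 \<beta> mult_left_mono[OF power_le_one[OF \<beta>, of i], of "2 * ?N"] by simp
  qed (use r in simp)
  also have "\<dots> = \<eta> + 2 * ?N * pois (real n * \<tau>) (\<lambda>i. ?\<beta> ^ i)"
  proof -
    have \<beta>i: "\<bar>?\<beta> ^ i\<bar> \<le> 1" for i using \<beta> power_le_one[OF \<beta>, of i] by simp
    have "\<bar>2 * ?N * ?\<beta> ^ i\<bar> \<le> 2 * ?N" for i
      using N0 \<beta> mult_left_mono[OF power_le_one[OF \<beta>, of i], of "2 * ?N"] by (simp add: abs_mult)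
    thus ?thesis by (subst pois_add[of _ "\<bar>\<eta>\<bar>"]) (auto simp: pois_cmult[OF \<beta>i])
  qed
  also have "pois (real n * \<tau>) (\<lambda>i. ?\<beta> ^ i) = exp (- real k * \<theta> * \<tau>)"
    using n3 by (simp add: pois_geometric)
  finally show "\<bar>expect (law x (r + \<tau>)) f - expect stat f\<bar> \<le> \<eta> + 2 * (?N * exp (- real k * \<theta> * \<tau>))"
    by (simp add: mult_ac)
qed

end

context rainbow_cycle
begin

lemma rainbow_tv_le:
  assumes \<gamma>: "0 \<le> \<gamma>" "\<gamma> < 2 * \<theta>" "\<gamma> \<le> lam" and r: "0 \<le> r" "0 \<le> \<tau>" and k: "0 < k" "k \<le> n"
  shows "tv_dist \<Omega> (law rbw (r + \<tau>)) stat \<le>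
    4 * real q ^ k * real k * (real n)\<^sup>2 * (1 - \<theta>) ^ L
    + sqrt ((1 + real q ^ k * ((kconst (real q) \<theta> \<gamma> k)\<^sup>2 / (\<theta> / real q) ^ k) * exp (- 2 * \<gamma> * r)) ^ n - 1)
    + 2 * (real n * (real (Suc k) * (4 * real L)) ^ (k - 1) * exp (- real k * \<theta> * \<tau>))"
proof -
  let ?\<eta> = "kconst (real q) \<theta> \<gamma> k * exp (- \<gamma> * r)"
  let ?e = "4 * real q ^ k * real k * (real n)\<^sup>2 * (1 - \<theta>) ^ L + sqrt ((1 + real q ^ k * (?\<eta>\<^sup>2 / (\<theta> / real q) ^ k)) ^ n - 1)"
  have "?\<eta>\<^sup>2 = (kconst (real q) \<theta> \<gamma> k)\<^sup>2 * exp (- 2 * \<gamma> * r)"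
    by (simp add: power_mult_distrib exp_double[symmetric])
  moreover have "tv_dist \<Omega> (law rbw (r + \<tau>)) stat \<le> ?e + 2 * (real n * (real (Suc k) * (4 * real L)) ^ (k - 1) * exp (- real k * \<theta> * \<tau>))"
  proof (rule thinning[OF rainbow_config r k])
    have "1 \<le> (1 + real q ^ k * (?\<eta>\<^sup>2 / (\<theta> / real q) ^ k)) ^ n"
      using \<theta>_pos by (intro one_le_power) simp
    thus "0 \<le> ?e" using \<theta>_le_1 by simp
    have "near_stat k ?\<eta> (law rbw r)" unfolding near_stat_def
      by (intro allI impI rainbow_local_mixing[OF \<gamma> r(1)]) auto
    thus "\<bar>expect (law rbw r) f - expect stat f\<bar> \<le> ?e"
      if "S \<subseteq> {..<n}" "spread L k S" "dep S f" "\<And>x. \<bar>f x\<bar> \<le> 1" for S f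
      by (rule spread_mixing[OF decorrelated_law[OF rainbow_config r(1)] _ that])
  qed
  ultimately show ?thesis by (simp only: times_divide_eq_left mult.assoc[symmetric]) (simp add: mult_ac)
qed

end

section \<open>Asymptotics of the mixing time\<close>

lemma one_minus_ratio_ge:
  fixes \<theta> \<epsilon> K X :: real
  assumes "0 < \<theta>" "\<epsilon> < 1" "0 < K" "K / (\<theta> * (1 - \<epsilon>)) \<le> X"
  shows "\<epsilon> \<le> 1 - K / (\<theta> * X)"
proof -
  have p: "0 < \<theta> * (1 - \<epsilon>)" using assms by simp
  have X: "0 < X" using assms(3) p assms(4) by (meson divide_pos_pos less_le_trans)
  have "K \<le> X * (\<theta> * (1 - \<epsilon>))" using assms(4) p by (simp add: pos_divide_le_eq)
  hence "K \<le> (1 - \<epsilon>) * (\<theta> * X)" by (simp add: mult_ac)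
  hence "K / (\<theta> * X) \<le> 1 - \<epsilon>" using assms(1) X by (simp add: pos_divide_le_eq)
  thus ?thesis by simp
qed

context voter_cycle
begin

lemma t_mix_stat:
  "t_mix G q \<theta> x \<epsilon> = Inf {t. 0 \<le> t \<and> tv_dist \<Omega> (law x t) stat < \<epsilon>}"
proof -
  have "sum (pmf (voter_stationary G q \<theta>)) A = sum stat A" if "A \<in> Pow \<Omega>" for A
    using that by (intro sum.cong refl pmf_voter_stationary) auto
  hence "tv_dist \<Omega> (law x t) (pmf (voter_stationary G q \<theta>)) = tv_dist \<Omega> (law x t) stat" for t
    unfolding tv_dist_def by (intro SUP_cong refl) simp
  thus ?thesis unfolding t_mix_def by simp
qed

lemma t_mix_le: "\<lbrakk>0 \<le> s; tv_dist \<Omega> (law x s) stat < \<epsilon>\<rbrakk> \<Longrightarrow> t_mix G q \<theta> x \<epsilon> \<le> s"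
  unfolding t_mix_stat by (rule cInf_lower) (auto intro: bdd_belowI[of _ 0])

lemma t_mix_ge:
  assumes x: "x \<in> \<Omega>" and \<epsilon>: "0 < \<epsilon>" and s: "\<And>t. \<lbrakk>0 \<le> t; t \<le> s\<rbrakk> \<Longrightarrow> \<epsilon> \<le> tv_dist \<Omega> (law x t) stat"
  shows "s \<le> t_mix G q \<theta> x \<epsilon>"
  unfolding t_mix_stat
proof (rule cInf_greatest)
  \<comment> \<open>Convergence to the stationary law makes the set in the infimum nonempty.\<close>
  have "((\<lambda>t. 2 * real n * 1 * exp (- \<theta> * t)) \<longlongrightarrow> 0) at_top"
    using \<theta>_pos by real_asymp
  from order_tendstoD(2)[OF this \<epsilon>]
  obtain T where T: "\<And>t. T \<le> t \<Longrightarrow> 2 * real n * 1 * exp (- \<theta> * t) < \<epsilon>"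
    unfolding eventually_at_top_linorder by blast
  have "tv_dist \<Omega> (law x (max 0 T)) stat \<le> 2 * real n * 1 * exp (- \<theta> * max 0 T)"
    by (intro tv_dist_le expect_law_stat x) auto
  hence "max 0 T \<in> {t. 0 \<le> t \<and> tv_dist \<Omega> (law x t) stat < \<epsilon>}" using T[of "max 0 T"] by auto
  thus "{t. 0 \<le> t \<and> tv_dist \<Omega> (law x t) stat < \<epsilon>} \<noteq> {}" by blast
  show "s \<le> t" if "t \<in> {t. 0 \<le> t \<and> tv_dist \<Omega> (law x t) stat < \<epsilon>}" for t
    using s[of t] that by fastforce
qed

end

context rainbow_cycle
begin

text \<open>If \<open>lam \<le> 2 * \<theta>\<close>, the autocorrelation is still large enough for
  \<open>tv_one_point\<close>. Otherwise either it happens to be large, or its contribution to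
  \<open>pair_gap\<close> is at most a constant over \<open>n\<close>. In the latter case
  \<open>M\<close> makes the rate in \<open>pair_gap\<close> at most
  \<open>\<theta> * (1 + \<delta>)\<close>, and with the factor \<open>1 - \<delta>\<close> in the
  time the gap has exponent \<open>- (1 - \<delta>\<^sup>2) / 2\<close>, above the noise level of
  exponent -1/2.\<close>

lemma tv_lower:
  assumes x: "x \<in> \<Omega>" and t: "0 \<le> t" and \<delta>: "0 < \<delta>" "\<delta> < 1" and \<epsilon>: "\<epsilon> < 1"
    and t_le: "t \<le> (1 - \<delta>) * ln (real n) / (2 * min lam (2 * \<theta>))"
    and one: "64 / (\<theta> * (1 - \<epsilon>)) \<le> low_const * real n powr \<delta>"
    and n4: "4 \<le> n" and M: "2 \<le> M" "M < n" "1 - (1 - \<theta>) * cos (pi / real M) \<le> \<theta> * (1 + \<delta>)"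
    and two: "2 * \<theta> < lam \<Longrightarrow> sqrt (256 / (\<theta> * (1 - \<epsilon>))) \<le> sqrt (real n) *
      ((1 - 1 / real q) * ((1 - \<theta>) / 2) ^ M * sin (pi / real M) * real n powr (- ((1 - \<delta>\<^sup>2) / 2)) - 64 / (\<theta> * (1 - \<epsilon>)) / real n)"
  shows "\<epsilon> \<le> tv_dist \<Omega> (law x t) stat"
proof -
  define A where "A = autocorr2 G q \<theta> x t"
  have A0: "0 < A"
    using autocorr2_lower[OF x t] low_const_pos unfolding A_def by (meson exp_gt_zero less_le_trans mult_pos_pos)
  have nA: ?thesis if "64 / (\<theta> * (1 - \<epsilon>)) \<le> real n * A"
    using one_minus_ratio_ge[OF \<theta>_pos \<epsilon> _ that] tv_one_point[OF x t] A0 unfolding A_def by fastforce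
  show ?thesis
  proof (cases "lam \<le> 2 * \<theta>")
    case True
    hence "2 * lam * t \<le> (1 - \<delta>) * ln (real n)"
      using t_le lam_pos by (simp add: min_def field_simps)
    hence "exp (- ((1 - \<delta>) * ln (real n))) \<le> exp (- 2 * lam * t)" by simp
    hence "real n powr (\<delta> - 1) \<le> exp (- 2 * lam * t)" using n3 by (simp add: powr_def algebra_simps)
    hence "low_const * real n powr (\<delta> - 1) \<le> A"
      using autocorr2_lower[OF x t] low_const_pos unfolding A_def by (smt (verit) mult_left_mono)
    hence "real n * (low_const * real n powr (\<delta> - 1)) \<le> real n * A" by (rule mult_left_mono) simp
    moreover have "real n * real n powr (\<delta> - 1) = real n powr \<delta>"
      using n3 by (simp add: powr_diff)
    ultimately have "low_const * real n powr \<delta> \<le> real n * A" by (simp only: mult.left_commute[of _ low_const])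
    thus ?thesis using one nA by linarith
  next
    case False
    hence lam: "2 * \<theta> < lam" by simp
    show ?thesis
    proof (cases "64 / (\<theta> * (1 - \<epsilon>)) \<le> real n * A")
      case True
      thus ?thesis by (rule nA)
    next
      case False
      define Q where "Q = 64 / (\<theta> * (1 - \<epsilon>))"
      define \<kappa> where "\<kappa> = (1 - 1 / real q) * ((1 - \<theta>) / 2) ^ M * sin (pi / real M)"
      define Y where "Y = 256 / (\<theta> * (1 - \<epsilon>))"
      define gap where "gap = pair_stat 1 - expect (law x t) (pairf 1)"
      have \<kappa>0: "0 \<le> \<kappa>"
      proof -
        have "0 \<le> sin (pi / real M)" using M(1) by (intro sin_ge_zero) (auto simp: field_simps)
        thus ?thesis using q3 \<theta>_le_1 by (simp add: \<kappa>_def)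
      qed
      have n0: "0 < real n" using n3 by simp
      have "real n * A \<le> Q" using False by (simp add: Q_def)
      hence AQ: "A \<le> Q / real n" using n0 by (simp add: pos_le_divide_eq mult.commute)
      let ?\<omega> = "1 - (1 - \<theta>) * cos (pi / real M)"
      have "2 * t * ?\<omega> \<le> 2 * t * (\<theta> * (1 + \<delta>))" using M(3) t by (intro mult_left_mono) auto
      also have "2 * t * (\<theta> * (1 + \<delta>)) = (4 * \<theta> * t) * ((1 + \<delta>) / 2)" by (simp add: field_simps)
      also have "\<dots> \<le> ((1 - \<delta>) * ln (real n)) * ((1 + \<delta>) / 2)"
        using t_le lam \<theta>_pos \<delta> by (intro mult_right_mono) (auto simp: min_def field_simps)
      also have "\<dots> = (1 - \<delta>\<^sup>2) / 2 * ln (real n)" by (simp add: power2_eq_square field_simps)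
      finally have "real n powr (- ((1 - \<delta>\<^sup>2) / 2)) \<le> exp (- 2 * t * ?\<omega>)" using n0 by (simp add: powr_def)
      from mult_left_mono[OF this \<kappa>0]
      have gap: "\<kappa> * real n powr (- ((1 - \<delta>\<^sup>2) / 2)) - Q / real n \<le> gap"
        using pair_gap[OF x t M(1,2) n4] AQ unfolding gap_def \<kappa>_def A_def by linarith
      have Y0: "0 < Y" using \<theta>_pos \<epsilon> by (simp add: Y_def)
      have "sqrt Y \<le> sqrt (real n) * (\<kappa> * real n powr (- ((1 - \<delta>\<^sup>2) / 2)) - Q / real n)"
        using two[OF lam] unfolding Y_def \<kappa>_def Q_def .
      also have "\<dots> \<le> sqrt (real n) * gap" by (intro mult_left_mono gap) simp
      finally have sq: "sqrt Y \<le> sqrt (real n) * gap" .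
      hence "(sqrt Y)\<^sup>2 \<le> (sqrt (real n) * gap)\<^sup>2" using Y0 by (intro power_mono) auto
      hence "Y \<le> real n * gap\<^sup>2" using Y0 by (simp add: power_mult_distrib)
      hence "\<epsilon> \<le> 1 - 256 / (\<theta> * (real n * gap\<^sup>2))"
        unfolding Y_def by (intro one_minus_ratio_ge \<theta>_pos \<epsilon>) auto
      also have "\<dots> \<le> tv_dist \<Omega> (law x t) stat"
      proof (rule tv_pair[OF x t gap_def])
        show "gap \<noteq> 0" using sq Y0 real_sqrt_gt_zero[OF Y0] by auto
      qed
      finally show ?thesis .
    qed
  qed
qed

text \<open>The time is split as \<open>r + \<tau>\<close> with shares
  \<open>1 + \<delta> / 2\<close> and \<open>\<delta> / 2\<close>. The rate \<open>\<gamma>'\<close>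
  is strictly below \<open>2 * \<theta>\<close>, where \<open>kconst\<close> is finite, yet large
  enough that \<open>n * exp (- 2 * \<gamma>' * r)\<close> is a negative power of \<open>n\<close>.
  With \<open>L\<close> about \<open>(ln n)\<^sup>2\<close> the correlations over distance
  \<open>L\<close> are smaller than any power of \<open>n\<close>, while powers of \<open>L\<close>
  stay polylogarithmic. The bound on \<open>k\<close> gives
  \<open>k * \<theta> * \<tau> \<ge> 2 * ln n\<close>, which beats the factor \<open>n\<close> in
  the number of linked tuples.\<close>

lemma tv_upper:
  assumes \<delta>: "0 < \<delta>" and k: "0 < k" "k \<le> n" "8 * min lam (2 * \<theta>) / (\<theta> * \<delta>) \<le> real k"
  defines "\<gamma> \<equiv> min lam (2 * \<theta>)"
  defines "\<gamma>' \<equiv> \<gamma> / (1 + \<delta> / 4)"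
  shows "tv_dist \<Omega> (law rbw ((1 + \<delta>) * ln (real n) / (2 * \<gamma>))) stat \<le>
      4 * real q ^ k * real k * (real n)\<^sup>2 * exp (- \<theta> * (ln (real n))\<^sup>2)
    + sqrt (exp (real q ^ k * ((kconst (real q) \<theta> \<gamma>' k)\<^sup>2 / (\<theta> / real q) ^ k) * real n powr (- ((\<delta> / 4) / (1 + \<delta> / 4)))) - 1)
    + 2 * (real n * (real (Suc k) * (4 * ((ln (real n))\<^sup>2 + 1))) ^ (k - 1) * real n powr (- 2))"
proof -
  define L where "L = nat \<lceil>(ln (real n))\<^sup>2\<rceil>"
  define r where "r = (1 + \<delta> / 2) * ln (real n) / (2 * \<gamma>)"
  define \<tau> where "\<tau> = (\<delta> / 2) * ln (real n) / (2 * \<gamma>)"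
  define H where "H = real q ^ k * ((kconst (real q) \<theta> \<gamma>' k)\<^sup>2 / (\<theta> / real q) ^ k)"
  have n0: "0 < real n" "0 < ln (real n)" using n3 by auto
  have \<gamma>: "0 < \<gamma>" "\<gamma> \<le> lam" "\<gamma> \<le> 2 * \<theta>" using lam_pos \<theta>_pos by (auto simp: \<gamma>_def)
  have \<gamma>': "0 < \<gamma>'" "\<gamma>' < \<gamma>" using \<gamma> \<delta> by (auto simp: \<gamma>'_def field_simps)
  have H0: "0 \<le> H" using \<theta>_pos by (simp add: H_def)
  have r0: "0 \<le> r" "0 \<le> \<tau>" using \<gamma> \<delta> n0 by (auto simp: r_def \<tau>_def)
  have rt: "(1 + \<delta>) * ln (real n) / (2 * \<gamma>) = r + \<tau>"
    using \<gamma>(1) by (simp add: r_def \<tau>_def field_simps)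
  have L: "(ln (real n))\<^sup>2 \<le> real L" "real L \<le> (ln (real n))\<^sup>2 + 1"
    unfolding L_def by (simp_all add: of_nat_nat)
  have "tv_dist \<Omega> (law rbw (r + \<tau>)) stat \<le>
    4 * real q ^ k * real k * (real n)\<^sup>2 * (1 - \<theta>) ^ L
    + sqrt ((1 + H * exp (- 2 * \<gamma>' * r)) ^ n - 1)
    + 2 * (real n * (real (Suc k) * (4 * real L)) ^ (k - 1) * exp (- real k * \<theta> * \<tau>))"
    unfolding H_def by (rule rainbow_tv_le) (use \<gamma> \<gamma>' r0 k in auto)
  also have "\<dots> \<le> 4 * real q ^ k * real k * (real n)\<^sup>2 * exp (- \<theta> * (ln (real n))\<^sup>2)
    + sqrt (exp (H * real n powr (- ((\<delta> / 4) / (1 + \<delta> / 4)))) - 1)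
    + 2 * (real n * (real (Suc k) * (4 * ((ln (real n))\<^sup>2 + 1))) ^ (k - 1) * real n powr (- 2))"
  proof (intro add_mono mult_left_mono mult_mono power_mono)
    have "(1 - \<theta>) ^ L \<le> exp (- \<theta>) ^ L"
      using exp_ge_add_one_self[of "- \<theta>"] \<theta>_le_1 by (intro power_mono) auto
    also have "\<dots> = exp (- \<theta> * real L)" by (simp add: exp_of_nat_mult[symmetric] mult.commute)
    also have "\<dots> \<le> exp (- \<theta> * (ln (real n))\<^sup>2)" using L(1) \<theta>_pos by simp
    finally show "(1 - \<theta>) ^ L \<le> exp (- \<theta> * (ln (real n))\<^sup>2)" .
    have "2 * \<gamma>' * r = (1 + (\<delta> / 4) / (1 + \<delta> / 4)) * ln (real n)"
    proof -
      have "2 * \<gamma>' * r = (1 + \<delta> / 2) / (1 + \<delta> / 4) * ln (real n)"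
        using \<gamma>(1) by (simp add: \<gamma>'_def r_def)
      also have "(1 + \<delta> / 2) / (1 + \<delta> / 4) = 1 + (\<delta> / 4) / (1 + \<delta> / 4)"
        using \<delta> by (simp add: field_simps)
      finally show ?thesis .
    qed
    hence E: "- 2 * \<gamma>' * r = - (1 + (\<delta> / 4) / (1 + \<delta> / 4)) * ln (real n)"
      by (simp only: mult_minus_left)
    have "exp (- 2 * \<gamma>' * r) = real n powr (- (1 + (\<delta> / 4) / (1 + \<delta> / 4)))"
      unfolding E powr_def using n0 by simp
    moreover have "real n * real n powr (- (1 + a)) = real n powr (- a)" for a
      using n0 powr_add[of "real n" 1 "- (1 + a)"] by simp
    ultimately have e: "real n * exp (- 2 * \<gamma>' * r) = real n powr (- ((\<delta> / 4) / (1 + \<delta> / 4)))"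
      by (simp only:)
    have "(1 + H * exp (- 2 * \<gamma>' * r)) ^ n \<le> exp (H * exp (- 2 * \<gamma>' * r)) ^ n"
      using H0 by (intro power_mono exp_ge_add_one_self) simp
    also have "\<dots> = exp (H * (real n * exp (- 2 * \<gamma>' * r)))"
      by (simp add: exp_of_nat_mult[symmetric] mult_ac)
    finally show "sqrt ((1 + H * exp (- 2 * \<gamma>' * r)) ^ n - 1) \<le> sqrt (exp (H * real n powr (- ((\<delta> / 4) / (1 + \<delta> / 4)))) - 1)"
      unfolding e by simp
    have "8 * \<gamma> \<le> real k * (\<theta> * \<delta>)" using k(3) \<theta>_pos \<delta> unfolding \<gamma>_def by (simp add: pos_divide_le_eq)
    hence "2 * ln (real n) \<le> (real k * (\<theta> * \<delta>) / (4 * \<gamma>)) * ln (real n)"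
      using \<gamma>(1) n0 by (intro mult_right_mono) (auto simp: field_simps)
    also have "\<dots> = real k * \<theta> * \<tau>" by (simp add: \<tau>_def)
    finally show "exp (- real k * \<theta> * \<tau>) \<le> real n powr (- 2)" using n0 by (simp add: powr_def)
  qed (use L \<theta>_le_1 in auto)
  finally show ?thesis unfolding rt H_def .
qed

end

lemma cos_pi_div_limit: "((\<lambda>M. cos (pi / real M)) \<longlongrightarrow> 1) sequentially"
  by real_asymp

text \<open>The mean shift of the pair statistic exceeds its fluctuations, of order
  \<open>n powr (- 1 / 2)\<close>, by a factor of order \<open>n powr e\<close>.\<close>

lemma lower_asymptotics:
  fixes \<kappa> e Q Y :: real
  assumes "0 < \<kappa>" "0 < e"
  shows "eventually (\<lambda>n. Y \<le> sqrt (real n) * (\<kappa> * real n powr (e - 1 / 2) - Q / real n)) sequentially"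
proof -
  have "filterlim (\<lambda>n::nat. \<kappa> * real n powr e - Q * real n powr (- 1 / 2)) at_top sequentially"
    using assms by real_asymp
  hence "eventually (\<lambda>n::nat. Y \<le> \<kappa> * real n powr e - Q * real n powr (- 1 / 2)) sequentially"
    by (simp add: filterlim_at_top)
  thus ?thesis
    using eventually_gt_at_top[of 0]
  proof eventually_elim
    case (elim n)
    have "sqrt (real n) * real n powr (e - 1 / 2) = real n powr e"
      using elim by (simp add: powr_half_sqrt[symmetric] powr_add[symmetric])
    moreover have "sqrt (real n) / real n = real n powr (- 1 / 2)"
      using elim powr_diff[of "real n" "1/2" 1] by (simp add: powr_half_sqrt[symmetric])
    ultimately have "sqrt (real n) * (\<kappa> * real n powr (e - 1 / 2) - Q / real n) = \<kappa> * real n powr e - Q * real n powr (- 1 / 2)"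
      by (simp add: right_diff_distrib mult.left_commute) (metis times_divide_eq_right mult.commute)
    thus ?case using elim by simp
  qed
qed

text \<open>The three terms are the errors of decoupling, of the chi-square comparison and of
  thinning; the last is a power of the logarithm over \<open>n\<close>.\<close>

lemma upper_asymptotics:
  fixes \<theta> b H K c \<epsilon> :: real
  assumes "0 < \<theta>" "0 < b" "0 < c" "0 < \<epsilon>"
  shows "eventually (\<lambda>n. K * (real n)\<^sup>2 * exp (- \<theta> * (ln (real n))\<^sup>2) + sqrt (exp (H * real n powr (- b)) - 1)
    + 2 * (real n * (c * (4 * ((ln (real n))\<^sup>2 + 1))) ^ j * real n powr (- 2)) < \<epsilon>) sequentially"
proof -
  have 1: "((\<lambda>n::nat. (real n)\<^sup>2 * exp (- \<theta> * (ln (real n))\<^sup>2)) \<longlongrightarrow> 0) sequentially"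
    using assms by real_asymp
  have p: "((\<lambda>n::nat. real n powr (- b)) \<longlongrightarrow> 0) sequentially"
    using assms by real_asymp
  have "((\<lambda>n::nat. sqrt (exp (H * real n powr (- b)) - 1)) \<longlongrightarrow> sqrt (exp (H * 0) - 1)) sequentially"
    by (intro tendsto_intros p)
  hence 2: "((\<lambda>n::nat. sqrt (exp (H * real n powr (- b)) - 1)) \<longlongrightarrow> 0) sequentially" by simp
  have 3: "((\<lambda>n::nat. ((ln (real n))\<^sup>2 + 1) ^ j * (real n * real n powr (- 2))) \<longlongrightarrow> 0) sequentially"
    by real_asymp
  have "((\<lambda>n::nat. K * ((real n)\<^sup>2 * exp (- \<theta> * (ln (real n))\<^sup>2)) + sqrt (exp (H * real n powr (- b)) - 1)
    + (2 * (c * 4) ^ j) * (((ln (real n))\<^sup>2 + 1) ^ j * (real n * real n powr (- 2)))) \<longlongrightarrow> K * 0 + 0 + (2 * (c * 4) ^ j) * 0) sequentially"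
    by (intro tendsto_intros 1 2 3)
  hence "eventually (\<lambda>n::nat. K * ((real n)\<^sup>2 * exp (- \<theta> * (ln (real n))\<^sup>2)) + sqrt (exp (H * real n powr (- b)) - 1)
    + (2 * (c * 4) ^ j) * (((ln (real n))\<^sup>2 + 1) ^ j * (real n * real n powr (- 2))) < \<epsilon>) sequentially"
    by (rule order_tendstoD(2)) (use assms(4) in simp)
  moreover have "(c * (4 * ((ln (real n))\<^sup>2 + 1))) ^ j = (c * 4) ^ j * ((ln (real n))\<^sup>2 + 1) ^ j" for n :: nat
    by (simp only: power_mult_distrib mult.assoc)
  ultimately show ?thesis by (simp only: mult_ac)
qed

text \<open>The distance \<open>M\<close> and the cluster size \<open>k\<close> are fixed before
  \<open>n\<close> and depend only on q, theta and delta. The conditions on \<open>n\<close> do not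
  mention the initial state, so the lower bound is uniform in it.\<close>

lemma eventually_t_mix_bounds:
  fixes q :: nat and \<theta> \<delta> \<epsilon> :: real
  assumes q: "3 \<le> q" and \<theta>: "0 < \<theta>" "\<theta> \<le> 1" and \<delta>: "0 < \<delta>" "\<delta> < 1" and \<epsilon>: "0 < \<epsilon>" "\<epsilon> < 1"
  defines "\<gamma> \<equiv> min (1 - (1 - \<theta>) * cos (2 * pi / real q)) (2 * \<theta>)"
  shows "eventually (\<lambda>n. q dvd n \<longrightarrow>
      (\<forall>x\<in>configs (cycle_graph n) q. (1 - \<delta>) * ln (real n) / (2 * \<gamma>) \<le> t_mix (cycle_graph n) q \<theta> x \<epsilon>)
      \<and> t_mix (cycle_graph n) q \<theta> (rainbow q n) \<epsilon> \<le> (1 + \<delta>) * ln (real n) / (2 * \<gamma>)) sequentially"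
proof -
  define l where "l = 1 - (1 - \<theta>) * cos (2 * pi / real q)"
  define b where "b = (\<delta> / 4) / (1 + \<delta> / 4)"
  have \<gamma>: "\<gamma> = min l (2 * \<theta>)" by (simp add: \<gamma>_def l_def)
  have "((\<lambda>M. 1 - (1 - \<theta>) * cos (pi / real M)) \<longlongrightarrow> 1 - (1 - \<theta>) * 1) sequentially"
    by (intro tendsto_intros cos_pi_div_limit)
  moreover have "1 - (1 - \<theta>) * 1 < \<theta> * (1 + \<delta>)" using \<theta> \<delta> by (simp add: distrib_left)
  ultimately have "eventually (\<lambda>M. 1 - (1 - \<theta>) * cos (pi / real M) < \<theta> * (1 + \<delta>)) sequentially"
    by (rule order_tendstoD(2))
  from eventually_happens[OF eventually_conj[OF this eventually_ge_at_top[of 2]]]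
  obtain M :: nat where M: "1 - (1 - \<theta>) * cos (pi / real M) \<le> \<theta> * (1 + \<delta>)" "2 \<le> M"
    by (auto intro: less_imp_le)
  obtain k0 :: nat where k0: "8 * \<gamma> / (\<theta> * \<delta>) \<le> real k0" using real_arch_simple by blast
  define k where "k = Suc k0"
  have k: "0 < k" "8 * \<gamma> / (\<theta> * \<delta>) \<le> real k" using k0 by (auto simp: k_def)
  have "filterlim (\<lambda>n::nat. exp (- 50) / real q * real n powr \<delta>) at_top sequentially"
    using q \<delta> by real_asymp
  hence "eventually (\<lambda>n::nat. 64 / (\<theta> * (1 - \<epsilon>)) \<le> exp (- 50) / real q * real n powr \<delta>) sequentially"
    by (simp only: filterlim_at_top)
  moreover have "eventually (\<lambda>n::nat. 2 * \<theta> < l \<longrightarrow> sqrt (256 / (\<theta> * (1 - \<epsilon>))) \<le> sqrt (real n) *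
      ((1 - 1 / real q) * ((1 - \<theta>) / 2) ^ M * sin (pi / real M) * real n powr (\<delta>\<^sup>2 / 2 - 1 / 2) - 64 / (\<theta> * (1 - \<epsilon>)) / real n)) sequentially"
  \<comment> \<open>In the first case theta is not 1, since \<open>l\<close> would be 1 there; hence
    the prefactor containing \<open>(1 - \<theta>) / 2\<close> is positive.\<close>
  proof (cases "2 * \<theta> < l")
    case True
    hence "\<theta> \<noteq> 1" by (auto simp: l_def)
    hence "0 < (1 - \<theta>) / 2" using \<theta> by simp
    moreover have "0 < sin (pi / real M)" using M(2) by (intro sin_gt_zero) (auto simp: field_simps)
    moreover have "0 < 1 - 1 / real q" using q by simp
    ultimately have "0 < (1 - 1 / real q) * ((1 - \<theta>) / 2) ^ M * sin (pi / real M)"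
      by (intro mult_pos_pos zero_less_power)
    moreover have "0 < \<delta>\<^sup>2 / 2" using \<delta> by simp
    ultimately show ?thesis unfolding eqTrueI[OF True] simp_thms by (rule lower_asymptotics)
  qed simp
  moreover have "eventually (\<lambda>n::nat. 4 * real q ^ k * real k * (real n)\<^sup>2 * exp (- \<theta> * (ln (real n))\<^sup>2)
    + sqrt (exp (real q ^ k * ((kconst (real q) \<theta> (\<gamma> / (1 + \<delta> / 4)) k)\<^sup>2 / (\<theta> / real q) ^ k) * real n powr (- b)) - 1)
    + 2 * (real n * (real (Suc k) * (4 * ((ln (real n))\<^sup>2 + 1))) ^ (k - 1) * real n powr (- 2)) < \<epsilon>) sequentially"
    by (rule upper_asymptotics) (use \<theta> \<delta> \<epsilon> in \<open>auto simp: b_def\<close>)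
  moreover have "eventually (\<lambda>n::nat. max 4 (max k (Suc M)) \<le> n) sequentially" by (rule eventually_ge_at_top)
  ultimately show ?thesis
  proof eventually_elim
    case (elim n)
    show ?case
    proof
      assume dvd: "q dvd n"
      interpret rainbow_cycle n q \<theta> by standard (use elim q \<theta> dvd in auto)
      have l: "l = lam" by (simp add: l_def lam_def)
      have lc: "low_const = exp (- 50) / real q" by (rule low_const_def)
      have g0: "0 < \<gamma>" using lam_pos \<theta> by (simp add: \<gamma> l)
      have "(1 - \<delta>) * ln (real n) / (2 * \<gamma>) \<le> t_mix G q \<theta> x \<epsilon>" if x: "x \<in> \<Omega>" for x
      proof (rule t_mix_ge[OF x \<epsilon>(1)])
        fix t assume t: "0 \<le> t" "t \<le> (1 - \<delta>) * ln (real n) / (2 * \<gamma>)"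
        have "- ((1 - \<delta>\<^sup>2) / 2) = \<delta>\<^sup>2 / 2 - 1 / 2" by (simp add: field_simps)
        with elim show "\<epsilon> \<le> tv_dist \<Omega> (law x t) stat"
          by (intro tv_lower[OF x t(1) \<delta> \<epsilon>(2) t(2)[unfolded \<gamma> l] _ _ M(2) _ M(1)]) (simp_all add: lc l)
      qed
      moreover have "t_mix G q \<theta> rbw \<epsilon> \<le> (1 + \<delta>) * ln (real n) / (2 * \<gamma>)"
      proof (rule t_mix_le)
        show "0 \<le> (1 + \<delta>) * ln (real n) / (2 * \<gamma>)" using \<delta> g0 n3 by simp
        have "k \<le> n" using elim by simp
        from tv_upper[OF \<delta>(1) k(1) this] k(2) elim
        show "tv_dist \<Omega> (law rbw ((1 + \<delta>) * ln (real n) / (2 * \<gamma>))) stat < \<epsilon>"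
          unfolding \<gamma> l b_def by (meson le_less_trans)
      qed
      ultimately show "(\<forall>x\<in>\<Omega>. (1 - \<delta>) * ln (real n) / (2 * \<gamma>) \<le> t_mix G q \<theta> x \<epsilon>)
        \<and> t_mix G q \<theta> rbw \<epsilon> \<le> (1 + \<delta>) * ln (real n) / (2 * \<gamma>)" by blast
    qed
  qed
qed

lemma rainbow_cycleI:
  assumes "3 \<le> q" "0 < \<theta>" "\<theta> \<le> 1" "0 < n" "q dvd n"
  shows "rainbow_cycle n q \<theta>"
proof -
  have "q \<le> n" using assms by (simp add: dvd_imp_le)
  thus ?thesis using assms by unfold_locales auto
qed

text \<open>The lower bound for \<open>x0\<close> and the upper bound for the rainbow are both
  multiples of \<open>ln n / (2 * \<gamma>)\<close> with factors close to 1, so the ratio is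
  eventually above any \<open>z\<close> below 1.\<close>

lemma t_mix_ratio_liminf:
  fixes q :: nat and \<theta> \<epsilon> :: real
  assumes q: "3 \<le> q" and \<theta>: "0 < \<theta>" "\<theta> \<le> 1" and \<epsilon>: "0 < \<epsilon>" "\<epsilon> < 1"
    and x0: "\<And>n. \<lbrakk>0 < n; q dvd n\<rbrakk> \<Longrightarrow> x0 n \<in> configs (cycle_graph n) q"
  shows "1 \<le> liminf (\<lambda>m. ereal (t_mix (cycle_graph (q * m)) q \<theta> (x0 (q * m)) \<epsilon> /
    t_mix (cycle_graph (q * m)) q \<theta> (rainbow q (q * m)) \<epsilon>))" (is "_ \<le> liminf ?R")
proof (rule dense_le)
  fix y :: ereal assume y: "y < 1"
  obtain z :: real where z: "y \<le> ereal z" "z < 1" "0 < z"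
  proof (cases y)
    case (real r)
    thus ?thesis using y that[of "max r (1/2)"] by auto
  qed (use y that[of "1/2"] in auto)
  \<comment> \<open>Chosen so that \<open>(1 - \<delta>) / (1 + \<delta>)\<close> equals
    \<open>z\<close>.\<close>
  define \<delta> where "\<delta> = (1 - z) / (1 + z)"
  define \<gamma> where "\<gamma> = min (1 - (1 - \<theta>) * cos (2 * pi / real q)) (2 * \<theta>)"
  have \<delta>: "0 < \<delta>" "\<delta> < 1" using z by (auto simp: \<delta>_def field_simps)
  have zd: "z * (1 + \<delta>) = 1 - \<delta>" using z by (simp add: \<delta>_def field_simps)
  have qm: "filterlim (\<lambda>m. q * m) sequentially sequentially"
    using q by (intro mult_nat_left_at_top) simp
  have "eventually (\<lambda>m. ereal z \<le> ?R m) sequentially"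
    using eventually_t_mix_bounds[OF q \<theta> \<delta> \<epsilon>, folded \<gamma>_def, THEN eventually_compose_filterlim[OF _ qm]]
      eventually_gt_at_top[of 0]
  proof eventually_elim
    case (elim m)
    have "0 < q * m" "q dvd q * m" using elim(2) q by auto
    then interpret rainbow_cycle "q * m" q \<theta> by (rule rainbow_cycleI[OF q \<theta>])
    let ?l = "ln (real (q * m)) / (2 * \<gamma>)"
    have "0 < \<gamma>" using lam_pos \<theta> by (simp add: \<gamma>_def lam_def)
    moreover have "real 1 < real (q * m)" using n3 by (intro of_nat_less_iff[THEN iffD2]) simp
    hence "1 < real (q * m)" by (simp only: of_nat_1)
    ultimately have l: "0 < ?l" by (intro divide_pos_pos ln_gt_zero) simp_all
    have lo: "(1 - \<delta>) * ?l \<le> t_mix G q \<theta> x \<epsilon>" if "x \<in> \<Omega>" for x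
      using elim(1) that by simp
    have up: "t_mix G q \<theta> rbw \<epsilon> \<le> (1 + \<delta>) * ?l" using elim(1) by simp
    have pos: "0 < t_mix G q \<theta> rbw \<epsilon>"
      using lo[OF rainbow_config] mult_pos_pos[of "1 - \<delta>" ?l] l \<delta> by linarith
    have "z * t_mix G q \<theta> rbw \<epsilon> \<le> z * ((1 + \<delta>) * ?l)" using up z by (intro mult_left_mono) auto
    also have "\<dots> = (1 - \<delta>) * ?l" by (simp only: mult.assoc[symmetric] zd)
    also have "\<dots> \<le> t_mix G q \<theta> (x0 (q * m)) \<epsilon>"
      by (rule lo, rule x0) (use \<open>0 < q * m\<close> in auto)
    finally show "ereal z \<le> ?R m" using pos by (simp add: pos_le_divide_eq)
  qed
  hence "ereal z \<le> liminf ?R" by (rule Liminf_bounded)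
  with z(1) show "y \<le> liminf ?R" by (rule order.trans)
qed

theorem theorem1p3:
  shows
    "(\<exists>c::real. c > 0 \<and>
        (\<forall>(q::nat) (\<theta>::real) (n::nat). q \<ge> 3 \<longrightarrow> 0 < \<theta> \<longrightarrow> \<theta> \<le> 1 \<longrightarrow> n > 0 \<longrightarrow> q dvd n \<longrightarrow>
          (\<forall>x0 \<in> configs (cycle_graph n) q. \<forall>t\<ge>0.
             autocorr2 (cycle_graph n) q \<theta> x0 t
               \<ge> c / (real q)\<^sup>2 * autocorr2 (cycle_graph n) q \<theta> (rainbow q n) t)))
     \<and> (\<forall>(q::nat) (\<theta>::real). q \<ge> 3 \<longrightarrow> 0 < \<theta> \<longrightarrow> \<theta> \<le> 1 \<longrightarrow>
          (\<exists>C::real. \<forall>n::nat. n > 0 \<longrightarrow> q dvd n \<longrightarrow>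
             (\<forall>x0 \<in> configs (cycle_graph n) q.
                autocorr_time (cycle_graph n) q \<theta> x0
                  \<ge> autocorr_time (cycle_graph n) q \<theta> (rainbow q n) - C)))
     \<and> (\<forall>(q::nat) (\<theta>::real) (\<epsilon>::real) (x0 :: nat \<Rightarrow> nat \<Rightarrow> nat).
          q \<ge> 3 \<longrightarrow> 0 < \<theta> \<longrightarrow> \<theta> \<le> 1 \<longrightarrow> 0 < \<epsilon> \<longrightarrow> \<epsilon> < 1 \<longrightarrow>
          (\<forall>n::nat. n > 0 \<longrightarrow> q dvd n \<longrightarrow> x0 n \<in> configs (cycle_graph n) q) \<longrightarrow>
          liminf (\<lambda>m. ereal (t_mix (cycle_graph (q * m)) q \<theta> (x0 (q * m)) \<epsilon> /
                              t_mix (cycle_graph (q * m)) q \<theta> (rainbow q (q * m)) \<epsilon>)) \<ge> 1)"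
proof (intro conjI)
  show "\<exists>c::real. c > 0 \<and>
        (\<forall>(q::nat) (\<theta>::real) (n::nat). q \<ge> 3 \<longrightarrow> 0 < \<theta> \<longrightarrow> \<theta> \<le> 1 \<longrightarrow> n > 0 \<longrightarrow> q dvd n \<longrightarrow>
          (\<forall>x0 \<in> configs (cycle_graph n) q. \<forall>t\<ge>0.
             autocorr2 (cycle_graph n) q \<theta> x0 t
               \<ge> c / (real q)\<^sup>2 * autocorr2 (cycle_graph n) q \<theta> (rainbow q n) t))"
    by (intro exI[of _ "exp (- 50)"] conjI allI impI ballI rainbow_cycle.autocorr2_comparison rainbow_cycleI) auto
  show "\<forall>(q::nat) (\<theta>::real). q \<ge> 3 \<longrightarrow> 0 < \<theta> \<longrightarrow> \<theta> \<le> 1 \<longrightarrow>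
          (\<exists>C::real. \<forall>n::nat. n > 0 \<longrightarrow> q dvd n \<longrightarrow>
             (\<forall>x0 \<in> configs (cycle_graph n) q.
                autocorr_time (cycle_graph n) q \<theta> x0
                  \<ge> autocorr_time (cycle_graph n) q \<theta> (rainbow q n) - C))"
    \<comment> \<open>The witness \<open>ln (q / low_const) / (2 * lam)\<close> does not involve
      \<open>n\<close>: \<open>low_const\<close> depends on q alone and \<open>lam\<close> on q and
      theta.\<close>
    using rainbow_cycle.autocorr_time_comparison[OF rainbow_cycleI] by blast
qed (use t_mix_ratio_liminf in blast)

end
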